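(* For all $\Psi\in H_0(\mathrm{curl})$ such that $\nu\,\mathrm{curl}\,\Psi\in H(\mathrm{curl})$ and for all $v_h\in P_k^b$, the weak consistency error $$\delta(v_h,\Psi):=(v_h,\mathrm{curl}(\nu\,\mathrm{curl}\,\Psi))-(C_{h0}(v_h),\mathrm{curl}\,\Psi)_\nu$$ satisfies $$|\delta(v_h,\Psi)|\le|v_h|_{nc}\ \min_{\Phi_h\in P_\ell^c}|||\nu\,\mathrm{curl}\,\Psi-\Phi_h|||_H .$$
   Context: $D\subset\mathbb R^3$ is an open, bounded, Lipschitz polyhedron with outward unit normal $n_D$. All functions are real-valued; $(\cdot,\cdot)$, $\|\cdot\|$ are the inner product and norm of $L^2(D)^3$. The coefficient $\nu:D\to\mathbb R^{3\times3}$ is measurable with symmetric positive-definite values whose eigenvalues are uniformly bounded from above and from below away from zero; for $a\in\{\nu,\nu^{-1}\}$, $(v,w)_a:=(av,w)$, $\|v\|_a^2:=(v,v)_a$. $H(\mathrm{curl}):=\{v\in L^2(D)^3:\mathrm{curl}\,v\in L^2(D)^3\}$ and $H_0(\mathrm{curl})$ is its subspace of fields with zero tangential trace on $\partial D$. $\mathcal T_h$ is an affine simplicial mesh covering $D$ exactly, $h_K$ is the diameter of $K\in\mathcal T_h$. The set of mesh faces $\mathcal F_h$ consists of interfaces $F$ shared by two distinct cells $K_l,K_r$, with unit normal $n_F$ pointing from $K_l$ to $K_r$ (arbitrary but fixed orientation), and of boundary faces $F$ belonging to one cell $K_l$, with $n_F:=n_D|_F$. Piecewise constant functions: $\tilde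 h|_K:=h_K$ and $\tilde\nu|_K:=\min_{|u|=1}\nu|_Ku\cdot u$ (essential infimum over $K$). Fix integers $k\ge1$, $\ell\ge k-1$. $P_m^b:=\{v\in L^2(D)^3: v|_K\in[\mathbb P_m]^3\ \forall K\in\mathcal T_h\}$ ($\mathbb P_m$: polynomials of total degree $\le m$), $P_\ell^c:=P_\ell^b\cap H(\mathrm{curl})$, $P_{k,0}^c:=P_k^b\cap H_0(\mathrm{curl})$. For $v_h$ piecewise polynomial, on an interface, $[v_h]^c_F:=v_h|_{K_l}\times n_F-v_h|_{K_r}\times n_F$ and $\{v_h\}_F:=\frac12(v_h|_{K_l}+v_h|_{K_r})$; on a boundary face, $[v_h]_F^c:=v_h|_{K_l}\times n_F$ and $\{v_h\}_F:=v_h|_{K_l}$. The lifting $L_{h0}(v_h)\in P_\ell^b$ of $v_h\in P_k^b$ is defined by $(L_{h0}(v_h),\phi_h)=\sum_{F\in\mathcal F_h}([v_h]^c_F,\{\phi_h\}_F)_{L^2(F)}$ for all $\phi_h\in P_\ell^b$, and the discrete curl is $C_{h0}(v_h):=\mathrm{curl}_hv_h+L_{h0}(v_h)$ with $\mathrm{curl}_h$ the cellwise curl. Norms: $|||v_h|||_E^2:=\|\tilde\nu^{1/2}\tilde h^{-1}v_h\|^2+\|C_{h0}(v_h)\|_\nu^2$ for $v_h\in P_k^b$; $|||v|||_H^2:=\|v\|_{\nu^{-1}}^2+\|\tilde\nu^{-1/2}\tilde h\,\mathrm{curl}\,v\|^2$ for $v\in H(\mathrm{curl})$. Nonconformity measure: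 $|v_h|_{nc}:=\min_{v_h^c\in P_{k,0}^c}|||v_h-v_h^c|||_E$ for $v_h\in P_k^b$. *)

theory Defs
  imports "HOL-Analysis.Analysis"
begin

text \<open>
  Functions on D are represented by total functions on \<open>real^3\<close>; their values outside D
  (and on null sets) never matter.
\<close>

section \<open>The space L2 and the weak curl\<close>

definition L2 :: "(real^3) set \<Rightarrow> (real^3 \<Rightarrow> real^3) set" where
  "L2 D = {v \<in> borel_measurable (lebesgue_on D). integrable (lebesgue_on D) (\<lambda>x. (norm (v x))\<^sup>2)}"

definition ip :: "(real^3) set \<Rightarrow> (real^3 \<Rightarrow> real^3) \<Rightarrow> (real^3 \<Rightarrow> real^3) \<Rightarrow> real" where
  "ip D v w = integral\<^sup>L (lebesgue_on D) (\<lambda>x. v x \<bullet> w x)"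

definition L2norm :: "(real^3) set \<Rightarrow> (real^3 \<Rightarrow> real^3) \<Rightarrow> real" where
  "L2norm D v = sqrt (ip D v v)"

definition ipw :: "(real^3) set \<Rightarrow> (real^3 \<Rightarrow> real^3^3) \<Rightarrow> (real^3 \<Rightarrow> real^3) \<Rightarrow> (real^3 \<Rightarrow> real^3) \<Rightarrow> real" where
  "ipw D a v w = ip D (\<lambda>x. a x *v v x) w"

definition wnorm :: "(real^3) set \<Rightarrow> (real^3 \<Rightarrow> real^3^3) \<Rightarrow> (real^3 \<Rightarrow> real^3) \<Rightarrow> real" where
  "wnorm D a v = sqrt (ipw D a v v)"

definition partial :: "3 \<Rightarrow> (real^3 \<Rightarrow> real^3) \<Rightarrow> real^3 \<Rightarrow> real^3" where
  "partial i f x = frechet_derivative f (at x) (axis i 1)"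

definition curl :: "(real^3 \<Rightarrow> real^3) \<Rightarrow> real^3 \<Rightarrow> real^3" where
  "curl f x = vector [partial 2 f x $ 3 - partial 3 f x $ 2,
                      partial 3 f x $ 1 - partial 1 f x $ 3,
                      partial 1 f x $ 2 - partial 2 f x $ 1]"

primrec Ck :: "nat \<Rightarrow> (real^3 \<Rightarrow> real^3) \<Rightarrow> bool" where
  "Ck 0 f \<longleftrightarrow> continuous_on UNIV f"
| "Ck (Suc m) f \<longleftrightarrow> (\<forall>x. f differentiable (at x)) \<and> (\<forall>i. Ck m (partial i f))"

definition test_fields :: "(real^3) set \<Rightarrow> (real^3 \<Rightarrow> real^3) set" where
  "test_fields D = {\<phi>. (\<forall>m. Ck m \<phi>) \<and> compact (closure {x. \<phi> x \<noteq> 0}) \<and> closure {x. \<phi> x \<noteq> 0} \<subseteq> D}"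

definition is_weak_curl :: "(real^3) set \<Rightarrow> (real^3 \<Rightarrow> real^3) \<Rightarrow> (real^3 \<Rightarrow> real^3) \<Rightarrow> bool" where
  "is_weak_curl D v w \<longleftrightarrow> w \<in> L2 D \<and> (\<forall>\<phi>\<in>test_fields D. ip D v (curl \<phi>) = ip D w \<phi>)"

definition Hcurl :: "(real^3) set \<Rightarrow> (real^3 \<Rightarrow> real^3) set" where
  "Hcurl D = {v \<in> L2 D. \<exists>w. is_weak_curl D v w}"

text \<open>A representative of the weak curl, which is unique almost everywhere in D.\<close>

definition wcurl :: "(real^3) set \<Rightarrow> (real^3 \<Rightarrow> real^3) \<Rightarrow> real^3 \<Rightarrow> real^3" where
  "wcurl D v = (SOME w. is_weak_curl D v w)"

definition H1 :: "(real^3) set \<Rightarrow> (real^3 \<Rightarrow> real^3) set" where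
  "H1 D = {v \<in> L2 D. \<forall>i. \<exists>g\<in>L2 D. \<forall>\<phi>\<in>test_fields D. ip D v (partial i \<phi>) = - ip D g \<phi>}"

text \<open>
  The tangential trace of a field v in H(curl) is the functional on the traces of the fields w of
  class H1 obtained by extending \<open>w \<mapsto> \<integral>\<^bsub>\<partial>D\<^esub> (v \<times> n\<^sub>D) \<bullet> w\<close> through Green's formula.
\<close>

definition tangential_trace :: "(real^3) set \<Rightarrow> (real^3 \<Rightarrow> real^3) \<Rightarrow> (real^3 \<Rightarrow> real^3) \<Rightarrow> real" where
  "tangential_trace D v w = ip D v (wcurl D w) - ip D (wcurl D v) w"

definition H0curl :: "(real^3) set \<Rightarrow> (real^3 \<Rightarrow> real^3) set" where
  "H0curl D = {v \<in> Hcurl D. \<forall>w\<in>H1 D. tangential_trace D v w = 0}"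

section \<open>Domain, coefficient and mesh\<close>

text \<open>
  Lipschitz boundary: near each boundary point, D is the strict hypograph, in some unit direction e,
  of a Lipschitz function g of the component orthogonal to e.
\<close>

definition lipschitz_boundary :: "(real^3) set \<Rightarrow> bool" where
  "lipschitz_boundary D \<longleftrightarrow> (\<forall>x\<in>frontier D. \<exists>r>0. \<exists>e. \<exists>g :: real^3 \<Rightarrow> real. \<exists>L.
      norm e = 1 \<and> L-lipschitz_on {z. z \<bullet> e = 0} g \<and>
      D \<inter> ball x r = {y \<in> ball x r. y \<bullet> e < g (y - (y \<bullet> e) *\<^sub>R e)})"

definition lipschitz_polyhedron :: "(real^3) set \<Rightarrow> bool" where
  "lipschitz_polyhedron D \<longleftrightarrow> open D \<and> bounded D \<and> lipschitz_boundary D \<and>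
     (\<exists>\<P>. finite \<P> \<and> (\<forall>P\<in>\<P>. polytope P) \<and> closure D = \<Union>\<P>)"

text \<open>\<open>n\<close> is the value at x of the outward unit normal, x being a point where the boundary is flat.\<close>

definition outward_unit_normal :: "(real^3) set \<Rightarrow> real^3 \<Rightarrow> real^3 \<Rightarrow> bool" where
  "outward_unit_normal D x n \<longleftrightarrow>
     norm n = 1 \<and> (\<exists>r>0. D \<inter> ball x r = {y \<in> ball x r. (y - x) \<bullet> n < 0})"

definition admissible_coeff :: "(real^3) set \<Rightarrow> (real^3 \<Rightarrow> real^3^3) \<Rightarrow> bool" where
  "admissible_coeff D \<nu> \<longleftrightarrow> \<nu> \<in> borel_measurable (lebesgue_on D) \<and>
     (\<forall>x\<in>D. transpose (\<nu> x) = \<nu> x \<and> (\<forall>u. u \<noteq> 0 \<longrightarrow> 0 < (\<nu> x *v u) \<bullet> u)) \<and>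
     (\<exists>\<alpha> \<beta>. 0 < \<alpha> \<and>
        (\<forall>x\<in>D. \<forall>\<mu> u. u \<noteq> 0 \<and> \<nu> x *v u = \<mu> *\<^sub>R u \<longrightarrow> \<alpha> \<le> \<mu> \<and> \<mu> \<le> \<beta>))"

definition simplicial_mesh :: "(real^3) set \<Rightarrow> (real^3) set set \<Rightarrow> bool" where
  "simplicial_mesh D \<T> \<longleftrightarrow> triangulation \<T> \<and> (\<forall>K\<in>\<T>. 3 simplex K) \<and> \<Union>\<T> = closure D"

definition faces :: "(real^3) set set \<Rightarrow> (real^3) set set" where
  "faces \<T> = {F. \<exists>K\<in>\<T>. F facet_of K}"

definition interfaces :: "(real^3) set set \<Rightarrow> (real^3) set set" where
  "interfaces \<T> = {F. \<exists>K\<in>\<T>. \<exists>K'\<in>\<T>. K \<noteq> K' \<and> F facet_of K \<and> F facet_of K'}"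

definition boundary_faces :: "(real^3) set set \<Rightarrow> (real^3) set set" where
  "boundary_faces \<T> = faces \<T> - interfaces \<T>"

text \<open>
  An arbitrary orientation of the faces: the cells \<open>Kl F\<close> and \<open>Kr F\<close> sharing the face F and the
  unit normal \<open>nF F\<close>. On a boundary face, \<open>Kr F\<close> is irrelevant.
\<close>

definition face_orientation ::
  "(real^3) set \<Rightarrow> (real^3) set set \<Rightarrow> ((real^3) set \<Rightarrow> (real^3) set) \<Rightarrow>
   ((real^3) set \<Rightarrow> (real^3) set) \<Rightarrow> ((real^3) set \<Rightarrow> real^3) \<Rightarrow> bool" where
  "face_orientation D \<T> Kl Kr nF \<longleftrightarrow>
     (\<forall>F\<in>interfaces \<T>. Kl F \<in> \<T> \<and> Kr F \<in> \<T> \<and> Kl F \<noteq> Kr F \<and> F facet_of Kl F \<and> F facet_of Kr F \<and>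
        norm (nF F) = 1 \<and>
        (\<forall>x\<in>F. (\<forall>y\<in>Kl F. (y - x) \<bullet> nF F \<le> 0) \<and> (\<forall>y\<in>Kr F. 0 \<le> (y - x) \<bullet> nF F))) \<and>
     (\<forall>F\<in>boundary_faces \<T>. Kl F \<in> \<T> \<and> F facet_of Kl F \<and>
        (\<forall>x\<in>rel_interior F. outward_unit_normal D x (nF F)))"

text \<open>
  The piecewise constant function with value \<open>c K\<close> in each cell K (and 0 on the mesh skeleton,
  a null set).
\<close>

definition piecewise :: "(real^3) set set \<Rightarrow> ((real^3) set \<Rightarrow> real) \<Rightarrow> real^3 \<Rightarrow> real" where
  "piecewise \<T> c x = (\<Sum>K\<in>\<T>. c K * indicat_real (interior K) x)"

definition h_tilde :: "(real^3) set set \<Rightarrow> real^3 \<Rightarrow> real" where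
  "h_tilde \<T> = piecewise \<T> diameter"

definition min_rayleigh :: "real^3^3 \<Rightarrow> real" where
  "min_rayleigh A = (INF u\<in>sphere 0 1. (A *v u) \<bullet> u)"

definition ess_inf_on :: "(real^3) set \<Rightarrow> (real^3 \<Rightarrow> real) \<Rightarrow> real" where
  "ess_inf_on K f = Sup {c. AE x in lebesgue_on K. c \<le> f x}"

definition nu_tilde :: "(real^3) set set \<Rightarrow> (real^3 \<Rightarrow> real^3^3) \<Rightarrow> real^3 \<Rightarrow> real" where
  "nu_tilde \<T> \<nu> = piecewise \<T> (\<lambda>K. ess_inf_on K (\<lambda>x. min_rayleigh (\<nu> x)))"

section \<open>Broken polynomial spaces, traces, lifting and discrete curl\<close>

text \<open>Vector-valued polynomials of total degree at most m; \<open>\<alpha>\<close> ranges over multi-indices.\<close>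

definition polys :: "nat \<Rightarrow> (real^3 \<Rightarrow> real^3) set" where
  "polys m = {p. \<exists>c :: (3 \<Rightarrow> nat) \<Rightarrow> real^3.
     \<forall>x. p x = (\<Sum>\<alpha> | sum \<alpha> UNIV \<le> m. (\<Prod>i\<in>UNIV. (x $ i) ^ \<alpha> i) *\<^sub>R c \<alpha>)}"

definition Pb :: "(real^3) set \<Rightarrow> (real^3) set set \<Rightarrow> nat \<Rightarrow> (real^3 \<Rightarrow> real^3) set" where
  "Pb D \<T> m = {v \<in> L2 D. \<forall>K\<in>\<T>. \<exists>p\<in>polys m. AE x in lebesgue_on K. v x = p x}"

definition Pc :: "(real^3) set \<Rightarrow> (real^3) set set \<Rightarrow> nat \<Rightarrow> (real^3 \<Rightarrow> real^3) set" where
  "Pc D \<T> m = Pb D \<T> m \<inter> Hcurl D"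

definition Pc0 :: "(real^3) set \<Rightarrow> (real^3) set set \<Rightarrow> nat \<Rightarrow> (real^3 \<Rightarrow> real^3) set" where
  "Pc0 D \<T> m = Pb D \<T> m \<inter> H0curl D"

text \<open>
  The polynomial with which a piecewise polynomial v agrees almost everywhere in K; evaluated on a
  face of K, it gives the trace of v from K.
\<close>

definition restr :: "(real^3) set \<Rightarrow> (real^3 \<Rightarrow> real^3) \<Rightarrow> real^3 \<Rightarrow> real^3" where
  "restr K v = (THE p. (\<exists>m. p \<in> polys m) \<and> (AE x in lebesgue_on K. v x = p x))"

definition curlh :: "(real^3) set set \<Rightarrow> (real^3 \<Rightarrow> real^3) \<Rightarrow> real^3 \<Rightarrow> real^3" where
  "curlh \<T> v x = (\<Sum>K\<in>\<T>. indicat_real (interior K) x *\<^sub>R curl (restr K v) x)"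

text \<open>
  Surface integral over a triangle F, by affine parametrisation over the unit triangle. The norm of
  the cross product is the area element; the value does not depend on the order of the vertices.
\<close>

definition face_integral :: "(real^3) set \<Rightarrow> (real^3 \<Rightarrow> real) \<Rightarrow> real" where
  "face_integral F f =
     (let (a, b, c) = (SOME (a, b, c). F = convex hull {a, b, c}) in
      norm (cross3 (b - a) (c - a)) *
      integral\<^sup>L (lebesgue_on {(s, t). 0 \<le> s \<and> 0 \<le> t \<and> s + t \<le> (1::real)})
        (\<lambda>(s, t). f (a + s *\<^sub>R (b - a) + t *\<^sub>R (c - a))))"

definition jump ::
  "(real^3) set set \<Rightarrow> ((real^3) set \<Rightarrow> (real^3) set) \<Rightarrow> ((real^3) set \<Rightarrow> (real^3) set) \<Rightarrow>
   ((real^3) set \<Rightarrow> real^3) \<Rightarrow> (real^3) set \<Rightarrow> (real^3 \<Rightarrow> real^3) \<Rightarrow> real^3 \<Rightarrow> real^3" where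
  "jump \<T> Kl Kr nF F v x =
     (if F \<in> interfaces \<T>
      then cross3 (restr (Kl F) v x) (nF F) - cross3 (restr (Kr F) v x) (nF F)
      else cross3 (restr (Kl F) v x) (nF F))"

definition average ::
  "(real^3) set set \<Rightarrow> ((real^3) set \<Rightarrow> (real^3) set) \<Rightarrow> ((real^3) set \<Rightarrow> (real^3) set) \<Rightarrow>
   (real^3) set \<Rightarrow> (real^3 \<Rightarrow> real^3) \<Rightarrow> real^3 \<Rightarrow> real^3" where
  "average \<T> Kl Kr F v x =
     (if F \<in> interfaces \<T> then (1/2) *\<^sub>R (restr (Kl F) v x + restr (Kr F) v x)
      else restr (Kl F) v x)"

text \<open>
  By the Riesz representation theorem on a finite-dimensional space, the lifting exists and is
  unique up to equality almost everywhere; \<open>SOME\<close> picks a representative.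
\<close>

definition lifting ::
  "(real^3) set \<Rightarrow> (real^3) set set \<Rightarrow> ((real^3) set \<Rightarrow> (real^3) set) \<Rightarrow> ((real^3) set \<Rightarrow> (real^3) set) \<Rightarrow>
   ((real^3) set \<Rightarrow> real^3) \<Rightarrow> nat \<Rightarrow> (real^3 \<Rightarrow> real^3) \<Rightarrow> real^3 \<Rightarrow> real^3" where
  "lifting D \<T> Kl Kr nF l v = (SOME L. L \<in> Pb D \<T> l \<and> (\<forall>\<phi>\<in>Pb D \<T> l.
     ip D L \<phi> = (\<Sum>F\<in>faces \<T>. face_integral F (\<lambda>x. jump \<T> Kl Kr nF F v x \<bullet> average \<T> Kl Kr F \<phi> x))))"

definition discrete_curl ::
  "(real^3) set \<Rightarrow> (real^3) set set \<Rightarrow> ((real^3) set \<Rightarrow> (real^3) set) \<Rightarrow> ((real^3) set \<Rightarrow> (real^3) set) \<Rightarrow>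
   ((real^3) set \<Rightarrow> real^3) \<Rightarrow> nat \<Rightarrow> (real^3 \<Rightarrow> real^3) \<Rightarrow> real^3 \<Rightarrow> real^3" where
  "discrete_curl D \<T> Kl Kr nF l v x = curlh \<T> v x + lifting D \<T> Kl Kr nF l v x"

section \<open>Norms, nonconformity measure and weak consistency error\<close>

definition normE ::
  "(real^3) set \<Rightarrow> (real^3) set set \<Rightarrow> ((real^3) set \<Rightarrow> (real^3) set) \<Rightarrow> ((real^3) set \<Rightarrow> (real^3) set) \<Rightarrow>
   ((real^3) set \<Rightarrow> real^3) \<Rightarrow> (real^3 \<Rightarrow> real^3^3) \<Rightarrow> nat \<Rightarrow> (real^3 \<Rightarrow> real^3) \<Rightarrow> real" where
  "normE D \<T> Kl Kr nF \<nu> l v =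
     sqrt ((L2norm D (\<lambda>x. (sqrt (nu_tilde \<T> \<nu> x) * inverse (h_tilde \<T> x)) *\<^sub>R v x))\<^sup>2
         + (wnorm D \<nu> (discrete_curl D \<T> Kl Kr nF l v))\<^sup>2)"

definition normH ::
  "(real^3) set \<Rightarrow> (real^3) set set \<Rightarrow> (real^3 \<Rightarrow> real^3^3) \<Rightarrow> (real^3 \<Rightarrow> real^3) \<Rightarrow> real" where
  "normH D \<T> \<nu> v =
     sqrt ((wnorm D (\<lambda>x. matrix_inv (\<nu> x)) v)\<^sup>2
         + (L2norm D (\<lambda>x. (inverse (sqrt (nu_tilde \<T> \<nu> x)) * h_tilde \<T> x) *\<^sub>R wcurl D v x))\<^sup>2)"

text \<open>
  The infimum here, like the one in the best-approximation error, is a minimum: it is the distance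
  to a finite-dimensional space.
\<close>

definition nc ::
  "(real^3) set \<Rightarrow> (real^3) set set \<Rightarrow> ((real^3) set \<Rightarrow> (real^3) set) \<Rightarrow> ((real^3) set \<Rightarrow> (real^3) set) \<Rightarrow>
   ((real^3) set \<Rightarrow> real^3) \<Rightarrow> (real^3 \<Rightarrow> real^3^3) \<Rightarrow> nat \<Rightarrow> nat \<Rightarrow> (real^3 \<Rightarrow> real^3) \<Rightarrow> real" where
  "nc D \<T> Kl Kr nF \<nu> k l v = (INF vc\<in>Pc0 D \<T> k. normE D \<T> Kl Kr nF \<nu> l (\<lambda>x. v x - vc x))"

definition consistency_error ::
  "(real^3) set \<Rightarrow> (real^3) set set \<Rightarrow> ((real^3) set \<Rightarrow> (real^3) set) \<Rightarrow> ((real^3) set \<Rightarrow> (real^3) set) \<Rightarrow>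
   ((real^3) set \<Rightarrow> real^3) \<Rightarrow> (real^3 \<Rightarrow> real^3^3) \<Rightarrow> nat \<Rightarrow> (real^3 \<Rightarrow> real^3) \<Rightarrow> (real^3 \<Rightarrow> real^3) \<Rightarrow> real" where
  "consistency_error D \<T> Kl Kr nF \<nu> l v \<Psi> =
     ip D v (wcurl D (\<lambda>x. \<nu> x *v wcurl D \<Psi> x))
     - ipw D \<nu> (discrete_curl D \<T> Kl Kr nF l v) (wcurl D \<Psi>)"

end

theory Submission
  imports Defs
begin

text \<open>
  Write \<open>\<sigma> = \<nu> curl \<Psi>\<close>. For \<open>v\<^sub>c\<close> in the conforming space with zero tangential trace and \<open>\<Phi>\<close> in
  the conforming space without boundary condition, put \<open>v' = v - v\<^sub>c\<close>. Two orthogonality relations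
  reduce the claim to the Cauchy--Schwarz inequality, since they yield
  \<open>\<delta>(v, \<Psi>) = (v', curl (\<sigma> - \<Phi>)) - (C v', \<sigma> - \<Phi>)\<close>.

  First, \<open>(v\<^sub>c, curl \<sigma>) = (curl v\<^sub>c, \<sigma>)\<close>, and the lifting does not see \<open>v\<^sub>c\<close>. The zero trace says that
  \<open>v\<^sub>c\<close>, extended by zero, has a weak curl on the whole space; localised by cutoff functions,
  shifted into \<open>D\<close> along the direction given by the Lipschitz boundary and mollified, it becomes a
  test field for the weak curl of \<open>\<sigma>\<close>. As \<open>v\<^sub>c\<close> is piecewise polynomial, hence bounded and
  continuous almost everywhere, dominated convergence replaces density arguments.

  Second, \<open>(v', curl \<Phi>) = (C v', \<Phi>)\<close>: this is Green's formula on each simplex, the definition of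
  the lifting, and the vanishing of the tangential jumps of \<open>\<Phi>\<close>, which follows by testing the weak
  curl of \<open>\<Phi>\<close> with bump functions times the jump. Almost everywhere bounds on \<open>\<nu>\<close> come from its
  eigenvalues, the minimum of the Rayleigh quotient being one of them.
\<close>

section \<open>Continuously differentiable functions and fields\<close>

text \<open>Plain mollification would spread that field across the boundary of D, which is why the
  kernels sit off centre. The tangential jumps of \<open>v\<^sub>c\<close>, on boundary faces too,
  are known only through pairings; fields that do not vanish on the boundary of D reveal them, and
  C1 fields on the whole space are rich enough for this. Hence the calculus below treats globally C1
  functions with explicit gradients and Jacobians, while smoothness of all orders is confined to one
  class of bump functions closed under differentiation.

  The bound has constant 1 because the norms carry dual weights: \<nu> against its inverse, and
  \<open>sqrt nu_tilde / h_tilde\<close> against its reciprocal. Each of the two pairings splits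
  without a constant, and the Cauchy-Schwarz inequality in the plane joins them.\<close>

definition C1_grad :: "(real^3 \<Rightarrow> real) \<Rightarrow> (real^3 \<Rightarrow> real^3) \<Rightarrow> bool" where
  "C1_grad f G \<longleftrightarrow> (\<forall>x. (f has_derivative (\<lambda>h. G x \<bullet> h)) (at x)) \<and> continuous_on UNIV G"

text \<open>\<open>J i\<close> is the partial derivative in direction i, a column of the Jacobian
  matrix. This grouping makes \<open>partial i\<close> and the arguments of \<open>crl\<close>
  immediate.\<close>

definition C1_jac :: "(real^3 \<Rightarrow> real^3) \<Rightarrow> (3 \<Rightarrow> real^3 \<Rightarrow> real^3) \<Rightarrow> bool" where
  "C1_jac \<phi> J \<longleftrightarrow> (\<forall>x. (\<phi> has_derivative (\<lambda>h. \<Sum>i\<in>UNIV. (h $ i) *\<^sub>R J i x)) (at x)) \<and>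
     (\<forall>i. continuous_on UNIV (J i))"

lemma C1_gradD:
  assumes "C1_grad f G"
  shows "(f has_derivative (\<lambda>h. G x \<bullet> h)) (at x)" "continuous_on S G" "continuous_on S f"
proof -
  show d: "(f has_derivative (\<lambda>h. G x \<bullet> h)) (at x)" for x
    using assms by (simp add: C1_grad_def)
  show "continuous_on S G"
    using assms continuous_on_subset[of UNIV G S] by (simp add: C1_grad_def)
  show "continuous_on S f"
    by (intro continuous_at_imp_continuous_on ballI has_derivative_continuous[OF d])
qed

lemma C1_jacD:
  assumes "C1_jac \<phi> J"
  shows "(\<phi> has_derivative (\<lambda>h. \<Sum>i\<in>UNIV. (h $ i) *\<^sub>R J i x)) (at x)"
    "continuous_on S (J i)" "continuous_on S \<phi>" "\<phi> differentiable (at x)"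
proof -
  show d: "(\<phi> has_derivative (\<lambda>h. \<Sum>i\<in>UNIV. (h $ i) *\<^sub>R J i x)) (at x)" for x
    using assms by (simp add: C1_jac_def)
  show "continuous_on S (J i)"
    using assms continuous_on_subset[of UNIV "J i" S] by (simp add: C1_jac_def)
  show "continuous_on S \<phi>"
    by (intro continuous_at_imp_continuous_on ballI has_derivative_continuous[OF d])
  show "\<phi> differentiable (at x)"
    using d unfolding differentiable_def by blast
qed

lemma sum_axis_scaleR: "(\<Sum>j\<in>UNIV. (axis i 1 $ j) *\<^sub>R f j) = f (i :: 3)" for f :: "3 \<Rightarrow> 'b::real_vector"
  by (simp add: axis_def if_distrib if_distribR cong: if_cong)

lemma C1_jac_partial:
  assumes "C1_jac \<phi> J"
  shows "partial i \<phi> = J i"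
proof
  fix x
  have "frechet_derivative \<phi> (at x) = (\<lambda>h. \<Sum>i\<in>UNIV. (h $ i) *\<^sub>R J i x)"
    by (rule frechet_derivative_at[OF C1_jacD(1)[OF assms], symmetric])
  then show "partial i \<phi> x = J i x"
    unfolding partial_def by (simp add: sum_axis_scaleR)
qed

lemma Ck_1_C1_jac:
  assumes "Ck (Suc 0) \<phi>"
  shows "C1_jac \<phi> (\<lambda>i. partial i \<phi>)"
proof -
  have "(\<phi> has_derivative (\<lambda>h. \<Sum>i\<in>UNIV. (h $ i) *\<^sub>R partial i \<phi> x)) (at x)" for x
  proof -
    let ?F = "frechet_derivative \<phi> (at x)"
    have d: "(\<phi> has_derivative ?F) (at x)"
      using assms by (simp add: frechet_derivative_works[symmetric])
    then have lin: "linear ?F" by (rule has_derivative_linear)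
    have "?F h = (\<Sum>i\<in>UNIV. (h $ i) *\<^sub>R partial i \<phi> x)" for h
    proof -
      have "?F h = ?F (\<Sum>i\<in>UNIV. (h $ i) *\<^sub>R axis i 1)"
        by (simp add: basis_expansion[of h, unfolded scalar_mult_eq_scaleR])
      also have "\<dots> = (\<Sum>i\<in>UNIV. (h $ i) *\<^sub>R ?F (axis i 1))"
        by (simp add: linear_sum[OF lin] linear_scale[OF lin])
      finally show ?thesis by (simp add: partial_def)
    qed
    then have "?F = (\<lambda>h. \<Sum>i\<in>UNIV. (h $ i) *\<^sub>R partial i \<phi> x)" by blast
    then show ?thesis using d by metis
  qed
  then show ?thesis using assms by (auto simp: C1_jac_def)
qed

lemma test_fields_C1_jac:
  assumes "\<phi> \<in> test_fields D"
  shows "C1_jac \<phi> (\<lambda>i. partial i \<phi>)"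
  using assms Ck_1_C1_jac unfolding test_fields_def by blast

text \<open>The curl as a linear function of the three partial derivatives, so that it can be formed
  from any explicit Jacobian, also from one whose columns are convolutions.\<close>

definition crl :: "(3 \<Rightarrow> real^3) \<Rightarrow> real^3" where
  "crl J = vector [J 2 $ 3 - J 3 $ 2, J 3 $ 1 - J 1 $ 3, J 1 $ 2 - J 2 $ 1]"

lemma curl_eq_crl: "curl \<phi> x = crl (\<lambda>i. partial i \<phi> x)"
  by (simp add: curl_def crl_def)

lemma C1_jac_curl: "C1_jac \<phi> J \<Longrightarrow> curl \<phi> x = crl (\<lambda>i. J i x)"
  by (simp add: curl_eq_crl C1_jac_partial)

text \<open>Applied to the Jacobian in \<open>C1_jac_scaleR\<close> these rules yield curl (f
  \<phi>) = f curl \<phi> + grad f \<times> \<phi>; \<open>crl_scaleR_vec\<close> supplies the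
  gradient term.\<close>

lemma crl_add: "crl (\<lambda>i. J i + K i) = crl J + crl K"
  and crl_diff: "crl (\<lambda>i. J i - K i) = crl J - crl K"
  and crl_scaleR: "crl (\<lambda>i. c *\<^sub>R J i) = c *\<^sub>R crl J"
  and crl_scaleR_vec: "crl (\<lambda>i. (a $ i) *\<^sub>R d) = cross3 a d"
  by (simp_all add: crl_def cross3_def vec_eq_iff forall_3 vector_3 algebra_simps)

text \<open>The algebra behind div (p \<times> q) = q . curl p - p . curl q: the summands are the
  diagonal entries of the Jacobian that \<open>C1_jac_cross\<close> gives for p \<times> q.\<close>

lemma crl_inner_diff: "crl J \<bullet> b - a \<bullet> crl K = (\<Sum>i\<in>UNIV. (cross3 (J i) b + cross3 a (K i)) $ i)"
  by (simp add: crl_def cross3_def inner_vec_def sum_3 vector_3 algebra_simps)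

lemma crl_eq_sum: "crl J = (\<Sum>i\<in>UNIV. cross3 (axis i 1) (J i))"
  by (simp add: crl_def cross3_def vec_eq_iff forall_3 vector_3 sum_3 axis_def)

lemma continuous_on_crl:
  "(\<And>i. continuous_on S (J i)) \<Longrightarrow> continuous_on S (\<lambda>x. crl (\<lambda>i. J i x))"
  for S :: "(real^3) set"
  unfolding crl_eq_sum by (intro continuous_on_sum continuous_on_cross continuous_on_const)

lemma C1_jac_const_scaleR:
  assumes "C1_grad f G"
  shows "C1_jac (\<lambda>x. f x *\<^sub>R d) (\<lambda>i x. (G x $ i) *\<^sub>R d)"
  unfolding C1_jac_def
proof (intro conjI allI)
  fix x
  show "((\<lambda>x. f x *\<^sub>R d) has_derivative (\<lambda>h. \<Sum>i\<in>UNIV. (h $ i) *\<^sub>R (G x $ i) *\<^sub>R d)) (at x)"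
    using has_derivative_scaleR_left[OF C1_gradD(1)[OF assms]]
    by (simp add: inner_vec_def scaleR_sum_left mult.commute)
next
  fix i
  show "continuous_on UNIV (\<lambda>x. (G x $ i) *\<^sub>R d)"
    by (intro continuous_intros C1_gradD(2)[OF assms])
qed

lemma C1_jac_add:
  assumes "C1_jac \<phi> J" "C1_jac \<psi> K"
  shows "C1_jac (\<lambda>x. \<phi> x + \<psi> x) (\<lambda>i x. J i x + K i x)"
  unfolding C1_jac_def
proof (intro conjI allI)
  fix x
  show "((\<lambda>x. \<phi> x + \<psi> x) has_derivative (\<lambda>h. \<Sum>i\<in>UNIV. (h $ i) *\<^sub>R (J i x + K i x))) (at x)"
    using has_derivative_add[OF C1_jacD(1)[OF assms(1)] C1_jacD(1)[OF assms(2)]]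
    by (simp add: scaleR_add_right sum.distrib)
qed (intro continuous_intros C1_jacD(2)[OF assms(1)] C1_jacD(2)[OF assms(2)])

lemma C1_jac_zero: "C1_jac (\<lambda>x. 0) (\<lambda>i x. 0)"
  by (auto simp: C1_jac_def)

lemma C1_jac_sum:
  assumes "\<And>k. k \<in> A \<Longrightarrow> C1_jac (\<phi> k) (J k)"
  shows "C1_jac (\<lambda>x. \<Sum>k\<in>A. \<phi> k x) (\<lambda>i x. \<Sum>k\<in>A. J k i x)"
  using assms
  by (induction A rule: infinite_finite_induct) (auto intro!: C1_jac_zero C1_jac_add)

lemma C1_jac_scaleR:
  assumes f: "C1_grad f G" and \<phi>: "C1_jac \<phi> J"
  shows "C1_jac (\<lambda>x. f x *\<^sub>R \<phi> x) (\<lambda>i x. f x *\<^sub>R J i x + (G x $ i) *\<^sub>R \<phi> x)"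
  unfolding C1_jac_def
proof (intro conjI allI)
  fix x
  have "(\<lambda>h. \<Sum>i\<in>UNIV. (h $ i) *\<^sub>R (f x *\<^sub>R J i x + (G x $ i) *\<^sub>R \<phi> x))
      = (\<lambda>h. f x *\<^sub>R (\<Sum>i\<in>UNIV. (h $ i) *\<^sub>R J i x) + (G x \<bullet> h) *\<^sub>R \<phi> x)"
    by (simp add: scaleR_add_right sum.distrib scaleR_sum_right inner_vec_def scaleR_sum_left
        mult.commute)
  then show "((\<lambda>x. f x *\<^sub>R \<phi> x) has_derivative
      (\<lambda>h. \<Sum>i\<in>UNIV. (h $ i) *\<^sub>R (f x *\<^sub>R J i x + (G x $ i) *\<^sub>R \<phi> x))) (at x)"
    using has_derivative_scaleR[OF C1_gradD(1)[OF f] C1_jacD(1)[OF \<phi>]] by simp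
qed (intro continuous_intros C1_jacD(2,3)[OF \<phi>] C1_gradD(2,3)[OF f])

lemma C1_jac_cmult:
  assumes "C1_jac \<phi> J"
  shows "C1_jac (\<lambda>x. c *\<^sub>R \<phi> x) (\<lambda>i x. c *\<^sub>R J i x)"
proof -
  have "C1_grad (\<lambda>x. c) (\<lambda>x. 0)" by (simp add: C1_grad_def)
  from C1_jac_scaleR[OF this assms] show ?thesis by simp
qed

lemma C1_jac_component:
  assumes "C1_jac \<phi> J"
  shows "C1_grad (\<lambda>x. \<phi> x $ j) (\<lambda>x. \<chi> i. J i x $ j)"
  unfolding C1_grad_def
proof (intro conjI allI)
  fix x
  have "((\<lambda>x. \<phi> x $ j) has_derivative (\<lambda>h. (\<Sum>i\<in>UNIV. (h $ i) *\<^sub>R J i x) $ j)) (at x)"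
    by (rule bounded_linear.has_derivative[OF bounded_linear_vec_nth C1_jacD(1)[OF assms]])
  then show "((\<lambda>x. \<phi> x $ j) has_derivative (\<bullet>) (\<chi> i. J i x $ j)) (at x)"
    by (rule has_derivative_eq_rhs) (simp add: fun_eq_iff inner_vec_def mult.commute)
qed (intro continuous_intros C1_jacD(2)[OF assms])

lemma C1_jac_cross:
  assumes p: "C1_jac p J" and q: "C1_jac q K"
  shows "C1_jac (\<lambda>x. cross3 (p x) (q x)) (\<lambda>i x. cross3 (J i x) (q x) + cross3 (p x) (K i x))"
  unfolding C1_jac_def
proof (intro conjI allI)
  fix x
  interpret bounded_bilinear cross3
    by (rule bilinear_conv_bounded_bilinear[THEN iffD1])
      (auto simp: bilinear_def cross_add_left cross_add_right cross_mult_left cross_mult_right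
        intro!: linearI)
  have "(\<lambda>h. \<Sum>i\<in>UNIV. (h $ i) *\<^sub>R (cross3 (J i x) (q x) + cross3 (p x) (K i x)))
      = (\<lambda>h. cross3 (p x) (\<Sum>i\<in>UNIV. (h $ i) *\<^sub>R K i x) + cross3 (\<Sum>i\<in>UNIV. (h $ i) *\<^sub>R J i x) (q x))"
    by (simp add: sum_3 cross_add_left cross_add_right cross_mult_left cross_mult_right
        scaleR_add_right algebra_simps)
  then show "((\<lambda>x. cross3 (p x) (q x)) has_derivative
      (\<lambda>h. \<Sum>i\<in>UNIV. (h $ i) *\<^sub>R (cross3 (J i x) (q x) + cross3 (p x) (K i x)))) (at x)"
    using FDERIV[OF C1_jacD(1)[OF p] C1_jacD(1)[OF q]] by simp
qed (intro continuous_intros continuous_on_cross C1_jacD(2,3)[OF p] C1_jacD(2,3)[OF q])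

lemma C1_grad_mult:
  assumes "C1_grad f F" "C1_grad g G"
  shows "C1_grad (\<lambda>x. f x * g x) (\<lambda>x. f x *\<^sub>R G x + g x *\<^sub>R F x)"
  unfolding C1_grad_def
proof (intro conjI allI)
  fix x
  show "((\<lambda>x. f x * g x) has_derivative (\<bullet>) (f x *\<^sub>R G x + g x *\<^sub>R F x)) (at x)"
    by (rule has_derivative_eq_rhs[OF has_derivative_mult[OF C1_gradD(1)[OF assms(1)] C1_gradD(1)[OF assms(2)]]])
      (auto simp: inner_add_left)
qed (intro continuous_intros C1_gradD(2,3)[OF assms(1)] C1_gradD(2,3)[OF assms(2)])

lemma C1_grad_add:
  assumes "C1_grad f F" "C1_grad g G"
  shows "C1_grad (\<lambda>x. f x + g x) (\<lambda>x. F x + G x)"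
  unfolding C1_grad_def
proof (intro conjI allI)
  fix x
  show "((\<lambda>x. f x + g x) has_derivative (\<bullet>) (F x + G x)) (at x)"
    by (rule has_derivative_eq_rhs[OF has_derivative_add[OF C1_gradD(1)[OF assms(1)] C1_gradD(1)[OF assms(2)]]])
      (auto simp: inner_add_left)
qed (intro continuous_intros C1_gradD(2)[OF assms(1)] C1_gradD(2)[OF assms(2)])

lemma C1_grad_const: "C1_grad (\<lambda>x. c) (\<lambda>x. 0)"
  by (simp add: C1_grad_def)

lemma C1_grad_coord: "C1_grad (\<lambda>x. x $ i) (\<lambda>x. axis i 1)"
proof -
  have "((\<lambda>x. x $ i) has_derivative (\<lambda>h::real^3. axis i 1 \<bullet> h)) (at x)" for x
    by (rule has_derivative_eq_rhs[OF bounded_linear_imp_has_derivative[OF bounded_linear_vec_nth]])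
      (simp add: inner_axis' fun_eq_iff)
  then show ?thesis by (simp add: C1_grad_def)
qed

lemma C1_grad_chain:
  assumes f: "C1_grad f G" and q: "\<And>t. (q has_real_derivative q' t) (at t)"
    and c: "continuous_on UNIV q'"
  shows "C1_grad (\<lambda>x. q (f x)) (\<lambda>x. q' (f x) *\<^sub>R G x)"
  unfolding C1_grad_def
proof (intro conjI allI)
  fix x
  show "((\<lambda>x. q (f x)) has_derivative (\<bullet>) (q' (f x) *\<^sub>R G x)) (at x)"
    by (rule has_derivative_eq_rhs[OF has_derivative_compose[OF C1_gradD(1)[OF f]
          q[unfolded has_field_derivative_def]]]) (simp add: fun_eq_iff)
next
  have "continuous_on UNIV (\<lambda>x. q' (f x))"
    using continuous_on_compose2[OF c C1_gradD(3)[OF f, of UNIV]] by simp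
  then show "continuous_on UNIV (\<lambda>x. q' (f x) *\<^sub>R G x)"
    by (intro continuous_intros C1_gradD(2)[OF f])
qed

lemma C1_grad_ball: "C1_grad (\<lambda>x. s - (norm (x - a))\<^sup>2) (\<lambda>x. (-2) *\<^sub>R (x - a))"
proof -
  have "((\<lambda>x. s - (norm (x - a))\<^sup>2) has_derivative (\<lambda>h. ((-2) *\<^sub>R (x - a)) \<bullet> h)) (at x)" for x
    unfolding power2_norm_eq_inner
    by (auto intro!: derivative_eq_intros simp: fun_eq_iff inner_diff_left inner_diff_right inner_commute algebra_simps)
  then show ?thesis by (auto simp: C1_grad_def intro!: continuous_intros)
qed

text \<open>A continuous gradient that vanishes outside a ball is uniformly continuous, so the
  Taylor remainder is small uniformly in the base point. The uniformity permits differentiation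
  under a convolution integral whose other factor is merely integrable.\<close>

lemma C1_grad_uniform:
  assumes f: "C1_grad f G" and z: "\<And>x. norm x \<ge> R \<Longrightarrow> G x = 0" and "0 < e"
  shows "\<exists>d>0. \<forall>z h. norm h < d \<longrightarrow> \<bar>f (z + h) - f z - G z \<bullet> h\<bar> \<le> e * norm h"
proof -
  \<comment> \<open>The ball is enlarged by 1 because d is at most 1: if one of two d-close points
    has norm below R, both lie in it.\<close>
  have "uniformly_continuous_on (cball 0 (\<bar>R\<bar>+1)) G"
    by (intro compact_uniformly_continuous C1_gradD(2)[OF f]) auto
  then obtain d0 where d0: "d0 > 0" and u: "\<And>x y. x \<in> cball 0 (\<bar>R\<bar>+1) \<Longrightarrow> y \<in> cball 0 (\<bar>R\<bar>+1) \<Longrightarrow>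
      dist y x < d0 \<Longrightarrow> dist (G y) (G x) < e"
    unfolding uniformly_continuous_on_def using \<open>0 < e\<close> by metis
  define d where "d = min d0 1"
  have G: "norm (G y - G x) \<le> e" if "dist y x < d" for x y
  proof (cases "norm x \<ge> R \<and> norm y \<ge> R")
    case True
    then show ?thesis using z \<open>0 < e\<close> by simp
  next
    case False
    have "norm x \<le> norm y + dist y x" "norm y \<le> norm x + dist y x"
      by (metis dist_commute dist_norm norm_triangle_sub) (metis dist_norm norm_triangle_sub)
    then have "x \<in> cball 0 (\<bar>R\<bar>+1)" "y \<in> cball 0 (\<bar>R\<bar>+1)"
      using False that by (auto simp: d_def)
    then show ?thesis using u[of x y] that by (auto simp: d_def dist_norm)
  qed
  show ?thesis
  proof (intro exI[of _ d] conjI allI impI)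
    show "d > 0" using d0 by (simp add: d_def)
    fix x h :: "real^3"
    assume h: "norm h < d"
    have "norm (f (x + h) - f x - (G x \<bullet> (x + h - x))) \<le> norm (x + h - x) * e"
    proof (rule differentiable_bound_linearization[where S = "ball x d" and f' = "\<lambda>x h. G x \<bullet> h"])
      show "x + t *\<^sub>R (x + h - x) \<in> ball x d" if "t \<in> {0..1}" for t
        using h that by (auto simp: dist_norm intro: order.strict_trans1[OF mult_left_le_one_le])
      show "(f has_derivative (\<bullet>) (G y)) (at y within ball x d)" for y
        using C1_gradD(1)[OF f] has_derivative_at_withinI by blast
      show "onorm ((\<bullet>) (G y) - (\<bullet>) (G x)) \<le> e" if "y \<in> ball x d" for y
      proof (rule onorm_bound)
        show "0 \<le> e" using \<open>0 < e\<close> by simp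
        fix v
        have "\<bar>(G y - G x) \<bullet> v\<bar> \<le> norm (G y - G x) * norm v" by (rule Cauchy_Schwarz_ineq2)
        also have "\<dots> \<le> e * norm v"
          using G[of y x] that by (intro mult_right_mono) (auto simp: dist_commute)
        finally show "norm (((\<bullet>) (G y) - (\<bullet>) (G x)) v) \<le> e * norm v"
          by (simp add: inner_diff_left)
      qed
      show "x \<in> ball x d" using d0 by (simp add: d_def)
    qed
    then show "\<bar>f (x + h) - f x - G x \<bullet> h\<bar> \<le> e * norm h" by (simp add: mult.commute)
  qed
qed

section \<open>Smooth bump functions and convolution\<close>

text \<open>For k = 0 this is the classical flat function exp (-1/t). The factors t^(-k) are
  included because differentiation produces them.\<close>

definition expinv :: "nat \<Rightarrow> real \<Rightarrow> real" where
  "expinv k t = (if 0 < t then exp (- (1 / t)) / t ^ k else 0)"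

lemma power_fact_le_exp: "x ^ n / fact n \<le> exp x" if "0 \<le> x" for x :: real
proof -
  have "x ^ n / fact n = (\<Sum>m\<in>{n}. x ^ m /\<^sub>R fact m)" by (simp add: divide_inverse mult.commute)
  also have "\<dots> \<le> exp x"
    unfolding exp_def using that
    by (intro sum_le_suminf summable_exp_generic) auto
  finally show ?thesis .
qed

text \<open>The single term of order k + 2 in the series of exp (1/t) already beats t^(-k) and
  leaves the square that yields derivative 0 at the origin.\<close>

lemma expinv_le: "\<bar>expinv k t\<bar> \<le> fact (k + 2) * t\<^sup>2"
proof (cases "0 < t")
  case True
  have "(1 / t) ^ (k + 2) / fact (k + 2) \<le> exp (1 / t)"
    using power_fact_le_exp[of "1 / t" "k + 2"] True by simp
  then have "1 \<le> exp (1 / t) * (fact (k + 2) * t ^ (k + 2))"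
    using True by (simp add: field_simps power_divide del: fact_Suc)
  then have "exp (- (1 / t)) \<le> fact (k + 2) * t ^ (k + 2)"
    by (simp add: exp_minus field_simps del: fact_Suc)
  then show ?thesis
    using True by (simp add: expinv_def field_simps power_add power2_eq_square del: fact_Suc)
qed (simp add: expinv_def)

lemma expinv_deriv:
  "(expinv k has_real_derivative (expinv (k + 2) t - real k * expinv (k + 1) t)) (at t)"
proof -
  consider "t < 0" | "t = 0" | "0 < t" by linarith
  then show ?thesis
  proof cases
    case 1
    have "(expinv k has_real_derivative 0) (at t)"
      by (rule has_field_derivative_transform_within_open[of "\<lambda>_. 0" _ _ "{..<0}"])
        (use 1 in \<open>auto simp: expinv_def\<close>)
    then show ?thesis using 1 by (simp add: expinv_def)
  next
    case 2
    have "(\<lambda>h. (expinv k (0 + h) - expinv k 0) / h) \<midarrow>0\<rightarrow> 0"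
    proof (rule tendsto_0_le[where K = "fact (k + 2)"])
      show "((\<lambda>h::real. h) \<longlongrightarrow> 0) (at 0)" by (rule tendsto_ident_at)
      have "norm ((expinv k (0 + h) - expinv k 0) / h) \<le> norm h * fact (k + 2)" for h
        using expinv_le[of k h]
        by (cases "h = 0") (auto simp: expinv_def[of k 0] field_simps power2_eq_square abs_mult simp del: fact_Suc)
      then show "\<forall>\<^sub>F h in at 0. norm ((expinv k (0 + h) - expinv k 0) / h) \<le> norm h * fact (k + 2)"
        by simp
    qed
    then show ?thesis using 2 by (simp add: DERIV_def expinv_def)
  next
    case 3
    have e: "((\<lambda>t. exp (- (1 / t))) has_real_derivative (exp (- (1 / t)) / t\<^sup>2)) (at t)"
      using 3 by (auto intro!: derivative_eq_intros simp: power2_eq_square)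
    have p: "((\<lambda>t. t ^ k) has_real_derivative (real k * t ^ (k - 1))) (at t)"
      using DERIV_pow[of k t] by simp
    have "((\<lambda>t. exp (- (1 / t)) / t ^ k) has_real_derivative (expinv (k + 2) t - real k * expinv (k + 1) t)) (at t)"
      by (rule DERIV_cong[OF DERIV_divide[OF e p]])
        (use 3 in \<open>cases k; simp add: expinv_def divide_simps power2_eq_square; simp add: algebra_simps\<close>)+
    then show ?thesis
      by (rule has_field_derivative_transform_within_open[of _ _ _ "{0<..}"])
        (use 3 in \<open>auto simp: expinv_def\<close>)
  qed
qed

text \<open>The span of polynomials times \<open>expinv k\<close> of r^2 - |x - a|^2, generated by
  rules instead of a formula. It is closed under partial derivatives and under multiplication by
  polynomials, so smoothness of all orders follows by induction on the order.\<close>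

inductive bump :: "real^3 \<Rightarrow> real \<Rightarrow> (real^3 \<Rightarrow> real) \<Rightarrow> bool" for a r where
  base: "bump a r (\<lambda>x. expinv k (r\<^sup>2 - (norm (x - a))\<^sup>2))"
| coord: "bump a r f \<Longrightarrow> bump a r (\<lambda>x. x $ i * f x)"
| add: "bump a r f \<Longrightarrow> bump a r g \<Longrightarrow> bump a r (\<lambda>x. f x + g x)"
| scale: "bump a r f \<Longrightarrow> bump a r (\<lambda>x. c * f x)"

lemma bump_outside: "bump a r f \<Longrightarrow> 0 < r \<Longrightarrow> r \<le> norm (x - a) \<Longrightarrow> f x = 0"
proof (induction rule: bump.induct)
  case (base k)
  then have "r\<^sup>2 \<le> (norm (x - a))\<^sup>2" by (intro power_mono) auto
  then show ?case by (simp add: expinv_def)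
qed auto

lemma bump_grad:
  "bump a r f \<Longrightarrow> \<exists>g. (\<forall>i. bump a r (g i)) \<and> C1_grad f (\<lambda>x. \<chi> i. g i x)"
proof (induction rule: bump.induct)
  case (base k)
  define q' where "q' t = expinv (k + 2) t - real k * expinv (k + 1) t" for t
  \<comment> \<open>This is q' times -2 (x_i - a_i), split so that \<open>coord\<close>,
    \<open>scale\<close> and \<open>add\<close> apply.\<close>
  define g where "g i x = (-2) * (x $ i * q' (r\<^sup>2 - (norm (x - a))\<^sup>2)) + (2 * a $ i) * q' (r\<^sup>2 - (norm (x - a))\<^sup>2)" for i x
  have c: "continuous_on UNIV (expinv k)" for k
    by (intro continuous_at_imp_continuous_on ballI DERIV_isCont[OF expinv_deriv])
  have C: "C1_grad (\<lambda>x. expinv k (r\<^sup>2 - (norm (x - a))\<^sup>2)) (\<lambda>x. q' (r\<^sup>2 - (norm (x - a))\<^sup>2) *\<^sub>R ((-2) *\<^sub>R (x - a)))"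
    unfolding q'_def
    by (rule C1_grad_chain[OF C1_grad_ball expinv_deriv]) (intro continuous_intros c)
  have e: "(\<lambda>x. q' (r\<^sup>2 - (norm (x - a))\<^sup>2) *\<^sub>R ((-2) *\<^sub>R (x - a))) = (\<lambda>x. \<chi> i. g i x)"
    by (auto simp: fun_eq_iff vec_eq_iff g_def algebra_simps)
  have q: "bump a r (\<lambda>x. q' (r\<^sup>2 - (norm (x - a))\<^sup>2))"
    unfolding q'_def
    using bump.add[OF bump.base[of a r "k + 2"] bump.scale[OF bump.base[of a r "k + 1"], of "- real k"]]
    by simp
  have "bump a r (g i)" for i
    unfolding g_def[abs_def] by (intro bump.add bump.scale bump.coord q)
  then show ?case using C unfolding e by blast
next
  case (coord f j)
  then obtain g where g: "\<And>i. bump a r (g i)" "C1_grad f (\<lambda>x. \<chi> i. g i x)" by blast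
  have e: "(\<lambda>x. x $ j *\<^sub>R (\<chi> i. g i x) + f x *\<^sub>R axis j 1) = (\<lambda>x. \<chi> i. x $ j * g i x + axis j 1 $ i * f x)"
    by (auto simp: fun_eq_iff vec_eq_iff)
  have "bump a r (\<lambda>x. x $ j * g i x + axis j 1 $ i * f x)" for i
    by (intro bump.add bump.scale bump.coord g coord)
  then show ?case using C1_grad_mult[OF C1_grad_coord[of j] g(2)] unfolding e
    by (intro exI[of _ "\<lambda>i x. x $ j * g i x + axis j 1 $ i * f x"]) simp
next
  case (add f1 f2)
  then obtain g1 g2 where g: "\<And>i. bump a r (g1 i)" "C1_grad f1 (\<lambda>x. \<chi> i. g1 i x)"
    "\<And>i. bump a r (g2 i)" "C1_grad f2 (\<lambda>x. \<chi> i. g2 i x)" by blast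
  have e: "(\<lambda>x. (\<chi> i. g1 i x) + (\<chi> i. g2 i x)) = (\<lambda>x. \<chi> i. g1 i x + g2 i x)"
    by (auto simp: fun_eq_iff vec_eq_iff)
  have "bump a r (\<lambda>x. g1 i x + g2 i x)" for i
    by (intro bump.add g)
  then show ?case using C1_grad_add[OF g(2,4)] unfolding e
    by (intro exI[of _ "\<lambda>i x. g1 i x + g2 i x"]) simp
next
  case (scale f c)
  then obtain g where g: "\<And>i. bump a r (g i)" "C1_grad f (\<lambda>x. \<chi> i. g i x)" by blast
  have e: "(\<lambda>x. c *\<^sub>R (\<chi> i. g i x) + f x *\<^sub>R 0) = (\<lambda>x. \<chi> i. c * g i x)"
    by (auto simp: fun_eq_iff vec_eq_iff)
  have "bump a r (\<lambda>x. c * g i x)" for i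
    by (intro bump.scale g)
  then show ?case using C1_grad_mult[OF C1_grad_const[of c] g(2)] unfolding e
    by (intro exI[of _ "\<lambda>i x. c * g i x"]) simp
qed

lemma bump_continuous: "bump a r f \<Longrightarrow> continuous_on S f"
  using bump_grad C1_gradD(3) by blast

lemma bump_bounded:
  assumes "bump a r f" "0 < r"
  obtains M where "0 < M" "\<And>x. \<bar>f x\<bar> \<le> M"
proof -
  have "bounded (f ` cball a r)"
    using assms by (intro compact_imp_bounded compact_continuous_image bump_continuous) auto
  then obtain M where M: "0 < M" "\<And>x. x \<in> cball a r \<Longrightarrow> \<bar>f x\<bar> \<le> M"
    unfolding bounded_pos by auto
  have "\<bar>f x\<bar> \<le> M" for x
    using M bump_outside[OF assms, of x] by (cases "x \<in> cball a r") (auto simp: dist_norm norm_minus_commute)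
  then show thesis using that M by blast
qed

section \<open>Convolution with off-centre smooth kernels\<close>

definition conv :: "(real^3 \<Rightarrow> real) \<Rightarrow> (real^3 \<Rightarrow> real^3) \<Rightarrow> real^3 \<Rightarrow> real^3" where
  "conv f u x = (\<integral>y. f (x - y) *\<^sub>R u y \<partial>lborel)"

lemma integrable_conv:
  fixes u :: "real^3 \<Rightarrow> real^3"
  assumes "bump a r f" "0 < r" "integrable lborel u"
  shows "integrable lborel (\<lambda>y. f (x - y) *\<^sub>R u y)"
proof -
  obtain M where M: "0 < M" "\<And>x. \<bar>f x\<bar> \<le> M" using bump_bounded[OF assms(1,2)] by blast
  have [measurable]: "f \<in> borel_measurable borel" "u \<in> borel_measurable borel"
    using borel_measurable_continuous_onI[OF bump_continuous[OF assms(1)]] assms(3) by auto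
  show ?thesis
  proof (rule Bochner_Integration.integrable_bound)
    show "integrable lborel (\<lambda>y. M *\<^sub>R norm (u y))" using assms(3) by simp
    show "AE y in lborel. norm (f (x - y) *\<^sub>R u y) \<le> norm (M *\<^sub>R norm (u y))"
      using M by (auto intro!: mult_mono)
  qed measurable
qed

text \<open>Under the integral the Taylor remainder of f at x - y is at most e |h| for all y at
  once, by \<open>C1_grad_uniform\<close>; only the L1 norm U of u enters the estimate.\<close>

lemma conv_C1_jac:
  assumes f: "bump a r f" and r: "0 < r" and u: "integrable lborel u"
    and g: "\<And>i. bump a r (g i)" and C: "C1_grad f (\<lambda>x. \<chi> i. g i x)"
  shows "C1_jac (conv f u) (\<lambda>i. conv (g i) u)"
proof -
  define U where "U = (\<integral>y. norm (u y) \<partial>lborel)"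
  have U: "0 \<le> U" by (simp add: U_def)
  \<comment> \<open>Stated for a general bump f' because it is used twice: for f, and for each
    \<open>g i\<close> to obtain continuity of the partial derivatives.\<close>
  have d: "(conv f' u has_derivative (\<lambda>h. \<Sum>i\<in>UNIV. (h $ i) *\<^sub>R conv (g' i) u x)) (at x)"
    if f': "bump a r f'" and g': "\<And>i. bump a r (g' i)" and C': "C1_grad f' (\<lambda>x. \<chi> i. g' i x)"
    for f' g' x
  proof (rule has_derivativeI)
    show "bounded_linear (\<lambda>h::real^3. \<Sum>i\<in>UNIV. (h $ i) *\<^sub>R conv (g' i) u x)"
      by (intro bounded_linear_sum bounded_linear_compose[OF bounded_linear_scaleR_left] bounded_linear_vec_nth)
    have i1: "integrable lborel (\<lambda>y. f' (x - y) *\<^sub>R u y)" for x by (rule integrable_conv[OF f' r u])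
    have i2: "integrable lborel (\<lambda>y. g' i (x - y) *\<^sub>R u y)" for x i by (rule integrable_conv[OF g' r u])
    have z: "(\<chi> i. g' i x) = 0" if "norm x \<ge> norm a + r" for x :: "real^3"
    proof -
      have "r \<le> norm (x - a)" using that norm_triangle_ineq2[of x a] by linarith
      then show ?thesis using bump_outside[OF g' r] by (simp add: vec_eq_iff)
    qed
    have key: "\<exists>d>0. \<forall>h. norm h < d \<longrightarrow>
        norm (conv f' u (x + h) - conv f' u x - (\<Sum>i\<in>UNIV. (h $ i) *\<^sub>R conv (g' i) u x)) \<le> e * U * norm h"
      if "0 < e" for e
    proof -
      obtain d where d: "d > 0" "\<And>z h. norm h < d \<Longrightarrow> \<bar>f' (z + h) - f' z - (\<chi> i. g' i z) \<bullet> h\<bar> \<le> e * norm h"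
        using C1_grad_uniform[OF C' z \<open>0 < e\<close>] by blast
      have "norm (conv f' u (x + h) - conv f' u x - (\<Sum>i\<in>UNIV. (h $ i) *\<^sub>R conv (g' i) u x)) \<le> e * U * norm h"
        if h: "norm h < d" for h
      proof -
        define F where "F y = f' (x + h - y) *\<^sub>R u y - f' (x - y) *\<^sub>R u y - (\<Sum>i\<in>UNIV. (h $ i) *\<^sub>R (g' i (x - y) *\<^sub>R u y))" for y
        have i3: "integrable lborel (\<lambda>y. (h $ i) *\<^sub>R (g' i (x - y) *\<^sub>R u y))" for i
          by (rule integrable_scaleR_right) (rule i2)
        have iF: "integrable lborel F" unfolding F_def
          by (intro Bochner_Integration.integrable_diff Bochner_Integration.integrable_sum i1 i3)
        have "conv f' u (x + h) - conv f' u x - (\<Sum>i\<in>UNIV. (h $ i) *\<^sub>R conv (g' i) u x) = (\<integral>y. F y \<partial>lborel)"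
          unfolding conv_def F_def
          by (subst Bochner_Integration.integral_diff Bochner_Integration.integral_sum integral_scaleR_right;
              (intro Bochner_Integration.integrable_diff Bochner_Integration.integrable_sum i1 i3)?)+
             (simp only: integral_scaleR_right)
        moreover have F: "F y = (f' (x - y + h) - f' (x - y) - (\<chi> i. g' i (x - y)) \<bullet> h) *\<^sub>R u y" for y
          by (simp add: F_def inner_vec_def scaleR_left_diff_distrib scaleR_sum_left mult.commute diff_add_eq)
        have "norm (\<integral>y. F y \<partial>lborel) \<le> (\<integral>y. (e * norm h) * norm (u y) \<partial>lborel)"
        proof (rule Bochner_Integration.integral_norm_bound_integral[OF iF])
          show "integrable lborel (\<lambda>y. (e * norm h) * norm (u y))" using u by simp
          show "norm (F y) \<le> (e * norm h) * norm (u y)" for y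
            unfolding F norm_scaleR using d(2)[OF h, of "x - y"] by (intro mult_right_mono) auto
        qed
        ultimately show ?thesis by (simp add: U_def algebra_simps)
      qed
      then show ?thesis using d(1) by blast
    qed
    show "((\<lambda>y. (conv f' u y - conv f' u x - (\<Sum>i\<in>UNIV. ((y - x) $ i) *\<^sub>R conv (g' i) u x)) /\<^sub>R norm (y - x)) \<longlongrightarrow> 0) (at x)"
      unfolding tendsto_iff
    proof (intro allI impI)
      fix e :: real assume "0 < e"
      \<comment> \<open>The summand 1 keeps the denominator positive when u vanishes almost
        everywhere; the factor 2 leaves room for a strict inequality.\<close>
      define e' where "e' = e / (2 * (U + 1))"
      have e': "0 < e'" "e' * U < e"
      proof -
        show "0 < e'" using \<open>0 < e\<close> U by (simp add: e'_def)
        have "e' * U \<le> e' * (U + 1)" using \<open>0 < e'\<close> by simp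
        also have "\<dots> = e / 2" using U by (simp add: e'_def field_simps add_nonneg_eq_0_iff)
        also have "\<dots> < e" using \<open>0 < e\<close> by simp
        finally show "e' * U < e" .
      qed
      obtain d where d: "d > 0" "\<And>h. norm h < d \<Longrightarrow>
        norm (conv f' u (x + h) - conv f' u x - (\<Sum>i\<in>UNIV. (h $ i) *\<^sub>R conv (g' i) u x)) \<le> e' * U * norm h"
        using key[OF e'(1)] by blast
      have "dist ((conv f' u y - conv f' u x - (\<Sum>i\<in>UNIV. ((y - x) $ i) *\<^sub>R conv (g' i) u x)) /\<^sub>R norm (y - x)) 0 < e"
        if "y \<noteq> x" "dist y x < d" for y
      proof -
        have n: "0 < norm (y - x)" using that by simp
        have "norm (conv f' u y - conv f' u x - (\<Sum>i\<in>UNIV. ((y - x) $ i) *\<^sub>R conv (g' i) u x)) \<le> e' * U * norm (y - x)"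
          using d(2)[of "y - x"] that by (simp add: dist_norm)
        also have "\<dots> < e * norm (y - x)" using e'(2) n by (intro mult_strict_right_mono)
        finally have "norm (conv f' u y - conv f' u x - (\<Sum>i\<in>UNIV. ((y - x) $ i) *\<^sub>R conv (g' i) u x)) < e * norm (y - x)" .
        then show ?thesis using n
          by (simp add: norm_divide divide_inverse[symmetric] pos_divide_less_eq mult.commute[of "inverse _"]
            del: vector_minus_component)
      qed
      then show "\<forall>\<^sub>F y in at x. dist ((conv f' u y - conv f' u x - (\<Sum>i\<in>UNIV. ((y - x) $ i) *\<^sub>R conv (g' i) u x)) /\<^sub>R norm (y - x)) 0 < e"
        unfolding eventually_at using d(1) by blast
    qed
  qed
  have "continuous_on UNIV (conv (g i) u)" for i
  proof -
    obtain g' where "\<And>j. bump a r (g' j)" "C1_grad (g i) (\<lambda>x. \<chi> i. g' i x)" using bump_grad[OF g] by blast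
    then show ?thesis
      by (intro continuous_at_imp_continuous_on ballI has_derivative_continuous[OF d[OF g]])
  qed
  then show ?thesis using d[OF f g C] by (simp add: C1_jac_def)
qed

lemma Ck_conv:
  assumes "0 < r" "integrable lborel u"
  shows "bump a r f \<Longrightarrow> Ck m (conv f u)"
proof (induction m arbitrary: f)
  case 0
  then obtain g where g: "\<And>i. bump a r (g i)" "C1_grad f (\<lambda>x. \<chi> i. g i x)" using bump_grad by blast
  then show ?case using C1_jacD(3)[OF conv_C1_jac[OF 0 assms g]] by simp
next
  case (Suc m)
  then obtain g where g: "\<And>i. bump a r (g i)" "C1_grad f (\<lambda>x. \<chi> i. g i x)" using bump_grad by blast
  note J = conv_C1_jac[OF Suc.prems assms g]
  show ?case using Suc.IH[OF g(1)] C1_jacD(4)[OF J] by (simp add: C1_jac_partial[OF J])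
qed

lemma conv_outside:
  assumes f: "bump a r f" and r: "0 < r" and u: "\<And>y. y \<notin> C \<Longrightarrow> u y = 0"
    and x: "\<And>y. y \<in> C \<Longrightarrow> x \<notin> cball (y + a) r"
  shows "conv f u x = 0"
proof -
  have "f (x - y) *\<^sub>R u y = 0" for y
  proof (cases "y \<in> C")
    case True
    then have "r \<le> norm (x - y - a)"
      using x[OF True] by (simp add: dist_norm norm_minus_commute algebra_simps)
    then show ?thesis using bump_outside[OF f r] by simp
  qed (simp add: u)
  then have "(\<lambda>y. f (x - y) *\<^sub>R u y) = (\<lambda>_. 0)" by blast
  then show ?thesis by (simp only: conv_def Bochner_Integration.integral_zero)
qed

text \<open>A kernel centred at a translates the support of u by a and then fattens it by r, so
  shifting and mollifying happen in one convolution.\<close>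

lemma conv_test_field:
  assumes f: "bump a r f" and r: "0 < r" and u: "integrable lborel u" "\<And>y. y \<notin> C \<Longrightarrow> u y = 0"
    and C: "compact C" and D: "\<And>y. y \<in> C \<Longrightarrow> cball (y + a) r \<subseteq> D"
  shows "conv f u \<in> test_fields D"
proof -
  let ?S = "(\<lambda>(y, z). y + a + z) ` (C \<times> cball 0 r)"
  have cS: "compact ?S"
    by (intro compact_continuous_image compact_Times C compact_cball) (auto intro!: continuous_intros simp: case_prod_unfold)
  have "x \<in> ?S" if "conv f u x \<noteq> 0" for x
  proof -
    have "\<not> (\<forall>y\<in>C. x \<notin> cball (y + a) r)"
    proof
      assume "\<forall>y\<in>C. x \<notin> cball (y + a) r"
      then have "conv f u x = 0" by (intro conv_outside[OF f r u(2)]) auto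
      with that show False by simp
    qed
    then obtain y where "y \<in> C" "x \<in> cball (y + a) r" by blast
    then show ?thesis by (intro image_eqI[of _ _ "(y, x - y - a)"]) (auto simp: dist_norm norm_minus_commute algebra_simps)
  qed
  then have sub: "closure {x. conv f u x \<noteq> 0} \<subseteq> ?S"
    by (intro closure_minimal) (auto intro: compact_imp_closed[OF cS])
  have SD: "?S \<subseteq> D"
  proof clarify
    fix y z assume "y \<in> C" "z \<in> cball (0::real^3) r"
    then show "y + a + z \<in> D" using D[of y] by (auto simp: subset_iff dist_norm norm_minus_commute)
  qed
  have "compact (closure {x. conv f u x \<noteq> 0})"
    unfolding compact_closure
    by (rule bounded_subset[OF compact_imp_bounded[OF cS]]) (rule subset_trans[OF closure_subset sub])
  moreover have "closure {x. conv f u x \<noteq> 0} \<subseteq> D" by (rule order_trans[OF sub SD])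
  moreover have "Ck m (conv f u)" for m by (rule Ck_conv[OF r u(1) f])
  ultimately show ?thesis unfolding test_fields_def by (intro CollectI conjI allI)
qed

text \<open>The normalisation is stated for y \<mapsto> f (x - y), the form in which the kernel
  occurs in \<open>conv\<close>; reflection and translation preserve Lebesgue measure.\<close>

lemma bump_exists:
  assumes "0 < r"
  obtains f where "bump a r f" "\<And>x. 0 \<le> f x" "\<And>x. (\<integral>y. f (x - y) \<partial>lborel) = 1"
    "\<And>x. norm (x - a) < r \<Longrightarrow> 0 < f x" "\<And>x. integrable lborel (\<lambda>y. f (x - y))"
proof -
  define f0 where "f0 x = expinv 0 (r\<^sup>2 - (norm (x - a))\<^sup>2)" for x :: "real^3"
  have b0: "bump a r f0" unfolding f0_def[abs_def] by (rule bump.base)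
  have p0: "0 \<le> f0 x" for x by (simp add: f0_def expinv_def)
  have pp: "0 < f0 x" if "norm (x - a) < r" for x
  proof -
    have "(norm (x - a))\<^sup>2 < r\<^sup>2" using that by (intro power_strict_mono) auto
    then show ?thesis by (simp add: f0_def expinv_def)
  qed
  have cont: "continuous_on S f0" for S by (rule bump_continuous[OF b0])
  have supp: "f0 x = 0" if "x \<notin> cball a r" for x
    using bump_outside[OF b0 assms, of x] that by (auto simp: dist_norm norm_minus_commute)
  have int: "integrable lborel f0"
  proof -
    have "integrable lborel (\<lambda>x. indicator (cball a r) x *\<^sub>R f0 x)"
      by (rule borel_integrable_compact[OF compact_cball cont])
    moreover have "(\<lambda>x. indicator (cball a r) x *\<^sub>R f0 x) = f0"
      using supp by (auto simp: fun_eq_iff indicator_def)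
    ultimately show ?thesis by simp
  qed
  have intr: "integrable lborel (\<lambda>y. f0 (x - y))" "(\<integral>y. f0 (x - y) \<partial>lborel) = (\<integral>y. f0 y \<partial>lborel)" for x
  proof -
    have m: "f0 \<in> borel_measurable borel" using int by auto
    have d: "lborel = distr lborel borel (\<lambda>y. x - y :: real^3)"
    proof -
      have "lborel = density (distr lborel borel (\<lambda>y. x + (-1) *\<^sub>R y)) (\<lambda>_. \<bar>- 1::real\<bar> ^ DIM(real^3))"
        by (rule lborel_affine) simp
      then show ?thesis by (simp add: density_1)
    qed
    have "(\<integral>y. f0 y \<partial>lborel) = (\<integral>y. f0 y \<partial>distr lborel borel (\<lambda>y. x - y))" using d by simp
    also have "\<dots> = (\<integral>y. f0 (x - y) \<partial>lborel)" using m by (subst integral_distr) auto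
    finally show "(\<integral>y. f0 (x - y) \<partial>lborel) = (\<integral>y. f0 y \<partial>lborel)" by simp
    have "integrable (distr lborel borel (\<lambda>y. x - y)) f0" using int d by simp
    then show "integrable lborel (\<lambda>y. f0 (x - y))" by (subst (asm) integrable_distr_eq) (use m in auto)
  qed
  define c where "c = (\<integral>y. f0 y \<partial>lborel)"
  have "0 < c"
  proof -
    have "c \<noteq> 0"
    proof
      assume "c = 0"
      then have "AE x in lborel. f0 x = 0"
        using integral_nonneg_eq_0_iff_AE[OF int] p0 by (simp add: c_def)
      then have "AE x in lborel. x \<notin> ball a r"
        by eventually_elim (use pp in \<open>force simp: dist_norm norm_minus_commute\<close>)
      then have "ball a r \<in> null_sets lborel"
        by (intro AE_iff_null_sets[THEN iffD2]) simp_all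
      then have "negligible (ball a r)"
        using negligible_iff_null_sets null_sets_completionI by blast
      then show False using open_not_negligible[of "ball a r"] assms by auto
    qed
    moreover have "0 \<le> c" unfolding c_def using p0 by simp
    ultimately show ?thesis by simp
  qed
  show thesis
  proof (rule that[of "\<lambda>x. inverse c * f0 x"])
    show "bump a r (\<lambda>x. inverse c * f0 x)" by (intro bump.scale b0)
  qed (use p0 pp intr \<open>0 < c\<close> in \<open>auto simp: c_def[symmetric]\<close>)
qed

text \<open>A normalised nonnegative kernel takes averages, here of the values of u at points y with
  x - y within r of a. Taking c = u x gives convergence, taking c = 0 the uniform bound.\<close>

lemma conv_close:
  assumes f: "bump a r f" and r: "0 < r" and f0: "\<And>x. 0 \<le> f x" and f1: "\<And>x. (\<integral>y. f (x - y) \<partial>lborel) = 1"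
    and fi: "\<And>x. integrable lborel (\<lambda>y. f (x - y))"
    and u: "integrable lborel u" and b: "\<And>y. norm (x - y - a) \<le> r \<Longrightarrow> norm (u y - c) \<le> e"
  shows "norm (conv f u x - c) \<le> e"
proof -
  have i: "integrable lborel (\<lambda>y. f (x - y) *\<^sub>R u y)" by (rule integrable_conv[OF f r u])
  have i2: "integrable lborel (\<lambda>y. f (x - y) *\<^sub>R c)" using fi by simp
  have "conv f u x - c = (\<integral>y. f (x - y) *\<^sub>R u y \<partial>lborel) - (\<integral>y. f (x - y) *\<^sub>R c \<partial>lborel)"
    using fi f1 by (simp add: conv_def)
  also have "\<dots> = (\<integral>y. f (x - y) *\<^sub>R (u y - c) \<partial>lborel)"
    using i i2 by (simp add: scaleR_diff_right)
  finally have "norm (conv f u x - c) = norm (\<integral>y. f (x - y) *\<^sub>R (u y - c) \<partial>lborel)" by simp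
  also have "\<dots> \<le> (\<integral>y. f (x - y) * e \<partial>lborel)"
  proof (rule Bochner_Integration.integral_norm_bound_integral)
    show "integrable lborel (\<lambda>y. f (x - y) *\<^sub>R (u y - c))"
      using Bochner_Integration.integrable_diff[OF i i2] by (simp add: scaleR_diff_right)
    show "integrable lborel (\<lambda>y. f (x - y) * e)" using fi by simp
    show "norm (f (x - y) *\<^sub>R (u y - c)) \<le> f (x - y) * e" for y
    proof (cases "norm (x - y - a) \<le> r")
      case True
      then show ?thesis using b[OF True] f0[of "x - y"] by (simp add: mult_left_mono)
    next
      case False
      then have "f (x - y) = 0" using bump_outside[OF f r, of "x - y"] by simp
      then show ?thesis by simp
    qed
  qed
  also have "\<dots> = e" using f1 by simp
  finally show ?thesis .
qed

text \<open>The kernels are centred at t_n e with radius r_n \<le> t_n, both tending to 0. The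
  translate of C by t_n e is compact in D, so r_n can be taken within its margin. The last two
  conclusions are what dominated convergence asks for; e = 0 gives ordinary mollification.\<close>

lemma mollifiers:
  assumes C: "compact C" and D: "open D" and t0: "0 < t0"
    and sh: "\<And>y t. y \<in> C \<Longrightarrow> 0 < t \<Longrightarrow> t < t0 \<Longrightarrow> y + t *\<^sub>R e \<in> D"
  obtains f :: "nat \<Rightarrow> real^3 \<Rightarrow> real" where
    "\<And>n. \<exists>a r. 0 < r \<and> bump a r (f n)"
    "\<And>n u. integrable lborel u \<Longrightarrow> (\<And>y. y \<notin> C \<Longrightarrow> u y = 0) \<Longrightarrow> conv (f n) u \<in> test_fields D"
    "\<And>n u x M. integrable lborel u \<Longrightarrow> (\<And>y. norm (u y) \<le> M) \<Longrightarrow> norm (conv (f n) u x) \<le> M"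
    "\<And>u x. integrable lborel u \<Longrightarrow> isCont u x \<Longrightarrow> (\<lambda>n. conv (f n) u x) \<longlonglongrightarrow> u x"
proof -
  \<comment> \<open>The offset 2 keeps \<open>t n\<close> strictly below t0 even for n = 0.\<close>
  define t where "t n = t0 / (n + 2)" for n :: nat
  have t: "0 < t n" "t n < t0" for n using t0 by (auto simp: t_def field_simps add_strict_increasing)
  have t_lim: "t \<longlonglongrightarrow> 0"
  proof -
    have "(\<lambda>n. t0 * inverse (real (Suc (Suc n)))) \<longlonglongrightarrow> t0 * 0"
      by (intro tendsto_mult tendsto_const LIMSEQ_Suc[OF LIMSEQ_inverse_real_of_nat])
    then show ?thesis by (simp add: t_def[abs_def] divide_inverse add.commute)
  qed
  have "\<exists>r. 0 < r \<and> r \<le> t n \<and> (\<forall>y\<in>C. cball (y + t n *\<^sub>R e) r \<subseteq> D)" for n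
  proof (cases "C = {}")
    case False
    have "compact ((\<lambda>y. y + t n *\<^sub>R e) ` C)"
      by (intro compact_continuous_image C continuous_intros)
    moreover have "(\<lambda>y. y + t n *\<^sub>R e) ` C \<subseteq> D" using sh t by auto
    ultimately obtain d where d: "d > 0" "(\<Union>x\<in>(\<lambda>y. y + t n *\<^sub>R e) ` C. cball x d) \<subseteq> D"
      using compact_subset_open_imp_cball_epsilon_subset[OF _ D] by metis
    show ?thesis
      by (rule exI[of _ "min d (t n)"]) (use d t[of n] in \<open>auto simp: subset_iff\<close>)
  qed (use t in auto)
  then obtain r where r: "\<And>n. 0 < r n" "\<And>n. r n \<le> t n" "\<And>n y. y \<in> C \<Longrightarrow> cball (y + t n *\<^sub>R e) (r n) \<subseteq> D"
    by metis
  define a where "a n = t n *\<^sub>R e" for n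
  have "\<exists>f. bump (a n) (r n) f \<and> (\<forall>x. 0 \<le> f x) \<and> (\<forall>x. (\<integral>y. f (x - y) \<partial>lborel) = 1) \<and> (\<forall>x. integrable lborel (\<lambda>y. f (x - y)))" for n
    by (rule bump_exists[OF r(1)[of n], where a = "a n"]) blast
  then obtain f where f: "\<And>n. bump (a n) (r n) (f n)" "\<And>n x. 0 \<le> f n x"
    "\<And>n x. (\<integral>y. f n (x - y) \<partial>lborel) = 1" "\<And>n x. integrable lborel (\<lambda>y. f n (x - y))"
    by metis
  have ar_lim: "(\<lambda>n. norm (a n) + r n) \<longlonglongrightarrow> 0"
  proof (rule tendsto_sandwich[OF _ _ tendsto_const])
    show "(\<lambda>n. t n * norm e + t n) \<longlonglongrightarrow> 0"
      using tendsto_add[OF tendsto_mult_right[OF t_lim, of "norm e"] t_lim] by simp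
    show "\<forall>\<^sub>F n in sequentially. norm (a n) + r n \<le> t n * norm e + t n"
      using r(2) t by (simp add: a_def less_imp_le)
    show "\<forall>\<^sub>F n in sequentially. 0 \<le> norm (a n) + r n"
      using r(1) by (simp add: add_nonneg_nonneg less_imp_le)
  qed
  show thesis
  proof (rule that[of f])
    show "\<exists>a r. 0 < r \<and> bump a r (f n)" for n using r(1) f(1) by blast
  next
    fix n and u :: "real^3 \<Rightarrow> real^3" assume u: "integrable lborel u" "\<And>y. y \<notin> C \<Longrightarrow> u y = 0"
    show "conv (f n) u \<in> test_fields D"
      by (rule conv_test_field[OF f(1) r(1) u C]) (use r(3) in \<open>auto simp: a_def\<close>)
  next
    fix n x M and u :: "real^3 \<Rightarrow> real^3" assume u: "integrable lborel u" "\<And>y. norm (u y) \<le> M"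
    show "norm (conv (f n) u x) \<le> M"
      using conv_close[OF f(1) r(1) f(2,3,4) u(1), where x = x and c = 0 and e = M] u(2) by simp
  next
    fix x and u :: "real^3 \<Rightarrow> real^3" assume u: "integrable lborel u" "isCont u x"
    show "(\<lambda>n. conv (f n) u x) \<longlonglongrightarrow> u x"
    proof (rule LIMSEQ_I)
      fix d :: real assume "0 < d"
      then obtain s where s: "s > 0" "\<And>y. dist y x < s \<Longrightarrow> dist (u y) (u x) < d / 2"
        using u(2) unfolding continuous_at_eps_delta by (metis half_gt_zero)
      obtain N where N: "\<And>n. n \<ge> N \<Longrightarrow> norm (a n) + r n < s"
        using order_tendstoD(2)[OF ar_lim s(1)] by (auto simp: eventually_sequentially)
      show "\<exists>N. \<forall>n\<ge>N. norm (conv (f n) u x - u x) < d"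
      proof (intro exI allI impI)
        fix n assume n: "n \<ge> N"
        have "norm (conv (f n) u x - u x) \<le> d / 2"
        proof (rule conv_close[OF f(1) r(1) f(2,3,4) u(1)])
          fix y assume y: "norm (x - y - a n) \<le> r n"
          have "norm (x - y) \<le> norm (x - y - a n) + norm (a n)" using norm_triangle_ineq[of "x - y - a n" "a n"] by simp
          then have "dist y x < s" using y N[OF n] by (simp add: dist_norm norm_minus_commute)
          then show "norm (u y - u x) \<le> d / 2" using s(2)[of y] by (simp add: dist_norm)
        qed
        then show "norm (conv (f n) u x - u x) < d" using \<open>0 < d\<close> by simp
      qed
    qed
  qed
qed

section \<open>Integration by parts and weak curls\<close>

lemma lborel_integral_translation:
  fixes f :: "real^3 \<Rightarrow> real"
  assumes "f \<in> borel_measurable borel"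
  shows "(\<integral>x. f (x + a) \<partial>lborel) = (\<integral>x. f x \<partial>lborel)"
proof -
  have "(\<integral>x. f x \<partial>lborel) = (\<integral>x. f x \<partial>distr lborel borel ((+) a))" by (simp add: lborel_distr_plus)
  also have "\<dots> = (\<integral>x. f (a + x) \<partial>lborel)" using assms by (subst integral_distr) auto
  finally show ?thesis by (simp add: add.commute)
qed

lemma continuous_bounded_cball:
  fixes f :: "real^3 \<Rightarrow> 'b::real_normed_vector"
  assumes "continuous_on UNIV f"
  obtains M where "0 \<le> M" "\<And>x. norm x \<le> R \<Longrightarrow> norm (f x) \<le> M"
proof -
  have "bounded (f ` cball 0 R)"
    by (intro compact_imp_bounded compact_continuous_image continuous_on_subset[OF assms]) auto
  then obtain a where "\<forall>x\<in>f ` cball 0 R. norm x \<le> a" unfolding bounded_iff by blast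
  then have "norm (f x) \<le> \<bar>a\<bar>" if "norm x \<le> R" for x using that by force
  then show thesis using that[of "\<bar>a\<bar>"] by simp
qed

lemma borel_lebesgue_on: "f \<in> borel_measurable borel \<Longrightarrow> f \<in> borel_measurable (lebesgue_on S)"
  for f :: "real^3 \<Rightarrow> 'b::topological_space"
  by (intro measurable_restrict_space1 measurable_completion) simp

lemma borel_norm_square: "v \<in> borel_measurable M \<Longrightarrow> (\<lambda>x. (norm (v x))\<^sup>2) \<in> borel_measurable M"
  for v :: "'a \<Rightarrow> real^3"
  by measurable

lemma integrable_lebesgue_on_subset:
  fixes g :: "real^3 \<Rightarrow> 'b::{banach,second_countable_topology}"
  assumes "integrable (lebesgue_on S) g" "T \<subseteq> S" "T \<in> sets lebesgue" "S \<in> sets lebesgue"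
  shows "integrable (lebesgue_on T) g"
proof -
  have "integrable lebesgue (\<lambda>x. indicator S x *\<^sub>R g x)"
    using assms by (simp add: integrable_restrict_space)
  from integrable_mult_indicator[OF assms(3) this]
  have "integrable lebesgue (\<lambda>x. indicator T x *\<^sub>R indicator S x *\<^sub>R g x)" .
  also have "(\<lambda>x. indicator T x *\<^sub>R indicator S x *\<^sub>R g x) = (\<lambda>x. indicator T x *\<^sub>R g x)"
    using assms(2) by (auto simp: fun_eq_iff indicator_def)
  finally show ?thesis using assms by (simp add: integrable_restrict_space)
qed

lemma integrable_bounded_support:
  fixes u :: "real^3 \<Rightarrow> 'b::{banach,second_countable_topology}"
  assumes "u \<in> borel_measurable borel" "\<And>x. norm (u x) \<le> M" "\<And>x. x \<notin> C \<Longrightarrow> u x = 0" "bounded C"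
  shows "integrable lborel u"
proof -
  obtain R where R: "C \<subseteq> ball 0 R" using bounded_subset_ballD[OF assms(4)] by blast
  show ?thesis
  proof (rule Bochner_Integration.integrable_bound)
    show "integrable lborel (\<lambda>x. M * indicator (cball 0 R) x :: real)"
      by (intro integrable_mult_right integrable_real_indicator emeasure_lborel_cball_finite) simp
    show "u \<in> borel_measurable lborel" using assms(1) by simp
    show "AE x in lborel. norm (u x) \<le> norm (M * indicator (cball 0 R) x :: real)"
    proof (rule AE_I2)
      fix x
      show "norm (u x) \<le> norm (M * indicator (cball 0 R) x :: real)"
        using assms(2)[of x] assms(3)[of x] R by (cases "x \<in> C") (auto simp: indicator_def subset_iff less_imp_le)
    qed
  qed
qed

text \<open>Difference quotients integrate to zero by translation invariance, and dominated
  convergence carries this over to the directional derivative.\<close>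

lemma integral_grad_eq_0:
  assumes f: "C1_grad f G" and z: "\<And>x. norm x \<ge> R \<Longrightarrow> f x = 0" "\<And>x. norm x \<ge> R \<Longrightarrow> G x = 0"
  shows "(\<integral>x. G x \<bullet> e \<partial>lborel) = 0"
proof -
  define t where "t n = inverse (real (Suc n))" for n
  have t: "t \<longlonglongrightarrow> 0" "\<And>n. 0 < t n" "\<And>n. t n \<le> 1"
    using LIMSEQ_inverse_real_of_nat by (auto simp: t_def[abs_def] field_simps)
  have m: "f \<in> borel_measurable borel" "G \<in> borel_measurable borel"
    using C1_gradD(2,3)[OF f] borel_measurable_continuous_onI by auto
  obtain M0 where M0: "0 \<le> M0" "\<And>x. norm x \<le> R \<Longrightarrow> norm (G x) \<le> M0"
    using continuous_bounded_cball[OF C1_gradD(2)[OF f]] by blast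
  then have M: "norm (G x) \<le> \<bar>M0\<bar>" for x
    using z(2)[of x] by (cases "norm x \<le> R") auto
  define q where "q n x = (f (x + t n *\<^sub>R e) - f x) / t n" for n x
  have intf: "integrable lborel f"
  proof -
    obtain K0 where K0: "0 \<le> K0" "\<And>x. norm x \<le> R \<Longrightarrow> norm (f x) \<le> K0"
      using continuous_bounded_cball[OF C1_gradD(3)[OF f]] by blast
    then have K: "norm (f x) \<le> K0" for x
      using z(1)[of x] by (cases "norm x \<le> R") auto
    show ?thesis
      by (rule integrable_bounded_support[OF m(1) K, of "cball 0 \<bar>R\<bar>"]) (use z(1) in auto)
  qed
  have intft: "integrable lborel (\<lambda>x. f (x + c))" for c
  proof -
    have "integrable (distr lborel borel ((+) c)) f" using intf by (simp add: lborel_distr_plus)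
    then have "integrable lborel (\<lambda>x. f (c + x))" by (subst (asm) integrable_distr_eq) (use m in auto)
    then show ?thesis by (simp add: add.commute)
  qed
  have q0: "(\<integral>x. q n x \<partial>lborel) = 0" for n
    unfolding q_def using intf intft lborel_integral_translation[OF m(1)] by simp
  \<comment> \<open>Since \<open>t n\<close> is at most 1, all quotients live in the ball enlarged
    by |e|, and the mean value inequality bounds them there.\<close>
  have bound: "norm (q n x) \<le> (\<bar>M0\<bar> * norm e) * indicator (cball 0 (\<bar>R\<bar> + norm e)) x" for n x
  proof -
    have "norm (f (x + t n *\<^sub>R e) - f x) \<le> norm (t n *\<^sub>R e) * \<bar>M0\<bar>"
    proof -
      show ?thesis
        by (rule differentiable_bound_segment[where G = UNIV and f' = "\<lambda>x h. G x \<bullet> h"])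
          (auto intro!: onorm_bound order_trans[OF Cauchy_Schwarz_ineq2] mult_right_mono M C1_gradD(1)[OF f])
    qed
    then have "norm (q n x) \<le> \<bar>M0\<bar> * norm e"
      using t(2)[of n] by (simp add: q_def field_simps)
    moreover have "q n x = 0" if "x \<notin> cball 0 (\<bar>R\<bar> + norm e)"
    proof -
      have "norm (t n *\<^sub>R e) \<le> norm e" using t(2,3)[of n] by (simp add: mult_left_le_one_le)
      then have "norm x - norm e \<le> norm (x + t n *\<^sub>R e)" using norm_diff_ineq[of x "t n *\<^sub>R e"] by linarith
      moreover have "\<bar>R\<bar> + norm e < norm x" using that by simp
      ultimately have "R \<le> norm (x + t n *\<^sub>R e)" "R \<le> norm x" using norm_ge_zero[of e] by linarith+
      then show ?thesis using z(1) by (simp add: q_def)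
    qed
    ultimately show ?thesis by (auto simp: indicator_def)
  qed
  have "(\<lambda>n. \<integral>x. q n x \<partial>lborel) \<longlonglongrightarrow> (\<integral>x. G x \<bullet> e \<partial>lborel)"
  proof (rule integral_dominated_convergence)
    show "integrable lborel (\<lambda>x. (\<bar>M0\<bar> * norm e) * indicator (cball 0 (\<bar>R\<bar> + norm e)) x :: real)"
      by (intro integrable_mult_right integrable_real_indicator emeasure_lborel_cball_finite) simp
    show "AE x in lborel. norm (q n x) \<le> (\<bar>M0\<bar> * norm e) * indicator (cball 0 (\<bar>R\<bar> + norm e)) x" for n
      using bound by simp
    show "(\<lambda>x. G x \<bullet> e) \<in> borel_measurable lborel" using m by simp
    show "q n \<in> borel_measurable lborel" for n unfolding q_def using m by measurable
    show "AE x in lborel. (\<lambda>n. q n x) \<longlonglongrightarrow> G x \<bullet> e"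
    proof (rule AE_I2)
      fix x
      have "((\<lambda>s. f (x + s *\<^sub>R e)) has_real_derivative (G x \<bullet> e)) (at 0)"
      proof -
        have "((\<lambda>s. f (x + s *\<^sub>R e)) has_derivative (\<lambda>h. G (x + 0 *\<^sub>R e) \<bullet> (h *\<^sub>R e))) (at 0)"
          by (rule has_derivative_compose[OF _ C1_gradD(1)[OF f]]) (auto intro!: derivative_eq_intros)
        then show ?thesis by (simp add: has_field_derivative_def mult_commute_abs)
      qed
      then have "(\<lambda>h. (f (x + h *\<^sub>R e) - f x) / h) \<midarrow>0\<rightarrow> G x \<bullet> e" by (simp add: DERIV_def)
      moreover have "filterlim t (at 0) sequentially"
        using t by (auto simp: filterlim_at intro!: always_eventually less_imp_neq[symmetric])
      ultimately show "(\<lambda>n. q n x) \<longlonglongrightarrow> G x \<bullet> e"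
        unfolding q_def by (rule filterlim_compose)
    qed
  qed
  then have "(\<lambda>n. 0) \<longlonglongrightarrow> (\<integral>x. G x \<bullet> e \<partial>lborel)" by (simp add: q0)
  then show ?thesis by (simp add: LIMSEQ_const_iff)
qed

lemma test_field_support:
  assumes "\<phi> \<in> test_fields D"
  obtains R where "\<And>x. norm x \<ge> R \<Longrightarrow> \<phi> x = 0" "\<And>x i. norm x \<ge> R \<Longrightarrow> partial i \<phi> x = 0"
    "\<And>x. x \<notin> D \<Longrightarrow> \<phi> x = 0" "\<And>x i. x \<notin> D \<Longrightarrow> partial i \<phi> x = 0"
proof -
  obtain S where S: "compact S" "S \<subseteq> D" and z: "\<And>x. x \<notin> S \<Longrightarrow> \<phi> x = 0"
  proof (rule that[of "closure {x. \<phi> x \<noteq> 0}"])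
    show "compact (closure {x. \<phi> x \<noteq> 0})" "closure {x. \<phi> x \<noteq> 0} \<subseteq> D"
      using assms by (auto simp: test_fields_def)
    show "\<phi> x = 0" if "x \<notin> closure {x. \<phi> x \<noteq> 0}" for x
    proof (rule ccontr)
      assume "\<phi> x \<noteq> 0"
      then have "x \<in> closure {x. \<phi> x \<noteq> 0}" by (intro closure_subset[THEN subsetD]) simp
      with that show False by simp
    qed
  qed
  have p: "partial i \<phi> x = 0" if "x \<notin> S" for x i
  proof -
    have "(\<phi> has_derivative (\<lambda>h. 0)) (at x)"
    proof (rule has_derivative_transform_within_open[of "\<lambda>_. 0" _ x UNIV "- S"])
      show "0 = \<phi> y" if "y \<in> - S" for y using z that by simp
    qed (use that compact_imp_closed[OF S(1)] in \<open>simp_all add: open_Compl\<close>)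
    then show ?thesis unfolding partial_def by (simp add: frechet_derivative_at[symmetric])
  qed
  obtain R where R: "S \<subseteq> ball 0 R" using bounded_subset_ballD[OF compact_imp_bounded[OF S(1)]] by blast
  have "x \<notin> S" if "norm x \<ge> R" for x using R that by (auto simp: subset_iff)
  moreover have "x \<notin> S" if "x \<notin> D" for x using S(2) that by blast
  ultimately show thesis using z p by (intro that[of R]) blast+
qed

lemma lebesgue_on_integral_extend:
  fixes F :: "real^3 \<Rightarrow> real"
  assumes "S \<in> sets lebesgue" "\<And>x. x \<notin> S \<Longrightarrow> F x = 0" "F \<in> borel_measurable borel"
  shows "integral\<^sup>L (lebesgue_on S) F = integral\<^sup>L lborel F"
proof -
  have "integral\<^sup>L (lebesgue_on S) F = (\<integral>x. indicator S x *\<^sub>R F x \<partial>lebesgue)"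
    using assms(1) by (intro integral_restrict_space) auto
  also have "(\<lambda>x. indicator S x *\<^sub>R F x) = F"
    using assms(2) by (auto simp: fun_eq_iff indicator_def)
  also have "(\<integral>x. F x \<partial>lebesgue) = integral\<^sup>L lborel F" using assms(3) by (intro integral_completion) simp
  finally show ?thesis .
qed

text \<open>The integrand is the divergence of the compactly supported C1 field w \<times> \<phi>
  and vanishes outside S; each diagonal derivative integrates to zero over the whole space.\<close>

lemma C1_curl_by_parts:
  assumes S: "S \<in> sets lebesgue" and w: "C1_jac w J" and \<phi>: "\<phi> \<in> test_fields S"
  shows "integral\<^sup>L (lebesgue_on S) (\<lambda>x. crl (\<lambda>i. J i x) \<bullet> \<phi> x - w x \<bullet> curl \<phi> x) = 0"
proof -
  obtain R where R: "\<And>x. norm x \<ge> R \<Longrightarrow> \<phi> x = 0" "\<And>x i. norm x \<ge> R \<Longrightarrow> partial i \<phi> x = 0"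
    "\<And>x. x \<notin> S \<Longrightarrow> \<phi> x = 0" "\<And>x i. x \<notin> S \<Longrightarrow> partial i \<phi> x = 0"
    using test_field_support[OF \<phi>] by metis
  note P = test_fields_C1_jac[OF \<phi>]
  let ?J = "\<lambda>i x. cross3 (J i x) (\<phi> x) + cross3 (w x) (partial i \<phi> x)"
  have C: "C1_jac (\<lambda>x. cross3 (w x) (\<phi> x)) ?J" by (rule C1_jac_cross[OF w P])
  have J0: "?J i x = 0" if "norm x \<ge> R \<or> x \<notin> S" for i x
    using that R by (auto simp: cross3_def vec_eq_iff forall_3 vector_3)
  have c0: "cross3 (w x) (\<phi> x) = 0" if "norm x \<ge> R" for x
    using that R by (auto simp: cross3_def vec_eq_iff forall_3 vector_3)
  have m: "(\<lambda>x. ?J i x $ j) \<in> borel_measurable borel" for i j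
    by (intro borel_measurable_continuous_onI continuous_intros C1_jacD(2)[OF C])
  have int: "integrable lborel (\<lambda>x. ?J i x $ j)" for i j
  proof -
    have c: "continuous_on UNIV (\<lambda>x. ?J i x $ j)" by (intro continuous_intros C1_jacD(2)[OF C])
    have J0j: "?J i x $ j = 0" if "norm x \<ge> R" for x
      using J0[of x i] that by (metis zero_index)
    obtain K0 where K0: "0 \<le> K0" "\<And>x. norm x \<le> R \<Longrightarrow> norm (?J i x $ j) \<le> K0"
      using continuous_bounded_cball[OF c] by blast
    have K: "norm (?J i x $ j) \<le> K0" for x
    proof (cases "norm x \<le> R")
      case False
      then have "?J i x $ j = 0" by (intro J0j) simp
      then show ?thesis using K0(1) by (simp only: norm_zero)
    qed (rule K0(2))
    show ?thesis
      by (rule integrable_bounded_support[OF m K _ bounded_cball, of 0 R], rule J0j) auto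
  qed
  have z: "(\<integral>x. ?J i x $ i \<partial>lborel) = 0" for i
    using integral_grad_eq_0[OF C1_jac_component[OF C, of i], of R "axis i 1"] c0 J0
    by (simp add: inner_axis vec_eq_iff)
  have e: "crl (\<lambda>i. J i x) \<bullet> \<phi> x - w x \<bullet> curl \<phi> x = (\<Sum>i\<in>UNIV. ?J i x $ i)" for x
    unfolding C1_jac_curl[OF P] by (rule crl_inner_diff)
  have "integral\<^sup>L (lebesgue_on S) (\<lambda>x. \<Sum>i\<in>UNIV. ?J i x $ i) = integral\<^sup>L lborel (\<lambda>x. \<Sum>i\<in>UNIV. ?J i x $ i)"
    by (intro lebesgue_on_integral_extend S borel_measurable_sum m) (use J0 in simp)
  also have "\<dots> = 0" using int z by simp
  finally show ?thesis unfolding e .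
qed

section \<open>Square-integrable fields and their inner product\<close>

lemma integrable_lebesgue_on_bounded:
  fixes f :: "real^3 \<Rightarrow> 'b::{banach,second_countable_topology}"
  assumes "S \<in> lmeasurable" "f \<in> borel_measurable (lebesgue_on S)" "AE x in lebesgue_on S. norm (f x) \<le> M"
  shows "integrable (lebesgue_on S) f"
proof -
  interpret finite_measure "lebesgue_on S" using assms(1) by (rule finite_measure_lebesgue_on)
  show ?thesis using assms(2,3) by (intro integrable_const_bound)
qed

lemma L2D: "v \<in> L2 S \<Longrightarrow> v \<in> borel_measurable (lebesgue_on S)"
  "v \<in> L2 S \<Longrightarrow> integrable (lebesgue_on S) (\<lambda>x. (norm (v x))\<^sup>2)"
  by (auto simp: L2_def)

lemma L2_bounded:
  assumes "S \<in> lmeasurable" "v \<in> borel_measurable (lebesgue_on S)" "\<And>x. x \<in> S \<Longrightarrow> norm (v x) \<le> M"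
  shows "v \<in> L2 S"
proof -
  have "norm ((norm (v x))\<^sup>2) \<le> M\<^sup>2" if "x \<in> S" for x
    using assms(3)[OF that] by (simp add: power_mono)
  then have "integrable (lebesgue_on S) (\<lambda>x. (norm (v x))\<^sup>2)"
    by (intro integrable_lebesgue_on_bounded[OF assms(1), where M = "M\<^sup>2"] borel_norm_square
        assms(2) AE_I2) (auto simp: space_restrict_space)
  then show ?thesis using assms(2) by (simp add: L2_def)
qed

lemma L2_inner_integrable:
  assumes "u \<in> L2 S" "v \<in> L2 S"
  shows "integrable (lebesgue_on S) (\<lambda>x. u x \<bullet> v x)"
proof (rule Bochner_Integration.integrable_bound)
  show "integrable (lebesgue_on S) (\<lambda>x. (norm (u x))\<^sup>2 + (norm (v x))\<^sup>2)"
    using assms by (intro Bochner_Integration.integrable_add L2D)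
  show "(\<lambda>x. u x \<bullet> v x) \<in> borel_measurable (lebesgue_on S)"
    using L2D(1)[OF assms(1)] L2D(1)[OF assms(2)] by measurable
  show "AE x in lebesgue_on S. norm (u x \<bullet> v x) \<le> norm ((norm (u x))\<^sup>2 + (norm (v x))\<^sup>2)"
  proof (rule AE_I2)
    fix x
    have "\<bar>u x \<bullet> v x\<bar> \<le> norm (u x) * norm (v x)" by (rule Cauchy_Schwarz_ineq2)
    moreover have "2 * (norm (u x) * norm (v x)) \<le> (norm (u x))\<^sup>2 + (norm (v x))\<^sup>2"
      using sum_squares_bound[of "norm (u x)" "norm (v x)"] by simp
    moreover have "0 \<le> norm (u x) * norm (v x)" by simp
    ultimately show "norm (u x \<bullet> v x) \<le> norm ((norm (u x))\<^sup>2 + (norm (v x))\<^sup>2)" by simp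
  qed
qed

lemma L2_add: assumes "u \<in> L2 S" "v \<in> L2 S" shows "(\<lambda>x. u x + v x) \<in> L2 S"
proof -
  have m: "(\<lambda>x. u x + v x) \<in> borel_measurable (lebesgue_on S)"
    using L2D(1)[OF assms(1)] L2D(1)[OF assms(2)] by simp
  have "integrable (lebesgue_on S) (\<lambda>x. (norm (u x))\<^sup>2 + (norm (v x))\<^sup>2 + 2 * (u x \<bullet> v x))"
    using assms by (intro Bochner_Integration.integrable_add L2D integrable_mult_right L2_inner_integrable)
  then show ?thesis using m
    by (simp add: L2_def power2_norm_eq_inner inner_add_left inner_add_right inner_commute algebra_simps)
qed

lemma L2_scaleR: assumes "u \<in> L2 S" shows "(\<lambda>x. c *\<^sub>R u x) \<in> L2 S"
proof -
  have "(\<lambda>x. c *\<^sub>R u x) \<in> borel_measurable (lebesgue_on S)" using L2D(1)[OF assms] by measurable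
  then show ?thesis using assms by (simp add: L2_def power_mult_distrib)
qed

lemma L2_diff: assumes "u \<in> L2 S" "v \<in> L2 S" shows "(\<lambda>x. u x - v x) \<in> L2 S"
  using L2_add[OF assms(1) L2_scaleR[OF assms(2), of "-1"]] by simp

lemma ip_cong_AE:
  assumes "u \<in> borel_measurable (lebesgue_on S)" "u' \<in> borel_measurable (lebesgue_on S)"
    "v \<in> borel_measurable (lebesgue_on S)" "v' \<in> borel_measurable (lebesgue_on S)"
    "AE x in lebesgue_on S. u x = u' x" "AE x in lebesgue_on S. v x = v' x"
  shows "ip S u v = ip S u' v'"
  unfolding ip_def using assms(1-4) by (intro integral_cong_AE) (use assms(5,6) in auto)

lemma ip_commute: "ip S u v = ip S v u"
  by (simp add: ip_def inner_commute)

lemma ip_add_left: "u \<in> L2 S \<Longrightarrow> v \<in> L2 S \<Longrightarrow> w \<in> L2 S \<Longrightarrow> ip S (\<lambda>x. u x + v x) w = ip S u w + ip S v w"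
  by (simp add: ip_def inner_add_left L2_inner_integrable)

lemma ip_diff_left: "u \<in> L2 S \<Longrightarrow> v \<in> L2 S \<Longrightarrow> w \<in> L2 S \<Longrightarrow> ip S (\<lambda>x. u x - v x) w = ip S u w - ip S v w"
  by (simp add: ip_def inner_diff_left L2_inner_integrable)

lemma ip_diff_right: "u \<in> L2 S \<Longrightarrow> v \<in> L2 S \<Longrightarrow> w \<in> L2 S \<Longrightarrow> ip S w (\<lambda>x. u x - v x) = ip S w u - ip S w v"
  by (simp add: ip_def inner_diff_right L2_inner_integrable)

lemma ip_add_right: "u \<in> L2 S \<Longrightarrow> v \<in> L2 S \<Longrightarrow> w \<in> L2 S \<Longrightarrow> ip S w (\<lambda>x. u x + v x) = ip S w u + ip S w v"
  by (simp add: ip_def inner_add_right L2_inner_integrable)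

lemma ip_scaleR_left: "ip S (\<lambda>x. c *\<^sub>R u x) v = c * ip S u v"
  by (simp add: ip_def)

lemma L2_continuous:
  assumes "continuous_on UNIV v" "bounded S" "S \<in> sets lebesgue"
  shows "v \<in> L2 S"
proof -
  obtain R where R: "S \<subseteq> ball 0 R" using bounded_subset_ballD[OF assms(2)] by blast
  obtain M where "\<And>x. norm x \<le> R \<Longrightarrow> norm (v x) \<le> M"
    using continuous_bounded_cball[OF assms(1)] by blast
  then have "\<And>x. x \<in> S \<Longrightarrow> norm (v x) \<le> M" using R by (auto simp: subset_iff)
  moreover have "S \<in> lmeasurable" using assms(2,3) bounded_set_imp_lmeasurable by blast
  moreover have "v \<in> borel_measurable (lebesgue_on S)"
    by (intro borel_lebesgue_on borel_measurable_continuous_onI assms)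
  ultimately show ?thesis by (intro L2_bounded) auto
qed

text \<open>The majorant |g|^2 + M^2 is integrable because S has finite measure, so bounded almost
  everywhere convergence is enough.\<close>

lemma ip_limit:
  assumes S: "S \<in> lmeasurable" and g: "g \<in> L2 S" and m: "\<And>n. \<phi> n \<in> borel_measurable (lebesgue_on S)"
    "u \<in> borel_measurable (lebesgue_on S)"
    and b: "\<And>n x. norm (\<phi> n x) \<le> M" and l: "AE x in lebesgue_on S. (\<lambda>n. \<phi> n x) \<longlonglongrightarrow> u x"
  shows "(\<lambda>n. ip S g (\<phi> n)) \<longlonglongrightarrow> ip S g u"
  unfolding ip_def
proof (rule integral_dominated_convergence)
  interpret finite_measure "lebesgue_on S" using S by (rule finite_measure_lebesgue_on)
  show "integrable (lebesgue_on S) (\<lambda>x. (norm (g x))\<^sup>2 + M\<^sup>2)"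
    using L2D(2)[OF g] by simp
  show "AE x in lebesgue_on S. norm (g x \<bullet> \<phi> n x) \<le> (norm (g x))\<^sup>2 + M\<^sup>2" for n
  proof (rule AE_I2)
    fix x
    have "\<bar>g x \<bullet> \<phi> n x\<bar> \<le> norm (g x) * norm (\<phi> n x)" by (rule Cauchy_Schwarz_ineq2)
    also have "\<dots> \<le> norm (g x) * M" using b by (intro mult_left_mono) auto
    also have "\<dots> \<le> (norm (g x))\<^sup>2 + M\<^sup>2"
    proof -
      have "0 \<le> M" using b[of n x] norm_ge_zero order_trans by blast
      then have "0 \<le> norm (g x) * M" by simp
      then show ?thesis using sum_squares_bound[of "norm (g x)" M] by linarith
    qed
    finally show "norm (g x \<bullet> \<phi> n x) \<le> (norm (g x))\<^sup>2 + M\<^sup>2" by simp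
  qed
  show "AE x in lebesgue_on S. (\<lambda>n. g x \<bullet> \<phi> n x) \<longlonglongrightarrow> g x \<bullet> u x"
    using l by eventually_elim (intro tendsto_intros)
  show "(\<lambda>x. g x \<bullet> u x) \<in> borel_measurable (lebesgue_on S)" using L2D(1)[OF g] m(2) by measurable
  show "(\<lambda>x. g x \<bullet> \<phi> n x) \<in> borel_measurable (lebesgue_on S)" for n
    using L2D(1)[OF g] m(1)[of n] by measurable
qed

definition nice_field :: "(real^3) set \<Rightarrow> (real^3) set \<Rightarrow> (real^3 \<Rightarrow> real^3) \<Rightarrow> bool" where
  "nice_field C N u \<longleftrightarrow> u \<in> borel_measurable borel \<and> bounded (range u) \<and> (\<forall>x. x \<notin> C \<longrightarrow> u x = 0) \<and>
     (\<forall>x. x \<notin> N \<longrightarrow> isCont u x)"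

lemma nice_fieldD:
  assumes "nice_field C N u" "compact C"
  shows "integrable lborel u" "\<And>y. y \<notin> C \<Longrightarrow> u y = 0" "\<And>x. x \<notin> N \<Longrightarrow> isCont u x"
    "u \<in> borel_measurable borel" "\<exists>M. \<forall>y. norm (u y) \<le> M"
proof -
  show m: "u \<in> borel_measurable borel" and z: "\<And>y. y \<notin> C \<Longrightarrow> u y = 0" and "\<And>x. x \<notin> N \<Longrightarrow> isCont u x"
    using assms(1) by (auto simp: nice_field_def)
  show "\<exists>M. \<forall>y. norm (u y) \<le> M" using assms(1) by (auto simp: nice_field_def bounded_iff)
  then obtain M where "\<And>y. norm (u y) \<le> M" by blast
  then show "integrable lborel u"
    by (rule integrable_bounded_support[OF m]) (use z compact_imp_bounded[OF assms(2)] in auto)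
qed

lemma AE_negligible: "negligible N \<Longrightarrow> S \<in> sets lebesgue \<Longrightarrow> (\<And>x. x \<in> S \<Longrightarrow> x \<notin> N \<Longrightarrow> P x) \<Longrightarrow> AE x in lebesgue_on S. P x"
  for S :: "(real^3) set"
  by (simp add: AE_restrict_space_iff negligible_iff_null_sets)
    (rule AE_I'[of N], auto)

lemma conv_ip_limit:
  assumes "S \<in> lmeasurable" "g \<in> L2 S" "nice_field C N u" "compact C" "negligible N"
    and f: "\<And>n. conv (f n) u \<in> borel_measurable borel"
     "\<And>n x M. integrable lborel u \<Longrightarrow> (\<And>y. norm (u y) \<le> M) \<Longrightarrow> norm (conv (f n) u x) \<le> M"
    "\<And>x. integrable lborel u \<Longrightarrow> isCont u x \<Longrightarrow> (\<lambda>n. conv (f n) u x) \<longlonglongrightarrow> u x"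
  shows "(\<lambda>n. ip S g (conv (f n) u)) \<longlonglongrightarrow> ip S g u"
proof -
  note n = nice_fieldD[OF assms(3,4)]
  obtain M where M: "\<And>y. norm (u y) \<le> M" using n(5) by blast
  show ?thesis
  proof (rule ip_limit[OF assms(1,2)])
    show "norm (conv (f k) u x) \<le> M" for k x using f(2)[OF n(1) M] .
    show "AE x in lebesgue_on S. (\<lambda>n. conv (f n) u x) \<longlonglongrightarrow> u x"
      using f(3)[OF n(1) n(3)] assms(1,5) by (intro AE_negligible) auto
  qed (use f(1) n(4) in \<open>auto intro: borel_lebesgue_on\<close>)
qed

section \<open>Uniqueness of the weak curl\<close>

lemma test_field_continuous: "\<phi> \<in> test_fields D \<Longrightarrow> continuous_on S \<phi>"
  using C1_jacD(3)[OF test_fields_C1_jac] .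

lemma test_field_borel: "\<phi> \<in> test_fields D \<Longrightarrow> \<phi> \<in> borel_measurable borel"
  by (intro borel_measurable_continuous_onI test_field_continuous)

text \<open>A box indicator times a constant vector is a bounded limit of test fields, so g has
  integral zero over every box inside D; Lebesgue differentiation over shrinking cubes then recovers
  g almost everywhere.\<close>

lemma fundamental_lemma:
  assumes D: "open D" "bounded D" and g: "g \<in> L2 D" and z: "\<And>\<phi>. \<phi> \<in> test_fields D \<Longrightarrow> ip D g \<phi> = 0"
  shows "AE x in lebesgue_on D. g x = 0"
proof -
  have Dm: "D \<in> lmeasurable" using D by (simp add: bounded_set_imp_lmeasurable)
  have int: "integrable (lebesgue_on D) g"
  proof (rule Bochner_Integration.integrable_bound)
    interpret finite_measure "lebesgue_on D" using Dm by (rule finite_measure_lebesgue_on)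
    show "integrable (lebesgue_on D) (\<lambda>x. (norm (g x))\<^sup>2 + 1)" using L2D(2)[OF g] by simp
    show "AE x in lebesgue_on D. norm (g x) \<le> norm ((norm (g x))\<^sup>2 + 1)"
    proof (rule AE_I2)
      fix x
      have "2 * norm (g x) \<le> (norm (g x))\<^sup>2 + 1" using sum_squares_bound[of "norm (g x)" 1] by simp
      then have "norm (g x) \<le> (norm (g x))\<^sup>2 + 1" using norm_ge_zero[of "g x"] by linarith
      then show "norm (g x) \<le> norm ((norm (g x))\<^sup>2 + 1)" by simp
    qed
  qed (rule L2D(1)[OF g])
  have box: "integral (cbox p q) g = 0" if pq: "cbox p q \<subseteq> D" for p q :: "real^3"
  proof (rule euclidean_eqI)
    fix d :: "real^3"
    let ?u = "\<lambda>x. indicator (cbox p q) x *\<^sub>R d"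
    have nice: "nice_field (cbox p q) (frontier (cbox p q)) ?u"
      unfolding nice_field_def
    proof (intro conjI allI impI)
      show "?u \<in> borel_measurable borel" by measurable
      show "bounded (range ?u)" unfolding bounded_iff by (rule exI[of _ "norm d"]) (auto simp: indicator_def)
      fix x assume "x \<notin> frontier (cbox p q)"
      then have "isCont (indicator (cbox p q) :: _ \<Rightarrow> real) x" by (simp add: isCont_indicator)
      then show "isCont ?u x" by (intro continuous_intros)
    qed auto
    \<comment> \<open>Mollification without shift: a compact box inside the open D already has a
      margin.\<close>
    obtain f where f: "\<And>n. \<exists>a r. 0 < r \<and> bump a r (f n)"
      "\<And>n u. integrable lborel u \<Longrightarrow> (\<And>y. y \<notin> cbox p q \<Longrightarrow> u y = 0) \<Longrightarrow> conv (f n) u \<in> test_fields D"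
      "\<And>n u x M. integrable lborel u \<Longrightarrow> (\<And>y. norm (u y) \<le> M) \<Longrightarrow> norm (conv (f n) u x) \<le> M"
      "\<And>u x. integrable lborel u \<Longrightarrow> isCont u x \<Longrightarrow> (\<lambda>n. conv (f n) u x) \<longlonglongrightarrow> u x"
      by (rule mollifiers[of "cbox p q" D 1 0]) (use D pq in auto)
    have t: "conv (f n) ?u \<in> test_fields D" for n
      by (rule f(2)) (use nice_fieldD[OF nice] in auto)
    have "(\<lambda>n. ip D g (conv (f n) ?u)) \<longlonglongrightarrow> ip D g ?u"
      by (rule conv_ip_limit[OF Dm g nice compact_cbox _ test_field_borel[OF t] f(3,4)])
        (simp add: negligible_convex_frontier)
    then have "ip D g ?u = 0" using z[OF t] by (simp add: LIMSEQ_const_iff)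
    moreover have "ip D g ?u = integral (cbox p q) g \<bullet> d"
    proof -
      have ig: "integrable (lebesgue_on (cbox p q)) g"
        using D by (intro integrable_lebesgue_on_subset[OF int pq]) auto
      have "ip D g ?u = (\<integral>x. indicator D x *\<^sub>R (g x \<bullet> ?u x) \<partial>lebesgue)"
        unfolding ip_def using D by (intro integral_restrict_space) auto
      also have "\<dots> = (\<integral>x. indicator (cbox p q) x *\<^sub>R (g x \<bullet> d) \<partial>lebesgue)"
        using pq by (intro Bochner_Integration.integral_cong) (auto simp: indicator_def)
      also have "\<dots> = integral\<^sup>L (lebesgue_on (cbox p q)) (\<lambda>x. g x \<bullet> d)"
        by (intro integral_restrict_space[symmetric]) auto
      also have "\<dots> = integral\<^sup>L (lebesgue_on (cbox p q)) g \<bullet> d" using ig by simp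
      finally show ?thesis using lebesgue_integral_eq_integral[OF ig] by simp
    qed
    ultimately show "integral (cbox p q) g \<bullet> d = 0 \<bullet> d" by simp
  qed
  define G where "G x = (if x \<in> D then g x else 0)" for x
  have "(\<lambda>x. indicator D x *\<^sub>R g x) = G" by (auto simp: G_def fun_eq_iff indicator_def)
  then have iG: "integrable lebesgue G"
    using int D by (simp add: integrable_restrict_space)
  have "G integrable_on cbox p q" for p q
  proof -
    have "integrable (lebesgue_on UNIV) G" using iG by (simp add: lebesgue_on_UNIV_eq)
    then have "integrable (lebesgue_on (cbox p q)) G"
      by (rule integrable_lebesgue_on_subset) auto
    then show ?thesis by (rule integrable_on_lebesgue_on) simp
  qed
  then obtain N where N: "negligible N" "\<And>x e. \<lbrakk>x \<notin> N; 0 < e\<rbrakk> \<Longrightarrow>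
      \<exists>d>0. \<forall>h. 0 < h \<and> h < d \<longrightarrow> norm (integral (cbox x (x + h *\<^sub>R One)) G /\<^sub>R h ^ DIM(real^3) - G x) < e"
    using integrable_ccontinuous_explicit[of G] by metis
  show ?thesis
  proof (rule AE_negligible[OF N(1)])
    show "D \<in> sets lebesgue" using D by simp
    fix x assume x: "x \<in> D" "x \<notin> N"
    show "g x = 0"
    proof (rule ccontr)
      assume "g x \<noteq> 0"
      then obtain d where d: "d > 0" "\<And>h. 0 < h \<Longrightarrow> h < d \<Longrightarrow>
          norm (integral (cbox x (x + h *\<^sub>R One)) G /\<^sub>R h ^ DIM(real^3) - G x) < norm (g x)"
        using N(2)[OF x(2), of "norm (g x)"] by auto
      obtain r where r: "r > 0" "ball x r \<subseteq> D" using D(1) x(1) openE by blast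
      \<comment> \<open>A cube of side h has all its points within 3 h of x, by the sum norm. Then 3
        h < r keeps it inside D, and h < d is the range in which the averages are close to G
        x.\<close>
      define h where "h = min (d / 2) (r / 4)"
      have h: "0 < h" "h < d" "3 * h < r" using d(1) r(1) by (auto simp: h_def min_def field_simps)
      have sub: "cbox x (x + h *\<^sub>R One) \<subseteq> D"
      proof
        fix y assume y: "y \<in> cbox x (x + h *\<^sub>R One)"
        have "norm (y - x) \<le> (\<Sum>i\<in>UNIV. \<bar>(y - x) $ i\<bar>)" by (rule norm_le_l1_cart)
        also have "\<dots> \<le> (\<Sum>i\<in>(UNIV::3 set). h)"
        proof (rule sum_mono)
          fix i :: 3
          have "(One :: real^3) $ i = 1" by (simp add: cart_eq_inner_axis inner_sum_left_Basis axis_in_Basis_iff)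
          then show "\<bar>(y - x) $ i\<bar> \<le> h" using y by (auto simp: mem_box_cart dest!: spec[of _ i])
        qed
        also have "\<dots> = 3 * h" by simp
        finally show "y \<in> D" using h(3) r(2) by (auto simp: dist_norm norm_minus_commute subset_iff)
      qed
      have "integral (cbox x (x + h *\<^sub>R One)) G = integral (cbox x (x + h *\<^sub>R One)) g"
        using sub by (intro integral_cong) (auto simp: G_def)
      then have "integral (cbox x (x + h *\<^sub>R One)) G = 0" using box[OF sub] by simp
      then show False using d(2)[OF h(1,2)] x(1) by (simp add: G_def)
    qed
  qed
qed

lemma weak_curl_AE_unique:
  assumes D: "open D" "bounded D" and v: "is_weak_curl D v w" "is_weak_curl D v w'"
  shows "AE x in lebesgue_on D. w x = w' x"
proof -
  have L: "w \<in> L2 D" "w' \<in> L2 D" using v by (auto simp: is_weak_curl_def)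
  have "AE x in lebesgue_on D. w x - w' x = 0"
  proof (rule fundamental_lemma[OF D L2_diff[OF L]])
    fix \<phi> assume \<phi>: "\<phi> \<in> test_fields D"
    have "\<phi> \<in> L2 D" using \<phi> D by (intro L2_continuous test_field_continuous) auto
    then show "ip D (\<lambda>x. w x - w' x) \<phi> = 0"
      using v \<phi> L by (simp add: ip_diff_left is_weak_curl_def)
  qed
  then show ?thesis by simp
qed

lemma wcurl_is_weak_curl: "v \<in> Hcurl D \<Longrightarrow> is_weak_curl D v (wcurl D v)"
  using someI_ex[of "is_weak_curl D v"] by (auto simp: wcurl_def Hcurl_def)

lemma crl_inner: "crl J \<bullet> d = (\<Sum>i\<in>UNIV. J i \<bullet> cross3 d (axis i 1))"
  by (simp add: crl_def cross3_def inner_vec_def sum_3 vector_3 axis_def algebra_simps)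

text \<open>For fixed x the field y \<mapsto> f (x - y) d is an admissible \<psi> in the hypothesis
  \<open>uw\<close>. The minus sign of the reflected gradient is absorbed by exchanging the factors
  of a cross product, so curl and convolution commute.\<close>

lemma crl_conv:
  assumes f: "bump a r f" and r: "0 < r" and g: "\<And>i. bump a r (g i)" and C: "C1_grad f (\<lambda>x. \<chi> i. g i x)"
    and u: "integrable lborel u" and w: "integrable lborel w"
    and uw: "\<And>\<psi> J. C1_jac \<psi> J \<Longrightarrow> (\<integral>y. u y \<bullet> crl (\<lambda>i. J i y) \<partial>lborel) = (\<integral>y. w y \<bullet> \<psi> y \<partial>lborel)"
  shows "crl (\<lambda>i. conv (g i) u x) = conv f w x"
proof (rule vector_eq_rdot[THEN iffD1], intro allI)
  fix d
  have C': "C1_grad (\<lambda>y. f (x - y)) (\<lambda>y. - (\<chi> i. g i (x - y)))"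
    unfolding C1_grad_def
  proof (intro conjI allI)
    fix y
    have "((\<lambda>y. f (x - y)) has_derivative (\<lambda>h. (\<chi> i. g i (x - y)) \<bullet> (- h))) (at y)"
      by (rule has_derivative_compose[OF _ C1_gradD(1)[OF C]]) (auto intro!: derivative_eq_intros)
    then show "((\<lambda>y. f (x - y)) has_derivative (\<bullet>) (- (\<chi> i. g i (x - y)))) (at y)"
      by (rule has_derivative_eq_rhs) (simp add: fun_eq_iff)
    show "continuous_on UNIV (\<lambda>y. - (\<chi> i. g i (x - y)))"
    proof -
      have "continuous_on UNIV (\<lambda>y. x - y)" by (intro continuous_intros)
      then show ?thesis
        using continuous_on_compose2[OF C1_gradD(2)[OF C, of UNIV], of UNIV "\<lambda>y. x - y"]
        by (intro continuous_on_minus) simp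
    qed
  qed
  have i: "integrable lborel (\<lambda>y. g i (x - y) *\<^sub>R u y)" for i by (rule integrable_conv[OF g r u])
  have "crl (\<lambda>i. conv (g i) u x) \<bullet> d = (\<integral>y. (\<Sum>i\<in>UNIV. (g i (x - y) *\<^sub>R u y) \<bullet> cross3 d (axis i 1)) \<partial>lborel)"
    unfolding crl_inner conv_def
    by (subst Bochner_Integration.integral_sum) (use i in \<open>auto simp del: inner_scaleR_left\<close>)
  also have "\<dots> = (\<integral>y. u y \<bullet> crl (\<lambda>i. ((- (\<chi> i. g i (x - y))) $ i) *\<^sub>R d) \<partial>lborel)"
    by (intro Bochner_Integration.integral_cong refl)
      (simp add: crl_def cross3_def inner_vec_def sum_3 vector_3 axis_def algebra_simps)
  also have "\<dots> = (\<integral>y. w y \<bullet> (f (x - y) *\<^sub>R d) \<partial>lborel)"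
    by (rule uw[OF C1_jac_const_scaleR[OF C']])
  also have "\<dots> = (\<integral>y. (f (x - y) *\<^sub>R w y) \<bullet> d \<partial>lborel)"
    by (intro Bochner_Integration.integral_cong) (auto simp: mult.commute)
  also have "\<dots> = conv f w x \<bullet> d"
    unfolding conv_def using integrable_conv[OF f r w] by (simp del: inner_scaleR_left)
  finally show "crl (\<lambda>i. conv (g i) u x) \<bullet> d = conv f w x \<bullet> d" .
qed

text \<open>Shifting a field into \<open>D\<close> before mollifying it turns it into a test field of \<open>D\<close>; this is
  how a field with zero tangential trace is tested against a weak curl.\<close>

lemma weak_curl_pairing:
  assumes D: "open D" "bounded D" and C: "compact C" and N: "negligible N" and t0: "0 < t0"
    and sh: "\<And>y t. y \<in> C \<Longrightarrow> 0 < t \<Longrightarrow> t < t0 \<Longrightarrow> y + t *\<^sub>R e \<in> D"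
    and u: "nice_field C N u" and w: "nice_field C N w"
    and uw: "\<And>\<psi> J. C1_jac \<psi> J \<Longrightarrow> (\<integral>y. u y \<bullet> crl (\<lambda>i. J i y) \<partial>lborel) = (\<integral>y. w y \<bullet> \<psi> y \<partial>lborel)"
    and \<sigma>: "\<sigma> \<in> L2 D" "is_weak_curl D \<sigma> s"
  shows "ip D s u = ip D \<sigma> w"
proof -
  have Dm: "D \<in> lmeasurable" using D by (simp add: bounded_set_imp_lmeasurable)
  obtain f where f: "\<And>n. \<exists>a r. 0 < r \<and> bump a r (f n)"
    "\<And>n u. integrable lborel u \<Longrightarrow> (\<And>y. y \<notin> C \<Longrightarrow> u y = 0) \<Longrightarrow> conv (f n) u \<in> test_fields D"
    "\<And>n u x M. integrable lborel u \<Longrightarrow> (\<And>y. norm (u y) \<le> M) \<Longrightarrow> norm (conv (f n) u x) \<le> M"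
    "\<And>u x. integrable lborel u \<Longrightarrow> isCont u x \<Longrightarrow> (\<lambda>n. conv (f n) u x) \<longlonglongrightarrow> u x"
    by (rule mollifiers[OF C D(1) t0 sh]) auto
  note nu = nice_fieldD[OF u C] and nw = nice_fieldD[OF w C]
  have tu: "conv (f n) u \<in> test_fields D" for n by (rule f(2)[OF nu(1,2)])
  have tw: "conv (f n) w \<in> test_fields D" for n by (rule f(2)[OF nw(1,2)])
  have "curl (conv (f n) u) x = conv (f n) w x" for n x
  proof -
    obtain a r where ar: "0 < r" "bump a r (f n)" using f(1) by blast
    obtain g where g: "\<And>i. bump a r (g i)" "C1_grad (f n) (\<lambda>x. \<chi> i. g i x)" using bump_grad[OF ar(2)] by blast
    show ?thesis
      using C1_jac_curl[OF conv_C1_jac[OF ar(2,1) nu(1) g]] crl_conv[OF ar(2,1) g nu(1) nw(1) uw] by simp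
  qed
  \<comment> \<open>The mollification of u is a test field whose classical curl is the mollification
    of w, so it can be inserted into the definition of the weak curl s of \<sigma>.\<close>
  then have e: "ip D \<sigma> (conv (f n) w) = ip D s (conv (f n) u)" for n
    using \<sigma>(2) tu[of n] unfolding is_weak_curl_def by (metis ext)
  have "(\<lambda>n. ip D \<sigma> (conv (f n) w)) \<longlonglongrightarrow> ip D \<sigma> w"
    by (rule conv_ip_limit[OF Dm \<sigma>(1) w C N test_field_borel[OF tw] f(3,4)])
  moreover have "(\<lambda>n. ip D s (conv (f n) u)) \<longlonglongrightarrow> ip D s u"
    using \<sigma>(2) by (intro conv_ip_limit[OF Dm _ u C N test_field_borel[OF tu] f(3,4)]) (simp add: is_weak_curl_def)
  ultimately show ?thesis unfolding e using LIMSEQ_unique by blast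
qed

section \<open>The divergence theorem on a simplex\<close>

lemma compact_sets: "compact S \<Longrightarrow> S \<in> sets borel" "compact S \<Longrightarrow> S \<in> sets lebesgue"
  for S :: "'a::euclidean_space set"
  by (auto dest: compact_imp_closed intro: borel_closed lebesgue_closedin)

lemma borel_indicator_continuous:
  fixes h :: "'a::euclidean_space \<Rightarrow> 'b::euclidean_space"
  assumes "compact A" "continuous_on UNIV h"
  shows "(\<lambda>x. indicator A x *\<^sub>R h x) \<in> borel_measurable borel"
  using compact_sets(1)[OF assms(1)] borel_measurable_continuous_onI[OF assms(2)]
  by (intro borel_measurable_scaleR borel_measurable_indicator)

lemma integrable_compact_continuous:
  fixes h :: "real^3 \<Rightarrow> 'b::euclidean_space"
  assumes "compact A" "continuous_on UNIV h"
  shows "integrable (lebesgue_on A) h"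
proof -
  have "integrable lborel (\<lambda>x. indicator A x *\<^sub>R h x)"
    using assms by (intro borel_integrable_compact) (auto intro: continuous_on_subset)
  then have "integrable lebesgue (\<lambda>x. indicator A x *\<^sub>R h x)" by (subst integrable_completion) auto
  then show ?thesis using compact_sets(2)[OF assms(1)] by (simp add: integrable_restrict_space)
qed

section \<open>Triangle integrals and the reference simplex\<close>

definition tri2 :: "(real \<times> real) set" where
  "tri2 = {(s, t). 0 \<le> s \<and> 0 \<le> t \<and> s + t \<le> 1}"

text \<open>The integral in \<open>face_integral\<close> for a given vertex order and without its
  area factor.\<close>

definition tri_integral :: "real^3 \<Rightarrow> real^3 \<Rightarrow> real^3 \<Rightarrow> (real^3 \<Rightarrow> real) \<Rightarrow> real" where
  "tri_integral a b c f = integral\<^sup>L (lebesgue_on tri2) (\<lambda>(s, t). f (a + s *\<^sub>R (b - a) + t *\<^sub>R (c - a)))"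

lemma closed_tri2: "closed tri2"
  unfolding tri2_def case_prod_unfold
  by (intro closed_Collect_conj closed_Collect_le continuous_intros)

lemma compact_tri2: "compact tri2"
proof -
  have "tri2 \<subseteq> cbox (0, 0) (1, 1)" by (auto simp: tri2_def cbox_Pair_eq)
  then show ?thesis using closed_tri2 bounded_cbox bounded_subset compact_eq_bounded_closed by blast
qed

lemma tri_integrable:
  assumes "continuous_on UNIV (f :: real^3 \<Rightarrow> real)"
  shows "integrable lborel (\<lambda>(s, t). indicator tri2 (s, t) * f (a + s *\<^sub>R u + t *\<^sub>R v))"
proof -
  have "integrable lborel (\<lambda>p. indicator tri2 p *\<^sub>R f (a + fst p *\<^sub>R u + snd p *\<^sub>R v))"
    by (intro borel_integrable_compact compact_tri2 continuous_on_compose2[OF assms] continuous_intros) auto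
  then show ?thesis by (simp add: case_prod_unfold)
qed

lemma tri_integral_lborel:
  assumes "continuous_on UNIV f"
  shows "tri_integral a b c f = (\<integral>p. (case p of (s, t) \<Rightarrow> indicator tri2 (s, t) * f (a + s *\<^sub>R (b - a) + t *\<^sub>R (c - a))) \<partial>lborel)"
proof -
  have "tri_integral a b c f = (\<integral>p. indicator tri2 p *\<^sub>R (case p of (s, t) \<Rightarrow> f (a + s *\<^sub>R (b - a) + t *\<^sub>R (c - a))) \<partial>lebesgue)"
    unfolding tri_integral_def using closed_tri2 by (intro integral_restrict_space) auto
  also have "\<dots> = (\<integral>p. (case p of (s, t) \<Rightarrow> indicator tri2 (s, t) * f (a + s *\<^sub>R (b - a) + t *\<^sub>R (c - a))) \<partial>lebesgue)"
    by (intro Bochner_Integration.integral_cong) auto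
  also have "\<dots> = (\<integral>p. (case p of (s, t) \<Rightarrow> indicator tri2 (s, t) * f (a + s *\<^sub>R (b - a) + t *\<^sub>R (c - a))) \<partial>lborel)"
    using tri_integrable[OF assms] by (intro integral_completion) auto
  finally show ?thesis .
qed

lemma tri_integral_iterated:
  assumes f: "continuous_on UNIV f"
  shows "tri_integral a b c f = (\<integral>t. (\<integral>s. indicator tri2 (s, t) * f (a + s *\<^sub>R (b - a) + t *\<^sub>R (c - a)) \<partial>lborel) \<partial>lborel)"
    "tri_integral a b c f = (\<integral>s. (\<integral>t. indicator tri2 (s, t) * f (a + s *\<^sub>R (b - a) + t *\<^sub>R (c - a)) \<partial>lborel) \<partial>lborel)"
proof -
  have i: "integrable (lborel \<Otimes>\<^sub>M lborel) (\<lambda>(s, t). indicator tri2 (s, t) * f (a + s *\<^sub>R (b - a) + t *\<^sub>R (c - a)))"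
    using tri_integrable[OF f] by (simp add: lborel_prod)
  show "tri_integral a b c f = (\<integral>t. (\<integral>s. indicator tri2 (s, t) * f (a + s *\<^sub>R (b - a) + t *\<^sub>R (c - a)) \<partial>lborel) \<partial>lborel)"
    using lborel_pair.integral_snd[OF i] by (simp add: tri_integral_lborel[OF f] lborel_prod)
  show "tri_integral a b c f = (\<integral>s. (\<integral>t. indicator tri2 (s, t) * f (a + s *\<^sub>R (b - a) + t *\<^sub>R (c - a)) \<partial>lborel) \<partial>lborel)"
    using lborel_pair.integral_fst'[OF i] by (simp add: tri_integral_lborel[OF f] lborel_prod)
qed

lemma tri_integral_swap23:
  assumes "continuous_on UNIV f"
  shows "tri_integral a b c f = tri_integral a c b f"
proof -
  have "indicator tri2 (s, t) * f (a + s *\<^sub>R (b - a) + t *\<^sub>R (c - a))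
      = indicator tri2 (t, s) * f (a + t *\<^sub>R (c - a) + s *\<^sub>R (b - a))" for s t
    by (simp add: tri2_def indicator_def add.commute add.left_commute)
  then show ?thesis
    unfolding tri_integral_iterated(1)[OF assms, of a b c] tri_integral_iterated(2)[OF assms, of a c b] by simp
qed

text \<open>On the slice at height t the substitution s \<mapsto> 1 - t - s reverses the interval
  [0, 1 - t] and exchanges the roles of a and b.\<close>

lemma tri_integral_swap12:
  assumes "continuous_on UNIV f"
  shows "tri_integral a b c f = tri_integral b a c f"
proof -
  have "(\<integral>s. indicator tri2 (s, t) * f (a + s *\<^sub>R (b - a) + t *\<^sub>R (c - a)) \<partial>lborel)
      = (\<integral>s. indicator tri2 (s, t) * f (b + s *\<^sub>R (a - b) + t *\<^sub>R (c - b)) \<partial>lborel)" for t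
  proof -
    have "(\<integral>s. indicator tri2 (s, t) * f (a + s *\<^sub>R (b - a) + t *\<^sub>R (c - a)) \<partial>lborel)
      = (\<integral>s. indicator tri2 ((1 - t) + (- 1) * s, t) * f (a + ((1 - t) + (- 1) * s) *\<^sub>R (b - a) + t *\<^sub>R (c - a)) \<partial>lborel)"
      by (subst lborel_integral_real_affine[where c = "-1" and t = "1 - t"]) auto
    also have "\<dots> = (\<integral>s. indicator tri2 (s, t) * f (b + s *\<^sub>R (a - b) + t *\<^sub>R (c - b)) \<partial>lborel)"
    proof (intro Bochner_Integration.integral_cong refl)
      fix s
      have "a + ((1 - t) + (- 1) * s) *\<^sub>R (b - a) + t *\<^sub>R (c - a) = b + s *\<^sub>R (a - b) + t *\<^sub>R (c - b)"
        by (simp add: algebra_simps)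
      moreover have "((1 - t) + (- 1) * s, t) \<in> tri2 \<longleftrightarrow> (s, t) \<in> tri2" by (auto simp: tri2_def)
      ultimately show "indicator tri2 ((1 - t) + (- 1) * s, t) * f (a + ((1 - t) + (- 1) * s) *\<^sub>R (b - a) + t *\<^sub>R (c - a))
        = indicator tri2 (s, t) * f (b + s *\<^sub>R (a - b) + t *\<^sub>R (c - b))" by (simp only: indicator_def)
    qed
    finally show ?thesis .
  qed
  then show ?thesis unfolding tri_integral_iterated(1)[OF assms] by simp
qed

definition tri3 :: "(real \<times> real \<times> real) set" where
  "tri3 = {(s, t, r). 0 \<le> s \<and> 0 \<le> t \<and> 0 \<le> r \<and> s + t + r \<le> 1}"

lemma compact_tri3: "compact tri3"
proof -
  have "closed tri3" unfolding tri3_def case_prod_unfold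
    by (intro closed_Collect_conj closed_Collect_le continuous_intros)
  moreover have "tri3 \<subseteq> cbox (0, 0, 0) (1, 1, 1)" by (auto simp: tri3_def cbox_Pair_eq)
  ultimately show ?thesis using bounded_cbox bounded_subset compact_eq_bounded_closed by blast
qed

text \<open>Integration along u comes first. For (t, r) in the reference triangle the segment runs
  from s = 0 on the face through a to s = 1 - t - r on the face through a + u, and (t, r)
  parametrises both end faces.\<close>

lemma tri3_FTC:
  assumes g: "C1_grad g G"
  shows "(\<integral>p. (case p of (s, t, r) \<Rightarrow> indicator tri3 (s, t, r) * (G (a + s *\<^sub>R u + t *\<^sub>R v + r *\<^sub>R w) \<bullet> u)) \<partial>lborel)
    = tri_integral (a + u) (a + v) (a + w) g - tri_integral a (a + v) (a + w) g"
proof -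
  let ?F = "\<lambda>(s, t, r). indicator tri3 (s, t, r) * (G (a + s *\<^sub>R u + t *\<^sub>R v + r *\<^sub>R w) \<bullet> u)"
  have "integrable lborel (\<lambda>p. indicator tri3 p *\<^sub>R (G (a + fst p *\<^sub>R u + fst (snd p) *\<^sub>R v + snd (snd p) *\<^sub>R w) \<bullet> u))"
    by (intro borel_integrable_compact compact_tri3 continuous_on_inner continuous_on_const
        continuous_on_compose2[OF C1_gradD(2)[OF g, of UNIV]] continuous_intros) auto
  then have i: "integrable (lborel \<Otimes>\<^sub>M lborel) ?F"
    by (simp add: case_prod_unfold lborel_prod)
  have c: "continuous_on UNIV g" by (rule C1_gradD(3)[OF g])
  have inner: "(\<integral>s. ?F (s, p) \<partial>lborel) =
      indicator tri2 p * g ((a + u) + fst p *\<^sub>R ((a + v) - (a + u)) + snd p *\<^sub>R ((a + w) - (a + u)))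
      - indicator tri2 p * g (a + fst p *\<^sub>R ((a + v) - a) + snd p *\<^sub>R ((a + w) - a))" for p
  proof -
    obtain t r where p: "p = (t, r)" by (cases p)
    show ?thesis
    proof (cases "p \<in> tri2")
      case True
      then have tr: "0 \<le> t" "0 \<le> r" "0 \<le> 1 - t - r" by (auto simp: p tri2_def)
      let ?h = "\<lambda>s. g (a + s *\<^sub>R u + t *\<^sub>R v + r *\<^sub>R w)"
      let ?h' = "\<lambda>s. G (a + s *\<^sub>R u + t *\<^sub>R v + r *\<^sub>R w) \<bullet> u"
      have "(\<integral>s. indicator {0..1 - t - r} s *\<^sub>R ?h' s \<partial>lborel) = ?h (1 - t - r) - ?h 0"
      proof (rule integral_FTC_atLeastAtMost[OF tr(3)])
        show "continuous_on {0..1 - t - r} ?h'"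
          by (intro continuous_on_inner continuous_on_const
              continuous_on_compose2[OF C1_gradD(2)[OF g, of UNIV]] continuous_intros) auto
        fix s
        have "(?h has_derivative (\<lambda>h. G (a + s *\<^sub>R u + t *\<^sub>R v + r *\<^sub>R w) \<bullet> (h *\<^sub>R u))) (at s within {0..1 - t - r})"
          by (rule has_derivative_compose[OF _ C1_gradD(1)[OF g]]) (auto intro!: derivative_eq_intros)
        then show "(?h has_vector_derivative ?h' s) (at s within {0..1 - t - r})"
          by (simp add: has_vector_derivative_def)
      qed
      moreover have "indicator tri3 (s, t, r) = (indicator {0..1 - t - r} s :: real)" for s
        using tr by (auto simp: tri3_def indicator_def)
      moreover have "a + (1 - t - r) *\<^sub>R u + t *\<^sub>R v + r *\<^sub>R w = (a + u) + t *\<^sub>R ((a + v) - (a + u)) + r *\<^sub>R ((a + w) - (a + u))"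
        by (simp add: algebra_simps)
      ultimately show ?thesis using True by (simp add: p)
    next
      case False
      then have "?F (s, p) = 0" for s by (auto simp: p tri3_def tri2_def indicator_def)
      then show ?thesis using False by simp
    qed
  qed
  have "(\<integral>p. ?F p \<partial>lborel) = (\<integral>p. (\<integral>s. ?F (s, p) \<partial>lborel) \<partial>lborel)"
    using lborel_pair.integral_snd[of "\<lambda>s p. ?F (s, p)"] i by (simp add: lborel_prod)
  also have "\<dots> = tri_integral (a + u) (a + v) (a + w) g - tri_integral a (a + v) (a + w) g"
    unfolding inner using tri_integrable[OF c, of "a + u" "(a + v) - (a + u)" "(a + w) - (a + u)"]
      tri_integrable[OF c, of a "(a + v) - a" "(a + w) - a"]
    by (subst Bochner_Integration.integral_diff) (simp_all add: tri_integral_lborel[OF c] case_prod_unfold)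
  finally show ?thesis .
qed

lemma Basis_axis: "(Basis :: (real^3) set) = {axis 1 1, axis 2 1, axis 3 1}"
  by (auto simp: Basis_vec_def UNIV_3)

lemma sum_prod_Basis_3:
  fixes x :: "real^3"
  shows "(\<Sum>b\<in>Basis. x \<bullet> b) = x$1 + x$2 + x$3" "(\<Prod>b\<in>Basis. x \<bullet> b) = x$1 * (x$2 * x$3)"
  by (simp_all add: Basis_axis axis_eq_axis inner_axis)

lemma emeasure_lborel_Times:
  fixes A :: "'a::euclidean_space set" and B :: "'b::euclidean_space set"
  assumes "A \<in> sets borel" "B \<in> sets borel"
  shows "emeasure lborel (A \<times> B) = emeasure lborel A * emeasure lborel B"
  using lborel.emeasure_pair_measure_Times[of A lborel B] assms by (simp add: lborel_prod)

text \<open>Links Fubini's theorem on nested pairs with Lebesgue measure on \<open>real^3\<close>;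
  agreement on boxes determines the measure.\<close>

lemma distr_lborel_vector: "distr lborel borel (\<lambda>(s, t, r). vector [s, t, r] :: real^3) = lborel"
proof (rule lborel_eqI[symmetric])
  let ?V = "\<lambda>(s, t, r). vector [s, t, r] :: real^3"
  have cont: "continuous_on UNIV ?V"
    by (subst continuous_on_componentwise)
      (auto simp: Basis_vec_def inner_axis forall_3 vector_3 case_prod_unfold UNIV_3 intro!: continuous_intros)
  then have m: "?V \<in> borel_measurable lborel" by (simp add: borel_measurable_continuous_onI)
  fix l u :: "real^3"
  assume le: "\<And>b. b \<in> Basis \<Longrightarrow> l \<bullet> b \<le> u \<bullet> b"
  then have le': "l $ i \<le> u $ i" for i by (simp add: cart_eq_inner_axis axis_in_Basis_iff)
  have "emeasure (distr lborel borel ?V) (box l u) = emeasure lborel (?V -` box l u \<inter> space lborel)"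
    using m by (intro emeasure_distr) auto
  also have "?V -` box l u \<inter> space lborel = {l$1<..<u$1} \<times> {l$2<..<u$2} \<times> {l$3<..<u$3}"
    by (auto simp: mem_box_cart forall_3 vector_3)
  also have "emeasure (lborel :: (real \<times> real \<times> real) measure) ({l$1<..<u$1} \<times> {l$2<..<u$2} \<times> {l$3<..<u$3})
      = ennreal ((u$1 - l$1) * ((u$2 - l$2) * (u$3 - l$3)))"
  proof -
    have "{l$2<..<u$2} \<times> {l$3<..<u$3} \<in> sets borel" by (intro borel_open open_Times) auto
    then show ?thesis using le' by (simp add: emeasure_lborel_Times ennreal_mult[symmetric])
  qed
  also have "(u$1 - l$1) * ((u$2 - l$2) * (u$3 - l$3)) = (\<Prod>b\<in>Basis. (u - l) \<bullet> b)"
    unfolding sum_prod_Basis_3(2) by simp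
  finally show "emeasure (distr lborel borel ?V) (box l u) = ennreal (\<Prod>b\<in>Basis. (u - l) \<bullet> b)" .
qed simp

definition std3 :: "(real^3) set" where
  "std3 = {x. 0 \<le> x$1 \<and> 0 \<le> x$2 \<and> 0 \<le> x$3 \<and> x$1 + x$2 + x$3 \<le> 1}"

lemma std3_hull: "std3 = convex hull {0, axis 1 1, axis 2 1, axis 3 1}"
proof -
  have "convex hull (insert 0 Basis) = {x::real^3. (\<forall>i\<in>Basis. 0 \<le> x \<bullet> i) \<and> (\<Sum>i\<in>Basis. x \<bullet> i) \<le> 1}"
    by (rule std_simplex)
  then show ?thesis unfolding sum_prod_Basis_3 by (auto simp: std3_def Basis_axis inner_axis)
qed

lemma hull4_image:
  "convex hull {a, a + u, a + v, a + w} = (\<lambda>x. a + (x$1 *\<^sub>R u + x$2 *\<^sub>R v + x$3 *\<^sub>R w)) ` std3" for a :: "real^3"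
proof -
  let ?L = "\<lambda>x::real^3. x$1 *\<^sub>R u + x$2 *\<^sub>R v + x$3 *\<^sub>R w"
  have lin: "linear ?L" by (rule linearI) (simp_all add: algebra_simps)
  have "(\<lambda>x. a + ?L x) ` std3 = (+) a ` ?L ` std3" by (simp add: image_image)
  also have "\<dots> = convex hull ((+) a ` ?L ` {0, axis 1 1, axis 2 1, axis 3 1})"
    by (simp only: std3_hull convex_hull_linear_image[OF lin] convex_hull_translation)
  also have "(+) a ` ?L ` {0, axis 1 1, axis 2 1, axis 3 1} = {a, a + u, a + v, a + w}"
  proof -
    have "axis i (1::real) $ j = (if i = j then 1 else 0)" for i j :: 3 by (simp add: axis_def)
    then show ?thesis by simp
  qed
  finally show ?thesis by simp
qed

lemma std3_compact: "compact std3"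
  unfolding std3_hull by (intro finite_imp_compact_convex_hull) simp

lemma integral_std3:
  assumes "continuous_on UNIV (h :: real^3 \<Rightarrow> real)"
  shows "integral\<^sup>L (lebesgue_on std3) h = (\<integral>p. (case p of (s, t, r) \<Rightarrow> indicator tri3 (s, t, r) * h (vector [s, t, r])) \<partial>lborel)"
proof -
  let ?V = "\<lambda>(s, t, r). vector [s, t, r] :: real^3"
  have m: "(\<lambda>x. indicator std3 x *\<^sub>R h x) \<in> borel_measurable borel"
    by (rule borel_indicator_continuous[OF std3_compact assms])
  have "continuous_on UNIV ?V"
    by (subst continuous_on_componentwise)
      (auto simp: Basis_vec_def inner_axis forall_3 vector_3 case_prod_unfold UNIV_3 intro!: continuous_intros)
  then have mV: "?V \<in> borel_measurable lborel" by (simp add: borel_measurable_continuous_onI)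
  have "integral\<^sup>L (lebesgue_on std3) h = (\<integral>x. indicator std3 x *\<^sub>R h x \<partial>lebesgue)"
    using compact_imp_closed[OF std3_compact] by (intro integral_restrict_space) auto
  also have "\<dots> = (\<integral>x. indicator std3 x *\<^sub>R h x \<partial>lborel)"
    using m by (intro integral_completion) simp
  also have "\<dots> = (\<integral>x. indicator std3 x *\<^sub>R h x \<partial>distr lborel borel ?V)"
    by (simp only: distr_lborel_vector)
  also have "\<dots> = (\<integral>p. indicator std3 (?V p) *\<^sub>R h (?V p) \<partial>lborel)"
    using mV m by (intro integral_distr) auto
  also have "\<dots> = (\<integral>p. (case p of (s, t, r) \<Rightarrow> indicator tri3 (s, t, r) * h (vector [s, t, r])) \<partial>lborel)"
    by (intro Bochner_Integration.integral_cong) (auto simp: std3_def tri3_def vector_3 indicator_def)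
  finally show ?thesis .
qed

lemma integral_linear_image:
  fixes f :: "real^3 \<Rightarrow> real" and L :: "real^3 \<Rightarrow> real^3"
  assumes f: "continuous_on UNIV f" and L: "linear L" and S: "compact S"
  shows "integral\<^sup>L (lebesgue_on (L ` S)) f = \<bar>det (matrix L)\<bar> * integral\<^sup>L (lebesgue_on S) (\<lambda>x. f (L x))"
proof -
  have cL: "continuous_on A L" for A using L by (simp add: linear_continuous_on linear_linear)
  have S': "compact (L ` S)" by (intro compact_continuous_image cL S)
  \<comment> \<open>The scalar integrand is lifted to \<open>real^1\<close> to fit the linear change
    of variables for vector-valued functions.\<close>
  let ?F = "\<lambda>x. vec (f x) :: real^1"
  have cF: "continuous_on UNIV ?F" 
    using f by (subst continuous_on_componentwise) (auto simp: Basis_vec_def inner_axis)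
  have iF: "integrable (lebesgue_on (L ` S)) ?F" by (rule integrable_compact_continuous[OF S' cF])
  then have aF: "?F absolutely_integrable_on (L ` S)"
    using compact_sets(2)[OF S'] by (simp add: set_integrable_def integrable_restrict_space)
  have "integral (L ` S) ?F = \<bar>det (matrix L)\<bar> *\<^sub>R integral S (?F \<circ> L)"
    using aF by (intro integral_change_of_variables_linear[OF L]) simp
  then have "integral (L ` S) ?F $ 1 = \<bar>det (matrix L)\<bar> * (integral S (?F \<circ> L) $ 1)" by simp
  moreover have "integral (L ` S) ?F $ 1 = integral (L ` S) f"
    using integral_component_eq_cart[OF integrable_on_lebesgue_on[OF iF compact_sets(2)[OF S']], of 1] by simp
  moreover have c2: "continuous_on UNIV (\<lambda>x. ?F (L x))" "continuous_on UNIV (\<lambda>x. f (L x))"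
    by (rule continuous_on_compose2[OF cF cL], simp, rule continuous_on_compose2[OF f cL], simp)
  moreover have "integral S (?F \<circ> L) $ 1 = integral S (\<lambda>x. f (L x))"
    using integral_component_eq_cart[OF integrable_on_lebesgue_on[OF integrable_compact_continuous[OF S c2(1)] compact_sets(2)[OF S]], of 1]
    by (simp add: o_def)
  moreover have "integral\<^sup>L (lebesgue_on (L ` S)) f = integral (L ` S) f"
    by (rule lebesgue_integral_eq_integral[OF integrable_compact_continuous[OF S' f] compact_sets(2)[OF S']])
  moreover have "integral\<^sup>L (lebesgue_on S) (\<lambda>x. f (L x)) = integral S (\<lambda>x. f (L x))"
    by (rule lebesgue_integral_eq_integral[OF integrable_compact_continuous[OF S c2(2)] compact_sets(2)[OF S]])
  ultimately show ?thesis by simp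
qed

lemma integral_translate_set:
  fixes f :: "real^3 \<Rightarrow> real"
  assumes f: "continuous_on UNIV f" and S: "compact S"
  shows "integral\<^sup>L (lebesgue_on ((+) a ` S)) f = integral\<^sup>L (lebesgue_on S) (\<lambda>x. f (a + x))"
proof -
  have f': "continuous_on UNIV (\<lambda>x. f (a + x))"
    by (rule continuous_on_compose2[OF f]) (auto intro: continuous_intros)
  have S': "compact ((+) a ` S)" by (intro compact_translation S)
  have m: "(\<lambda>x. indicator A x *\<^sub>R h x) \<in> borel_measurable borel" if "compact A" "continuous_on UNIV h"
    for A and h :: "real^3 \<Rightarrow> real"
    by (rule borel_indicator_continuous[OF that])
  have e: "integral\<^sup>L (lebesgue_on A) h = (\<integral>x. indicator A x *\<^sub>R h x \<partial>lborel)" if "compact A" "continuous_on UNIV h"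
    for A and h :: "real^3 \<Rightarrow> real"
    using compact_imp_closed[OF that(1)] m[OF that]
    by (subst integral_restrict_space) (auto intro!: integral_completion)
  have "(\<integral>x. indicator ((+) a ` S) x *\<^sub>R f x \<partial>lborel) = (\<integral>x. indicator ((+) a ` S) (x + a) *\<^sub>R f (x + a) \<partial>lborel)"
    by (rule lborel_integral_translation[OF m[OF S' f], symmetric])
  also have "\<dots> = (\<integral>x. indicator S x *\<^sub>R f (a + x) \<partial>lborel)"
    by (intro Bochner_Integration.integral_cong) (auto simp: indicator_def add.commute image_iff)
  finally show ?thesis by (simp only: e[OF S' f] e[OF S f'])
qed

text \<open>Pulling the simplex back to the reference simplex turns the edge b - a into the first
  coordinate direction; the Jacobian determinant is the scalar triple product of the edges at
  a.\<close>

lemma simplex_edge_FTC: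
  assumes g: "C1_grad g G"
  shows "integral\<^sup>L (lebesgue_on (convex hull {a, b, c, d})) (\<lambda>x. G x \<bullet> (b - a))
    = \<bar>(b - a) \<bullet> cross3 (c - a) (d - a)\<bar> * (tri_integral b c d g - tri_integral a c d g)"
proof -
  define u v w where "u = b - a" and "v = c - a" and "w = d - a"
  let ?L = "\<lambda>x::real^3. x$1 *\<^sub>R u + x$2 *\<^sub>R v + x$3 *\<^sub>R w"
  have lin: "linear ?L" by (rule linearI) (simp_all add: algebra_simps)
  have cL: "continuous_on A ?L" for A by (intro continuous_intros)
  have bcd: "b = a + u" "c = a + v" "d = a + w" by (simp_all add: u_def v_def w_def)
  have cG: "continuous_on UNIV (\<lambda>x. G x \<bullet> u)" by (intro continuous_intros C1_gradD(2)[OF g])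
  have cG': "continuous_on UNIV (\<lambda>x. G (a + x) \<bullet> u)"
    by (intro continuous_on_inner continuous_on_const continuous_on_compose2[OF C1_gradD(2)[OF g, of UNIV]] continuous_intros) auto
  have cG'': "continuous_on UNIV (\<lambda>x. G (a + ?L x) \<bullet> u)"
    by (intro continuous_on_inner continuous_on_const continuous_on_compose2[OF C1_gradD(2)[OF g, of UNIV]] continuous_intros) auto
  have det: "\<bar>det (matrix ?L)\<bar> = \<bar>u \<bullet> cross3 v w\<bar>"
    by (simp add: matrix_def det_3 cross3_def inner_vec_def sum_3 vector_3 axis_def algebra_simps)
  have H: "convex hull {a, b, c, d} = (+) a ` ?L ` std3"
    unfolding bcd hull4_image by (simp add: image_image)
  have "integral\<^sup>L (lebesgue_on (convex hull {a, b, c, d})) (\<lambda>x. G x \<bullet> u)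
      = integral\<^sup>L (lebesgue_on (?L ` std3)) (\<lambda>x. G (a + x) \<bullet> u)"
    unfolding H by (intro integral_translate_set[OF cG] compact_continuous_image cL std3_compact)
  also have "\<dots> = \<bar>det (matrix ?L)\<bar> * integral\<^sup>L (lebesgue_on std3) (\<lambda>x. G (a + ?L x) \<bullet> u)"
    by (rule integral_linear_image[OF cG' lin std3_compact])
  also have "integral\<^sup>L (lebesgue_on std3) (\<lambda>x. G (a + ?L x) \<bullet> u)
      = (\<integral>p. (case p of (s, t, r) \<Rightarrow> indicator tri3 (s, t, r) * (G (a + s *\<^sub>R u + t *\<^sub>R v + r *\<^sub>R w) \<bullet> u)) \<partial>lborel)"
    unfolding integral_std3[OF cG''] by (simp add: vector_3 add.assoc)
  also have "\<dots> = tri_integral b c d g - tri_integral a c d g"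
    unfolding tri3_FTC[OF g] bcd ..
  finally show ?thesis unfolding det by (simp only: u_def v_def w_def)
qed

text \<open>\<open>face_integral\<close> picks the order of the vertices by \<open>SOME\<close>, so
  its value must not depend on the order. Two transpositions generate all permutations, and neither
  changes the area factor.\<close>

lemma tri_integral_perm:
  assumes "continuous_on UNIV f" "{a, b, c} = {a', b', c'}" "card {a, b, c} = 3"
  shows "norm (cross3 (b - a) (c - a)) * tri_integral a b c f
       = norm (cross3 (b' - a') (c' - a')) * tri_integral a' b' c' f"
proof -
  note s = tri_integral_swap12[OF assms(1)] tri_integral_swap23[OF assms(1)]
  have n12: "norm (cross3 (q - p) (r - p)) = norm (cross3 (p - q) (r - q))" for p q r :: "real^3"
  proof -
    have "cross3 (q - p) (r - p) = - cross3 (p - q) (r - q)" by (simp add: cross3_simps)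
    then show ?thesis by simp
  qed
  have n23: "norm (cross3 (q - p) (r - p)) = norm (cross3 (r - p) (q - p))" for p q r :: "real^3"
    using cross_skew[of "q - p" "r - p"] by simp
  define P where "P p q r = norm (cross3 (q - p) (r - p)) * tri_integral p q r f" for p q r
  have T12: "P p q r = P q p r" for p q r using s(1) n12 by (simp add: P_def)
  have T23: "P p q r = P p r q" for p q r using s(2) n23 by (simp add: P_def)
  have ne: "a \<noteq> b" "a \<noteq> c" "b \<noteq> c" using assms(3) by (auto simp: card_insert_if split: if_splits)
  have "a' \<in> {a, b, c}" "b' \<in> {a, b, c}" "c' \<in> {a, b, c}" unfolding assms(2) by simp_all
  moreover have "a \<in> {a', b', c'}" "b \<in> {a', b', c'}" "c \<in> {a', b', c'}" unfolding assms(2)[symmetric] by simp_all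
  ultimately consider "a' = a" "b' = b" "c' = c" | "a' = a" "b' = c" "c' = b" | "a' = b" "b' = a" "c' = c"
    | "a' = b" "b' = c" "c' = a" | "a' = c" "b' = a" "c' = b" | "a' = c" "b' = b" "c' = a"
    using ne by (simp only: insert_iff empty_iff) metis
  then have "P a b c = P a' b' c'"
    by cases (use T12[of a b c] T23[of a b c] T23[of b a c] T12[of a c b] T23[of c a b] in simp_all)
  then show ?thesis by (simp add: P_def)
qed

text \<open>The vertices of a nondegenerate triangle are its extreme points, so whichever triple is
  picked is a permutation of a, b, c.\<close>

lemma face_integral_eq:
  assumes f: "continuous_on UNIV f" and ind: "\<not> affine_dependent {a, b, c}" and "card {a, b, c} = 3"
  shows "face_integral (convex hull {a, b, c}) f = norm (cross3 (b - a) (c - a)) * tri_integral a b c f"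
proof -
  let ?P = "\<lambda>(a', b', c'). convex hull {a, b, c} = convex hull {a', b', c' :: real^3}"
  obtain a' b' c' where s: "(SOME p. ?P p) = (a', b', c')" by (metis prod_cases3)
  have "?P (SOME p. ?P p)" by (rule someI[of ?P "(a, b, c)"]) simp
  then have h: "convex hull {a, b, c} = convex hull {a', b', c'}" by (simp add: s)
  have "{a, b, c} \<subseteq> {a', b', c'}"
  proof
    fix x assume "x \<in> {a, b, c}"
    then have "x extreme_point_of (convex hull {a, b, c})"
      using extreme_point_of_convex_hull_affine_independent[OF ind] by blast
    then show "x \<in> {a', b', c'}" unfolding h by (rule extreme_point_of_convex_hull)
  qed
  then have "{a, b, c} = {a', b', c'}"
    using assms(3) by (intro card_subset_eq) (auto simp: card_insert_if split: if_splits)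
  then show ?thesis
    using tri_integral_perm[OF f _ assms(3)]
    unfolding face_integral_def s tri_integral_def tri2_def by simp
qed

text \<open>n is orthogonal to p and q, hence p \<times> q is a multiple of n. This trades area
  times normal component for a triple product.\<close>

lemma unit_normal_cross:
  fixes n p q e :: "real^3"
  assumes "norm n = 1" "n \<bullet> p = 0" "n \<bullet> q = 0"
  shows "norm (cross3 p q) * \<bar>n \<bullet> e\<bar> = \<bar>e \<bullet> cross3 p q\<bar>"
proof -
  let ?X = "cross3 p q"
  have "cross3 n ?X = 0" using assms(2,3) by (simp add: Lagrange)
  then have "(n \<bullet> ?X) *\<^sub>R n = (n \<bullet> n) *\<^sub>R ?X" using Lagrange[of n n ?X] by (simp del: Lagrange)
  moreover have "n \<bullet> n = 1" using assms(1) by (simp add: power2_norm_eq_inner[symmetric])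
  ultimately have X: "?X = (n \<bullet> ?X) *\<^sub>R n" by simp
  then have "norm ?X = \<bar>n \<bullet> ?X\<bar>" using assms(1) by (metis mult.right_neutral norm_scaleR)
  moreover have "e \<bullet> ?X = (n \<bullet> ?X) * (e \<bullet> n)" using X by (metis inner_scaleR_right)
  ultimately show ?thesis by (simp add: abs_mult inner_commute)
qed

text \<open>Supporting half-spaces encode outwardness; two points of F taken in both orders show
  that n F is orthogonal to F.\<close>

definition outer_normals :: "(real^3) set \<Rightarrow> ((real^3) set \<Rightarrow> real^3) \<Rightarrow> bool" where
  "outer_normals K n \<longleftrightarrow> (\<forall>F. F facet_of K \<longrightarrow> norm (n F) = 1 \<and> (\<forall>x\<in>F. \<forall>y\<in>K. (y - x) \<bullet> n F \<le> 0))"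

lemma simplex_facets:
  fixes C :: "(real^3) set"
  assumes "\<not> affine_dependent C" "card C = 4"
  shows "{F. F facet_of (convex hull C)} = (\<lambda>p. convex hull (C - {p})) ` C"
    "inj_on (\<lambda>p. convex hull (C - {p})) C"
proof -
  have fin: "finite C" using assms(1) aff_independent_finite by blast
  show "{F. F facet_of (convex hull C)} = (\<lambda>p. convex hull (C - {p})) ` C"
    unfolding facet_of_convex_hull_affine_independent_alt[OF assms(1)] using assms(2) by auto
  show "inj_on (\<lambda>p. convex hull (C - {p})) C"
  proof (rule inj_onI)
    fix p q assume pq: "p \<in> C" "q \<in> C" "convex hull (C - {p}) = convex hull (C - {q})"
    have "\<not> affine_dependent (C - {p})" "\<not> affine_dependent (C - {q})"
      using assms(1) affine_independent_subset by blast+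
    then have "x \<in> C - {p} \<longleftrightarrow> x \<in> C - {q}" for x
      using extreme_point_of_convex_hull_affine_independent pq(3) by metis
    then show "p = q" using pq(1,2) by blast
  qed
qed

text \<open>The facets opposite to c and d contain the edge p q, so their normals do not see the
  direction q - p. On the facets opposite to p and q, area times normal component is plus or minus
  the triple product of \<open>simplex_edge_FTC\<close>.\<close>

lemma simplex_edge_gradient:
  assumes g: "C1_grad g G" and ind: "\<not> affine_dependent {p, q, c, d}" and card: "card {p, q, c, d} = 4"
    and n: "outer_normals (convex hull {p, q, c, d}) n"
  shows "integral\<^sup>L (lebesgue_on (convex hull {p, q, c, d})) (\<lambda>x. G x \<bullet> (q - p))
    = (\<Sum>F | F facet_of (convex hull {p, q, c, d}). (n F \<bullet> (q - p)) * face_integral F g)"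
proof -
  let ?C = "{p, q, c, d}"
  let ?K = "convex hull ?C"
  have dist: "p \<noteq> q" "p \<noteq> c" "p \<noteq> d" "q \<noteq> c" "q \<noteq> d" "c \<noteq> d"
    using card by (auto simp: card_insert_if split: if_splits)
  have fi: "face_integral (convex hull {x, y, z}) g = norm (cross3 (y - x) (z - x)) * tri_integral x y z g"
    if "{x, y, z} \<subseteq> ?C" "x \<noteq> y" "x \<noteq> z" "y \<noteq> z" for x y z
    using that affine_independent_subset[OF ind that(1)] by (intro face_integral_eq C1_gradD(3)[OF g]) auto
  let ?F = "\<lambda>x. convex hull (?C - {x})"
  have fac: "?F x facet_of ?K" if "x \<in> ?C" for x using simplex_facets(1)[OF ind card] that by blast
  have n1: "norm (n (?F x)) = 1" if "x \<in> ?C" for x using fac[OF that] n by (simp add: outer_normals_def)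
  have nle: "(y - z) \<bullet> n (?F x) \<le> 0" if "x \<in> ?C" "z \<in> ?C - {x}" "y \<in> ?C" for x y z
    using fac[OF that(1)] n that(2,3) hull_inc[of z "?C - {x}" convex] hull_inc[of y ?C convex]
    by (auto simp: outer_normals_def)
  have n0: "n (?F x) \<bullet> (y - z) = 0" if "x \<in> ?C" "z \<in> ?C - {x}" "y \<in> ?C - {x}" for x y z
    using nle[OF that(1,2), of y] nle[OF that(1,3), of z] that by (simp add: inner_diff_left inner_diff_right inner_commute)
  have "(\<Sum>F | F facet_of ?K. (n F \<bullet> (q - p)) * face_integral F g) = (\<Sum>x\<in>?C. (n (?F x) \<bullet> (q - p)) * face_integral (?F x) g)"
    unfolding simplex_facets(1)[OF ind card]
    by (rule sum.reindex[OF simplex_facets(2)[OF ind card], unfolded o_def])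
  also have "\<dots> = (n (?F p) \<bullet> (q - p)) * face_integral (?F p) g + (n (?F q) \<bullet> (q - p)) * face_integral (?F q) g"
    using dist n0[of c p q] n0[of d p q] by (simp del: insert_Diff_single)
  also have "?F p = convex hull {q, c, d}" using dist by (intro arg_cong[of _ _ "\<lambda>S. convex hull S"]) auto
  also have "?F q = convex hull {p, c, d}" using dist by (intro arg_cong[of _ _ "\<lambda>S. convex hull S"]) auto
  finally have S: "(\<Sum>F | F facet_of ?K. (n F \<bullet> (q - p)) * face_integral F g) =
    (n (convex hull {q, c, d}) \<bullet> (q - p)) * face_integral (convex hull {q, c, d}) g
    + (n (convex hull {p, c, d}) \<bullet> (q - p)) * face_integral (convex hull {p, c, d}) g" .
  have Fp: "?F p = convex hull {q, c, d}" and Fq: "?F q = convex hull {p, c, d}"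
    using dist by (auto intro!: arg_cong[of _ _ "\<lambda>S. convex hull S"])
  let ?D = "\<bar>(q - p) \<bullet> cross3 (c - p) (d - p)\<bar>"
  have "norm (cross3 (c - q) (d - q)) * \<bar>n (convex hull {q, c, d}) \<bullet> (q - p)\<bar> = \<bar>(q - p) \<bullet> cross3 (c - q) (d - q)\<bar>"
    using n1[of p] n0[of p q c] n0[of p q d] dist unfolding Fp by (intro unit_normal_cross) auto
  \<comment> \<open>Replacing the base point p by q changes c - p and d - p by multiples of q - p,
    which the triple product ignores.\<close>
  also have "(q - p) \<bullet> cross3 (c - q) (d - q) = (q - p) \<bullet> cross3 (c - p) (d - p)"
    by (simp add: cross3_simps)
  also have "\<bar>n (convex hull {q, c, d}) \<bullet> (q - p)\<bar> = n (convex hull {q, c, d}) \<bullet> (q - p)"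
    using nle[of p q p] dist unfolding Fp by (simp add: inner_diff_left inner_diff_right inner_commute)
  finally have 1: "norm (cross3 (c - q) (d - q)) * (n (convex hull {q, c, d}) \<bullet> (q - p)) = ?D" .
  have "norm (cross3 (c - p) (d - p)) * \<bar>n (convex hull {p, c, d}) \<bullet> (q - p)\<bar> = ?D"
    using n1[of q] n0[of q p c] n0[of q p d] dist unfolding Fq by (intro unit_normal_cross) auto
  also have "\<bar>n (convex hull {p, c, d}) \<bullet> (q - p)\<bar> = - (n (convex hull {p, c, d}) \<bullet> (q - p))"
    using nle[of q p q] dist unfolding Fq by (simp add: inner_diff_left inner_diff_right inner_commute)
  finally have 2: "norm (cross3 (c - p) (d - p)) * (n (convex hull {p, c, d}) \<bullet> (q - p)) = - ?D" by simp
  have f1: "face_integral (convex hull {q, c, d}) g = norm (cross3 (c - q) (d - q)) * tri_integral q c d g"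
    and f2: "face_integral (convex hull {p, c, d}) g = norm (cross3 (c - p) (d - p)) * tri_integral p c d g"
    using dist by (auto intro!: fi)
  have "(\<Sum>F | F facet_of ?K. (n F \<bullet> (q - p)) * face_integral F g) = ?D * tri_integral q c d g - ?D * tri_integral p c d g"
  proof -
    have "(n (convex hull {q, c, d}) \<bullet> (q - p)) * (norm (cross3 (c - q) (d - q)) * t) = ?D * t" for t
      unfolding 1[symmetric] by (simp only: ac_simps)
    moreover have "(n (convex hull {p, c, d}) \<bullet> (q - p)) * (norm (cross3 (c - p) (d - p)) * t) = - ?D * t" for t
      unfolding 2[symmetric] by (simp only: ac_simps)
    ultimately show ?thesis unfolding S f1 f2 by simp
  qed
  then show ?thesis using simplex_edge_FTC[OF g, of p q c d] by (simp add: right_diff_distrib)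
qed

text \<open>Both sides are linear in e, and the three edges at one vertex span the space.\<close>

lemma simplex_gradient:
  assumes g: "C1_grad g G" and K: "3 simplex K" and n: "outer_normals K n"
  shows "integral\<^sup>L (lebesgue_on K) (\<lambda>x. G x \<bullet> e) = (\<Sum>F | F facet_of K. (n F \<bullet> e) * face_integral F g)"
proof -
  obtain C where C: "\<not> affine_dependent C" "card C = 4" "K = convex hull C"
    using K unfolding simplex_def by auto
  then obtain a b c d where abcd: "C = {a, b, c, d}" "distinct [a, b, c, d]"
    by (auto simp: card_Suc_eq numeral_eq_Suc)
  have cK: "compact K" unfolding C(3) abcd(1) by (intro finite_imp_compact_convex_hull) simp
  have int: "integrable (lebesgue_on K) (\<lambda>x. G x \<bullet> e)" for e
  proof -
    have "continuous_on UNIV (\<lambda>x. G x \<bullet> e)" by (intro continuous_intros C1_gradD(2)[OF g])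
    then show ?thesis by (rule integrable_compact_continuous[OF cK])
  qed
  define Q where "Q e = integral\<^sup>L (lebesgue_on K) (\<lambda>x. G x \<bullet> e) - (\<Sum>F | F facet_of K. (n F \<bullet> e) * face_integral F g)" for e
  have lin: "linear Q"
  proof (rule linearI)
    fix x y :: "real^3" and r :: real
    show "Q (x + y) = Q x + Q y"
      using int by (simp add: Q_def inner_add_right distrib_right sum.distrib)
    show "Q (r *\<^sub>R x) = r *\<^sub>R Q x"
      by (simp add: Q_def sum_distrib_left right_diff_distrib mult.assoc)
  qed
  have Q0: "Q (q - a) = 0" if "q \<in> {b, c, d}" for q
  proof -
    obtain c' d' where e: "{a, b, c, d} = {a, q, c', d'}"
      using \<open>q \<in> {b, c, d}\<close> by (metis insert_commute insert_iff singletonD)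
    show ?thesis
      using simplex_edge_gradient[OF g, of a q c' d' n] C n unfolding e[symmetric] abcd Q_def by simp
  qed
  have "independent ((\<lambda>x. x - a) ` ({a, b, c, d} - {a}))"
    using C(1) abcd affine_dependent_iff_dependent2[of a "{a, b, c, d}"] by simp
  moreover have "{a, b, c, d} - {a} = {b, c, d}" using abcd(2) by auto
  ultimately have ind: "independent ((\<lambda>x. x - a) ` {b, c, d})" by simp
  have "card ((\<lambda>x. x - a) ` {b, c, d}) = 3"
    using abcd(2) by (subst card_image) (auto simp: inj_on_def)
  then have "UNIV \<subseteq> span ((\<lambda>x. x - a) ` {b, c, d})"
    using ind by (intro card_ge_dim_independent) (auto simp: dim_UNIV)
  then have "Q e = 0"
    using linear_eq_0_on_span[OF lin, of "(\<lambda>x. x - a) ` {b, c, d}" e] Q0 by blast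
  then show ?thesis by (simp add: Q_def)
qed

section \<open>Geometry of the mesh\<close>

lemma simplex3_props:
  fixes K :: "(real^3) set"
  assumes "3 simplex K"
  shows "compact K" "convex K" "interior K \<noteq> {}" "aff_dim K = 3"
proof -
  obtain C where C: "\<not> affine_dependent C" "card C = 4" "K = convex hull C"
    using assms unfolding simplex_def by auto
  show "compact K" using C by (simp add: aff_independent_finite finite_imp_compact_convex_hull)
  show cv: "convex K" using C by simp
  show d: "aff_dim K = 3" using aff_dim_simplex[OF assms] by simp
  then have "affine hull K = UNIV" by (simp add: aff_dim_eq_full[symmetric])
  then have "interior K = rel_interior K" by (simp add: rel_interior_interior)
  moreover have "K \<noteq> {}" using d by auto
  ultimately show "interior K \<noteq> {}" using rel_interior_eq_empty[OF cv] by simp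
qed

lemma simplex3_closure_interior:
  fixes K :: "(real^3) set"
  assumes "3 simplex K"
  shows "closure (interior K) = K"
  using simplex3_props[OF assms] convex_closure_interior[of K] by (simp add: compact_imp_closed)

lemma simplex3_facet:
  fixes K :: "(real^3) set"
  assumes K: "3 simplex K" and F: "F facet_of K"
  obtains a b c where "F = convex hull {a, b, c}" "0 < norm (cross3 (b - a) (c - a))"
    "\<And>f. continuous_on UNIV f \<Longrightarrow> face_integral F f = norm (cross3 (b - a) (c - a)) * tri_integral a b c f"
proof -
  obtain C where C: "\<not> affine_dependent C" "card C = 4" "K = convex hull C"
    using K unfolding simplex_def by auto
  obtain p where p: "p \<in> C" "F = convex hull (C - {p})"
    using F simplex_facets(1)[OF C(1,2)] C(3) by blast
  have "card (C - {p}) = 3" using p C by (simp add: card_Diff_singleton)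
  then obtain a b c where abc: "C - {p} = {a, b, c}" "distinct [a, b, c]"
    by (auto simp: card_Suc_eq numeral_eq_Suc)
  have ind: "\<not> affine_dependent {a, b, c}" using affine_independent_subset[OF C(1), of "{a, b, c}"] abc(1) by blast
  have "\<not> collinear {b, a, c}" using ind abc(2)
    by (simp add: collinear_3_eq_affine_dependent insert_commute)
  then have "\<not> collinear {0, b - a, c - a}"
    by (subst (asm) collinear_3[of b a c, symmetric, THEN sym]) (simp_all add: NO_MATCH_def)
  then have "cross3 (b - a) (c - a) \<noteq> 0" by (simp add: cross_eq_0)
  moreover have "card {a, b, c} = 3" using abc(2) by simp
  ultimately show thesis
    using p(2) abc face_integral_eq[OF _ ind] by (intro that[of a b c]) auto
qed

section \<open>Face integrals as functionals of the integrand\<close>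

lemma tri_param_in_hull: "(s, t) \<in> tri2 \<Longrightarrow> a + s *\<^sub>R (b - a) + t *\<^sub>R (c - a) \<in> convex hull {a, b, c}"
  unfolding convex_hull_3_alt tri2_def by auto

lemma tri_integral_cong:
  assumes "\<And>x. x \<in> convex hull {a, b, c} \<Longrightarrow> f x = g x"
  shows "tri_integral a b c f = tri_integral a b c g"
  unfolding tri_integral_def
  by (intro Bochner_Integration.integral_cong refl)
    (use closed_tri2 in \<open>auto simp: space_restrict_space intro!: assms tri_param_in_hull\<close>)

lemma tri_integrable_on:
  assumes "continuous_on UNIV (f :: real^3 \<Rightarrow> real)"
  shows "integrable (lebesgue_on tri2) (\<lambda>(s, t). f (a + s *\<^sub>R u + t *\<^sub>R v))"
proof -
  have "integrable lebesgue (\<lambda>p. indicator tri2 p *\<^sub>R (case p of (s, t) \<Rightarrow> f (a + s *\<^sub>R u + t *\<^sub>R v)))"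
    using tri_integrable[OF assms, of a u v] by (subst integrable_completion) (auto simp: case_prod_unfold)
  then show ?thesis using compact_sets(2)[OF compact_tri2] by (simp add: integrable_restrict_space)
qed

lemma tri_integral_add:
  assumes "continuous_on UNIV f" "continuous_on UNIV g"
  shows "tri_integral a b c (\<lambda>x. f x + g x) = tri_integral a b c f + tri_integral a b c g"
  using tri_integrable_on[OF assms(1)] tri_integrable_on[OF assms(2)]
  by (simp add: tri_integral_def case_prod_unfold)

text \<open>Almost everywhere turns into everywhere by continuity: the zero set is closed and
  contains the interior of the reference triangle, hence its closure.\<close>

lemma tri_integral_eq_0:
  assumes f: "continuous_on UNIV f" and p: "\<And>x. x \<in> convex hull {a, b, c} \<Longrightarrow> 0 \<le> f x"
    and z: "tri_integral a b c f = 0" and x: "x \<in> convex hull {a, b, c}"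
  shows "f x = 0"
proof -
  let ?h = "\<lambda>(s, t). f (a + s *\<^sub>R (b - a) + t *\<^sub>R (c - a))"
  have ch: "continuous_on UNIV ?h" unfolding case_prod_unfold
    by (intro continuous_on_compose2[OF f] continuous_intros) auto
  have "AE q in lebesgue_on tri2. 0 \<le> ?h q"
    using compact_sets(2)[OF compact_tri2] by (intro AE_I2) (auto simp: space_restrict_space intro!: p tri_param_in_hull)
  then have "AE q in lebesgue_on tri2. ?h q = 0"
    using z integral_nonneg_eq_0_iff_AE[OF tri_integrable_on[OF f]] by (simp add: tri_integral_def)
  then have AE: "AE q in lebesgue. q \<in> tri2 \<longrightarrow> ?h q = 0"
    using compact_sets(2)[OF compact_tri2] by (simp add: AE_restrict_space_iff)
  let ?S = "{q :: real \<times> real. 0 < fst q} \<inter> {q. 0 < snd q} \<inter> {q. fst q + snd q < 1}"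
  have oS: "open ?S" by (intro open_Int open_Collect_less continuous_intros)
  have cl: "closed {q. ?h q = 0}" using ch by (intro closed_Collect_eq) auto
  have St: "?S \<subseteq> tri2" by (auto simp: tri2_def)
  have "closure (interior tri2) \<subseteq> {q. ?h q = 0}"
  proof -
    have "interior tri2 \<subseteq> {q. ?h q = 0}"
    proof
      fix q assume q: "q \<in> interior tri2"
      have "AE q \<in> interior tri2 in lebesgue. q \<in> {q. ?h q = 0}"
        using AE by eventually_elim (use interior_subset in blast)
      from mem_closed_if_AE_lebesgue_open[OF open_interior cl this q] show "q \<in> {q. ?h q = 0}" .
    qed
    then show ?thesis using cl closure_minimal by blast
  qed
  moreover have "closure (interior tri2) = tri2"
  proof -
    have "convex tri2"
    proof (rule convexI)
      fix p q :: "real \<times> real" and u v :: real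
      assume pq: "p \<in> tri2" "q \<in> tri2" and uv: "0 \<le> u" "0 \<le> v" "u + v = 1"
      obtain s t s' t' where e: "p = (s, t)" "q = (s', t')" by (metis surj_pair)
      have "u * (s + t) + v * (s' + t') \<le> u * 1 + v * 1"
        using pq uv by (intro add_mono mult_left_mono) (auto simp: e tri2_def)
      then show "u *\<^sub>R p + v *\<^sub>R q \<in> tri2"
        using pq uv by (auto simp: e tri2_def algebra_simps)
    qed
    moreover have "(1/4, 1/4) \<in> interior tri2"
      by (rule interiorI[OF oS]) (use St in auto)
    ultimately show ?thesis using convex_closure_interior[of tri2] closed_tri2 by auto
  qed
  moreover obtain s t where "(s, t) \<in> tri2" "x = a + s *\<^sub>R (b - a) + t *\<^sub>R (c - a)"
    using x unfolding convex_hull_3_alt tri2_def by auto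
  ultimately show ?thesis by auto
qed

lemma face_integral_add:
  assumes "3 simplex K" "F facet_of K" "continuous_on UNIV f" "continuous_on UNIV g"
  shows "face_integral F (\<lambda>x. f x + g x) = face_integral F f + face_integral F g"
proof -
  obtain a b c where "F = convex hull {a, b, c}" and
    fi: "\<And>f. continuous_on UNIV f \<Longrightarrow> face_integral F f = norm (cross3 (b - a) (c - a)) * tri_integral a b c f"
    using simplex3_facet[OF assms(1,2)] by metis
  show ?thesis using assms(3,4)
    by (simp add: fi continuous_on_add tri_integral_add distrib_left)
qed

lemma face_integral_cmult: "face_integral F (\<lambda>x. r * f x) = r * face_integral F f"
  unfolding face_integral_def by (auto simp: Let_def case_prod_unfold)

lemma face_integral_cong:
  assumes "3 simplex K" "F facet_of K" "continuous_on UNIV f" "continuous_on UNIV g"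
    "\<And>x. x \<in> F \<Longrightarrow> f x = g x"
  shows "face_integral F f = face_integral F g"
proof -
  obtain a b c where F: "F = convex hull {a, b, c}" and
    fi: "\<And>f. continuous_on UNIV f \<Longrightarrow> face_integral F f = norm (cross3 (b - a) (c - a)) * tri_integral a b c f"
    using simplex3_facet[OF assms(1,2)] by metis
  show ?thesis unfolding fi[OF assms(3)] fi[OF assms(4)] using assms(5) F tri_integral_cong[of a b c f g] by simp
qed

lemma face_integral_eq_0:
  assumes "3 simplex K" "F facet_of K" "continuous_on UNIV f" "\<And>x. x \<in> F \<Longrightarrow> 0 \<le> f x"
    "face_integral F f = 0" "x \<in> F"
  shows "f x = 0"
proof -
  obtain a b c where F: "F = convex hull {a, b, c}" and n: "0 < norm (cross3 (b - a) (c - a))" and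
    fi: "\<And>f. continuous_on UNIV f \<Longrightarrow> face_integral F f = norm (cross3 (b - a) (c - a)) * tri_integral a b c f"
    using simplex3_facet[OF assms(1,2)] by metis
  have "tri_integral a b c f = 0" using fi[OF assms(3)] assms(5) n by simp
  then show ?thesis using tri_integral_eq_0[OF assms(3)] assms(4,6) F by blast
qed

text \<open>Close to a relative interior point of a facet the simplex is a half-ball. Project y
  centrally from an interior point z onto the plane of F; the projection is continuous and fixes x,
  so it lands in F for y near x, and y lies between the projection and z.\<close>

lemma facet_local_halfspace:
  fixes K :: "(real^3) set"
  assumes K: "3 simplex K" and F: "F facet_of K" and x: "x \<in> rel_interior F"
    and n: "norm n = 1" "\<And>y z. y \<in> K \<Longrightarrow> z \<in> F \<Longrightarrow> (y - z) \<bullet> n \<le> 0"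
  obtains r where "0 < r" "K \<inter> ball x r = {y \<in> ball x r. (y - x) \<bullet> n \<le> 0}"
proof -
  note KP = simplex3_props[OF K]
  have FK: "F \<subseteq> K" by (rule facet_of_imp_subset[OF F])
  have xF: "x \<in> F" using x rel_interior_subset by blast
  have F0: "(y - x) \<bullet> n = 0" if "y \<in> F" for y
  proof -
    have "y \<in> K" "x \<in> K" using that xF FK by auto
    then show ?thesis using n(2)[of y x] n(2)[of x y] that xF by (simp add: inner_diff_left)
  qed
  have n0: "n \<noteq> 0" using n(1) by auto
  have hyp: "affine hull F = {y. n \<bullet> y = n \<bullet> x}"
  proof (rule affine_dim_equal)
    show "affine hull F \<noteq> {}" using xF by auto
    show "affine hull F \<subseteq> {y. n \<bullet> y = n \<bullet> x}"
      by (rule hull_minimal) (use F0 affine_hyperplane[of n] in \<open>auto simp: inner_diff_left inner_diff_right inner_commute[of _ n]\<close>)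
    show "aff_dim (affine hull F) = aff_dim {y. n \<bullet> y = n \<bullet> x}"
      using F KP(4) n0 by (simp add: facet_of_def)
  qed (auto simp: affine_hyperplane)
  obtain e where e: "0 < e" "ball x e \<inter> affine hull F \<subseteq> F" using x mem_rel_interior_ball by blast
  obtain z where z: "z \<in> interior K" using KP(3) by blast
  then have zK: "z \<in> K" using interior_subset by blast
  define q where "q = (z - x) \<bullet> n"
  have q: "q < 0"
  proof -
    have "interior K \<subseteq> interior {y. n \<bullet> y \<le> n \<bullet> x}"
      by (intro interior_mono) (use n(2)[OF _ xF] in \<open>auto simp: inner_diff_right inner_commute[of _ n]\<close>)
    then show ?thesis using z n0 by (auto simp: q_def inner_diff_right inner_commute[of _ n])
  qed
  \<comment> \<open>\<open>T y\<close> is the share of z in y: it solves y = (1 - T) p + T z with p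
    in the plane of F, and p is \<open>f y\<close>.\<close>
  define T where "T y = ((y - x) \<bullet> n) / q" for y
  define f where "f y = (1 / (1 - T y)) *\<^sub>R (y - T y *\<^sub>R z)" for y
  have T0: "T x = 0" by (simp add: T_def)
  have cT: "isCont T x" unfolding T_def[abs_def] using q by (intro continuous_intros) auto
  have cf: "isCont f x" unfolding f_def[abs_def] using cT T0 by (intro continuous_intros) auto
  have fx: "f x = x" by (simp add: f_def T0)
  obtain d1 where d1: "d1 > 0" "\<And>y. dist y x < d1 \<Longrightarrow> dist (f y) x < e"
    using cf e(1) fx unfolding continuous_at_eps_delta by metis
  obtain d2 where d2: "d2 > 0" "\<And>y. dist y x < d2 \<Longrightarrow> dist (T y) 0 < 1"
    using cT T0 unfolding continuous_at_eps_delta by (metis zero_less_one)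
  have "y \<in> K" if y: "y \<in> ball x (min d1 d2)" "(y - x) \<bullet> n \<le> 0" for y
  proof -
    have t: "0 \<le> T y" "T y < 1"
      using y d2(2)[of y] q by (auto simp: T_def dist_commute divide_nonpos_neg zero_le_divide_iff)
    have "(y - T y *\<^sub>R z - (1 - T y) *\<^sub>R x) \<bullet> n = 0"
      using q by (simp add: T_def q_def[symmetric] inner_diff_left algebra_simps)
        (simp add: q_def inner_diff_left field_simps)
    moreover have "f y - x = (1 / (1 - T y)) *\<^sub>R (y - T y *\<^sub>R z - (1 - T y) *\<^sub>R x)"
      using t by (simp add: f_def scaleR_diff_right)
    ultimately have "(f y - x) \<bullet> n = 0" by simp
    then have "f y \<in> affine hull F" unfolding hyp by (simp add: inner_diff_right inner_commute[of _ n])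
    then have "f y \<in> F" using e(2) d1(2)[of y] y by (auto simp: dist_commute subset_iff)
    then have "f y \<in> K" using FK by blast
    moreover have "y = (1 - T y) *\<^sub>R f y + T y *\<^sub>R z" using t by (simp add: f_def)
    ultimately show ?thesis using KP(2) zK t unfolding convex_alt by (metis less_imp_le)
  qed
  then show thesis
    using d1(1) d2(1) n(2)[OF _ xF] by (intro that[of "min d1 d2"]) (auto simp del: mem_ball)
qed

text \<open>Continuity of g lets the inequality pass to limits of points of D, at the price of
  strictness.\<close>

lemma hypograph_closure_le:
  assumes e: "norm e = 1" and g: "L-lipschitz_on {z. z \<bullet> e = 0} (g :: real^3 \<Rightarrow> real)"
    and D: "D \<inter> ball x r = {y \<in> ball x r. y \<bullet> e < g (y - (y \<bullet> e) *\<^sub>R e)}"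
    and y: "y \<in> closure D" "y \<in> ball x r"
  shows "y \<bullet> e \<le> g (y - (y \<bullet> e) *\<^sub>R e)"
proof -
  have ee: "e \<bullet> e = 1" using e by (simp add: power2_norm_eq_inner[symmetric])
  obtain f where f: "\<And>n. f n \<in> D" "f \<longlonglongrightarrow> y" using y(1) unfolding closure_sequential by blast
  have "\<forall>\<^sub>F n in sequentially. f n \<in> ball x r" using topological_tendstoD[OF f(2) open_ball y(2)] .
  then have ev: "\<forall>\<^sub>F n in sequentially. f n \<bullet> e \<le> g (f n - (f n \<bullet> e) *\<^sub>R e)"
    by eventually_elim (use f(1) D in force)
  have "((\<lambda>n. g (f n - (f n \<bullet> e) *\<^sub>R e)) \<longlongrightarrow> g (y - (y \<bullet> e) *\<^sub>R e)) sequentially"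
  proof (rule continuous_on_tendsto_compose[OF lipschitz_on_continuous_on[OF g]])
    show "(\<lambda>n. f n - (f n \<bullet> e) *\<^sub>R e) \<longlonglongrightarrow> y - (y \<bullet> e) *\<^sub>R e" by (intro tendsto_intros f(2))
  qed (auto simp: inner_diff_left ee)
  moreover have "(\<lambda>n. f n \<bullet> e) \<longlonglongrightarrow> y \<bullet> e" by (intro tendsto_intros f(2))
  ultimately show ?thesis using ev by (intro tendsto_le[of sequentially]) auto
qed

text \<open>A domain lying locally on one side of its boundary has no slits: if a boundary point x
  had a neighbourhood in the closure, x + t e would satisfy the weak hypograph inequality, which
  puts x strictly below the graph. The mesh covers the closure of D, and this brings cell interiors
  into D itself.\<close>

lemma lipschitz_interior_closure:
  assumes "open D" "lipschitz_boundary D"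
  shows "interior (closure D) \<subseteq> D"
proof
  fix x assume x: "x \<in> interior (closure D)"
  show "x \<in> D"
  proof (rule ccontr)
    assume xD: "x \<notin> D"
    then have "x \<in> frontier D" using x interior_subset[of "closure D"] assms(1) by (auto simp: frontier_def interior_open)
    then obtain r e g L where r: "r > 0" "norm e = 1" "L-lipschitz_on {z. z \<bullet> e = 0} g"
      "D \<inter> ball x r = {y \<in> ball x r. y \<bullet> e < g (y - (y \<bullet> e) *\<^sub>R e)}"
      using assms(2) unfolding lipschitz_boundary_def by meson
    have le: "y \<bullet> e \<le> g (y - (y \<bullet> e) *\<^sub>R e)" if "y \<in> closure D" "y \<in> ball x r" for y
      using hypograph_closure_le[OF r(2-4)] that by blast
    obtain d where d: "d > 0" "ball x d \<subseteq> closure D" using x by (auto simp: mem_interior)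
    define t where "t = min d r / 2"
    have t: "0 < t" "t < d" "t < r" using d r(1) by (auto simp: t_def min_def)
    have "x + t *\<^sub>R e \<in> closure D" using d(2) t r(2) by (auto simp: subset_iff dist_norm)
    then have "(x + t *\<^sub>R e) \<bullet> e \<le> g ((x + t *\<^sub>R e) - ((x + t *\<^sub>R e) \<bullet> e) *\<^sub>R e)"
      using t r(2) by (intro le) (auto simp: dist_norm)
    moreover have "e \<bullet> e = 1" using r(2) by (simp add: power2_norm_eq_inner[symmetric])
    ultimately have "x \<bullet> e + t \<le> g (x - (x \<bullet> e) *\<^sub>R e)" by (simp add: inner_add_left algebra_simps)
    then have "x \<in> D \<inter> ball x r" unfolding r(4) using t r(1) by auto
    then show False using xD by blast
  qed
qed

section \<open>Incidence and orientation of cells and faces\<close>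

locale mesh =
  fixes D :: "(real^3) set" and \<T> :: "(real^3) set set"
    and Kl Kr :: "(real^3) set \<Rightarrow> (real^3) set" and nF :: "(real^3) set \<Rightarrow> real^3"
  assumes poly: "lipschitz_polyhedron D" and simpl: "simplicial_mesh D \<T>"
    and orient: "face_orientation D \<T> Kl Kr nF"
begin

lemma open_D: "open D" and bounded_D: "bounded D" and lipschitz_D: "lipschitz_boundary D"
  using poly by (auto simp: lipschitz_polyhedron_def)

lemma D_lmeasurable: "D \<in> lmeasurable" and D_sets: "D \<in> sets lebesgue"
  using open_D bounded_D by (auto simp: bounded_set_imp_lmeasurable)

lemma finite_mesh: "finite \<T>" and cell: "K \<in> \<T> \<Longrightarrow> 3 simplex K" and Union_mesh: "\<Union>\<T> = closure D"
  and cell_Int: "K \<in> \<T> \<Longrightarrow> K' \<in> \<T> \<Longrightarrow> (K \<inter> K') face_of K"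
  using simpl by (auto simp: simplicial_mesh_def triangulation_def)

lemma cell_props: 
  assumes "K \<in> \<T>"
  shows "compact K" "convex K" "interior K \<noteq> {}" "aff_dim K = 3" "closure (interior K) = K"
    "K \<in> sets lebesgue" "K \<in> lmeasurable" "negligible (frontier K)"
  using simplex3_props[OF cell[OF assms]] simplex3_closure_interior[OF cell[OF assms]]
  by (auto simp: compact_sets lmeasurable_compact negligible_convex_frontier)

text \<open>The common face of two cells would meet the interior of each, and a face that does so is
  the whole cell.\<close>

lemma cell_interior_disjoint:
  assumes "K \<in> \<T>" "K' \<in> \<T>" "K \<noteq> K'"
  shows "interior K \<inter> interior K' = {}"
proof (rule ccontr)
  assume "interior K \<inter> interior K' \<noteq> {}"
  then obtain x where x: "x \<in> interior K" "x \<in> interior K'" by blast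
  have "K \<inter> K' = K"
    using face_of_disjoint_interior[OF cell_Int[OF assms(1,2)]] x interior_subset by blast
  moreover have "K' \<inter> K = K'"
    using face_of_disjoint_interior[OF cell_Int[OF assms(2,1)]] x interior_subset by blast
  ultimately show False using assms(3) by blast
qed

lemma interior_cell_subset: "K \<in> \<T> \<Longrightarrow> interior K \<subseteq> D"
  using interior_mono[of K "closure D"] Union_mesh lipschitz_interior_closure[OF open_D lipschitz_D] by blast

text \<open>The cells meet in a common face, which contains F because it meets the relative interior
  of F. A proper face has dimension at most 2, the dimension of F, so the two coincide.\<close>

lemma cell_facet_shared:
  assumes K: "K \<in> \<T>" "F facet_of K" and K': "K' \<in> \<T>" and x: "x \<in> rel_interior F" "x \<in> K'"
  shows "F facet_of K'"
proof (cases "K = K'")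
  case False
  let ?G = "K \<inter> K'"
  have FK: "F \<subseteq> K" by (rule facet_of_imp_subset[OF K(2)])
  have FG: "F \<subseteq> ?G"
    using subset_of_face_of[OF cell_Int[OF K(1) K'] FK] x rel_interior_subset FK by blast
  have "?G \<noteq> K"
  proof
    assume "?G = K"
    then have "interior K \<subseteq> interior K'" by (intro interior_mono) blast
    then show False using cell_interior_disjoint[OF K(1) K' False] cell_props(3)[OF K(1)] by blast
  qed
  then have "aff_dim ?G < 3"
    using face_of_aff_dim_lt[OF cell_props(2)[OF K(1)] cell_Int[OF K(1) K']] cell_props(4)[OF K(1)] by simp
  moreover have "F face_of ?G" using K(2) FG face_of_subset[of F K ?G] by (auto simp: facet_of_def)
  moreover have "aff_dim F = 2" using K cell_props(4) by (simp add: facet_of_def)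
  ultimately have "F = ?G"
    using face_of_aff_dim_lt[of ?G F] cell_props(2) K(1) K' by (force intro: convex_Int)
  moreover have "?G face_of K'" using cell_Int[OF K' K(1)] by (simp add: Int_commute)
  ultimately show ?thesis using \<open>aff_dim F = 2\<close> K(2) cell_props(4)[OF K'] by (simp add: facet_of_def)
qed (use K in simp)

text \<open>There are no hanging nodes: F is a face of any facet through one of its relative
  interior points, and both have the same dimension.\<close>

lemma facet_unique_point:
  assumes K: "K \<in> \<T>" "F facet_of K" and K': "K' \<in> \<T>" "F' facet_of K'" and x: "x \<in> rel_interior F" "x \<in> F'"
  shows "F' = F"
proof (rule ccontr)
  assume ne: "F' \<noteq> F"
  have "F facet_of K'"
    using cell_facet_shared[OF K K'(1) x(1)] x(2) facet_of_imp_subset[OF K'(2)] by blast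
  moreover have "F \<subseteq> F'"
    using subset_of_face_of[of F' K' F] K'(2) \<open>F facet_of K'\<close> x facet_of_imp_subset by (auto simp: facet_of_def)
  ultimately have "F face_of F'" using face_of_subset[of F K' F'] K'(2) facet_of_imp_subset by (auto simp: facet_of_def)
  then have "aff_dim F < aff_dim F'"
    using face_of_aff_dim_lt[of F' F] ne K'(2) face_of_imp_convex by (auto simp: facet_of_def)
  then show False using K'(2) \<open>F facet_of K'\<close> by (simp add: facet_of_def)
qed

lemma facet_props:
  assumes "K \<in> \<T>" "F facet_of K"
  shows "convex F" "rel_interior F \<noteq> {}" "compact F" "F \<subseteq> K"
proof -
  show c: "convex F" using assms(2) face_of_imp_convex by (auto simp: facet_of_def)
  show "rel_interior F \<noteq> {}" using assms(2) rel_interior_eq_empty[OF c] by (auto simp: facet_of_def)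
  show "compact F"
    by (rule face_of_imp_compact[OF cell_props(2)[OF assms(1)] cell_props(1)[OF assms(1)] facet_of_imp_face_of[OF assms(2)]])
  show "F \<subseteq> K" by (rule facet_of_imp_subset[OF assms(2)])
qed

text \<open>The two cells fill opposite half-balls at each relative interior point x of F. The
  interior of a third cell near x would lie in the plane of F, and x itself is interior to the
  closure of D, hence in D.\<close>

lemma interface_cells:
  assumes F: "F \<in> interfaces \<T>"
  shows "{K \<in> \<T>. F facet_of K} = {Kl F, Kr F}" "Kl F \<noteq> Kr F" and "rel_interior F \<subseteq> D"
proof -
  have o: "Kl F \<in> \<T>" "Kr F \<in> \<T>" "Kl F \<noteq> Kr F" "F facet_of Kl F" "F facet_of Kr F" "norm (nF F) = 1"
    "\<And>y x. y \<in> Kl F \<Longrightarrow> x \<in> F \<Longrightarrow> (y - x) \<bullet> nF F \<le> 0" "\<And>y x. y \<in> Kr F \<Longrightarrow> x \<in> F \<Longrightarrow> (y - x) \<bullet> (- nF F) \<le> 0"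
    using orient F by (auto simp: face_orientation_def)
  show "Kl F \<noteq> Kr F" by fact
  have near: "\<exists>r>0. ball x r \<subseteq> Kl F \<union> Kr F \<and> {y \<in> ball x r. (y - x) \<bullet> nF F \<noteq> 0} \<subseteq> interior (Kl F) \<union> interior (Kr F)"
    if x: "x \<in> rel_interior F" for x
  proof -
    obtain r1 where r1: "0 < r1" "Kl F \<inter> ball x r1 = {y \<in> ball x r1. (y - x) \<bullet> nF F \<le> 0}"
      using facet_local_halfspace[OF cell[OF o(1)] o(4) x o(6,7)] by blast
    have nn: "norm (- nF F) = 1" using o(6) by simp
    obtain r2 where r2: "0 < r2" "Kr F \<inter> ball x r2 = {y \<in> ball x r2. (y - x) \<bullet> (- nF F) \<le> 0}"
      using facet_local_halfspace[OF cell[OF o(2)] o(5) x nn o(8)] by blast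
    let ?r = "min r1 r2"
    have 1: "ball x ?r \<subseteq> Kl F \<union> Kr F"
    proof
      fix y assume y: "y \<in> ball x ?r"
      then have "y \<in> {y \<in> ball x r1. (y - x) \<bullet> nF F \<le> 0} \<or> y \<in> {y \<in> ball x r2. (y - x) \<bullet> (- nF F) \<le> 0}" by auto
      then show "y \<in> Kl F \<union> Kr F" unfolding r1(2)[symmetric] r2(2)[symmetric] by blast
    qed
    have op: "open {y \<in> ball x ?r. (y - x) \<bullet> nF F < 0}" "open {y \<in> ball x ?r. 0 < (y - x) \<bullet> nF F}"
      by (simp_all only: Collect_conj_eq Collect_mem_eq) (intro open_Int open_ball open_Collect_less continuous_intros)+
    have "{y \<in> ball x ?r. (y - x) \<bullet> nF F < 0} \<subseteq> Kl F" "{y \<in> ball x ?r. 0 < (y - x) \<bullet> nF F} \<subseteq> Kr F"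
      using r1(2) r2(2) by (auto simp: set_eq_iff)
    then have "{y \<in> ball x ?r. (y - x) \<bullet> nF F < 0} \<subseteq> interior (Kl F)" "{y \<in> ball x ?r. 0 < (y - x) \<bullet> nF F} \<subseteq> interior (Kr F)"
      using interior_maximal[OF _ op(1)] interior_maximal[OF _ op(2)] by simp_all
    then have 2: "{y \<in> ball x ?r. (y - x) \<bullet> nF F \<noteq> 0} \<subseteq> interior (Kl F) \<union> interior (Kr F)"
      by (auto simp: neq_iff)
    show ?thesis using 1 2 r1(1) r2(1) by (intro exI[of _ ?r]) auto
  qed
  show "{K \<in> \<T>. F facet_of K} = {Kl F, Kr F}"
  proof (rule ccontr)
    assume "{K \<in> \<T>. F facet_of K} \<noteq> {Kl F, Kr F}"
    then obtain K where K: "K \<in> \<T>" "F facet_of K" "K \<noteq> Kl F" "K \<noteq> Kr F" using o by auto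
    obtain x where x: "x \<in> rel_interior F" using facet_props(2)[OF K(1,2)] by blast
    obtain r where r: "r > 0" "{y \<in> ball x r. (y - x) \<bullet> nF F \<noteq> 0} \<subseteq> interior (Kl F) \<union> interior (Kr F)"
      using near[OF x] by blast
    let ?U = "interior K \<inter> ball x r"
    have "x \<in> closure (interior K)" using cell_props(5)[OF K(1)] x rel_interior_subset facet_props(4)[OF K(1,2)] by blast
    then have "x \<in> ball x r \<inter> closure (interior K)" using r(1) by simp
    then have "ball x r \<inter> closure (interior K) \<noteq> {}" by blast
    then have "?U \<noteq> {}" by (simp add: open_Int_closure_eq_empty Int_commute)
    moreover have "?U \<subseteq> {y. nF F \<bullet> y = nF F \<bullet> x}"
    proof
      fix y assume y: "y \<in> ?U"
      have "y \<notin> interior (Kl F) \<union> interior (Kr F)"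
        using y cell_interior_disjoint[OF K(1) o(1) K(3)] cell_interior_disjoint[OF K(1) o(2) K(4)] by blast
      then have "(y - x) \<bullet> nF F = 0" using r(2) y by blast
      then show "y \<in> {y. nF F \<bullet> y = nF F \<bullet> x}" by (simp add: inner_diff_right inner_commute[of _ "nF F"])
    qed
    ultimately have "interior {y. nF F \<bullet> y = nF F \<bullet> x} \<noteq> {}"
      using interior_maximal[of ?U] by (auto simp del: interior_hyperplane)
    moreover have "nF F \<noteq> 0" using o(6) by auto
    ultimately show False by simp
  qed
  show "rel_interior F \<subseteq> D"
  proof
    fix x assume "x \<in> rel_interior F"
    then obtain r where r: "r > 0" "ball x r \<subseteq> Kl F \<union> Kr F" using near by blast
    then have "ball x r \<subseteq> closure D" using o(1,2) Union_mesh by blast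
    then have "x \<in> interior (closure D)" using r(1) by (meson centre_in_ball interiorI open_ball)
    then show "x \<in> D" using lipschitz_interior_closure[OF open_D lipschitz_D] by blast
  qed
qed

text \<open>The outward normal of D is known only near relative interior points of F. Scaling
  towards such a point makes the half-space condition global on the convex cell; prolonging segments
  of F beyond the point shows that F lies in the bounding plane, which settles the remaining base
  points.\<close>

lemma boundary_face_cells:
  assumes F: "F \<in> boundary_faces \<T>"
  shows "{K \<in> \<T>. F facet_of K} = {Kl F}" "norm (nF F) = 1"
    "\<And>x y. x \<in> F \<Longrightarrow> y \<in> Kl F \<Longrightarrow> (y - x) \<bullet> nF F \<le> 0"
proof -
  have o: "Kl F \<in> \<T>" "F facet_of Kl F" "\<And>x. x \<in> rel_interior F \<Longrightarrow> outward_unit_normal D x (nF F)"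
    using orient F by (auto simp: face_orientation_def)
  show "{K \<in> \<T>. F facet_of K} = {Kl F}"
    using F o(1,2) by (auto simp: boundary_faces_def interfaces_def)
  obtain x where x: "x \<in> rel_interior F" using facet_props(2)[OF o(1,2)] by blast
  have xF: "x \<in> F" using x rel_interior_subset by blast
  obtain r where r: "norm (nF F) = 1" "r > 0" "D \<inter> ball x r = {y \<in> ball x r. (y - x) \<bullet> nF F < 0}"
    using o(3)[OF x] unfolding outward_unit_normal_def by blast
  show "norm (nF F) = 1" by fact
  have cl: "(y - x) \<bullet> nF F \<le> 0" if "y \<in> closure D" "y \<in> ball x r" for y
  proof -
    have "y \<in> closure (D \<inter> ball x r)" using that open_Int_closure_subset[of "ball x r" D] by (auto simp: Int_commute)
    moreover have "closure (D \<inter> ball x r) \<subseteq> {y. (y - x) \<bullet> nF F \<le> 0}"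
      unfolding r(3) by (intro closure_minimal closed_Collect_le continuous_intros) auto
    ultimately show ?thesis by blast
  qed
  have Kle: "(y - x) \<bullet> nF F \<le> 0" if y: "y \<in> Kl F" for y
  proof -
    \<comment> \<open>Small enough to bring x + t (y - x) into the ball of radius r; the summand 1
      covers y = x.\<close>
    define t where "t = min 1 (r / (2 * (norm (y - x) + 1)))"
    have t: "0 < t" "t \<le> 1" using r(2) by (auto simp: t_def add_nonneg_pos)
    have "t * norm (y - x) \<le> r / (2 * (norm (y - x) + 1)) * norm (y - x)"
      by (intro mult_right_mono) (auto simp: t_def)
    also have "\<dots> < r"
    proof -
      have "0 < norm (y - x) + 2" by (rule add_nonneg_pos) simp_all
      then have "r * norm (y - x) < r * (2 * (norm (y - x) + 1))"
        using r(2) by (intro mult_strict_left_mono) simp_all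
      moreover have "0 < 2 * (norm (y - x) + 1)" by (simp add: add_nonneg_pos)
      ultimately show ?thesis by (simp add: pos_divide_less_eq)
    qed
    finally have b: "x + t *\<^sub>R (y - x) \<in> ball x r" using t by (simp add: dist_norm)
    have "x \<in> Kl F" using facet_props(4)[OF o(1,2)] xF by blast
    then have "(1 - t) *\<^sub>R x + t *\<^sub>R y \<in> Kl F"
      using cell_props(2)[OF o(1)] y t unfolding convex_alt by simp
    then have "x + t *\<^sub>R (y - x) \<in> Kl F" by (simp add: algebra_simps)
    then have "(t *\<^sub>R (y - x)) \<bullet> nF F \<le> 0" using cl[OF _ b] Union_mesh o(1) by force
    then show ?thesis using t by (simp add: mult_le_0_iff)
  qed
  have F0: "(z - x) \<bullet> nF F = 0" if z: "z \<in> F" for z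
  proof -
    \<comment> \<open>The segment from z to x can be prolonged beyond x within F; the half-space
      condition at its far end bounds the normal component of z - x from below.\<close>
    obtain e where e: "e > 1" "(1 - e) *\<^sub>R z + e *\<^sub>R x \<in> F"
      using convex_rel_interior_if2[OF facet_props(1)[OF o(1,2)] x] z by (meson rel_interior_subset subsetD hull_inc)
    have "((1 - e) *\<^sub>R z + e *\<^sub>R x) - x = (1 - e) *\<^sub>R (z - x)" by (simp add: algebra_simps)
    then have "(1 - e) * ((z - x) \<bullet> nF F) \<le> 0"
      using Kle[of "(1 - e) *\<^sub>R z + e *\<^sub>R x"] e(2) facet_props(4)[OF o(1,2)] by auto
    then have "0 \<le> (z - x) \<bullet> nF F" using e(1) by (simp add: mult_le_0_iff)
    moreover have "(z - x) \<bullet> nF F \<le> 0" using Kle z facet_props(4)[OF o(1,2)] by blast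
    ultimately show ?thesis by simp
  qed
  show "(y - z) \<bullet> nF F \<le> 0" if "z \<in> F" "y \<in> Kl F" for z y
    using Kle[OF that(2)] F0[OF that(1)] by (simp add: inner_diff_left)
qed

end

section \<open>Piecewise polynomials\<close>

lemma finite_multiindices: "finite {\<alpha> :: 3 \<Rightarrow> nat. sum \<alpha> UNIV \<le> m}"
proof (rule finite_subset)
  show "{\<alpha> :: 3 \<Rightarrow> nat. sum \<alpha> UNIV \<le> m} \<subseteq> PiE UNIV (\<lambda>_. {..m})"
  proof
    fix \<alpha> :: "3 \<Rightarrow> nat" assume a: "\<alpha> \<in> {\<alpha>. sum \<alpha> UNIV \<le> m}"
    have "\<alpha> i \<le> sum \<alpha> UNIV" for i by (intro member_le_sum) auto
    then show "\<alpha> \<in> PiE UNIV (\<lambda>_. {..m})" using a by (auto intro: order_trans)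
  qed
  show "finite (PiE (UNIV :: 3 set) (\<lambda>_. {..m}))" by (intro finite_PiE) auto
qed

lemma polysI: "(\<And>x. p x = (\<Sum>\<alpha> | sum \<alpha> UNIV \<le> m. (\<Prod>i\<in>UNIV. (x $ i) ^ \<alpha> i) *\<^sub>R c \<alpha>)) \<Longrightarrow> p \<in> polys m"
  unfolding polys_def by blast

lemma polysE:
  assumes "p \<in> polys m"
  obtains c where "p = (\<lambda>x. \<Sum>\<alpha> | sum \<alpha> UNIV \<le> m. (\<Prod>i\<in>UNIV. (x $ i) ^ \<alpha> i) *\<^sub>R c \<alpha>)"
  using assms unfolding polys_def by auto

lemma polys_linear:
  assumes "linear L" "p \<in> polys m"
  shows "(\<lambda>x. L (p x)) \<in> polys m"
proof -
  obtain c where c: "p = (\<lambda>x. \<Sum>\<alpha> | sum \<alpha> UNIV \<le> m. (\<Prod>i\<in>UNIV. (x $ i) ^ \<alpha> i) *\<^sub>R c \<alpha>)"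
    using polysE[OF assms(2)] by blast
  show ?thesis
    by (rule polysI[where c = "\<lambda>\<alpha>. L (c \<alpha>)"])
      (simp add: c linear_sum[OF assms(1)] linear_scale[OF assms(1)])
qed

lemma polys_add:
  assumes "p \<in> polys m" "q \<in> polys m"
  shows "(\<lambda>x. p x + q x) \<in> polys m"
proof -
  obtain c where c: "p = (\<lambda>x. \<Sum>\<alpha> | sum \<alpha> UNIV \<le> m. (\<Prod>i\<in>UNIV. (x $ i) ^ \<alpha> i) *\<^sub>R c \<alpha>)"
    using polysE[OF assms(1)] by blast
  obtain d where d: "q = (\<lambda>x. \<Sum>\<alpha> | sum \<alpha> UNIV \<le> m. (\<Prod>i\<in>UNIV. (x $ i) ^ \<alpha> i) *\<^sub>R d \<alpha>)"
    using polysE[OF assms(2)] by blast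
  show ?thesis
    by (rule polysI[where c = "\<lambda>\<alpha>. c \<alpha> + d \<alpha>"]) (simp add: c d scaleR_add_right sum.distrib)
qed

lemma polys_scaleR: "p \<in> polys m \<Longrightarrow> (\<lambda>x. r *\<^sub>R p x) \<in> polys m"
  using polys_linear[of "\<lambda>x. r *\<^sub>R x"] by (simp add: linear_scaleR)

lemma polys_diff: "p \<in> polys m \<Longrightarrow> q \<in> polys m \<Longrightarrow> (\<lambda>x. p x - q x) \<in> polys m"
  using polys_add[of p m "\<lambda>x. (-1) *\<^sub>R q x"] polys_scaleR[of q m "-1"] by simp

lemma polys_zero: "(\<lambda>x. 0) \<in> polys m"
  by (rule polysI[where c = "\<lambda>_. 0"]) simp

lemma polys_mono:
  assumes "p \<in> polys m" "m \<le> n"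
  shows "p \<in> polys n"
proof -
  obtain c where c: "p = (\<lambda>x. \<Sum>\<alpha> | sum \<alpha> UNIV \<le> m. (\<Prod>i\<in>UNIV. (x $ i) ^ \<alpha> i) *\<^sub>R c \<alpha>)"
    using polysE[OF assms(1)] by blast
  show ?thesis
  proof (rule polysI[where c = "\<lambda>\<alpha>. if sum \<alpha> UNIV \<le> m then c \<alpha> else 0"])
    fix x
    show "p x = (\<Sum>\<alpha> | sum \<alpha> UNIV \<le> n. (\<Prod>i\<in>UNIV. (x $ i) ^ \<alpha> i) *\<^sub>R (if sum \<alpha> UNIV \<le> m then c \<alpha> else 0))"
      unfolding c using assms(2) by (intro sum.mono_neutral_cong_left) (auto simp: finite_multiindices)
  qed
qed

lemma C1_grad_power: "C1_grad f G \<Longrightarrow> \<exists>H. C1_grad (\<lambda>x. f x ^ n) H"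
proof (induction n)
  case 0 then show ?case using C1_grad_const[of 1] by auto
next
  case (Suc n) then show ?case using C1_grad_mult[of f G] by fastforce
qed

lemma C1_grad_monomial: "\<exists>H. C1_grad (\<lambda>x. \<Prod>i\<in>A. (x $ i) ^ \<alpha> i) H"
proof (induction A rule: infinite_finite_induct)
  case (insert a A)
  then show ?case using C1_grad_mult C1_grad_power[OF C1_grad_coord[of a]] by fastforce
qed (auto intro: C1_grad_const)

lemma polys_C1_jac:
  assumes "p \<in> polys m"
  shows "C1_jac p (\<lambda>i. partial i p)"
proof -
  obtain c where c: "p = (\<lambda>x. \<Sum>\<alpha> | sum \<alpha> UNIV \<le> m. (\<Prod>i\<in>UNIV. (x $ i) ^ \<alpha> i) *\<^sub>R c \<alpha>)"
    using polysE[OF assms] by blast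
  have "\<forall>\<alpha> :: 3 \<Rightarrow> nat. \<exists>H. C1_grad (\<lambda>x. \<Prod>i\<in>UNIV. (x $ i) ^ \<alpha> i) H"
    by (intro allI C1_grad_monomial)
  from choice[OF this] obtain H where
    H: "\<And>\<alpha> :: 3 \<Rightarrow> nat. C1_grad (\<lambda>x. \<Prod>i\<in>UNIV. (x $ i) ^ \<alpha> i) (H \<alpha>)" by blast
  have J: "C1_jac p (\<lambda>i x. \<Sum>\<alpha> | sum \<alpha> UNIV \<le> m. (H \<alpha> x $ i) *\<^sub>R c \<alpha>)"
    unfolding c by (intro C1_jac_sum C1_jac_const_scaleR H)
  show ?thesis unfolding C1_jac_partial[OF J] by (rule J)
qed

lemma polys_continuous: "p \<in> polys m \<Longrightarrow> continuous_on S p"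
  using C1_jacD(3)[OF polys_C1_jac] .

lemma continuous_curl:
  assumes "C1_jac p J"
  shows "continuous_on S (curl p)"
proof -
  have "curl p = (\<lambda>x. crl (\<lambda>i. J i x))" using C1_jac_curl[OF assms] by auto
  then show ?thesis using continuous_on_crl[OF C1_jacD(2)[OF assms]] by simp
qed

text \<open>On the line from x0 to y each component is a univariate polynomial with infinitely many
  roots near 0, so it also vanishes at t = 1.\<close>

lemma polys_eq_0:
  assumes p: "p \<in> polys m" and S: "open S" "x0 \<in> S" "\<And>x. x \<in> S \<Longrightarrow> p x = 0"
  shows "p y = 0"
proof (subst vec_eq_iff, intro allI)
  fix j
  obtain c where c: "p = (\<lambda>x. \<Sum>\<alpha> | sum \<alpha> UNIV \<le> m. (\<Prod>i\<in>UNIV. (x $ i) ^ \<alpha> i) *\<^sub>R c \<alpha>)"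
    using polysE[OF p] by blast
  define P where "P = (\<Sum>\<alpha> | sum \<alpha> UNIV \<le> m. (\<Prod>i\<in>UNIV. [:x0 $ i, (y - x0) $ i:] ^ \<alpha> i) * [:c \<alpha> $ j:])"
  have P: "poly P t = p (x0 + t *\<^sub>R (y - x0)) $ j" for t
    by (simp add: P_def c poly_sum poly_prod) (simp only: mult.commute)
  obtain e where e: "e > 0" "ball x0 e \<subseteq> S" using S openE by blast
  define d where "d = e / (norm (y - x0) + 1)"
  have np: "0 < norm (y - x0) + 1" by (rule add_nonneg_pos) simp_all
  have d: "0 < d" using e(1) np by (simp add: d_def)
  have "poly P t = 0" if "t \<in> {0<..<d}" for t
  proof -
    have "t * norm (y - x0) \<le> t * (norm (y - x0) + 1)" using that by (intro mult_left_mono) auto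
    also have "\<dots> < d * (norm (y - x0) + 1)" using that np by (intro mult_strict_right_mono) auto
    also have "\<dots> = e" using np by (simp add: d_def)
    finally have "x0 + t *\<^sub>R (y - x0) \<in> ball x0 e" using that by (simp add: dist_norm)
    then show ?thesis using e(2) S(3) by (auto simp: P)
  qed
  then have "{0<..<d} \<subseteq> {t. poly P t = 0}" by blast
  then have "infinite {t. poly P t = 0}" using d infinite_Ioo finite_subset by blast
  then have "P = 0" using poly_roots_finite by blast
  then show "p y $ j = 0 $ j" using P[of 1] by simp
qed

lemma AE_open_closed:
  fixes S :: "(real^3) set"
  assumes "open S" "S \<subseteq> K" "K \<in> sets lebesgue" "closed {x. P x}" "AE x in lebesgue_on K. P x" "x \<in> S"
  shows "P x"
proof -
  have "AE x in lebesgue. x \<in> K \<longrightarrow> P x" using assms(3,5) by (simp add: AE_restrict_space_iff)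
  then have "AE x \<in> S in lebesgue. x \<in> {x. P x}" by eventually_elim (use assms(2) in auto)
  then show ?thesis using mem_closed_if_AE_lebesgue_open[OF assms(1,4) _ assms(6)] by blast
qed

text \<open>Polynomials that agree almost everywhere on a cell agree on its nonempty interior and
  thus everywhere, so the description in \<open>restr\<close> has a unique solution even across all
  degrees.\<close>

lemma restr_eq:
  assumes K: "3 simplex K" and p: "p \<in> polys m" "AE x in lebesgue_on K. v x = p x"
  shows "restr K v = p"
  unfolding restr_def
proof (rule the_equality)
  show "(\<exists>m. p \<in> polys m) \<and> (AE x in lebesgue_on K. v x = p x)" using p by blast
  fix q assume q: "(\<exists>m. q \<in> polys m) \<and> (AE x in lebesgue_on K. v x = q x)"
  then obtain n where n: "q \<in> polys n" by blast
  note KP = simplex3_props[OF K]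
  have qp: "(\<lambda>x. q x - p x) \<in> polys (max m n)"
    using p(1) n by (intro polys_diff) (auto intro: polys_mono)
  have AE: "AE x in lebesgue_on K. q x - p x = 0" using q p(2) by (auto elim: eventually_elim2)
  have z: "q x - p x = 0" if "x \<in> interior K" for x
    by (rule AE_open_closed[OF open_interior interior_subset compact_sets(2)[OF KP(1)] _ AE that])
      (intro closed_Collect_eq polys_continuous[OF qp] continuous_on_const)
  obtain x0 where "x0 \<in> interior K" using KP(3) by blast
  then have "q y - p y = 0" for y
    using polys_eq_0[OF qp open_interior _ z] by blast
  then show "q = p" by (auto simp: fun_eq_iff)
qed

text \<open>The divergence theorem for p \<times> q, one component at a time.\<close>

lemma cell_green:
  assumes K: "3 simplex K" and n: "outer_normals K n" and p: "C1_jac p J" and q: "C1_jac q J'"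
  shows "integral\<^sup>L (lebesgue_on K) (\<lambda>x. curl p x \<bullet> q x - p x \<bullet> curl q x)
    = (\<Sum>F | F facet_of K. face_integral F (\<lambda>x. n F \<bullet> cross3 (p x) (q x)))"
proof -
  let ?W = "\<lambda>i x. cross3 (J i x) (q x) + cross3 (p x) (J' i x)"
  let ?X = "\<lambda>x. cross3 (p x) (q x)"
  note C = C1_jac_cross[OF p q]
  have KP: "compact K" using simplex3_props[OF K] by blast
  have int: "integrable (lebesgue_on K) (\<lambda>x. ?W i x $ i)" for i
  proof -
    have c: "continuous_on UNIV (\<lambda>x. ?W i x $ i)" by (intro continuous_intros C1_jacD(2)[OF C])
    show ?thesis by (rule integrable_compact_continuous[OF KP c])
  qed
  have cX: "continuous_on UNIV (\<lambda>x. ?X x $ i)" for i by (intro continuous_intros C1_jacD(3)[OF C])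
  have "integral\<^sup>L (lebesgue_on K) (\<lambda>x. curl p x \<bullet> q x - p x \<bullet> curl q x)
      = integral\<^sup>L (lebesgue_on K) (\<lambda>x. \<Sum>i\<in>UNIV. ?W i x $ i)"
    by (simp only: C1_jac_curl[OF p] C1_jac_curl[OF q] crl_inner_diff)
  also have "\<dots> = (\<Sum>i\<in>UNIV. integral\<^sup>L (lebesgue_on K) (\<lambda>x. ?W i x $ i))"
    using int by (intro Bochner_Integration.integral_sum)
  also have "\<dots> = (\<Sum>i\<in>UNIV. \<Sum>F | F facet_of K. (n F $ i) * face_integral F (\<lambda>x. ?X x $ i))"
  proof (rule sum.cong[OF refl])
    fix i :: 3
    show "integral\<^sup>L (lebesgue_on K) (\<lambda>x. ?W i x $ i) = (\<Sum>F | F facet_of K. (n F $ i) * face_integral F (\<lambda>x. ?X x $ i))"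
      using simplex_gradient[OF C1_jac_component[OF C, of i] K n, of "axis i 1"] by (simp add: inner_axis)
  qed
  also have "\<dots> = (\<Sum>F | F facet_of K. \<Sum>i\<in>UNIV. face_integral F (\<lambda>x. (n F $ i) * (?X x $ i)))"
    unfolding face_integral_cmult by (rule sum.swap)
  also have "\<dots> = (\<Sum>F | F facet_of K. face_integral F (\<lambda>x. n F \<bullet> ?X x))"
  proof (rule sum.cong[OF refl], clarify)
    fix F assume F: "F facet_of K"
    have "face_integral F (\<lambda>x. (n F $ 1 * (?X x $ 1) + n F $ 2 * (?X x $ 2)) + n F $ 3 * (?X x $ 3))
      = face_integral F (\<lambda>x. n F $ 1 * (?X x $ 1)) + face_integral F (\<lambda>x. n F $ 2 * (?X x $ 2)) + face_integral F (\<lambda>x. n F $ 3 * (?X x $ 3))"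
      by (subst face_integral_add[OF K F], intro continuous_intros cX, intro continuous_intros cX,
          subst face_integral_add[OF K F], intro continuous_intros cX, intro continuous_intros cX, rule refl)
    then show "(\<Sum>i\<in>UNIV. face_integral F (\<lambda>x. (n F $ i) * (?X x $ i))) = face_integral F (\<lambda>x. n F \<bullet> ?X x)"
      by (simp add: sum_3 inner_vec_def)
  qed
  finally show ?thesis .
qed

lemma bump_monomial:
  assumes "bump a r f"
  shows "bump a r (\<lambda>x. (\<Prod>i\<in>UNIV. (x $ i) ^ \<alpha> i) * f x)"
proof -
  have p: "bump a r (\<lambda>x. (x $ i) ^ k * g x)" if "bump a r g" for i k g
  proof (induction k)
    case 0 then show ?case using that by simp
  next
    case (Suc k) then show ?case using bump.coord[OF Suc, of i] by (simp add: mult.assoc)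
  qed
  have "bump a r (\<lambda>x. (x $ 1) ^ \<alpha> 1 * ((x $ 2) ^ \<alpha> 2 * ((x $ 3) ^ \<alpha> 3 * f x)))" by (intro p assms)
  moreover have "(\<lambda>x. (\<Prod>i\<in>UNIV. (x $ i) ^ \<alpha> i) * f x) = (\<lambda>x. (x $ 1) ^ \<alpha> 1 * ((x $ 2) ^ \<alpha> 2 * ((x $ 3) ^ \<alpha> 3 * f x)))"
    by (rule ext, subst UNIV_3) (simp add: mult.assoc)
  ultimately show ?thesis by simp
qed

lemma Ck_bump_sum:
  "(\<And>k. k \<in> A \<Longrightarrow> bump a r (f k)) \<Longrightarrow> Ck m (\<lambda>x. \<Sum>k\<in>A. f k x *\<^sub>R c k)"
proof (induction m arbitrary: f)
  case 0
  then show ?case unfolding Ck.simps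
    by (intro continuous_on_sum continuous_on_scaleR bump_continuous[OF 0] continuous_on_const)
next
  case (Suc m)
  have "\<forall>k. \<exists>g. k \<in> A \<longrightarrow> (\<forall>i. bump a r (g i)) \<and> C1_grad (f k) (\<lambda>x. \<chi> i. g i x)"
    using bump_grad Suc.prems by blast
  then obtain g where g: "\<And>k i. k \<in> A \<Longrightarrow> bump a r (g k i)" "\<And>k. k \<in> A \<Longrightarrow> C1_grad (f k) (\<lambda>x. \<chi> i. g k i x)"
    by metis
  have J: "C1_jac (\<lambda>x. \<Sum>k\<in>A. f k x *\<^sub>R c k) (\<lambda>i x. \<Sum>k\<in>A. g k i x *\<^sub>R c k)"
    using C1_jac_sum[of A "\<lambda>k x. f k x *\<^sub>R c k" "\<lambda>k i x. (\<chi> i. g k i x) $ i *\<^sub>R c k"] C1_jac_const_scaleR[OF g(2)] by simp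
  show ?case using Suc.IH[OF g(1)] C1_jacD(4)[OF J] by (simp add: C1_jac_partial[OF J])
qed

text \<open>Closure of \<open>bump\<close> under multiplication by coordinates pays off here: a bump
  times a vector polynomial is a combination of bumps with constant vectors.\<close>

lemma bump_polys_test_field:
  assumes b: "bump a r f" and r: "0 < r" and p: "p \<in> polys m" and D: "cball a r \<subseteq> D"
  shows "(\<lambda>x. f x *\<^sub>R p x) \<in> test_fields D"
proof -
  obtain c where c: "p = (\<lambda>x. \<Sum>\<alpha> | sum \<alpha> UNIV \<le> m. (\<Prod>i\<in>UNIV. (x $ i) ^ \<alpha> i) *\<^sub>R c \<alpha>)"
    using polysE[OF p] by blast
  have "(\<lambda>x. f x *\<^sub>R p x) = (\<lambda>x. \<Sum>\<alpha> | sum \<alpha> UNIV \<le> m. ((\<Prod>i\<in>UNIV. (x $ i) ^ \<alpha> i) * f x) *\<^sub>R c \<alpha>)"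
    by (simp add: c scaleR_sum_right mult.commute)
  then have Ck: "Ck k (\<lambda>x. f x *\<^sub>R p x)" for k
    using Ck_bump_sum[OF bump_monomial[OF b]] by simp
  have sub: "{x. f x *\<^sub>R p x \<noteq> 0} \<subseteq> cball a r"
  proof
    fix x assume "x \<in> {x. f x *\<^sub>R p x \<noteq> 0}"
    then have "f x \<noteq> 0" by auto
    then have "norm (x - a) < r" using bump_outside[OF b r, of x] by force
    then show "x \<in> cball a r" by (simp add: dist_norm norm_minus_commute)
  qed
  then have cl: "closure {x. f x *\<^sub>R p x \<noteq> 0} \<subseteq> cball a r" by (intro closure_minimal) auto
  have "compact (closure {x. f x *\<^sub>R p x \<noteq> 0})"
    unfolding compact_closure by (rule bounded_subset[OF bounded_cball sub])
  then show ?thesis unfolding test_fields_def using Ck order_trans[OF cl D] by (intro CollectI conjI allI)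
qed

section \<open>Broken polynomial spaces and summation over cells\<close>

context mesh
begin

lemma PbD:
  assumes "v \<in> Pb D \<T> m" 
  shows "v \<in> L2 D" "K \<in> \<T> \<Longrightarrow> restr K v \<in> polys m" "K \<in> \<T> \<Longrightarrow> AE x in lebesgue_on K. v x = restr K v x"
proof -
  show "v \<in> L2 D" using assms by (simp add: Pb_def)
  assume K: "K \<in> \<T>"
  then obtain p where p: "p \<in> polys m" "AE x in lebesgue_on K. v x = p x" using assms by (auto simp: Pb_def)
  then show "restr K v \<in> polys m" "AE x in lebesgue_on K. v x = restr K v x"
    using restr_eq[OF cell[OF K] p] by auto
qed

lemma PbI:
  assumes "v \<in> L2 D" "\<And>K. K \<in> \<T> \<Longrightarrow> q K \<in> polys m" "\<And>K. K \<in> \<T> \<Longrightarrow> AE x in lebesgue_on K. v x = q K x"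
  shows "v \<in> Pb D \<T> m" "\<And>K. K \<in> \<T> \<Longrightarrow> restr K v = q K"
proof -
  show "v \<in> Pb D \<T> m" unfolding Pb_def
  proof (intro CollectI conjI ballI assms(1))
    fix K assume "K \<in> \<T>"
    then show "\<exists>p\<in>polys m. AE x in lebesgue_on K. v x = p x" by (intro bexI[of _ "q K"] assms)
  qed
  show "restr K v = q K" if "K \<in> \<T>" for K
    by (rule restr_eq[OF cell[OF that] assms(2)[OF that] assms(3)[OF that]])
qed

lemma Pb_add: 
  assumes "v \<in> Pb D \<T> m" "w \<in> Pb D \<T> m"
  shows "(\<lambda>x. v x + w x) \<in> Pb D \<T> m" "K \<in> \<T> \<Longrightarrow> restr K (\<lambda>x. v x + w x) = (\<lambda>x. restr K v x + restr K w x)"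
proof -
  have AE: "AE x in lebesgue_on K. v x + w x = restr K v x + restr K w x" if "K \<in> \<T>" for K
    using PbD(3)[OF assms(1) that] PbD(3)[OF assms(2) that] by eventually_elim simp
  note I = PbI[OF L2_add[OF PbD(1)[OF assms(1)] PbD(1)[OF assms(2)]]
      polys_add[OF PbD(2)[OF assms(1)] PbD(2)[OF assms(2)]] AE]
  show "(\<lambda>x. v x + w x) \<in> Pb D \<T> m" by (rule I(1))
  show "K \<in> \<T> \<Longrightarrow> restr K (\<lambda>x. v x + w x) = (\<lambda>x. restr K v x + restr K w x)" by (rule I(2))
qed

lemma Pb_scaleR: 
  assumes "v \<in> Pb D \<T> m"
  shows "(\<lambda>x. r *\<^sub>R v x) \<in> Pb D \<T> m" "K \<in> \<T> \<Longrightarrow> restr K (\<lambda>x. r *\<^sub>R v x) = (\<lambda>x. r *\<^sub>R restr K v x)"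
proof -
  have AE: "AE x in lebesgue_on K. r *\<^sub>R v x = r *\<^sub>R restr K v x" if "K \<in> \<T>" for K
    using PbD(3)[OF assms(1) that] by eventually_elim simp
  note I = PbI[OF L2_scaleR[OF PbD(1)[OF assms(1)]] polys_scaleR[OF PbD(2)[OF assms(1)]] AE]
  show "(\<lambda>x. r *\<^sub>R v x) \<in> Pb D \<T> m" by (rule I(1))
  show "K \<in> \<T> \<Longrightarrow> restr K (\<lambda>x. r *\<^sub>R v x) = (\<lambda>x. r *\<^sub>R restr K v x)" by (rule I(2))
qed

lemma Pb_diff: 
  assumes "v \<in> Pb D \<T> m" "w \<in> Pb D \<T> m"
  shows "(\<lambda>x. v x - w x) \<in> Pb D \<T> m" "K \<in> \<T> \<Longrightarrow> restr K (\<lambda>x. v x - w x) = (\<lambda>x. restr K v x - restr K w x)"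
  using Pb_add[OF assms(1) Pb_scaleR(1)[OF assms(2), of "-1"]] Pb_scaleR(2)[OF assms(2), of _ "-1"] by simp_all

text \<open>A concrete representative defined everywhere: 0 on the mesh skeleton and, for continuous
  pieces, Borel, bounded and continuous off the skeleton. These are requirements of
  \<open>nice_field\<close>, which an arbitrary representative may fail.\<close>

definition glue :: "((real^3) set \<Rightarrow> real^3 \<Rightarrow> real^3) \<Rightarrow> real^3 \<Rightarrow> real^3" where
  "glue q x = (\<Sum>K\<in>\<T>. indicat_real (interior K) x *\<^sub>R q K x)"

lemma glue_interior:
  assumes "K \<in> \<T>" "x \<in> interior K"
  shows "glue q x = q K x"
proof -
  have "glue q x = (\<Sum>K'\<in>{K}. indicat_real (interior K') x *\<^sub>R q K' x)"
    unfolding glue_def using assms cell_interior_disjoint[OF assms(1)]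
    by (intro sum.mono_neutral_right finite_mesh) (auto simp: indicator_def)
  then show ?thesis using assms by simp
qed

lemma AE_cell: 
  assumes "K \<in> \<T>" "\<And>x. x \<in> interior K \<Longrightarrow> P x"
  shows "AE x in lebesgue_on K. P x"
  by (rule AE_negligible[OF cell_props(8)[OF assms(1)] cell_props(6)[OF assms(1)]])
    (use assms(2) closure_subset in \<open>auto simp: frontier_def\<close>)

definition skel :: "(real^3) set" where "skel = (\<Union>K\<in>\<T>. frontier K)"

lemma skel: "negligible skel" "closed skel"
  using cell_props(8) finite_mesh by (auto simp: skel_def intro!: negligible_Union)

lemma interior_if_not_skel: "x \<in> closure D \<Longrightarrow> x \<notin> skel \<Longrightarrow> \<exists>K\<in>\<T>. x \<in> interior K"
  unfolding Union_mesh[symmetric] skel_def frontier_def using closure_subset by blast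

lemma AE_mesh:
  assumes "\<And>K x. K \<in> \<T> \<Longrightarrow> x \<in> interior K \<Longrightarrow> P x"
  shows "AE x in lebesgue_on D. P x"
  by (rule AE_negligible[OF skel(1) D_sets]) (use interior_if_not_skel closure_subset assms in blast)

lemma AE_mesh_cells:
  assumes "\<And>K. K \<in> \<T> \<Longrightarrow> AE x in lebesgue_on K. P x"
  shows "AE x in lebesgue_on D. P x"
proof -
  have "AE x in lebesgue. x \<in> K \<longrightarrow> P x" if "K \<in> \<T>" for K
    using assms[OF that] cell_props(6)[OF that] by (simp add: AE_restrict_space_iff)
  from AE_finite_allI[OF finite_mesh this]
  have "AE x in lebesgue. \<forall>K\<in>\<T>. x \<in> K \<longrightarrow> P x" .
  then have "AE x in lebesgue. x \<in> D \<longrightarrow> P x"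
    by eventually_elim (use Union_mesh closure_subset in blast)
  then show ?thesis using D_sets by (simp add: AE_restrict_space_iff)
qed

text \<open>Cells overlap only in null sets: their interiors are disjoint and exhaust D up to the
  skeleton.\<close>

lemma integral_cells:
  fixes f :: "real^3 \<Rightarrow> real"
  assumes "integrable (lebesgue_on D) f"
  shows "integral\<^sup>L (lebesgue_on D) f = (\<Sum>K\<in>\<T>. integral\<^sup>L (lebesgue_on K) f)"
    and "K \<in> \<T> \<Longrightarrow> integrable (lebesgue_on K) f"
proof -
  have iD: "integrable lebesgue (\<lambda>x. indicator D x *\<^sub>R f x)"
    using assms D_sets by (simp add: integrable_restrict_space)
  have mI: "interior K \<in> sets lebesgue" for K :: "(real^3) set" by simp
  have AEK: "AE x in lebesgue. indicator (interior K) x *\<^sub>R f x = indicator K x *\<^sub>R f x" if "K \<in> \<T>" for K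
    using cell_props(8)[OF that] unfolding negligible_iff_null_sets
    by (rule AE_I') (auto simp: indicator_def frontier_def intro: closure_subset[THEN subsetD] dest: interior_subset[THEN subsetD])
  have iI: "integrable lebesgue (\<lambda>x. indicator (interior K) x *\<^sub>R f x)" if "K \<in> \<T>" for K
  proof -
    have "(\<lambda>x. indicator (interior K) x *\<^sub>R f x) = (\<lambda>x. indicator (interior K) x *\<^sub>R (indicator D x *\<^sub>R f x))"
      using interior_cell_subset[OF that] by (auto simp: indicator_def fun_eq_iff)
    then show ?thesis using integrable_mult_indicator[OF mI iD] by simp
  qed
  have iK: "integrable lebesgue (\<lambda>x. indicator K x *\<^sub>R f x) \<and>
      (\<integral>x. indicator K x *\<^sub>R f x \<partial>lebesgue) = (\<integral>x. indicator (interior K) x *\<^sub>R f x \<partial>lebesgue)" if "K \<in> \<T>" for K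
  proof -
    have "(\<lambda>x. indicator (interior K) x *\<^sub>R f x) absolutely_integrable_on UNIV"
      using iI[OF that] by (simp add: set_integrable_def)
    then have "(\<lambda>x. indicator K x *\<^sub>R f x) absolutely_integrable_on UNIV"
      by (rule absolutely_integrable_spike[OF _ cell_props(8)[OF that]])
        (auto simp: indicator_def frontier_def intro: closure_subset[THEN subsetD] dest: interior_subset[THEN subsetD])
    then have i: "integrable lebesgue (\<lambda>x. indicator K x *\<^sub>R f x)"
      by (simp add: set_integrable_def)
    show ?thesis
      using i integral_cong_AE[OF borel_measurable_integrable[OF iI[OF that]] borel_measurable_integrable[OF i] AEK[OF that]] by simp
  qed
  show "integrable (lebesgue_on K) f" if "K \<in> \<T>"
    using iK[OF that] cell_props(6)[OF that] by (simp add: integrable_restrict_space)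
  have "integral\<^sup>L (lebesgue_on D) f = (\<integral>x. indicator D x *\<^sub>R f x \<partial>lebesgue)"
    using D_sets by (intro integral_restrict_space) auto
  also have "\<dots> = (\<integral>x. (\<Sum>K\<in>\<T>. indicator (interior K) x *\<^sub>R f x) \<partial>lebesgue)"
  proof (rule integral_cong_AE)
    show "(\<lambda>x. \<Sum>K\<in>\<T>. indicator (interior K) x *\<^sub>R f x) \<in> borel_measurable lebesgue"
      using iI by (intro borel_measurable_sum) auto
    have "indicator D x *\<^sub>R f x = (\<Sum>K\<in>\<T>. indicator (interior K) x *\<^sub>R f x)" if ns: "x \<notin> skel" for x
    proof (cases "x \<in> D")
      case True
      then have "x \<in> closure D" by (rule closure_subset[THEN subsetD])
      then obtain K where K: "K \<in> \<T>" "x \<in> interior K" using interior_if_not_skel[OF _ ns] by blast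
      have "(\<Sum>K\<in>\<T>. indicator (interior K) x *\<^sub>R f x) = (\<Sum>K'\<in>{K}. indicator (interior K') x *\<^sub>R f x)"
        using K cell_interior_disjoint[OF K(1)]
        by (intro sum.mono_neutral_right finite_mesh) (auto simp: indicator_def)
      then show ?thesis using K True by simp
    next
      case False
      then have "indicator (interior K) x *\<^sub>R f x = 0" if "K \<in> \<T>" for K
        using interior_cell_subset[OF that] by (auto simp: indicator_def)
      then have "(\<Sum>K\<in>\<T>. indicator (interior K) x *\<^sub>R f x) = 0" by (intro sum.neutral) blast
      then show ?thesis using False by simp
    qed
    then show "AE x in lebesgue. indicator D x *\<^sub>R f x = (\<Sum>K\<in>\<T>. indicator (interior K) x *\<^sub>R f x)"
      using skel(1) unfolding negligible_iff_null_sets by (intro AE_I'[of skel]) auto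
  qed (use iD in auto)
  also have "\<dots> = (\<Sum>K\<in>\<T>. \<integral>x. indicator (interior K) x *\<^sub>R f x \<partial>lebesgue)"
    using iI by (intro Bochner_Integration.integral_sum)
  also have "\<dots> = (\<Sum>K\<in>\<T>. integral\<^sup>L (lebesgue_on K) f)"
    using iK cell_props(6) by (intro sum.cong refl) (simp add: integral_restrict_space)
  finally show "integral\<^sup>L (lebesgue_on D) f = (\<Sum>K\<in>\<T>. integral\<^sup>L (lebesgue_on K) f)" .
qed

lemma glue_L2:
  assumes "\<And>K. K \<in> \<T> \<Longrightarrow> continuous_on UNIV (q K)"
  shows "glue q \<in> L2 D" "glue q \<in> borel_measurable borel" "bounded (range (glue q))"
    "\<And>x. x \<notin> closure D \<Longrightarrow> glue q x = 0" "\<And>x. x \<notin> skel \<Longrightarrow> isCont (glue q) x"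
proof -
  show m: "glue q \<in> borel_measurable borel"
    unfolding glue_def[abs_def]
    by (intro borel_measurable_sum borel_measurable_scaleR borel_measurable_indicator borel_measurable_continuous_onI assms) auto
  show z: "\<And>x. x \<notin> closure D \<Longrightarrow> glue q x = 0"
  proof -
    fix x assume x: "x \<notin> closure D"
    have "x \<notin> interior K" if "K \<in> \<T>" for K using x that interior_subset[of K] Union_mesh by blast
    then show "glue q x = 0" unfolding glue_def by (intro sum.neutral) (auto simp: indicator_def)
  qed
  have "\<exists>M. \<forall>x\<in>K. norm (q K x) \<le> M" if "K \<in> \<T>" for K
  proof -
    have "compact (q K ` K)" by (intro compact_continuous_image continuous_on_subset[OF assms[OF that]] cell_props(1)[OF that]) simp
    from compact_imp_bounded[OF this] show ?thesis unfolding bounded_iff by auto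
  qed
  then obtain M where M: "\<And>K x. K \<in> \<T> \<Longrightarrow> x \<in> K \<Longrightarrow> norm (q K x) \<le> M K" by metis
  have b: "norm (glue q x) \<le> (\<Sum>K\<in>\<T>. \<bar>M K\<bar>)" for x
    unfolding glue_def
  proof (rule sum_norm_le)
    fix K assume K: "K \<in> \<T>"
    show "norm (indicat_real (interior K) x *\<^sub>R q K x) \<le> \<bar>M K\<bar>"
      using M[OF K, of x] interior_subset[of K] by (cases "x \<in> interior K") (auto simp: indicator_def intro: order_trans)
  qed
  then show "bounded (range (glue q))" unfolding bounded_iff by blast
  show "glue q \<in> L2 D" by (rule L2_bounded[OF D_lmeasurable borel_lebesgue_on[OF m] b])
  fix x assume x: "x \<notin> skel"
  show "isCont (glue q) x"
    unfolding glue_def[abs_def]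
  proof (intro continuous_sum continuous_scaleR)
    fix K assume K: "K \<in> \<T>"
    have "x \<notin> frontier (interior K)" using x K frontier_interior_subset[of K] by (auto simp: skel_def)
    then show "isCont (indicat_real (interior K)) x" by (simp add: isCont_indicator)
    show "isCont (q K) x" using assms[OF K] by (simp add: continuous_on_eq_continuous_at)
  qed
qed

lemma glue_Pb:
  assumes "\<And>K. K \<in> \<T> \<Longrightarrow> q K \<in> polys m"
  shows "glue q \<in> Pb D \<T> m" "K \<in> \<T> \<Longrightarrow> restr K (glue q) = q K"
proof -
  have AE: "AE x in lebesgue_on K. glue q x = q K x" if "K \<in> \<T>" for K
    by (rule AE_cell[OF that glue_interior[OF that]])
  note I = PbI[OF glue_L2(1)[OF polys_continuous[OF assms]] assms AE]
  show "glue q \<in> Pb D \<T> m" by (rule I(1))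
  show "K \<in> \<T> \<Longrightarrow> restr K (glue q) = q K" by (rule I(2))
qed

lemma Pb_glue:
  assumes "v \<in> Pb D \<T> m"
  shows "AE x in lebesgue_on D. v x = glue (\<lambda>K. restr K v) x"
proof (rule AE_mesh_cells)
  fix K assume K: "K \<in> \<T>"
  have "AE x in lebesgue_on K. glue (\<lambda>K. restr K v) x = restr K v x"
    by (rule AE_cell[OF K glue_interior[OF K]])
  with PbD(3)[OF assms K] show "AE x in lebesgue_on K. v x = glue (\<lambda>K. restr K v) x" by eventually_elim simp
qed

lemma curlh_glue: "curlh \<T> v = glue (\<lambda>K. curl (restr K v))"
  by (simp add: curlh_def glue_def fun_eq_iff)

lemma curlh_L2: "v \<in> Pb D \<T> m \<Longrightarrow> curlh \<T> v \<in> L2 D"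
  unfolding curlh_glue by (intro glue_L2(1) continuous_curl[OF polys_C1_jac[OF PbD(2)]])

text \<open>The fixed normal of an interface points out of \<open>Kl F\<close>, so it is reversed
  when seen from \<open>Kr F\<close>. The test on \<open>interfaces\<close> protects boundary faces,
  where \<open>Kr F\<close> is arbitrary.\<close>

definition nK :: "(real^3) set \<Rightarrow> (real^3) set \<Rightarrow> real^3" where
  "nK K F = (if F \<in> interfaces \<T> \<and> K = Kr F then - nF F else nF F)"

lemma faces_cases: "K \<in> \<T> \<Longrightarrow> F facet_of K \<Longrightarrow> F \<in> interfaces \<T> \<or> F \<in> boundary_faces \<T>"
  by (auto simp: boundary_faces_def faces_def)

lemma outer_normals_nK:
  assumes K: "K \<in> \<T>"
  shows "outer_normals K (nK K)"
  unfolding outer_normals_def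
proof (intro allI impI)
  fix F assume F: "F facet_of K"
  from faces_cases[OF K F] show "norm (nK K F) = 1 \<and> (\<forall>x\<in>F. \<forall>y\<in>K. (y - x) \<bullet> nK K F \<le> 0)"
  proof
    assume I: "F \<in> interfaces \<T>"
    then have o: "norm (nF F) = 1" "\<forall>x\<in>F. (\<forall>y\<in>Kl F. (y - x) \<bullet> nF F \<le> 0) \<and> (\<forall>y\<in>Kr F. 0 \<le> (y - x) \<bullet> nF F)"
      using orient by (auto simp: face_orientation_def)
    have "K = Kl F \<or> K = Kr F" using interface_cells(1)[OF I] K F by blast
    then show ?thesis using o I interface_cells(2)[OF I] by (auto simp: nK_def)
  next
    assume B: "F \<in> boundary_faces \<T>"
    then have "K = Kl F" "F \<notin> interfaces \<T>" using boundary_face_cells(1)[OF B] K F by (auto simp: boundary_faces_def)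
    then show ?thesis using boundary_face_cells(2,3)[OF B] by (auto simp: nK_def)
  qed
qed

lemma finite_facets: "K \<in> \<T> \<Longrightarrow> finite {F. F facet_of K}"
proof -
  assume "K \<in> \<T>"
  then obtain C where C: "\<not> affine_dependent C" "card C = 4" "K = convex hull C"
    using cell[of K] unfolding simplex_def by auto
  then show ?thesis using simplex_facets(1)[OF C(1,2)] aff_independent_finite[OF C(1)] by simp
qed

lemma finite_faces: "finite (faces \<T>)"
proof -
  have "faces \<T> = (\<Union>K\<in>\<T>. {F. F facet_of K})" by (auto simp: faces_def)
  then show ?thesis using finite_mesh finite_facets by simp
qed

lemma sum_cells_faces:
  "(\<Sum>K\<in>\<T>. \<Sum>F | F facet_of K. h K F) =
   (\<Sum>F\<in>faces \<T>. if F \<in> interfaces \<T> then h (Kl F) F + h (Kr F) F else h (Kl F) F)" for h :: "_ \<Rightarrow> _ \<Rightarrow> real"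
proof -
  have "(\<Sum>K\<in>\<T>. \<Sum>F | F facet_of K. h K F) = (\<Sum>K\<in>\<T>. \<Sum>F | F \<in> faces \<T> \<and> F facet_of K. h K F)"
    by (intro sum.cong refl) (auto simp: faces_def)
  also have "\<dots> = (\<Sum>F\<in>faces \<T>. \<Sum>K | K \<in> \<T> \<and> F facet_of K. h K F)"
    by (rule sum.swap_restrict[OF finite_mesh finite_faces])
  also have "\<dots> = (\<Sum>F\<in>faces \<T>. if F \<in> interfaces \<T> then h (Kl F) F + h (Kr F) F else h (Kl F) F)"
  proof (rule sum.cong[OF refl])
    fix F assume "F \<in> faces \<T>"
    then show "(\<Sum>K | K \<in> \<T> \<and> F facet_of K. h K F) = (if F \<in> interfaces \<T> then h (Kl F) F + h (Kr F) F else h (Kl F) F)"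
      using interface_cells(1,2)[of F] boundary_face_cells(1)[of F] by (auto simp: boundary_faces_def)
  qed
  finally show ?thesis .
qed

end

section \<open>Jumps of conforming fields\<close>

context mesh
begin

definition face_sum :: "((real^3) set \<Rightarrow> real^3 \<Rightarrow> real) \<Rightarrow> real" where
  "face_sum h = (\<Sum>F\<in>faces \<T>. face_integral F (h F))"

lemma face_cell: "F \<in> faces \<T> \<Longrightarrow> Kl F \<in> \<T> \<and> F facet_of Kl F"
  "F \<in> interfaces \<T> \<Longrightarrow> Kr F \<in> \<T> \<and> F facet_of Kr F"
  using orient by (auto simp: face_orientation_def boundary_faces_def)

text \<open>Both fields may be unrelated on the two sides of a face; the minus sign on the
  \<open>Kr F\<close> term is that of the outer normal.\<close>

lemma broken_green:
  assumes p: "\<And>K. K \<in> \<T> \<Longrightarrow> C1_jac (p K) (J K)" and q: "\<And>K. K \<in> \<T> \<Longrightarrow> C1_jac (q K) (J' K)"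
  shows "(\<Sum>K\<in>\<T>. integral\<^sup>L (lebesgue_on K) (\<lambda>x. curl (p K) x \<bullet> q K x - p K x \<bullet> curl (q K) x))
    = face_sum (\<lambda>F x. nF F \<bullet> cross3 (p (Kl F) x) (q (Kl F) x)
        - (if F \<in> interfaces \<T> then nF F \<bullet> cross3 (p (Kr F) x) (q (Kr F) x) else 0))"
proof -
  let ?h = "\<lambda>K F. face_integral F (\<lambda>x. nK K F \<bullet> cross3 (p K x) (q K x))"
  have c: "continuous_on UNIV (\<lambda>x. n \<bullet> cross3 (p K x) (q K x))" if "K \<in> \<T>" for K n
    by (intro continuous_on_inner continuous_on_const C1_jacD(3)[OF C1_jac_cross[OF p[OF that] q[OF that]]])
  have "(\<Sum>K\<in>\<T>. integral\<^sup>L (lebesgue_on K) (\<lambda>x. curl (p K) x \<bullet> q K x - p K x \<bullet> curl (q K) x))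
      = (\<Sum>K\<in>\<T>. \<Sum>F | F facet_of K. ?h K F)"
    by (intro sum.cong refl cell_green[OF cell outer_normals_nK p q])
  also have "\<dots> = (\<Sum>F\<in>faces \<T>. if F \<in> interfaces \<T> then ?h (Kl F) F + ?h (Kr F) F else ?h (Kl F) F)"
    by (rule sum_cells_faces)
  also have "\<dots> = face_sum (\<lambda>F x. nF F \<bullet> cross3 (p (Kl F) x) (q (Kl F) x)
        - (if F \<in> interfaces \<T> then nF F \<bullet> cross3 (p (Kr F) x) (q (Kr F) x) else 0))"
    unfolding face_sum_def
  proof (rule sum.cong[OF refl])
    fix F assume F: "F \<in> faces \<T>"
    note l = face_cell(1)[OF F]
    show "(if F \<in> interfaces \<T> then ?h (Kl F) F + ?h (Kr F) F else ?h (Kl F) F) =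
      face_integral F (\<lambda>x. nF F \<bullet> cross3 (p (Kl F) x) (q (Kl F) x)
        - (if F \<in> interfaces \<T> then nF F \<bullet> cross3 (p (Kr F) x) (q (Kr F) x) else 0))"
    proof (cases "F \<in> interfaces \<T>")
      case True
      note r = face_cell(2)[OF True]
      have "nK (Kl F) F = nF F" "nK (Kr F) F = - nF F" using True interface_cells(2)[OF True] by (auto simp: nK_def)
      moreover have "face_integral F (\<lambda>x. nF F \<bullet> cross3 (p (Kl F) x) (q (Kl F) x) + (- nF F) \<bullet> cross3 (p (Kr F) x) (q (Kr F) x))
        = face_integral F (\<lambda>x. nF F \<bullet> cross3 (p (Kl F) x) (q (Kl F) x)) + face_integral F (\<lambda>x. (- nF F) \<bullet> cross3 (p (Kr F) x) (q (Kr F) x))"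
        using l r by (intro face_integral_add[of "Kl F"] cell c) auto
      ultimately show ?thesis using True by simp
    qed (simp add: nK_def)
  qed
  finally show ?thesis .
qed

abbreviation "jmp \<equiv> jump \<T> Kl Kr nF"

lemma jump_polys:
  assumes v: "v \<in> Pb D \<T> m" and F: "F \<in> faces \<T>"
  shows "jmp F v \<in> polys m"
proof -
  have lin: "linear (\<lambda>x. cross3 x n)" for n
    by (rule linearI) (simp_all add: cross_add_left cross_mult_left)
  have "(\<lambda>x. cross3 (restr (Kl F) v x) (nF F)) \<in> polys m"
    using face_cell(1)[OF F] by (intro polys_linear[OF lin] PbD(2)[OF v]) simp
  moreover have "(\<lambda>x. cross3 (restr (Kr F) v x) (nF F)) \<in> polys m" if "F \<in> interfaces \<T>"
    using face_cell(2)[OF that] by (intro polys_linear[OF lin] PbD(2)[OF v]) simp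
  ultimately show ?thesis
    by (cases "F \<in> interfaces \<T>") (auto simp: jump_def[abs_def] intro: polys_diff)
qed

text \<open>w is single-valued, so the two sides of a face combine to the jump of v; n . (p \<times>
  w) = - (p \<times> n) . w brings in the tangential traces.\<close>

lemma broken_green_jump:
  assumes v: "v \<in> Pb D \<T> m" and w: "C1_jac w J"
  shows "(\<Sum>K\<in>\<T>. integral\<^sup>L (lebesgue_on K) (\<lambda>x. curl (restr K v) x \<bullet> w x - restr K v x \<bullet> curl w x))
    = - face_sum (\<lambda>F x. jmp F v x \<bullet> w x)"
proof -
  have t: "n \<bullet> cross3 p q = - (cross3 p n \<bullet> q)" for n p q :: "real^3"
    by (simp add: cross3_simps)
  have e: "nF F \<bullet> cross3 (restr (Kl F) v x) (w x)
        - (if F \<in> interfaces \<T> then nF F \<bullet> cross3 (restr (Kr F) v x) (w x) else 0) = (-1) * (jmp F v x \<bullet> w x)" for F x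
    unfolding t jump_def by (simp add: inner_diff_left)
  show ?thesis
    using broken_green[of "\<lambda>K. restr K v" "\<lambda>K i. partial i (restr K v)" "\<lambda>_. w" "\<lambda>_. J"] polys_C1_jac[OF PbD(2)[OF v]] w
    unfolding e face_sum_def face_integral_cmult by (simp add: sum_negf)
qed

text \<open>The other faces are finitely many compact sets, none of which contains x.\<close>

lemma other_faces_away:
  assumes F: "F \<in> faces \<T>" and x: "x \<in> rel_interior F"
  obtains r where "0 < r" "\<And>F'. F' \<in> faces \<T> \<Longrightarrow> F' \<noteq> F \<Longrightarrow> F' \<inter> cball x r = {}"
proof -
  let ?U = "\<Union>(faces \<T> - {F})"
  have "closed ?U"
    using finite_faces facet_props(3) by (intro closed_Union) (auto simp: faces_def intro: compact_imp_closed)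
  moreover have "x \<notin> ?U"
  proof
    assume "x \<in> ?U"
    then obtain F' where F': "F' \<in> faces \<T>" "F' \<noteq> F" "x \<in> F'" by blast
    obtain K K' where "K \<in> \<T>" "F facet_of K" "K' \<in> \<T>" "F' facet_of K'"
      using F F'(1) by (auto simp: faces_def)
    from facet_unique_point[OF this x F'(3)] F'(2) show False by simp
  qed
  ultimately have "open (- ?U)" "x \<in> - ?U" by (simp_all only: open_Compl Compl_iff not_False_eq_True)
  then obtain r where "r > 0" "cball x r \<subseteq> - ?U"
    using open_contains_cball_eq by metis
  then show thesis by (intro that[of r]) auto
qed

text \<open>Testing with a bump function times the jump itself localises the sum over the faces.\<close>

lemma jump_eq_0:
  assumes v: "v \<in> Pb D \<T> m" and F: "F \<in> faces \<T>"
    and t: "\<And>x. x \<in> rel_interior F \<Longrightarrow> \<exists>r0>0. \<forall>r f. 0 < r \<longrightarrow> r < r0 \<longrightarrow> bump x r f \<longrightarrow>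
      face_sum (\<lambda>F' y. jmp F' v y \<bullet> (f y *\<^sub>R jmp F v y)) = 0"
    and x: "x \<in> F"
  shows "jmp F v x = 0"
proof -
  let ?J = "jmp F v"
  note l = face_cell(1)[OF F]
  have cJ: "continuous_on UNIV (jmp F' v)" if "F' \<in> faces \<T>" for F'
    by (rule polys_continuous[OF jump_polys[OF v that]])
  have "?J y = 0" if y: "y \<in> rel_interior F" for y
  proof -
    from t[OF y] obtain r0 where r0: "r0 > 0" "\<forall>r f. 0 < r \<longrightarrow> r < r0 \<longrightarrow> bump y r f \<longrightarrow>
      face_sum (\<lambda>F' z. jmp F' v z \<bullet> (f z *\<^sub>R ?J z)) = 0" by (elim exE conjE) (rule that)
    obtain r1 where r1: "r1 > 0" "\<And>F'. F' \<in> faces \<T> \<Longrightarrow> F' \<noteq> F \<Longrightarrow> F' \<inter> cball y r1 = {}"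
      using other_faces_away[OF F y] by blast
    \<comment> \<open>Below r0 the test is admissible, and below r1 the bump meets no face other
      than F.\<close>
    define r where "r = min r0 r1 / 2"
    have r: "0 < r" "r < r0" "r < r1" using r0(1) r1(1) by (auto simp: r_def min_def)
    have "\<exists>f. bump y r f \<and> (\<forall>x. 0 \<le> f x) \<and> (\<forall>x. norm (x - y) < r \<longrightarrow> 0 < f x)"
      by (rule bump_exists[OF r(1), where a = y]) blast
    then obtain f where f: "bump y r f" "\<And>x. 0 \<le> f x" "\<And>x. norm (x - y) < r \<Longrightarrow> 0 < f x"
      by blast
    have cf: "continuous_on UNIV f" by (rule bump_continuous[OF f(1)])
    have c: "continuous_on UNIV (\<lambda>z. jmp F' v z \<bullet> (f z *\<^sub>R ?J z))" if "F' \<in> faces \<T>" for F'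
      by (intro continuous_on_inner continuous_on_scaleR cJ F that cf)
    have z: "face_integral F' (\<lambda>z. jmp F' v z \<bullet> (f z *\<^sub>R ?J z)) = 0" if F': "F' \<in> faces \<T>" "F' \<noteq> F" for F'
    proof -
      have "face_integral F' (\<lambda>z. jmp F' v z \<bullet> (f z *\<^sub>R ?J z)) = face_integral F' (\<lambda>z. 0 * 0)"
      proof (rule face_integral_cong[of "Kl F'"])
        fix z assume "z \<in> F'"
        then have "z \<notin> cball y r1" using r1(2)[OF F'] by blast
        then have "r \<le> norm (z - y)" using r by (simp add: dist_norm norm_minus_commute)
        then show "jmp F' v z \<bullet> (f z *\<^sub>R ?J z) = 0 * 0" using bump_outside[OF f(1) r(1)] by simp
      qed (use face_cell(1)[OF F'(1)] cell c[OF F'(1)] in auto)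
      then show ?thesis unfolding face_integral_cmult by simp
    qed
    have "face_sum (\<lambda>F' z. jmp F' v z \<bullet> (f z *\<^sub>R ?J z)) = face_integral F (\<lambda>z. ?J z \<bullet> (f z *\<^sub>R ?J z))"
      unfolding face_sum_def using z by (subst sum.remove[OF finite_faces F]) simp
    then have "face_integral F (\<lambda>z. ?J z \<bullet> (f z *\<^sub>R ?J z)) = 0" using r0(2)[rule_format, OF r(1,2) f(1)] by simp
    \<comment> \<open>The integrand f |J|^2 is continuous and nonnegative with zero integral, so it
      vanishes on F; positivity of f at y then forces the jump there to be 0.\<close>
    then have "?J y \<bullet> (f y *\<^sub>R ?J y) = 0"
      using y rel_interior_subset f(2) l
      by (intro face_integral_eq_0[of "Kl F" F "\<lambda>z. ?J z \<bullet> (f z *\<^sub>R ?J z)"] cell c F) auto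
    then show ?thesis using f(3)[of y] r(1) by simp
  qed
  moreover have "closure (rel_interior F) = closure F"
    using facet_props(1) l convex_closure_rel_interior by blast
  moreover have "closed {y. ?J y = 0}" using cJ[OF F] by (intro closed_Collect_eq) auto
  ultimately show ?thesis using closure_minimal[of "rel_interior F" "{y. ?J y = 0}"] x closure_subset by blast
qed

text \<open>A test field supported in the interior of one cell sees only the polynomial there, whose
  weak curl is the classical one. The skeleton is null, so this fixes the weak curl almost
  everywhere.\<close>

lemma wcurl_Pb:
  assumes v: "v \<in> Pb D \<T> m" and w: "is_weak_curl D v w"
  shows "AE x in lebesgue_on D. w x = curlh \<T> v x"
proof (rule AE_mesh_cells)
  fix K assume K: "K \<in> \<T>"
  let ?I = "interior K"
  have I: "?I \<in> sets lebesgue" "?I \<subseteq> D" using interior_cell_subset[OF K] by auto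
  have bI: "bounded ?I" using I(2) bounded_D bounded_subset by blast
  note p = PbD(2)[OF v K]
  have wL: "w \<in> L2 D" using w by (simp add: is_weak_curl_def)
  have sub: "u \<in> L2 ?I" if "u \<in> L2 D" for u
    using that integrable_lebesgue_on_subset[OF L2D(2)[OF that] I(2,1) D_sets]
      measurable_restrict_mono[OF L2D(1)[OF that] I(2)] by (simp add: L2_def)
  have cL: "curl (restr K v) \<in> L2 ?I"
    by (intro L2_continuous continuous_curl[OF polys_C1_jac[OF p]] bI I(1))
  have AEv: "AE x in lebesgue_on ?I. v x = restr K v x"
    using PbD(3)[OF v K] cell_props(6)[OF K] interior_subset[of K] by (auto simp: AE_restrict_space_iff elim: eventually_mono)
  have ext: "ip D a b = ip ?I a b" if "\<And>x. x \<notin> ?I \<Longrightarrow> b x = 0" for a b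
  proof -
    have "ip D a b = (\<integral>x. indicator D x *\<^sub>R (a x \<bullet> b x) \<partial>lebesgue)"
      unfolding ip_def using D_sets by (intro integral_restrict_space) auto
    also have "\<dots> = (\<integral>x. indicator ?I x *\<^sub>R (a x \<bullet> b x) \<partial>lebesgue)"
      using that I(2) by (intro Bochner_Integration.integral_cong) (auto simp: indicator_def)
    also have "\<dots> = ip ?I a b"
      unfolding ip_def using I(1) by (intro integral_restrict_space[symmetric]) auto
    finally show ?thesis .
  qed
  have "AE x in lebesgue_on ?I. w x - curl (restr K v) x = 0"
  proof (rule fundamental_lemma[OF open_interior bI L2_diff[OF sub[OF wL] cL]])
    fix \<phi> assume \<phi>: "\<phi> \<in> test_fields ?I"
    then have \<phi>D: "\<phi> \<in> test_fields D" using I(2) by (auto simp: test_fields_def)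
    obtain R where R: "\<And>x. norm x \<ge> R \<Longrightarrow> \<phi> x = 0" "\<And>x i. norm x \<ge> R \<Longrightarrow> partial i \<phi> x = 0"
      "\<And>x. x \<notin> ?I \<Longrightarrow> \<phi> x = 0" "\<And>x i. x \<notin> ?I \<Longrightarrow> partial i \<phi> x = 0"
      using test_field_support[OF \<phi>] by metis
    have \<phi>0: "\<phi> x = 0" "curl \<phi> x = 0" if "x \<notin> ?I" for x
      using R(3,4)[OF that] by (simp_all add: curl_def vec_eq_iff forall_3 vector_3)
    note P = test_fields_C1_jac[OF \<phi>]
    have L: "\<phi> \<in> L2 ?I" "curl \<phi> \<in> L2 ?I" "restr K v \<in> L2 ?I"
      by (intro L2_continuous test_field_continuous[OF \<phi>] continuous_curl[OF P] polys_continuous[OF p] bI I(1))+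
    have "ip ?I w \<phi> = ip D w \<phi>" using ext[OF \<phi>0(1)] by simp
    also have "\<dots> = ip D v (curl \<phi>)" using w \<phi>D by (simp add: is_weak_curl_def)
    also have "\<dots> = ip ?I v (curl \<phi>)" by (rule ext[OF \<phi>0(2)])
    also have "\<dots> = ip ?I (restr K v) (curl \<phi>)"
      using L2D(1)[OF sub[OF PbD(1)[OF v]]] L2D(1)[OF L(3)] L2D(1)[OF L(2)] AEv by (intro ip_cong_AE) auto
    also have "\<dots> = ip ?I (curl (restr K v)) \<phi>"
    proof -
      have "integral\<^sup>L (lebesgue_on ?I) (\<lambda>x. curl (restr K v) x \<bullet> \<phi> x - restr K v x \<bullet> curl \<phi> x) = 0"
        using C1_curl_by_parts[OF I(1) polys_C1_jac[OF p] \<phi>] by (simp add: curl_eq_crl[symmetric])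
      then show ?thesis using L2_inner_integrable[OF cL L(1)] L2_inner_integrable[OF L(3,2)] by (simp add: ip_def)
    qed
    finally show "ip ?I (\<lambda>x. w x - curl (restr K v) x) \<phi> = 0"
      by (simp add: ip_diff_left[OF sub[OF wL] cL L(1)])
  qed
  then have "AE x in lebesgue. x \<in> ?I \<longrightarrow> w x = curl (restr K v) x"
    using I(1) by (simp add: AE_restrict_space_iff)
  moreover have "AE x in lebesgue. x \<notin> frontier K"
    using cell_props(8)[OF K] unfolding negligible_iff_null_sets by (rule AE_not_in)
  ultimately have "AE x in lebesgue. x \<in> K \<longrightarrow> w x = curlh \<T> v x"
  proof eventually_elim
    case (elim x)
    then show ?case
      using glue_interior[OF K, of x "\<lambda>K. curl (restr K v)"] closure_subset[of K] by (auto simp: curlh_glue frontier_def)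
  qed
  then show "AE x in lebesgue_on K. w x = curlh \<T> v x" using cell_props(6)[OF K] by (simp add: AE_restrict_space_iff)
qed

text \<open>The failure of the broken curl to be a weak curl is carried by the jumps alone. Since w
  may be nonzero on the boundary of D, boundary faces contribute too.\<close>

lemma face_sum_defect:
  assumes v: "v \<in> Pb D \<T> m" and w: "C1_jac w J"
  shows "ip D (curlh \<T> v) w - ip D v (curl w) = - face_sum (\<lambda>F x. jmp F v x \<bullet> w x)"
proof -
  have "w \<in> L2 D" "curl w \<in> L2 D"
    by (intro L2_continuous C1_jacD(3)[OF w] continuous_curl[OF w] bounded_D D_sets)+
  then have L: "w \<in> L2 D" "curl w \<in> L2 D" "v \<in> L2 D" "curlh \<T> v \<in> L2 D"
    using PbD(1)[OF v] curlh_L2[OF v] by auto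
  let ?f = "\<lambda>x. curlh \<T> v x \<bullet> w x - v x \<bullet> curl w x"
  have i: "integrable (lebesgue_on D) ?f"
    by (intro Bochner_Integration.integrable_diff L2_inner_integrable L)
  have "ip D (curlh \<T> v) w - ip D v (curl w) = integral\<^sup>L (lebesgue_on D) ?f"
    using L2_inner_integrable[OF L(4,1)] L2_inner_integrable[OF L(3,2)] by (simp add: ip_def)
  also have "\<dots> = (\<Sum>K\<in>\<T>. integral\<^sup>L (lebesgue_on K) ?f)" by (rule integral_cells(1)[OF i])
  also have "\<dots> = (\<Sum>K\<in>\<T>. integral\<^sup>L (lebesgue_on K) (\<lambda>x. curl (restr K v) x \<bullet> w x - restr K v x \<bullet> curl w x))"
  proof (rule sum.cong[OF refl], rule integral_cong_AE)
    fix K assume K: "K \<in> \<T>"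
    note p = PbD(2)[OF v K]
    show "?f \<in> borel_measurable (lebesgue_on K)" using integral_cells(2)[OF i K] by auto
    show "(\<lambda>x. curl (restr K v) x \<bullet> w x - restr K v x \<bullet> curl w x) \<in> borel_measurable (lebesgue_on K)"
      by (intro borel_lebesgue_on borel_measurable_continuous_onI continuous_intros continuous_curl[OF polys_C1_jac[OF p]]
          continuous_curl[OF w] polys_continuous[OF p] C1_jacD(3)[OF w])
    have "AE x in lebesgue_on K. curlh \<T> v x = curl (restr K v) x"
      unfolding curlh_glue by (rule AE_cell[OF K glue_interior[OF K]])
    then show "AE x in lebesgue_on K. ?f x = curl (restr K v) x \<bullet> w x - restr K v x \<bullet> curl w x"
      using PbD(3)[OF v K] by eventually_elim simp
  qed
  also have "\<dots> = - face_sum (\<lambda>F x. jmp F v x \<bullet> w x)" by (rule broken_green_jump[OF v w])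
  finally show ?thesis .
qed

text \<open>Around a relative interior point of an interface there is a ball inside D, so small
  bumps times the jump are test fields, and for these the defect is zero by definition of the weak
  curl.\<close>

lemma Pc_jump:
  assumes v: "v \<in> Pc D \<T> m" and F: "F \<in> interfaces \<T>" and x: "x \<in> F"
  shows "jmp F v x = 0"
proof -
  have vP: "v \<in> Pb D \<T> m" and vH: "v \<in> Hcurl D" using v by (auto simp: Pc_def)
  have Ff: "F \<in> faces \<T>" using F by (auto simp: faces_def interfaces_def)
  note wc = wcurl_is_weak_curl[OF vH]
  show ?thesis
  proof (rule jump_eq_0[OF vP Ff _ x])
    fix y assume "y \<in> rel_interior F"
    then obtain r0 where r0: "r0 > 0" "cball y r0 \<subseteq> D"
      using interface_cells(3)[OF F] open_contains_cball open_D by blast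
    show "\<exists>r0>0. \<forall>r f. 0 < r \<longrightarrow> r < r0 \<longrightarrow> bump y r f \<longrightarrow> face_sum (\<lambda>F' z. jmp F' v z \<bullet> (f z *\<^sub>R jmp F v z)) = 0"
    proof (intro exI[of _ r0] conjI r0(1) allI impI)
      fix r f assume r: "0 < r" "r < r0" and f: "bump y r f"
      have "cball y r \<subseteq> D" using r0(2) r(2) by (auto simp: subset_iff)
      then have t: "(\<lambda>z. f z *\<^sub>R jmp F v z) \<in> test_fields D"
        by (rule bump_polys_test_field[OF f r(1) jump_polys[OF vP Ff]])
      have "ip D (curlh \<T> v) (\<lambda>z. f z *\<^sub>R jmp F v z) = ip D (wcurl D v) (\<lambda>z. f z *\<^sub>R jmp F v z)"
        using wcurl_Pb[OF vP wc] wc curlh_L2[OF vP] test_field_borel[OF t]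
        by (intro ip_cong_AE) (auto simp: is_weak_curl_def L2D borel_lebesgue_on elim: eventually_mono)
      also have "\<dots> = ip D v (curl (\<lambda>z. f z *\<^sub>R jmp F v z))" using wc t by (simp add: is_weak_curl_def)
      finally show "face_sum (\<lambda>F' z. jmp F' v z \<bullet> (f z *\<^sub>R jmp F v z)) = 0"
        using face_sum_defect[OF vP test_fields_C1_jac[OF t]] by simp
    qed
  qed
qed

text \<open>Makes globally C1 fields admissible in the definition of the zero tangential
  trace.\<close>

lemma C1_H1:
  assumes w: "C1_jac w J"
  shows "w \<in> H1 D"
  unfolding H1_def
proof (intro CollectI conjI allI)
  show "w \<in> L2 D" by (intro L2_continuous C1_jacD(3)[OF w] bounded_D D_sets)
  fix i
  show "\<exists>g\<in>L2 D. \<forall>\<phi>\<in>test_fields D. ip D w (partial i \<phi>) = - ip D g \<phi>"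
  proof (intro bexI[of _ "J i"] ballI)
    show gL: "J i \<in> L2 D" by (intro L2_continuous C1_jacD(2)[OF w] bounded_D D_sets)
    fix \<phi> assume \<phi>: "\<phi> \<in> test_fields D"
    note P = test_fields_C1_jac[OF \<phi>]
    obtain R where R: "\<And>x. norm x \<ge> R \<Longrightarrow> \<phi> x = 0" "\<And>x i. norm x \<ge> R \<Longrightarrow> partial i \<phi> x = 0"
      "\<And>x. x \<notin> D \<Longrightarrow> \<phi> x = 0" "\<And>x i. x \<notin> D \<Longrightarrow> partial i \<phi> x = 0"
      using test_field_support[OF \<phi>] by metis
    have G: "C1_grad (\<lambda>x. w x \<bullet> \<phi> x) (\<lambda>x. \<chi> j. J j x \<bullet> \<phi> x + w x \<bullet> partial j \<phi> x)"
      unfolding C1_grad_def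
    proof (intro conjI allI)
      fix x
      show "((\<lambda>x. w x \<bullet> \<phi> x) has_derivative (\<bullet>) (\<chi> j. J j x \<bullet> \<phi> x + w x \<bullet> partial j \<phi> x)) (at x)"
        by (rule has_derivative_eq_rhs[OF has_derivative_inner[OF C1_jacD(1)[OF w] C1_jacD(1)[OF P]]])
          (simp add: fun_eq_iff inner_vec_def[of "\<chi> j. _ j"] inner_sum_left inner_sum_right sum.distrib algebra_simps)
    qed (intro continuous_intros C1_jacD(2,3)[OF w] C1_jacD(2,3)[OF P])
    have z: "(\<integral>x. (J i x \<bullet> \<phi> x + w x \<bullet> partial i \<phi> x) \<partial>lborel) = 0"
      using integral_grad_eq_0[OF G, of R "axis i 1"] R(1,2) by (simp add: inner_axis vec_eq_iff)
    have pL: "\<phi> \<in> L2 D" "partial i \<phi> \<in> L2 D" "w \<in> L2 D"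
      by (intro L2_continuous C1_jacD(2,3)[OF w] C1_jacD(2,3)[OF P] bounded_D D_sets)+
    have "ip D (J i) \<phi> + ip D w (partial i \<phi>) = integral\<^sup>L (lebesgue_on D) (\<lambda>x. J i x \<bullet> \<phi> x + w x \<bullet> partial i \<phi> x)"
      using L2_inner_integrable[OF gL pL(1)] L2_inner_integrable[OF pL(3,2)] by (simp add: ip_def)
    also have "\<dots> = (\<integral>x. (J i x \<bullet> \<phi> x + w x \<bullet> partial i \<phi> x) \<partial>lborel)"
      by (intro lebesgue_on_integral_extend D_sets borel_measurable_continuous_onI continuous_intros
          C1_jacD(2,3)[OF w] C1_jacD(2,3)[OF P]) (use R in simp)
    finally show "ip D w (partial i \<phi>) = - ip D (J i) \<phi>" using z by simp
  qed
qed

lemma C1_wcurl: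
  assumes w: "C1_jac w J"
  shows "w \<in> Hcurl D" "AE x in lebesgue_on D. wcurl D w x = curl w x"
proof -
  have L: "w \<in> L2 D" "curl w \<in> L2 D"
    by (intro L2_continuous C1_jacD(3)[OF w] continuous_curl[OF w] bounded_D D_sets)+
  have wk: "is_weak_curl D w (curl w)"
    unfolding is_weak_curl_def
  proof (intro conjI ballI L(2))
    fix \<phi> assume \<phi>: "\<phi> \<in> test_fields D"
    note P = test_fields_C1_jac[OF \<phi>]
    have pL: "\<phi> \<in> L2 D" "curl \<phi> \<in> L2 D"
      by (intro L2_continuous C1_jacD(3)[OF P] continuous_curl[OF P] bounded_D D_sets)+
    have "integral\<^sup>L (lebesgue_on D) (\<lambda>x. curl w x \<bullet> \<phi> x - w x \<bullet> curl \<phi> x) = 0"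
      using C1_curl_by_parts[OF D_sets w \<phi>] by (simp add: C1_jac_curl[OF w])
    then show "ip D w (curl \<phi>) = ip D (curl w) \<phi>"
      using L2_inner_integrable[OF L(2) pL(1)] L2_inner_integrable[OF L(1) pL(2)] by (simp add: ip_def)
  qed
  then show H: "w \<in> Hcurl D" using L(1) by (auto simp: Hcurl_def)
  show "AE x in lebesgue_on D. wcurl D w x = curl w x"
    by (rule weak_curl_AE_unique[OF open_D bounded_D wcurl_is_weak_curl[OF H] wk])
qed

text \<open>The vanishing tangential trace replaces the compact support of a test field. In other
  words, the zero extension of v has the zero extension of its broken curl as weak curl on the whole
  space.\<close>

lemma Pc0_by_parts:
  assumes v: "v \<in> Pc0 D \<T> m" and w: "C1_jac w J"
  shows "ip D v (curl w) = ip D (curlh \<T> v) w"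
proof -
  have vP: "v \<in> Pb D \<T> m" and v0: "v \<in> H0curl D" using v by (auto simp: Pc0_def)
  have vH: "v \<in> Hcurl D" using v0 by (simp add: H0curl_def)
  note wv = wcurl_is_weak_curl[OF vH] and ww = wcurl_is_weak_curl[OF C1_wcurl(1)[OF w]]
  have m: "w \<in> borel_measurable (lebesgue_on D)" "curl w \<in> borel_measurable (lebesgue_on D)"
    "wcurl D v \<in> borel_measurable (lebesgue_on D)" "wcurl D w \<in> borel_measurable (lebesgue_on D)"
    "v \<in> borel_measurable (lebesgue_on D)" "curlh \<T> v \<in> borel_measurable (lebesgue_on D)"
    using wv ww L2D(1)[OF PbD(1)[OF vP]] L2D(1)[OF curlh_L2[OF vP]]
    by (auto simp: is_weak_curl_def intro: L2D borel_lebesgue_on borel_measurable_continuous_onI C1_jacD(3)[OF w] continuous_curl[OF w])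
  have "ip D v (wcurl D w) = ip D (wcurl D v) w"
    using v0 C1_H1[OF w] by (simp add: H0curl_def tangential_trace_def)
  moreover have "ip D v (wcurl D w) = ip D v (curl w)"
    using C1_wcurl(2)[OF w] by (intro ip_cong_AE m) auto
  moreover have "ip D (wcurl D v) w = ip D (curlh \<T> v) w"
    using wcurl_Pb[OF vP wv] by (intro ip_cong_AE m) auto
  ultimately show ?thesis by simp
qed

text \<open>By \<open>Pc0_by_parts\<close> the bump may reach across the boundary of D, so all faces
  are covered and any radius will do.\<close>

lemma Pc0_jump:
  assumes v: "v \<in> Pc0 D \<T> m" and F: "F \<in> faces \<T>" and x: "x \<in> F"
  shows "jmp F v x = 0"
proof -
  have vP: "v \<in> Pb D \<T> m" using v by (auto simp: Pc0_def)
  show ?thesis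
  proof (rule jump_eq_0[OF vP F _ x])
    fix y
    have "face_sum (\<lambda>F' z. jmp F' v z \<bullet> (f z *\<^sub>R jmp F v z)) = 0" if f: "bump y r f" for r f
    proof -
      obtain g where "C1_grad f (\<lambda>x. \<chi> i. g i x)" using bump_grad[OF f] by blast
      from C1_jac_scaleR[OF this polys_C1_jac[OF jump_polys[OF vP F]]]
      show ?thesis using face_sum_defect[OF vP] Pc0_by_parts[OF v] by fastforce
    qed
    then show "\<exists>r0>0. \<forall>r f. 0 < r \<longrightarrow> r < r0 \<longrightarrow> bump y r f \<longrightarrow> face_sum (\<lambda>F' z. jmp F' v z \<bullet> (f z *\<^sub>R jmp F v z)) = 0"
      by (intro exI[of _ 1]) auto
  qed
qed

end

section \<open>Conforming fields are limits of test fields\<close>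

lemma C1_grad_unique: "C1_grad f G \<Longrightarrow> C1_grad f H \<Longrightarrow> G = H"
proof
  fix x assume "C1_grad f G" "C1_grad f H"
  then have "(\<lambda>h. G x \<bullet> h) = (\<lambda>h. H x \<bullet> h)"
    using has_derivative_unique C1_gradD(1) by blast
  then show "G x = H x" by (metis vector_eq_rdot)
qed

lemma C1_grad_eq_0_open:
  assumes "C1_grad f G" "open S" "x \<in> S" "\<And>y. y \<in> S \<Longrightarrow> f y = 0"
  shows "G x = 0"
proof -
  have "(f has_derivative (\<lambda>h. 0)) (at x)"
    by (rule has_derivative_transform_within_open[of "\<lambda>_. 0" _ x UNIV S]) (use assms in auto)
  then have "(\<lambda>h. G x \<bullet> h) = (\<lambda>h. 0)"
    using has_derivative_unique C1_gradD(1)[OF assms(1)] by blast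
  then have "G x \<bullet> G x = 0" by metis
  then show ?thesis by simp
qed

text \<open>The squared positive part is C1 across 0. One derivative suffices, as the cutoffs built
  from it multiply the field before mollification.\<close>

definition possq :: "real \<Rightarrow> real" where "possq t = (max 0 t)\<^sup>2"

lemma possq_deriv: "(possq has_real_derivative 2 * max 0 t) (at t)"
proof -
  consider "t < 0" | "t = 0" | "0 < t" by linarith
  then show ?thesis
  proof cases
    case 1
    have "(possq has_real_derivative 0) (at t)"
      by (rule has_field_derivative_transform_within_open[of "\<lambda>_. 0" _ _ "{..<0}"])
        (use 1 in \<open>auto simp: possq_def\<close>)
    then show ?thesis using 1 by simp
  next
    case 2
    have "(\<lambda>h. (possq (0 + h) - possq 0) / h) \<midarrow>0\<rightarrow> 0"
    proof (rule tendsto_0_le[where K = 1])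
      show "((\<lambda>h::real. h) \<longlongrightarrow> 0) (at 0)" by (rule tendsto_ident_at)
      have "norm ((possq (0 + h) - possq 0) / h) \<le> norm h * 1" for h
        by (cases "0 < h") (auto simp: possq_def max_def power2_eq_square)
      then show "\<forall>\<^sub>F h in at 0. norm ((possq (0 + h) - possq 0) / h) \<le> norm h * 1" by simp
    qed
    then show ?thesis using 2 by (simp add: DERIV_def)
  next
    case 3
    have "((\<lambda>t. t\<^sup>2) has_real_derivative (2 * t)) (at t)" by (auto intro!: derivative_eq_intros)
    then have "(possq has_real_derivative (2 * t)) (at t)"
      by (rule has_field_derivative_transform_within_open[of _ _ _ "{0<..}"])
        (use 3 in \<open>auto simp: possq_def max_def\<close>)
    then show ?thesis using 3 by simp
  qed
qed

text \<open>Equal to 0 within r/2 of a and to 1 beyond r. The constant 3 r^2 / 4 is r^2 - (r/2)^2,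
  the inner argument at distance r/2: the normalised inner term is at least 1 on the half ball, and
  the outer positive part cuts it off there.\<close>

definition cutoff :: "real^3 \<Rightarrow> real \<Rightarrow> real^3 \<Rightarrow> real" where
  "cutoff a r x = possq (1 + (- inverse ((3 * r\<^sup>2 / 4)\<^sup>2)) * possq (r\<^sup>2 - (norm (x - a))\<^sup>2))"

lemma cutoff_C1: "\<exists>G. C1_grad (cutoff a r) G"
proof -
  have c: "continuous_on UNIV (\<lambda>t::real. 2 * max 0 t)" by (intro continuous_intros)
  have p: "\<exists>G. C1_grad (\<lambda>x. possq (f x)) G" if "\<exists>G. C1_grad f G" for f
    using that C1_grad_chain[OF _ possq_deriv c] by blast
  have m: "\<exists>G. C1_grad (\<lambda>x. 1 + k * f x) G" if "\<exists>G. C1_grad f G" for f k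
    using that C1_grad_add[OF C1_grad_const C1_grad_mult[OF C1_grad_const]] by blast
  have b: "\<exists>G. C1_grad (\<lambda>x. r\<^sup>2 - (norm (x - a))\<^sup>2) G"
    using C1_grad_ball by blast
  show ?thesis unfolding cutoff_def[abs_def] by (rule p[OF m[OF p[OF b]]])
qed

lemma cutoff_eq_0:
  assumes "0 < r" "norm (x - a) \<le> r / 2"
  shows "cutoff a r x = 0"
proof -
  have "(norm (x - a))\<^sup>2 \<le> (r / 2)\<^sup>2" using assms(2) by (intro power_mono) auto
  then have b: "3 * r\<^sup>2 / 4 \<le> r\<^sup>2 - (norm (x - a))\<^sup>2" by (simp add: power_divide)
  have p: "0 < 3 * r\<^sup>2 / 4" using assms(1) by simp
  have "(3 * r\<^sup>2 / 4)\<^sup>2 \<le> possq (r\<^sup>2 - (norm (x - a))\<^sup>2)"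
  proof -
    have "max 0 (r\<^sup>2 - (norm (x - a))\<^sup>2) = r\<^sup>2 - (norm (x - a))\<^sup>2" using b p by (intro max_absorb2) linarith
    then show ?thesis unfolding possq_def using b p by (simp only:) (intro power_mono; simp)
  qed
  then have "1 \<le> inverse ((3 * r\<^sup>2 / 4)\<^sup>2) * possq (r\<^sup>2 - (norm (x - a))\<^sup>2)"
    using p by (simp add: field_simps)
  then show ?thesis by (simp add: cutoff_def possq_def)
qed

lemma cutoff_eq_1: "0 < r \<Longrightarrow> r \<le> norm (x - a) \<Longrightarrow> cutoff a r x = 1"
proof -
  assume "0 < r" "r \<le> norm (x - a)"
  then have "r\<^sup>2 \<le> (norm (x - a))\<^sup>2" by (intro power_mono) auto
  then show ?thesis by (simp add: cutoff_def possq_def)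
qed

text \<open>Replaces a partition of unity: \<psi> = \<psi> c_j + \<psi> (1 - c_j) splits off one
  localised piece at a time, and only the remainder, \<psi> times the product of all c_j, is left to
  be checked.\<close>

lemma local_to_global:
  assumes "finite J" and c: "\<And>j. \<exists>G. C1_grad (c j) G"
    and loc: "\<And>\<psi> j. j \<in> J \<Longrightarrow> \<exists>G. C1_grad \<psi> G \<Longrightarrow> P (\<lambda>x. \<psi> x * (1 - c j x))"
    and add: "\<And>f g. \<exists>G. C1_grad f G \<Longrightarrow> \<exists>G. C1_grad g G \<Longrightarrow> P f \<Longrightarrow> P g \<Longrightarrow> P (\<lambda>x. f x + g x)"
  shows "\<exists>G. C1_grad \<psi> G \<Longrightarrow> P (\<lambda>x. \<psi> x * (\<Prod>j\<in>J. c j x)) \<Longrightarrow> P \<psi>"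
  using assms(1) loc
proof (induction J arbitrary: \<psi>)
  case empty
  then show ?case by simp
next
  case (insert j J)
  obtain G H where GH: "C1_grad \<psi> G" "C1_grad (c j) H" using insert.prems(1) c by blast
  have 1: "\<exists>G. C1_grad (\<lambda>x. \<psi> x * c j x) G" using C1_grad_mult[OF GH] by blast
  note C1_grad_add[OF C1_grad_const[of 1] C1_grad_mult[OF C1_grad_const[of "-1"] GH(2)]]
  from C1_grad_mult[OF GH(1) this] have 2: "\<exists>G. C1_grad (\<lambda>x. \<psi> x * (1 - c j x)) G" by auto
  have "P (\<lambda>x. \<psi> x * c j x * (\<Prod>j\<in>J. c j x))"
    using insert.prems(2) insert.hyps by (simp add: mult.assoc)
  then have "P (\<lambda>x. \<psi> x * c j x)" using insert.IH[OF 1] insert.prems(3) by blast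
  moreover have "P (\<lambda>x. \<psi> x * (1 - c j x))" by (rule insert.prems(3)[OF _ insert.prems(1)]) simp
  ultimately have "P (\<lambda>x. \<psi> x * c j x + \<psi> x * (1 - c j x))" by (rule add[OF 1 2])
  then show ?case by (simp add: algebra_simps)
qed

section \<open>Pairing a conforming field with a weak curl\<close>

context mesh
begin

lemma glue_0: "x \<notin> D \<Longrightarrow> glue q x = 0"
  unfolding glue_def using interior_cell_subset by (intro sum.neutral) (auto simp: indicator_def)

text \<open>In the interior the zero shift works. At a boundary point the shift is along -e,
  downwards in the local hypograph: a point of the closure lies weakly below the graph, hence
  strictly below after the shift, and the halved radius keeps it in the chart.\<close>

lemma local_shift:
  assumes x: "x \<in> closure D"
  shows "\<exists>r>0. \<exists>e. \<exists>t0>0. \<forall>y t. y \<in> closure D \<inter> cball x r \<longrightarrow> 0 < t \<longrightarrow> t < t0 \<longrightarrow> y + t *\<^sub>R e \<in> D"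
proof (cases "x \<in> D")
  case True
  then obtain r where "r > 0" "cball x r \<subseteq> D" using open_D open_contains_cball by blast
  then show ?thesis by (intro exI[of _ r] conjI exI[of _ 0] exI[of _ 1]) auto
next
  case False
  then have "x \<in> frontier D" using x open_D by (simp add: frontier_def interior_open)
  then obtain r e g L where r: "r > 0" "norm e = 1" "L-lipschitz_on {z. z \<bullet> e = 0} g"
    "D \<inter> ball x r = {y \<in> ball x r. y \<bullet> e < g (y - (y \<bullet> e) *\<^sub>R e)}"
    using lipschitz_D unfolding lipschitz_boundary_def by meson
  have ee: "e \<bullet> e = 1" using r(2) by (simp add: power2_norm_eq_inner[symmetric])
  have "y + t *\<^sub>R (- e) \<in> D" if y: "y \<in> closure D \<inter> cball x (r / 2)" and t: "0 < t" "t < r / 2" for y t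
  proof -
    have yb: "y \<in> ball x r" using y r(1) by auto
    have "y \<bullet> e \<le> g (y - (y \<bullet> e) *\<^sub>R e)" using hypograph_closure_le[OF r(2-4)] y yb by blast
    moreover have "dist x (y + t *\<^sub>R (- e)) \<le> dist x y + t"
      using dist_triangle[of x "y + t *\<^sub>R (- e)" y] r(2) t by (simp add: dist_norm)
    ultimately have "y + t *\<^sub>R (- e) \<in> {y \<in> ball x r. y \<bullet> e < g (y - (y \<bullet> e) *\<^sub>R e)}"
      using y t by (simp add: inner_diff_left inner_add_left ee algebra_simps)
    then show ?thesis unfolding r(4)[symmetric] by blast
  qed
  then show ?thesis using r(1) by (intro exI[of _ "r / 2"] conjI exI[of _ "- e"] exI[of _ "r / 2"]) auto
qed

text \<open>Localised by \<eta>, the zero extension of v has weak curl \<eta> curl v + grad \<eta>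
  \<times> v on the whole space, which \<open>weak_curl_pairing\<close> can pair with \<sigma>. The
  gradient terms cancel when the local identities add up to \<eta> = 1.\<close>

lemma H0curl_Pb_pairing:
  assumes v: "v \<in> Pc0 D \<T> m" and \<sigma>: "\<sigma> \<in> L2 D" "is_weak_curl D \<sigma> s"
  shows "ip D s v = ip D \<sigma> (curlh \<T> v)"
proof -
  have vP: "v \<in> Pb D \<T> m" using v by (auto simp: Pc0_def)
  have sL: "s \<in> L2 D" using \<sigma>(2) by (simp add: is_weak_curl_def)
  \<comment> \<open>Representatives are fixed pointwise, since continuity off the skeleton is a
    property of functions and not of their classes.\<close>
  define V where "V = glue (\<lambda>K. restr K v)"
  define W where "W = curlh \<T> v"
  have Wg: "W = glue (\<lambda>K. curl (restr K v))" by (simp add: W_def curlh_glue)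
  note Vp = glue_L2[of "\<lambda>K. restr K v", OF polys_continuous[OF PbD(2)[OF vP]], folded V_def]
  note Wp = glue_L2[of "\<lambda>K. curl (restr K v)", OF continuous_curl[OF polys_C1_jac[OF PbD(2)[OF vP]]], folded Wg]
  have V0: "V x = 0" "W x = 0" if "x \<notin> D" for x using glue_0[OF that] by (simp_all add: V_def Wg)
  obtain MV where MV: "\<And>x. norm (V x) \<le> MV" using Vp(3) unfolding bounded_iff by blast
  obtain MW where MW: "\<And>x. norm (W x) \<le> MW" using Wp(3) unfolding bounded_iff by blast
  have Vv: "ip D a V = ip D a v" if "a \<in> L2 D" for a
    using Pb_glue[OF vP] L2D(1)[OF that] L2D(1)[OF PbD(1)[OF vP]] L2D(1)[OF Vp(1)]
    by (intro ip_cong_AE) (auto simp: V_def elim: eventually_mono)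
  define u where "u \<eta> x = \<eta> x *\<^sub>R V x" for \<eta> :: "real^3 \<Rightarrow> real" and x
  define w where "w \<eta> X x = \<eta> x *\<^sub>R W x + cross3 (X x) (V x)" for \<eta> :: "real^3 \<Rightarrow> real" and X x
  have um: "u \<eta> \<in> borel_measurable borel" and wm: "w \<eta> X \<in> borel_measurable borel" if "C1_grad \<eta> X" for \<eta> X
  proof -
    have [measurable]: "\<eta> \<in> borel_measurable borel" "X \<in> borel_measurable borel" "V \<in> borel_measurable borel" "W \<in> borel_measurable borel"
      using C1_gradD(2,3)[OF that] Vp(2) Wp(2) by (auto intro: borel_measurable_continuous_onI)
    show "u \<eta> \<in> borel_measurable borel" unfolding u_def by measurable
    have "(\<lambda>(a, b). cross3 a b) \<in> borel_measurable borel"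
      by (intro borel_measurable_continuous_onI) (auto simp: case_prod_unfold intro!: continuous_on_cross continuous_intros)
    then have "(\<lambda>p. cross3 (fst p) (snd p)) \<in> borel_measurable (borel \<Otimes>\<^sub>M borel)"
      by (simp add: borel_prod case_prod_unfold)
    from measurable_compose[OF measurable_Pair[of X borel borel V borel] this]
    have "(\<lambda>x. cross3 (X x) (V x)) \<in> borel_measurable borel" by simp
    then show "w \<eta> X \<in> borel_measurable borel" unfolding w_def by measurable
  qed
  have bnd: "\<exists>M. \<forall>x. norm (u \<eta> x) \<le> M \<and> norm (w \<eta> X x) \<le> M" if C: "C1_grad \<eta> X" for \<eta> X
  proof -
    obtain R where R: "D \<subseteq> ball 0 R" using bounded_subset_ballD[OF bounded_D] by blast
    obtain M1 where M1: "0 \<le> M1" "\<And>x. norm x \<le> R \<Longrightarrow> norm (\<eta> x) \<le> M1"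
      using continuous_bounded_cball[OF C1_gradD(3)[OF C]] by blast
    obtain M2 where M2: "0 \<le> M2" "\<And>x. norm x \<le> R \<Longrightarrow> norm (X x) \<le> M2"
      using continuous_bounded_cball[OF C1_gradD(2)[OF C]] by blast
    have cross_zero: "cross3 a 0 = 0" for a by (simp add: cross3_simps)
    have nn: "0 \<le> MV" "0 \<le> MW" using MV MW norm_ge_zero order_trans by blast+
    have "norm (u \<eta> x) \<le> M1 * MV + (M1 * MW + M2 * MV) \<and> norm (w \<eta> X x) \<le> M1 * MV + (M1 * MW + M2 * MV)" for x
    proof (cases "x \<in> D")
      case True
      then have "norm x \<le> R" using R by (auto simp: subset_iff less_imp_le)
      note m = M1(2)[OF this] M2(2)[OF this]
      have c: "norm (cross3 (X x) (V x)) \<le> norm (X x) * norm (V x)"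
      proof (rule power2_le_imp_le)
        show "(norm (cross3 (X x) (V x)))\<^sup>2 \<le> (norm (X x) * norm (V x))\<^sup>2"
          by (simp add: norm_cross power_mult_distrib)
      qed simp
      have "norm (u \<eta> x) \<le> M1 * MV"
        unfolding u_def norm_scaleR using m MV M1(1) by (intro mult_mono) auto
      moreover have "norm (\<eta> x *\<^sub>R W x) \<le> M1 * MW"
        unfolding norm_scaleR using m MW M1(1) by (intro mult_mono) auto
      moreover have "norm (cross3 (X x) (V x)) \<le> M2 * MV"
        using c m MV M2(1) by (intro order_trans[OF c] mult_mono) auto
      moreover have "0 \<le> M1 * MV" "0 \<le> M1 * MW" "0 \<le> M2 * MV" using nn M1(1) M2(1) by auto
      ultimately show ?thesis unfolding w_def
        using norm_triangle_ineq[of "\<eta> x *\<^sub>R W x" "cross3 (X x) (V x)"] by auto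
    next
      case False
      then show ?thesis using V0[OF False] nn M1(1) M2(1) by (simp add: u_def w_def cross_zero)
    qed
    then show ?thesis by blast
  qed
  have uL: "u \<eta> \<in> L2 D" and wL: "w \<eta> X \<in> L2 D" if C: "C1_grad \<eta> X" for \<eta> X
    using bnd[OF C] by (auto intro!: L2_bounded[OF D_lmeasurable] borel_lebesgue_on um[OF C] wm[OF C])
  \<comment> \<open>Quantifying over the gradient X, which is unique, makes P a predicate of \<eta>
    alone, as \<open>local_to_global\<close> expects.\<close>
  define P where "P \<eta> \<longleftrightarrow> (\<forall>X. C1_grad \<eta> X \<longrightarrow> ip D s (u \<eta>) = ip D \<sigma> (w \<eta> X))" for \<eta>
  have add: "P (\<lambda>x. f x + g x)" if fg: "\<exists>G. C1_grad f G" "\<exists>G. C1_grad g G" "P f" "P g" for f g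
    unfolding P_def
  proof (intro allI impI)
    fix X assume X: "C1_grad (\<lambda>x. f x + g x) X"
    obtain F G where FG: "C1_grad f F" "C1_grad g G" using fg by blast
    have XFG: "X = (\<lambda>x. F x + G x)" by (rule C1_grad_unique[OF X C1_grad_add[OF FG]])
    have "u (\<lambda>x. f x + g x) = (\<lambda>x. u f x + u g x)" by (simp add: u_def fun_eq_iff scaleR_add_left)
    moreover have "w (\<lambda>x. f x + g x) X = (\<lambda>x. w f F x + w g G x)"
      by (simp add: w_def fun_eq_iff scaleR_add_left XFG cross_add_left)
    moreover have "ip D s (u f) = ip D \<sigma> (w f F)" "ip D s (u g) = ip D \<sigma> (w g G)"
      using fg(3,4) FG by (auto simp: P_def)
    ultimately show "ip D s (u (\<lambda>x. f x + g x)) = ip D \<sigma> (w (\<lambda>x. f x + g x) X)"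
      using ip_add_right[OF uL[OF FG(1)] uL[OF FG(2)] sL] ip_add_right[OF wL[OF FG(1)] wL[OF FG(2)] \<sigma>(1)] by simp
  qed
  have loc: "P \<eta>" if r: "0 < t0" "\<And>y t. y \<in> closure D \<inter> cball a r \<Longrightarrow> 0 < t \<Longrightarrow> t < t0 \<Longrightarrow> y + t *\<^sub>R e \<in> D"
    and z: "\<And>x. x \<notin> cball a r \<Longrightarrow> \<eta> x = 0" for \<eta> a r e t0
    unfolding P_def
  proof (intro allI impI)
    fix X assume C: "C1_grad \<eta> X"
    let ?C = "closure D \<inter> cball a r"
    have X0: "X x = 0" if "x \<notin> cball a r" for x
      by (rule C1_grad_eq_0_open[OF C, of "- cball a r"]) (use that z in auto)
    have out: "u \<eta> x = 0" "w \<eta> X x = 0" if "x \<notin> ?C" for x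
    proof -
      have "x \<notin> cball a r \<or> x \<notin> D" using that closure_subset[of D] by blast
      then show "u \<eta> x = 0" "w \<eta> X x = 0"
        using z[of x] X0[of x] V0[of x] by (auto simp: u_def w_def cross3_def vec_eq_iff forall_3 vector_3)
    qed
    have ct: "isCont \<eta> x" "isCont X x" for x
      using C1_gradD(2,3)[OF C, of UNIV] by (simp_all add: continuous_on_eq_continuous_at)
    obtain M where M: "\<And>x. norm (u \<eta> x) \<le> M" "\<And>x. norm (w \<eta> X x) \<le> M" using bnd[OF C] by blast
    have nu: "nice_field ?C skel (u \<eta>)"
      unfolding nice_field_def
    proof (intro conjI allI impI)
      show "bounded (range (u \<eta>))" unfolding bounded_iff using M by blast
      show "isCont (u \<eta>) x" if "x \<notin> skel" for x
        unfolding u_def[abs_def] by (intro continuous_scaleR ct Vp(5) that)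
    qed (use um[OF C] out in auto)
    have nw: "nice_field ?C skel (w \<eta> X)"
      unfolding nice_field_def
    proof (intro conjI allI impI)
      show "bounded (range (w \<eta> X))" unfolding bounded_iff using M by blast
      show "isCont (w \<eta> X) x" if "x \<notin> skel" for x
        unfolding w_def[abs_def] by (intro continuous_add continuous_cross continuous_scaleR ct Vp(5) Wp(5) that)
    qed (use wm[OF C] out in auto)
    have toD: "(\<integral>y. b y \<bullet> c y \<partial>lborel) = ip D b c"
      if "b \<in> borel_measurable borel" "continuous_on UNIV c" "\<And>x. x \<notin> D \<Longrightarrow> b x = 0" for b c :: "real^3 \<Rightarrow> real^3"
      unfolding ip_def using that borel_measurable_continuous_onI[OF that(2)]
      by (intro lebesgue_on_integral_extend[symmetric] D_sets borel_measurable_inner) auto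
    show "ip D s (u \<eta>) = ip D \<sigma> (w \<eta> X)"
    proof (rule weak_curl_pairing[OF open_D bounded_D _ skel(1) r(1) r(2) nu nw _ \<sigma>])
      show "compact ?C" using bounded_D by (intro closed_Int_compact) auto
      fix \<psi> J assume J: "C1_jac \<psi> J"
      note JX = C1_jac_scaleR[OF C J]
      \<comment> \<open>The product rule moves \<eta> onto the smooth field, so that
        \<open>Pc0_by_parts\<close> applies to \<eta> \<psi>.\<close>
      have crl: "\<eta> y *\<^sub>R crl (\<lambda>i. J i y) = curl (\<lambda>x. \<eta> x *\<^sub>R \<psi> x) y - cross3 (X y) (\<psi> y)" for y
        by (simp add: C1_jac_curl[OF JX] crl_add crl_scaleR crl_scaleR_vec)
      have cc: "continuous_on UNIV (\<lambda>y. cross3 (X y) (\<psi> y))"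
        by (intro continuous_on_cross C1_gradD(2)[OF C] C1_jacD(3)[OF J])
      have cj: "continuous_on UNIV (\<lambda>y. crl (\<lambda>i. J i y))" by (intro continuous_on_crl C1_jacD(2)[OF J])
      have L: "curl (\<lambda>x. \<eta> x *\<^sub>R \<psi> x) \<in> L2 D" "(\<lambda>y. cross3 (X y) (\<psi> y)) \<in> L2 D"
        "(\<lambda>x. \<eta> x *\<^sub>R \<psi> x) \<in> L2 D" "\<psi> \<in> L2 D"
        by (intro L2_continuous continuous_curl[OF JX] cc C1_jacD(3)[OF JX] C1_jacD(3)[OF J] bounded_D D_sets)+
      have u0: "u \<eta> x = 0" "w \<eta> X x = 0" if "x \<notin> D" for x
        using V0[OF that] by (auto simp: u_def w_def cross3_def vec_eq_iff forall_3 vector_3)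
      have "(\<integral>y. u \<eta> y \<bullet> crl (\<lambda>i. J i y) \<partial>lborel) = ip D (u \<eta>) (\<lambda>y. crl (\<lambda>i. J i y))"
        by (rule toD[OF um[OF C] cj u0(1)])
      also have "\<dots> = ip D V (\<lambda>y. curl (\<lambda>x. \<eta> x *\<^sub>R \<psi> x) y - cross3 (X y) (\<psi> y))"
        unfolding crl[symmetric] ip_def u_def by simp
      also have "\<dots> = ip D V (curl (\<lambda>x. \<eta> x *\<^sub>R \<psi> x)) - ip D V (\<lambda>y. cross3 (X y) (\<psi> y))"
        by (rule ip_diff_right[OF L(1,2) Vp(1)])
      also have "ip D V (curl (\<lambda>x. \<eta> x *\<^sub>R \<psi> x)) = ip D v (curl (\<lambda>x. \<eta> x *\<^sub>R \<psi> x))"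
        using Vv[OF L(1)] by (simp add: ip_commute)
      also have "\<dots> = ip D W (\<lambda>x. \<eta> x *\<^sub>R \<psi> x)"
        unfolding W_def by (rule Pc0_by_parts[OF v JX])
      also have "\<dots> = ip D (\<lambda>x. \<eta> x *\<^sub>R W x) \<psi>" by (simp add: ip_def)
      also have "ip D V (\<lambda>y. cross3 (X y) (\<psi> y)) = - ip D (\<lambda>y. cross3 (X y) (V y)) \<psi>"
      proof -
        have "V y \<bullet> cross3 (X y) (\<psi> y) = - (cross3 (X y) (V y) \<bullet> \<psi> y)" for y by (simp add: cross3_simps)
        then show ?thesis by (simp add: ip_def)
      qed
      also have "ip D (\<lambda>x. \<eta> x *\<^sub>R W x) \<psi> - - ip D (\<lambda>y. cross3 (X y) (V y)) \<psi> = ip D (w \<eta> X) \<psi>"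
      proof -
        have a: "(\<lambda>x. \<eta> x *\<^sub>R W x) \<in> L2 D"
        proof -
          have [measurable]: "\<eta> \<in> borel_measurable borel" "W \<in> borel_measurable borel"
            using C1_gradD(3)[OF C] Wp(2) by (auto intro: borel_measurable_continuous_onI)
          obtain R where R: "D \<subseteq> ball 0 R" using bounded_subset_ballD[OF bounded_D] by blast
          obtain M1 where M1: "0 \<le> M1" "\<And>x. norm x \<le> R \<Longrightarrow> norm (\<eta> x) \<le> M1"
            using continuous_bounded_cball[OF C1_gradD(3)[OF C]] by blast
          have mm: "(\<lambda>x. \<eta> x *\<^sub>R W x) \<in> borel_measurable borel" by measurable
          show ?thesis
          proof (rule L2_bounded[OF D_lmeasurable borel_lebesgue_on[OF mm]])
            fix x assume "x \<in> D"
            then have "norm x \<le> R" using R by (auto simp: subset_iff less_imp_le)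
            then show "norm (\<eta> x *\<^sub>R W x) \<le> M1 * MW"
              unfolding norm_scaleR using M1 MW by (intro mult_mono) auto
          qed
        qed
        have b: "(\<lambda>y. cross3 (X y) (V y)) \<in> L2 D"
          using L2_diff[OF wL[OF C] a] by (simp add: w_def)
        show ?thesis using ip_add_left[OF a b L(4)] by (simp add: w_def[abs_def])
      qed
      also have "\<dots> = (\<integral>y. w \<eta> X y \<bullet> \<psi> y \<partial>lborel)"
        by (rule toD[OF wm[OF C] C1_jacD(3)[OF J] u0(2), symmetric])
      finally show "(\<integral>y. u \<eta> y \<bullet> crl (\<lambda>i. J i y) \<partial>lborel) = (\<integral>y. w \<eta> X y \<bullet> \<psi> y \<partial>lborel)" .
    qed
  qed
  have "\<forall>x\<in>closure D. \<exists>r e t0. 0 < r \<and> 0 < t0 \<and> (\<forall>y t. y \<in> closure D \<inter> cball x r \<longrightarrow> 0 < t \<longrightarrow> t < t0 \<longrightarrow> y + t *\<^sub>R e \<in> D)"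
    using local_shift by meson
  then obtain r e t0 where r: "\<And>x. x \<in> closure D \<Longrightarrow> 0 < r x" "\<And>x. x \<in> closure D \<Longrightarrow> 0 < t0 x"
    "\<And>x y t. x \<in> closure D \<Longrightarrow> y \<in> closure D \<inter> cball x (r x) \<Longrightarrow> 0 < t \<Longrightarrow> t < t0 x \<Longrightarrow> y + t *\<^sub>R e x \<in> D"
    by metis
  have cpt: "compact (closure D)" using bounded_D by simp
  have cov: "closure D \<subseteq> (\<Union>x\<in>closure D. ball x (r x / 2))"
    using r(1) by (auto intro!: bexI)
  obtain J where J: "J \<subseteq> closure D" "finite J" "closure D \<subseteq> (\<Union>x\<in>J. ball x (r x / 2))"
    by (rule compactE_image[OF cpt _ cov]) auto
  \<comment> \<open>Each point of D lies in one of the half balls, and the cutoff of that ball is 0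
    there.\<close>
  have prod0: "(\<Prod>j\<in>J. cutoff j (r j) x) = 0" if "x \<in> D" for x
  proof -
    have "x \<in> closure D" by (rule closure_subset[THEN subsetD, OF that])
    then have "x \<in> (\<Union>x\<in>J. ball x (r x / 2))" by (rule J(3)[THEN subsetD])
    then obtain j where "j \<in> J" "x \<in> ball j (r j / 2)" by (rule UN_E)
    then have "cutoff j (r j) x = 0"
      using r(1) J(1) by (intro cutoff_eq_0) (auto simp: dist_norm norm_minus_commute)
    then show ?thesis using J(2) \<open>j \<in> J\<close> by (auto simp: prod_zero_iff)
  qed
  have "P (\<lambda>x. 1)"
  proof (rule local_to_global[OF J(2), of "\<lambda>j. cutoff j (r j)"])
    show "\<exists>G. C1_grad (cutoff j (r j)) G" for j by (rule cutoff_C1)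
    show "\<exists>G. C1_grad (\<lambda>x::real^3. 1::real) G" using C1_grad_const by blast
    show "P (\<lambda>x. f x + g x)" if "\<exists>G. C1_grad f G" "\<exists>G. C1_grad g G" "P f" "P g" for f g
      by (rule add[OF that])
    show "P (\<lambda>x. \<psi> x * (1 - cutoff j (r j) x))" if j: "j \<in> J" for \<psi> j
    proof (rule loc[of "t0 j" j "r j" "e j"])
      have jD: "j \<in> closure D" using j J(1) by blast
      show "0 < t0 j" by (rule r(2)[OF jD])
      show "y + t *\<^sub>R e j \<in> D" if "y \<in> closure D \<inter> cball j (r j)" "0 < t" "t < t0 j" for y t
        by (rule r(3)[OF jD that])
      show "\<psi> x * (1 - cutoff j (r j) x) = 0" if "x \<notin> cball j (r j)" for x
        using cutoff_eq_1[OF r(1)[OF jD], of x j] that by (simp add: dist_norm norm_minus_commute)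
    qed
    show "P (\<lambda>x. 1 * (\<Prod>j\<in>J. cutoff j (r j) x))"
      unfolding P_def
    proof (intro allI impI)
      let ?f = "\<lambda>x. 1 * (\<Prod>j\<in>J. cutoff j (r j) x)"
      fix X assume X: "C1_grad ?f X"
      \<comment> \<open>On the open set D the remainder is constantly 0, so its gradient is 0 as
        well; outside D the fields V and W vanish. Both sides are therefore integrals of 0.\<close>
      have X0: "X x = 0" if "x \<in> D" for x
        by (rule C1_grad_eq_0_open[OF X open_D that]) (simp add: prod0)
      have "u ?f x = 0" "w ?f X x = 0" for x
        using prod0[of x] X0[of x] V0[of x]
        by (cases "x \<in> D"; simp add: u_def w_def cross3_def vec_eq_iff forall_3 vector_3)+
      then show "ip D s (u ?f) = ip D \<sigma> (w ?f X)" by (simp add: ip_def)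
    qed
  qed
  then have "ip D s (u (\<lambda>x. 1)) = ip D \<sigma> (w (\<lambda>x. 1) (\<lambda>x. 0))" using C1_grad_const by (simp add: P_def)
  moreover have "u (\<lambda>x. 1) = V" by (simp add: u_def fun_eq_iff)
  moreover have "w (\<lambda>x. 1) (\<lambda>x. 0) = W" by (simp add: w_def fun_eq_iff cross3_def vec_eq_iff forall_3 vector_3)
  ultimately show ?thesis using Vv[OF sL] by (simp add: W_def)
qed

end

section \<open>The lifting\<close>

text \<open>The common core of the Cauchy-Schwarz inequalities below; the degenerate case c = 0 is
  included so that it serves semidefinite forms.\<close>

lemma quadratic_nonneg_discriminant:
  fixes a b c :: real
  assumes "\<And>t. 0 \<le> a + 2 * t * b + t\<^sup>2 * c" "0 \<le> c"
  shows "b\<^sup>2 \<le> a * c"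
proof (cases "c = 0")
  case True
  have "b = 0"
  proof (rule ccontr)
    assume "b \<noteq> 0"
    \<comment> \<open>At this t the affine function a + 2 t b equals -1.\<close>
    then show False using assms(1)[of "- (a + 1) / (2 * b)"] True by (simp add: field_simps)
  qed
  then show ?thesis using True by simp
next
  case False
  then have "0 < c" using assms(2) by simp
  \<comment> \<open>The minimiser t = - b / c of the quadratic is inserted.\<close>
  have "0 \<le> a + 2 * (- b / c) * b + (- b / c)\<^sup>2 * c" by (rule assms(1))
  also have "\<dots> = a - b\<^sup>2 / c" using \<open>0 < c\<close> by (simp add: power2_eq_square field_simps)
  finally show ?thesis using \<open>0 < c\<close> by (simp add: field_simps)
qed

text \<open>Finite-dimensional Riesz representation: a consistent linear system with a positive
  semidefinite Gram matrix is solvable.\<close>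

lemma gram_system_solvable:
  fixes G :: "'i \<Rightarrow> 'i \<Rightarrow> real"
  assumes "finite I" and sym: "\<And>i j. G i j = G j i"
    and psd: "\<And>J a. finite J \<Longrightarrow> J \<subseteq> I \<Longrightarrow> 0 \<le> (\<Sum>i\<in>J. \<Sum>j\<in>J. a i * a j * G i j)"
    and l: "\<And>a. (\<Sum>i\<in>I. \<Sum>j\<in>I. a i * a j * G i j) = 0 \<Longrightarrow> (\<Sum>i\<in>I. a i * l i) = 0"
  shows "\<exists>a. \<forall>i\<in>I. (\<Sum>j\<in>I. a j * G j i) = l i"
  using assms(1) psd l
proof (induction I arbitrary: l)
  case empty
  then show ?case by simp
next
  case (insert k I)
  \<comment> \<open>Semidefiniteness is assumed on all subsets J so that it passes to the smaller
    index set.\<close>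
  have psdI: "0 \<le> (\<Sum>i\<in>J. \<Sum>j\<in>J. a i * a j * G i j)" if "finite J" "J \<subseteq> I" for J and a :: "'i \<Rightarrow> real"
    using insert.prems(1)[of J a] that by blast
  define Q where "Q a = (\<Sum>i\<in>I. \<Sum>j\<in>I. a i * a j * G i j)" for a :: "'i \<Rightarrow> real"
  have expand: "(\<Sum>i\<in>insert k I. \<Sum>j\<in>insert k I. a i * a j * G i j)
      = a k * a k * G k k + 2 * a k * (\<Sum>i\<in>I. a i * G k i) + Q a" for a
  proof -
    have e: "(\<Sum>i\<in>I. a i * a k * G i k) = a k * (\<Sum>i\<in>I. a i * G k i)"
      unfolding sum_distrib_left by (intro sum.cong refl) (simp add: sym[of _ k])
    have e': "(\<Sum>j\<in>I. a k * a j * G k j) = a k * (\<Sum>i\<in>I. a i * G k i)"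
      unfolding sum_distrib_left by (intro sum.cong refl) simp
    show ?thesis using insert.hyps by (simp add: sum.distrib e e' Q_def)
  qed
  have Qcong: "Q a = Q b" if "\<And>i. i \<in> I \<Longrightarrow> a i = b i" for a b
    unfolding Q_def using that by (intro sum.cong) auto
  \<comment> \<open>p holds the coefficients of the projection of vector k onto the span of the
    others; the Cauchy-Schwarz inequality for the semidefinite form gives the consistency that the
    induction hypothesis demands.\<close>
  obtain p where p: "\<And>i. i \<in> I \<Longrightarrow> (\<Sum>j\<in>I. p j * G j i) = G k i"
  proof -
    have "(\<Sum>i\<in>I. a i * G k i) = 0" if z: "(\<Sum>i\<in>I. \<Sum>j\<in>I. a i * a j * G i j) = 0" for a
    proof -
      have "0 \<le> Q a + 2 * t * (\<Sum>i\<in>I. a i * G k i) + t\<^sup>2 * G k k" for t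
      proof -
        obtain b where b: "b k = t" "\<And>i. i \<in> I \<Longrightarrow> b i = a i"
          using insert.hyps by (intro that[of "a(k := t)"]) auto
        have "Q b = Q a" using b(2) by (intro Qcong) auto
        moreover have "(\<Sum>i\<in>I. b i * G k i) = (\<Sum>i\<in>I. a i * G k i)" using b(2) by (intro sum.cong) auto
        moreover have "0 \<le> (\<Sum>i\<in>insert k I. \<Sum>j\<in>insert k I. b i * b j * G i j)"
          using insert.hyps by (intro insert.prems(1)) auto
        ultimately show ?thesis unfolding expand by (simp add: b(1) power2_eq_square)
      qed
      moreover have "0 \<le> G k k"
        using insert.prems(1)[of "{k}" "\<lambda>_. 1"] by simp
      ultimately have "(\<Sum>i\<in>I. a i * G k i)\<^sup>2 \<le> Q a * G k k" by (rule quadratic_nonneg_discriminant)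
      then show ?thesis using z by (simp add: Q_def)
    qed
    from insert.IH[OF psdI this] show thesis using that by blast
  qed
  \<comment> \<open>Vector k minus its projection: orthogonal to all others by \<open>c0\<close>,
    with squared length \<gamma>.\<close>
  define c where "c i = (if i = k then 1 else - p i)" for i
  have c0: "(\<Sum>j\<in>insert k I. c j * G j i) = 0" if "i \<in> I" for i
  proof -
    have "(\<Sum>j\<in>I. c j * G j i) = - (\<Sum>j\<in>I. p j * G j i)"
      unfolding sum_negf[symmetric] using insert.hyps by (intro sum.cong) (auto simp: c_def)
    then show ?thesis using insert.hyps p[OF that] by (simp add: c_def)
  qed
  define \<gamma> where "\<gamma> = (\<Sum>j\<in>insert k I. c j * G j k)"
  have c\<gamma>: "(\<Sum>i\<in>insert k I. \<Sum>j\<in>insert k I. c i * c j * G i j) = \<gamma>"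
  proof -
    have "(\<Sum>i\<in>insert k I. \<Sum>j\<in>insert k I. c i * c j * G i j) = (\<Sum>i\<in>insert k I. c i * (\<Sum>j\<in>insert k I. c j * G j i))"
      unfolding sum_distrib_left by (intro sum.cong refl) (simp add: sym)
    also have "\<dots> = c k * \<gamma>" using insert.hyps c0 by (simp add: \<gamma>_def)
    finally show ?thesis by (simp add: c_def)
  qed
  obtain a0 where a0: "\<And>i. i \<in> I \<Longrightarrow> (\<Sum>j\<in>I. a0 j * G j i) = l i"
  proof -
    have "(\<Sum>i\<in>I. a i * l i) = 0" if z: "(\<Sum>i\<in>I. \<Sum>j\<in>I. a i * a j * G i j) = 0" for a
    proof -
      let ?a = "a(k := 0)"
      have "Q ?a = Q a" using insert.hyps by (intro Qcong) auto
      then have "(\<Sum>i\<in>insert k I. \<Sum>j\<in>insert k I. ?a i * ?a j * G i j) = 0"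
        unfolding expand using z by (simp add: Q_def)
      then have "(\<Sum>i\<in>insert k I. ?a i * l i) = 0" by (rule insert.prems(2))
      moreover have "(\<Sum>i\<in>I. ?a i * l i) = (\<Sum>i\<in>I. a i * l i)" using insert.hyps by (intro sum.cong) auto
      ultimately show ?thesis using insert.hyps by simp
    qed
    from insert.IH[OF psdI this] show thesis using that by blast
  qed
  define g where "g = (\<Sum>j\<in>I. a0 j * G j k)"
  \<comment> \<open>The correction along c adjusts equation k and leaves the others alone. If
    \<gamma> = 0, the quotient is 0 by convention, and consistency applied to c shows that equation
    k holds already.\<close>
  define t where "t = (l k - g) / \<gamma>"
  have key: "g + t * \<gamma> = l k"
  proof (cases "\<gamma> = 0")
    case True
    then have "(\<Sum>i\<in>insert k I. c i * l i) = 0" using insert.prems(2)[of c] c\<gamma> by simp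
    moreover have "(\<Sum>i\<in>I. c i * l i) = - (\<Sum>i\<in>I. p i * l i)"
      unfolding sum_negf[symmetric] using insert.hyps by (intro sum.cong) (auto simp: c_def)
    ultimately have lk: "l k = (\<Sum>i\<in>I. p i * l i)" using insert.hyps by (simp add: c_def)
    have "g = (\<Sum>j\<in>I. a0 j * (\<Sum>i\<in>I. p i * G i j))"
      unfolding g_def using p by (intro sum.cong refl) (simp add: sym[of _ k])
    also have "\<dots> = (\<Sum>i\<in>I. p i * (\<Sum>j\<in>I. a0 j * G j i))"
      unfolding sum_distrib_left by (subst sum.swap) (simp add: sym mult.left_commute)
    also have "\<dots> = l k" unfolding lk using a0 by simp
    finally show ?thesis using True by simp
  qed (simp add: t_def)
  define a where "a j = (if j = k then 0 else a0 j) + t * c j" for j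
  have a: "(\<Sum>j\<in>insert k I. a j * G j i) = (\<Sum>j\<in>I. a0 j * G j i) + t * (\<Sum>j\<in>insert k I. c j * G j i)" for i
  proof -
    have "(\<Sum>j\<in>insert k I. a j * G j i) = (\<Sum>j\<in>insert k I. (if j = k then 0 else a0 j) * G j i + t * (c j * G j i))"
      by (intro sum.cong) (auto simp: a_def algebra_simps)
    also have "\<dots> = (\<Sum>j\<in>insert k I. (if j = k then 0 else a0 j) * G j i) + t * (\<Sum>j\<in>insert k I. c j * G j i)"
      by (simp only: sum.distrib sum_distrib_left)
    also have "(\<Sum>j\<in>insert k I. (if j = k then 0 else a0 j) * G j i) = (\<Sum>j\<in>I. a0 j * G j i)"
      using insert.hyps by (simp, intro sum.cong) auto
    finally show ?thesis .
  qed
  have "\<forall>i\<in>insert k I. (\<Sum>j\<in>insert k I. a j * G j i) = l i"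
    unfolding a using c0 a0 key by (auto simp: \<gamma>_def[symmetric] g_def[symmetric])
  then show ?case by blast
qed

text \<open>Only the tangential part of q enters a triple product with n, and it is the same on both
  sides; it may thus be replaced by that of the average.\<close>

lemma cross_average:
  fixes n p p' q q' :: "real^3"
  assumes "cross3 q n = cross3 q' n"
  shows "n \<bullet> cross3 p q - n \<bullet> cross3 p' q' = (-1) * ((cross3 p n - cross3 p' n) \<bullet> ((1/2) *\<^sub>R (q + q')))"
proof -
  have 1: "n \<bullet> cross3 a b = a \<bullet> cross3 b n" for a b :: "real^3" by (simp add: cross3_simps)
  have 2: "cross3 a n \<bullet> b = - (a \<bullet> cross3 b n)" for a b :: "real^3" by (simp add: cross3_simps)
  have "(cross3 p n - cross3 p' n) \<bullet> ((1/2) *\<^sub>R (q + q'))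
      = (1/2) * (cross3 p n \<bullet> q + cross3 p n \<bullet> q' - cross3 p' n \<bullet> q - cross3 p' n \<bullet> q')"
    by (simp add: inner_diff_left inner_add_right algebra_simps)
  also have "\<dots> = p' \<bullet> cross3 q n - p \<bullet> cross3 q n" unfolding 2 assms by simp
  finally show ?thesis unfolding 1[of p q] 1[of p' q'] assms by simp
qed

section \<open>Riesz representation of the jump form\<close>

context mesh
begin

abbreviation "avg \<equiv> average \<T> Kl Kr"

lemma avg_continuous:
  assumes "\<phi> \<in> Pb D \<T> m" "F \<in> faces \<T>"
  shows "continuous_on UNIV (avg F \<phi>)"
proof -
  have "continuous_on UNIV (restr (Kl F) \<phi>)"
    using face_cell(1)[OF assms(2)] by (intro polys_continuous[OF PbD(2)[OF assms(1)]]) simp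
  moreover have "continuous_on UNIV (restr (Kr F) \<phi>)" if "F \<in> interfaces \<T>"
    using face_cell(2)[OF that] by (intro polys_continuous[OF PbD(2)[OF assms(1)]]) simp
  ultimately show ?thesis
    by (cases "F \<in> interfaces \<T>") (auto simp: average_def[abs_def] intro!: continuous_intros)
qed

definition jump_form :: "(real^3 \<Rightarrow> real^3) \<Rightarrow> (real^3 \<Rightarrow> real^3) \<Rightarrow> real" where
  "jump_form v \<phi> = face_sum (\<lambda>F x. jmp F v x \<bullet> avg F \<phi> x)"

lemma jump_form_cong:
  assumes "\<And>K. K \<in> \<T> \<Longrightarrow> restr K \<phi> = restr K \<psi>"
  shows "jump_form v \<phi> = jump_form v \<psi>"
proof -
  have "avg F \<phi> = avg F \<psi>" if "F \<in> faces \<T>" for F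
    using assms face_cell(1)[OF that] face_cell(2)[of F] by (auto simp: average_def fun_eq_iff)
  then show ?thesis by (simp add: jump_form_def face_sum_def)
qed

lemma jump_form_add:
  assumes v: "v \<in> Pb D \<T> k" and \<phi>: "\<phi> \<in> Pb D \<T> m" "\<psi> \<in> Pb D \<T> m"
  shows "jump_form v (\<lambda>x. \<phi> x + \<psi> x) = jump_form v \<phi> + jump_form v \<psi>"
  unfolding jump_form_def face_sum_def sum.distrib[symmetric]
proof (rule sum.cong[OF refl])
  fix F assume F: "F \<in> faces \<T>"
  note l = face_cell(1)[OF F]
  have "avg F (\<lambda>x. \<phi> x + \<psi> x) x = avg F \<phi> x + avg F \<psi> x" for x
    using l face_cell(2)[of F] Pb_add(2)[OF \<phi>] by (simp add: average_def scaleR_add_right)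
  then show "face_integral F (\<lambda>x. jmp F v x \<bullet> avg F (\<lambda>x. \<phi> x + \<psi> x) x) =
    face_integral F (\<lambda>x. jmp F v x \<bullet> avg F \<phi> x) + face_integral F (\<lambda>x. jmp F v x \<bullet> avg F \<psi> x)"
    using l by (simp add: inner_add_right)
      (intro face_integral_add[of "Kl F"] cell continuous_on_inner avg_continuous[OF \<phi>(1) F] avg_continuous[OF \<phi>(2) F]
        polys_continuous[OF jump_polys[OF v F]]; simp)
qed

lemma jump_form_scaleR:
  assumes \<phi>: "\<phi> \<in> Pb D \<T> m"
  shows "jump_form v (\<lambda>x. r *\<^sub>R \<phi> x) = r * jump_form v \<phi>"
  unfolding jump_form_def face_sum_def sum_distrib_left
proof (rule sum.cong[OF refl])
  fix F assume F: "F \<in> faces \<T>"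
  have "avg F (\<lambda>x. r *\<^sub>R \<phi> x) x = r *\<^sub>R avg F \<phi> x" for x
    using face_cell(1)[OF F] face_cell(2)[of F] Pb_scaleR(2)[OF \<phi>] by (simp add: average_def scaleR_add_right)
  then show "face_integral F (\<lambda>x. jmp F v x \<bullet> avg F (\<lambda>x. r *\<^sub>R \<phi> x) x) = r * face_integral F (\<lambda>x. jmp F v x \<bullet> avg F \<phi> x)"
    by (simp add: face_integral_cmult[symmetric])
qed

lemma Pb_zero: "(\<lambda>x. 0) \<in> Pb D \<T> m" "K \<in> \<T> \<Longrightarrow> restr K (\<lambda>x. 0) = (\<lambda>x. 0)"
proof -
  have "(\<lambda>x. 0) \<in> L2 D" by (rule L2_bounded[OF D_lmeasurable, of _ 0]) auto
  note I = PbI[of "\<lambda>x. 0" "\<lambda>K x. 0" m, OF this polys_zero]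
  show "(\<lambda>x. 0) \<in> Pb D \<T> m" by (rule I(1)) simp
  show "K \<in> \<T> \<Longrightarrow> restr K (\<lambda>x. 0) = (\<lambda>x. 0)" by (rule I(2)) simp_all
qed

lemma Pb_sum:
  assumes "finite I" "\<And>i. i \<in> I \<Longrightarrow> b i \<in> Pb D \<T> m"
  shows "(\<lambda>x. \<Sum>i\<in>I. a i *\<^sub>R b i x) \<in> Pb D \<T> m \<and>
    (\<forall>K\<in>\<T>. restr K (\<lambda>x. \<Sum>i\<in>I. a i *\<^sub>R b i x) = (\<lambda>x. \<Sum>i\<in>I. a i *\<^sub>R restr K (b i) x)) \<and>
    (\<forall>v\<in>Pb D \<T> k. jump_form v (\<lambda>x. \<Sum>i\<in>I. a i *\<^sub>R b i x) = (\<Sum>i\<in>I. a i * jump_form v (b i)))"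
  using assms
proof (induction I rule: finite_induct)
  case empty
  have "jump_form v (\<lambda>x. 0) = 0" for v
    using jump_form_scaleR[OF Pb_zero(1), of v 0] by simp
  then show ?case using Pb_zero by simp
next
  case (insert j I)
  have b: "b j \<in> Pb D \<T> m" using insert.prems by simp
  have IH: "(\<lambda>x. \<Sum>i\<in>I. a i *\<^sub>R b i x) \<in> Pb D \<T> m"
    "\<And>K. K \<in> \<T> \<Longrightarrow> restr K (\<lambda>x. \<Sum>i\<in>I. a i *\<^sub>R b i x) = (\<lambda>x. \<Sum>i\<in>I. a i *\<^sub>R restr K (b i) x)"
    "\<And>v. v \<in> Pb D \<T> k \<Longrightarrow> jump_form v (\<lambda>x. \<Sum>i\<in>I. a i *\<^sub>R b i x) = (\<Sum>i\<in>I. a i * jump_form v (b i))"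
    using insert.IH insert.prems by auto
  note s = Pb_scaleR[OF b, where r = "a j"]
  show ?case
    using insert.hyps Pb_add[OF s(1) IH(1)] IH(2) s(2) jump_form_add[OF _ s(1) IH(1)] IH(3) jump_form_scaleR[OF b]
    by simp
qed

text \<open>Monomials times coordinate vectors, supported in one cell each: a finite spanning family
  of \<open>Pb\<close>, up to null sets.\<close>

definition basis_field :: "(real^3) set \<times> (3 \<Rightarrow> nat) \<times> 3 \<Rightarrow> real^3 \<Rightarrow> real^3" where
  "basis_field = (\<lambda>(K, \<alpha>, i). glue (\<lambda>K' x. if K' = K then (\<Prod>j\<in>UNIV. (x $ j) ^ \<alpha> j) *\<^sub>R axis i 1 else 0))"

definition basis_index :: "nat \<Rightarrow> ((real^3) set \<times> (3 \<Rightarrow> nat) \<times> 3) set" where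
  "basis_index m = \<T> \<times> {\<alpha>. sum \<alpha> UNIV \<le> m} \<times> UNIV"

lemma finite_basis_index: "finite (basis_index m)"
  using finite_mesh finite_multiindices by (simp add: basis_index_def)

lemma basis_field_Pb:
  assumes "(K, \<alpha>, i) \<in> basis_index m"
  shows "basis_field (K, \<alpha>, i) \<in> Pb D \<T> m"
    "K' \<in> \<T> \<Longrightarrow> restr K' (basis_field (K, \<alpha>, i)) = (\<lambda>x. if K' = K then (\<Prod>j\<in>UNIV. (x $ j) ^ \<alpha> j) *\<^sub>R axis i 1 else 0)"
proof -
  have p: "(\<lambda>x. (\<Prod>j\<in>UNIV. (x $ j) ^ \<alpha> j) *\<^sub>R axis i 1) \<in> polys m"
  proof (rule polysI[where c = "\<lambda>\<beta>. if \<beta> = \<alpha> then axis i 1 else 0"])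
    fix x :: "real^3"
    have "(\<Sum>\<beta> | sum \<beta> UNIV \<le> m. (\<Prod>j\<in>UNIV. (x $ j) ^ \<beta> j) *\<^sub>R (if \<beta> = \<alpha> then axis i 1 else 0))
      = (\<Sum>\<beta>\<in>{\<alpha>}. (\<Prod>j\<in>UNIV. (x $ j) ^ \<beta> j) *\<^sub>R (if \<beta> = \<alpha> then axis i 1 else (0 :: real^3)))"
      using assms by (intro sum.mono_neutral_right finite_multiindices) (auto simp: basis_index_def)
    then show "(\<Prod>j\<in>UNIV. (x $ j) ^ \<alpha> j) *\<^sub>R axis i 1 =
      (\<Sum>\<beta> | sum \<beta> UNIV \<le> m. (\<Prod>j\<in>UNIV. (x $ j) ^ \<beta> j) *\<^sub>R (if \<beta> = \<alpha> then axis i 1 else (0 :: real^3)))" by simp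
  qed
  have q: "(\<lambda>x. if K' = K then (\<Prod>j\<in>UNIV. (x $ j) ^ \<alpha> j) *\<^sub>R axis i 1 else 0) \<in> polys m" for K'
    using p polys_zero by (cases "K' = K") auto
  note G = glue_Pb[of "\<lambda>K' x. if K' = K then (\<Prod>j\<in>UNIV. (x $ j) ^ \<alpha> j) *\<^sub>R axis i 1 else 0" m, OF q]
  show "basis_field (K, \<alpha>, i) \<in> Pb D \<T> m" using G(1) by (simp add: basis_field_def)
  show "K' \<in> \<T> \<Longrightarrow> restr K' (basis_field (K, \<alpha>, i)) = (\<lambda>x. if K' = K then (\<Prod>j\<in>UNIV. (x $ j) ^ \<alpha> j) *\<^sub>R axis i 1 else 0)"
    using G(2)[of K'] by (simp add: basis_field_def)
qed

text \<open>Agreement is expressed through \<open>restr\<close> because members of \<open>Pb\<close>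
  are determined only almost everywhere; the inner product and the jump form depend on these
  polynomials alone.\<close>

lemma basis_expansion_Pb:
  assumes \<phi>: "\<phi> \<in> Pb D \<T> m"
  obtains a where "\<And>K. K \<in> \<T> \<Longrightarrow> restr K \<phi> = restr K (\<lambda>x. \<Sum>i\<in>basis_index m. a i *\<^sub>R basis_field i x)"
proof -
  have "\<forall>K\<in>\<T>. \<exists>c. restr K \<phi> = (\<lambda>x. \<Sum>\<alpha> | sum \<alpha> UNIV \<le> m. (\<Prod>i\<in>UNIV. (x $ i) ^ \<alpha> i) *\<^sub>R c \<alpha>)"
  proof
    fix K assume "K \<in> \<T>"
    from polysE[OF PbD(2)[OF \<phi> this]]
    show "\<exists>c. restr K \<phi> = (\<lambda>x. \<Sum>\<alpha> | sum \<alpha> UNIV \<le> m. (\<Prod>i\<in>UNIV. (x $ i) ^ \<alpha> i) *\<^sub>R c \<alpha>)" by blast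
  qed
  from bchoice[OF this] obtain c where
    c: "\<And>K. K \<in> \<T> \<Longrightarrow> restr K \<phi> = (\<lambda>x. \<Sum>\<alpha> | sum \<alpha> UNIV \<le> m. (\<Prod>i\<in>UNIV. (x $ i) ^ \<alpha> i) *\<^sub>R c K \<alpha>)"
    by blast
  define a where "a = (\<lambda>(K, \<alpha>, i). c K \<alpha> $ i)"
  have "basis_field i \<in> Pb D \<T> m" if "i \<in> basis_index m" for i
    using basis_field_Pb(1)[of "fst i" "fst (snd i)" "snd (snd i)" m] that by simp
  note S = Pb_sum[OF finite_basis_index this, where a = a]
  have "restr K \<phi> = restr K (\<lambda>x. \<Sum>i\<in>basis_index m. a i *\<^sub>R basis_field i x)" if K: "K \<in> \<T>" for K
  proof
    fix x
    have "restr K (\<lambda>x. \<Sum>i\<in>basis_index m. a i *\<^sub>R basis_field i x) x = (\<Sum>i\<in>basis_index m. a i *\<^sub>R restr K (basis_field i) x)"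
      using S K by simp
    also have "\<dots> = (\<Sum>K'\<in>\<T>. \<Sum>\<alpha> | sum \<alpha> UNIV \<le> m. \<Sum>i\<in>UNIV. a (K', \<alpha>, i) *\<^sub>R restr K (basis_field (K', \<alpha>, i)) x)"
      unfolding basis_index_def by (simp add: sum.cartesian_product case_prod_unfold)
    also have "\<dots> = (\<Sum>K'\<in>\<T>. \<Sum>\<alpha> | sum \<alpha> UNIV \<le> m. \<Sum>i\<in>UNIV. a (K', \<alpha>, i) *\<^sub>R (if K = K' then (\<Prod>j\<in>UNIV. (x $ j) ^ \<alpha> j) *\<^sub>R axis i 1 else 0))"
      by (intro sum.cong refl) (simp add: basis_field_Pb(2)[OF _ K] basis_index_def)
    also have "\<dots> = (\<Sum>K'\<in>{K}. \<Sum>\<alpha> | sum \<alpha> UNIV \<le> m. \<Sum>i\<in>UNIV. a (K', \<alpha>, i) *\<^sub>R (if K = K' then (\<Prod>j\<in>UNIV. (x $ j) ^ \<alpha> j) *\<^sub>R axis i 1 else 0))"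
    proof (rule sum.mono_neutral_right[OF finite_mesh])
      show "{K} \<subseteq> \<T>" using K by simp
      show "\<forall>K'\<in>\<T> - {K}. (\<Sum>\<alpha> | sum \<alpha> UNIV \<le> m. \<Sum>i\<in>UNIV. a (K', \<alpha>, i) *\<^sub>R (if K = K' then (\<Prod>j\<in>UNIV. (x $ j) ^ \<alpha> j) *\<^sub>R axis i 1 else (0::real^3))) = 0"
      proof
        fix K' assume "K' \<in> \<T> - {K}"
        then have "(K = K') = False" by auto
        then show "(\<Sum>\<alpha> | sum \<alpha> UNIV \<le> m. \<Sum>i\<in>UNIV. a (K', \<alpha>, i) *\<^sub>R (if K = K' then (\<Prod>j\<in>UNIV. (x $ j) ^ \<alpha> j) *\<^sub>R axis i 1 else (0::real^3))) = 0"
          by (simp only: if_False) simp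
      qed
    qed
    also have "\<dots> = (\<Sum>\<alpha> | sum \<alpha> UNIV \<le> m. (\<Prod>j\<in>UNIV. (x $ j) ^ \<alpha> j) *\<^sub>R (\<Sum>i\<in>UNIV. (c K \<alpha> $ i) *\<^sub>R axis i 1))"
      by (simp add: a_def scaleR_sum_right mult.commute)
    also have "\<dots> = restr K \<phi> x"
    proof -
      have "(\<Sum>i\<in>UNIV. (d $ i) *\<^sub>R axis i 1) = d" for d :: "real^3"
        by (simp add: basis_expansion[of d, unfolded scalar_mult_eq_scaleR])
      then show ?thesis unfolding c[OF K] by simp
    qed
    finally show "restr K \<phi> x = restr K (\<lambda>x. \<Sum>i\<in>basis_index m. a i *\<^sub>R basis_field i x) x" by simp
  qed
  then show thesis by (rule that)
qed

lemma ip_cong_restr: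
  assumes "u \<in> L2 D" "\<phi> \<in> Pb D \<T> m" "\<psi> \<in> Pb D \<T> m" "\<And>K. K \<in> \<T> \<Longrightarrow> restr K \<phi> = restr K \<psi>"
  shows "ip D u \<phi> = ip D u \<psi>"
proof -
  have g: "glue (\<lambda>K. restr K \<phi>) x = glue (\<lambda>K. restr K \<psi>) x" for x using assms(4) by (simp add: glue_def)
  have "AE x in lebesgue_on D. \<phi> x = \<psi> x"
    using Pb_glue[OF assms(2)] Pb_glue[OF assms(3)] by eventually_elim (simp add: g)
  then show ?thesis
    using L2D(1)[OF assms(1)] L2D(1)[OF PbD(1)[OF assms(2)]] L2D(1)[OF PbD(1)[OF assms(3)]]
    by (intro ip_cong_AE) auto
qed

lemma ip_sum_left:
  assumes "finite I" "\<And>i. i \<in> I \<Longrightarrow> b i \<in> L2 D" "w \<in> L2 D"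
  shows "ip D (\<lambda>x. \<Sum>i\<in>I. a i *\<^sub>R b i x) w = (\<Sum>i\<in>I. a i * ip D (b i) w)"
  using assms L2_inner_integrable by (simp add: ip_def inner_sum_left Bochner_Integration.integral_sum)

text \<open>The choice in \<open>lifting\<close> is meaningful only if a solution exists. In terms
  of the spanning family the defining equation is a Gram system; a combination of zero norm vanishes
  on every cell and thus in the jump form, which is the consistency condition.\<close>

lemma lifting_exists:
  assumes v: "v \<in> Pb D \<T> k"
  shows "\<exists>L\<in>Pb D \<T> m. \<forall>\<phi>\<in>Pb D \<T> m. ip D L \<phi> = jump_form v \<phi>"
proof -
  let ?I = "basis_index m"
  let ?b = basis_field
  let ?c = "\<lambda>a x. \<Sum>i\<in>?I. a i *\<^sub>R ?b i x"
  have b: "?b i \<in> Pb D \<T> m" if "i \<in> ?I" for i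
    using basis_field_Pb(1)[of "fst i" "fst (snd i)" "snd (snd i)" m] that by simp
  have bL: "?b i \<in> L2 D" if "i \<in> ?I" for i using PbD(1)[OF b[OF that]] .
  have sub: "(\<lambda>x. \<Sum>i\<in>J. a i *\<^sub>R ?b i x) \<in> Pb D \<T> m" if "J \<subseteq> ?I" for J and a :: "_ \<Rightarrow> real"
    using Pb_sum[where I = J and b = ?b and m = m and a = a] b that finite_subset[OF that finite_basis_index] by blast
  have quad: "ip D (\<lambda>x. \<Sum>i\<in>J. a i *\<^sub>R ?b i x) (\<lambda>x. \<Sum>i\<in>J. a i *\<^sub>R ?b i x) = (\<Sum>i\<in>J. \<Sum>j\<in>J. a i * a j * ip D (?b i) (?b j))"
    if J: "J \<subseteq> ?I" for J and a :: "_ \<Rightarrow> real"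
  proof -
    note fJ = finite_subset[OF J finite_basis_index]
    have "ip D (\<lambda>x. \<Sum>i\<in>J. a i *\<^sub>R ?b i x) (\<lambda>x. \<Sum>i\<in>J. a i *\<^sub>R ?b i x)
      = (\<Sum>i\<in>J. a i * ip D (?b i) (\<lambda>x. \<Sum>i\<in>J. a i *\<^sub>R ?b i x))"
      using J bL PbD(1)[OF sub[OF J]] by (intro ip_sum_left fJ) auto
    also have "\<dots> = (\<Sum>i\<in>J. a i * (\<Sum>j\<in>J. a j * ip D (?b j) (?b i)))"
      using J bL by (intro sum.cong refl) (subst ip_commute, subst ip_sum_left[OF fJ], auto)
    finally show ?thesis by (simp add: sum_distrib_left mult.assoc ip_commute)
  qed
  have "\<exists>a. \<forall>i\<in>?I. (\<Sum>j\<in>?I. a j * ip D (?b j) (?b i)) = jump_form v (?b i)"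
  proof (rule gram_system_solvable[OF finite_basis_index])
    show "ip D (?b i) (?b j) = ip D (?b j) (?b i)" for i j by (rule ip_commute)
    show "0 \<le> (\<Sum>i\<in>J. \<Sum>j\<in>J. a i * a j * ip D (?b i) (?b j))" if "finite J" "J \<subseteq> ?I" for J a
      unfolding quad[OF that(2), symmetric] by (simp add: ip_def)
    fix a :: "_ \<Rightarrow> real"
    assume "(\<Sum>i\<in>?I. \<Sum>j\<in>?I. a i * a j * ip D (?b i) (?b j)) = 0"
    then have z: "ip D (?c a) (?c a) = 0" by (simp add: quad)
    note P = sub[OF order_refl, of a]
    have "AE x in lebesgue_on D. ?c a x \<bullet> ?c a x = 0"
      using z integral_nonneg_eq_0_iff_AE[OF L2_inner_integrable[OF PbD(1)[OF P] PbD(1)[OF P]]] by (simp add: ip_def)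
    then have AE: "AE x in lebesgue_on D. ?c a x = 0" by eventually_elim simp
    have "restr K (?c a) = (\<lambda>x. 0)" if K: "K \<in> \<T>" for K
    proof (rule restr_eq[OF cell[OF K] polys_zero])
      have "AE x in lebesgue. x \<in> D \<longrightarrow> ?c a x = 0" using AE D_sets by (simp add: AE_restrict_space_iff)
      moreover have "AE x in lebesgue. x \<notin> frontier K"
        using cell_props(8)[OF K] unfolding negligible_iff_null_sets by (rule AE_not_in)
      ultimately have "AE x in lebesgue. x \<in> K \<longrightarrow> ?c a x = 0"
        by eventually_elim (use interior_cell_subset[OF K] closure_subset[of K] in \<open>auto simp: frontier_def\<close>)
      then show "AE x in lebesgue_on K. ?c a x = 0" using cell_props(6)[OF K] by (simp add: AE_restrict_space_iff)
    qed
    then have "jump_form v (?c a) = jump_form v (\<lambda>x. 0)" using Pb_zero(2) by (intro jump_form_cong) simp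
    also have "\<dots> = 0" using jump_form_scaleR[OF Pb_zero(1), of v 0] by simp
    finally show "(\<Sum>i\<in>?I. a i * jump_form v (?b i)) = 0"
      using Pb_sum[OF finite_basis_index b, where k = k and a = a] v by simp
  qed
  then obtain a where a: "\<And>i. i \<in> ?I \<Longrightarrow> (\<Sum>j\<in>?I. a j * ip D (?b j) (?b i)) = jump_form v (?b i)" by blast
  note P = sub[OF order_refl, of a]
  have "ip D (?c a) \<phi> = jump_form v \<phi>" if \<phi>: "\<phi> \<in> Pb D \<T> m" for \<phi>
  proof -
    obtain d where d: "\<And>K. K \<in> \<T> \<Longrightarrow> restr K \<phi> = restr K (?c d)" using basis_expansion_Pb[OF \<phi>] by blast
    note Q = sub[OF order_refl, of d]
    have "ip D (?c a) \<phi> = ip D (?c d) (?c a)"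
      using ip_cong_restr[OF PbD(1)[OF P] \<phi> Q d] by (simp add: ip_commute)
    also have "\<dots> = (\<Sum>i\<in>?I. d i * ip D (?c a) (?b i))"
      using bL PbD(1)[OF P] by (subst ip_sum_left[OF finite_basis_index]) (auto simp: ip_commute)
    also have "\<dots> = (\<Sum>i\<in>?I. d i * jump_form v (?b i))"
      using bL a by (intro sum.cong refl) (subst ip_sum_left[OF finite_basis_index], auto)
    also have "\<dots> = jump_form v (?c d)" using Pb_sum[OF finite_basis_index b, where k = k and a = d] v by simp
    also have "\<dots> = jump_form v \<phi>" using d by (intro jump_form_cong) simp
    finally show ?thesis .
  qed
  then show ?thesis using P by blast
qed

abbreviation "lft \<equiv> lifting D \<T> Kl Kr nF"

lemma lifting_spec:
  assumes "v \<in> Pb D \<T> k"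
  shows "lft l v \<in> Pb D \<T> l" "\<And>\<phi>. \<phi> \<in> Pb D \<T> l \<Longrightarrow> ip D (lft l v) \<phi> = jump_form v \<phi>"
proof -
  have "\<exists>L. L \<in> Pb D \<T> l \<and> (\<forall>\<phi>\<in>Pb D \<T> l.
     ip D L \<phi> = (\<Sum>F\<in>faces \<T>. face_integral F (\<lambda>x. jmp F v x \<bullet> avg F \<phi> x)))"
    using lifting_exists[OF assms, of l] by (auto simp: jump_form_def face_sum_def)
  from someI_ex[OF this]
  have "lft l v \<in> Pb D \<T> l \<and> (\<forall>\<phi>\<in>Pb D \<T> l. ip D (lft l v) \<phi> = jump_form v \<phi>)"
    unfolding lifting_def jump_form_def face_sum_def .
  then show "lft l v \<in> Pb D \<T> l" "\<And>\<phi>. \<phi> \<in> Pb D \<T> l \<Longrightarrow> ip D (lft l v) \<phi> = jump_form v \<phi>" by auto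
qed

text \<open>v and v - w have the same jumps on all faces, so the predicates under
  \<open>SOME\<close> coincide and the chosen functions are equal, not just equal almost
  everywhere.\<close>

lemma lifting_diff_Pc0:
  assumes v: "v \<in> Pb D \<T> k" and w: "w \<in> Pc0 D \<T> k"
  shows "lft l (\<lambda>x. v x - w x) = lft l v"
proof -
  have wP: "w \<in> Pb D \<T> k" using w by (simp add: Pc0_def)
  have "face_integral F (\<lambda>x. jmp F (\<lambda>x. v x - w x) x \<bullet> avg F \<phi> x) = face_integral F (\<lambda>x. jmp F v x \<bullet> avg F \<phi> x)"
    if F: "F \<in> faces \<T>" and \<phi>: "\<phi> \<in> Pb D \<T> l" for F \<phi>
  proof (rule face_integral_cong[of "Kl F"])
    show "3 simplex Kl F" "F facet_of Kl F" using face_cell(1)[OF F] cell by auto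
    show "continuous_on UNIV (\<lambda>x. jmp F (\<lambda>x. v x - w x) x \<bullet> avg F \<phi> x)"
      by (intro continuous_on_inner avg_continuous[OF \<phi> F] polys_continuous[OF jump_polys[OF Pb_diff(1)[OF v wP] F]])
    show "continuous_on UNIV (\<lambda>x. jmp F v x \<bullet> avg F \<phi> x)"
      by (intro continuous_on_inner avg_continuous[OF \<phi> F] polys_continuous[OF jump_polys[OF v F]])
    fix x assume x: "x \<in> F"
    have "jmp F (\<lambda>x. v x - w x) x = jmp F v x - jmp F w x"
      using face_cell(1)[OF F] face_cell(2)[of F] Pb_diff(2)[OF v wP]
      by (simp add: jump_def Cross3.left_diff_distrib)
    then show "jmp F (\<lambda>x. v x - w x) x \<bullet> avg F \<phi> x = jmp F v x \<bullet> avg F \<phi> x"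
      using Pc0_jump[OF w F x] by simp
  qed
  then have "(\<lambda>L. L \<in> Pb D \<T> l \<and> (\<forall>\<phi>\<in>Pb D \<T> l.
     ip D L \<phi> = (\<Sum>F\<in>faces \<T>. face_integral F (\<lambda>x. jmp F (\<lambda>x. v x - w x) x \<bullet> avg F \<phi> x))))
    = (\<lambda>L. L \<in> Pb D \<T> l \<and> (\<forall>\<phi>\<in>Pb D \<T> l.
     ip D L \<phi> = (\<Sum>F\<in>faces \<T>. face_integral F (\<lambda>x. jmp F v x \<bullet> avg F \<phi> x))))"
    by (auto simp: fun_eq_iff)
  then show ?thesis unfolding lifting_def by (rule arg_cong)
qed

lemma curlh_diff:
  assumes v: "v \<in> Pb D \<T> k" and w: "w \<in> Pb D \<T> k"
  shows "curlh \<T> (\<lambda>x. v x - w x) x = curlh \<T> v x - curlh \<T> w x"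
proof -
  have "curl (restr K (\<lambda>x. v x - w x)) x = curl (restr K v) x - curl (restr K w) x" if K: "K \<in> \<T>" for K
  proof -
    note J = polys_C1_jac[OF PbD(2)[OF v K]] and J' = polys_C1_jac[OF PbD(2)[OF w K]]
    have "C1_jac (\<lambda>x. restr K v x + (-1) *\<^sub>R restr K w x) (\<lambda>i x. partial i (restr K v) x + (-1) *\<^sub>R partial i (restr K w) x)"
      by (intro C1_jac_add J C1_jac_cmult J')
    from C1_jac_curl[OF this, of x] show ?thesis
      unfolding Pb_diff(2)[OF v w K] by (simp add: curl_eq_crl crl_diff)
  qed
  then show ?thesis by (simp add: curlh_def scaleR_diff_right sum_subtractf)
qed

text \<open>Green's formula on each cell leaves face terms. The tangential traces of \<Phi> match
  across interfaces, so the terms reduce to minus jump times average; and as \<Phi> belongs to the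
  space in which the lifting is sought, their sum is minus the lifting tested with \<Phi>.\<close>

lemma discrete_curl_consistent:
  assumes v: "v \<in> Pb D \<T> k" and \<Phi>: "\<Phi> \<in> Pc D \<T> l"
  shows "ip D v (wcurl D \<Phi>) = ip D (discrete_curl D \<T> Kl Kr nF l v) \<Phi>"
proof -
  have \<Phi>P: "\<Phi> \<in> Pb D \<T> l" and \<Phi>H: "\<Phi> \<in> Hcurl D" using \<Phi> by (auto simp: Pc_def)
  note J = polys_C1_jac[OF PbD(2)[OF v]] and J' = polys_C1_jac[OF PbD(2)[OF \<Phi>P]]
  note L = PbD(1)[OF v] PbD(1)[OF \<Phi>P] curlh_L2[OF v] curlh_L2[OF \<Phi>P]
  note wc = wcurl_is_weak_curl[OF \<Phi>H]
  let ?f = "\<lambda>x. curlh \<T> v x \<bullet> \<Phi> x - v x \<bullet> curlh \<T> \<Phi> x"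
  have i: "integrable (lebesgue_on D) ?f"
    by (intro Bochner_Integration.integrable_diff L2_inner_integrable L)
  have "ip D (curlh \<T> v) \<Phi> - ip D v (curlh \<T> \<Phi>) = integral\<^sup>L (lebesgue_on D) ?f"
    using L2_inner_integrable[OF L(3,2)] L2_inner_integrable[OF L(1,4)] by (simp add: ip_def)
  also have "\<dots> = (\<Sum>K\<in>\<T>. integral\<^sup>L (lebesgue_on K) ?f)" by (rule integral_cells(1)[OF i])
  also have "\<dots> = (\<Sum>K\<in>\<T>. integral\<^sup>L (lebesgue_on K) (\<lambda>x. curl (restr K v) x \<bullet> restr K \<Phi> x - restr K v x \<bullet> curl (restr K \<Phi>) x))"
  proof (rule sum.cong[OF refl], rule integral_cong_AE)
    fix K assume K: "K \<in> \<T>"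
    show "?f \<in> borel_measurable (lebesgue_on K)" using integral_cells(2)[OF i K] by auto
    show "(\<lambda>x. curl (restr K v) x \<bullet> restr K \<Phi> x - restr K v x \<bullet> curl (restr K \<Phi>) x) \<in> borel_measurable (lebesgue_on K)"
      by (intro borel_lebesgue_on borel_measurable_continuous_onI continuous_intros continuous_curl[OF J[OF K]]
          continuous_curl[OF J'[OF K]] C1_jacD(3)[OF J[OF K]] C1_jacD(3)[OF J'[OF K]])
    have "AE x in lebesgue_on K. curlh \<T> v x = curl (restr K v) x" "AE x in lebesgue_on K. curlh \<T> \<Phi> x = curl (restr K \<Phi>) x"
      unfolding curlh_glue by (rule AE_cell[OF K glue_interior[OF K]], assumption)+
    then show "AE x in lebesgue_on K. ?f x = curl (restr K v) x \<bullet> restr K \<Phi> x - restr K v x \<bullet> curl (restr K \<Phi>) x"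
      using PbD(3)[OF v K] PbD(3)[OF \<Phi>P K] by eventually_elim simp
  qed
  also have "\<dots> = face_sum (\<lambda>F x. nF F \<bullet> cross3 (restr (Kl F) v x) (restr (Kl F) \<Phi> x)
        - (if F \<in> interfaces \<T> then nF F \<bullet> cross3 (restr (Kr F) v x) (restr (Kr F) \<Phi> x) else 0))"
    by (rule broken_green[OF J J'])
  also have "\<dots> = face_sum (\<lambda>F x. (-1) * (jmp F v x \<bullet> avg F \<Phi> x))"
    unfolding face_sum_def
  proof (rule sum.cong[OF refl])
    fix F assume F: "F \<in> faces \<T>"
    note l = face_cell(1)[OF F]
    have cv: "continuous_on UNIV (restr K v)" "continuous_on UNIV (restr K \<Phi>)" if "K \<in> \<T>" for K
      using C1_jacD(3)[OF J[OF that]] C1_jacD(3)[OF J'[OF that]] by auto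
    have t: "n \<bullet> cross3 p q = - (cross3 p n \<bullet> q)" for n p q :: "real^3"
      by (simp add: cross3_simps)
    show "face_integral F (\<lambda>x. nF F \<bullet> cross3 (restr (Kl F) v x) (restr (Kl F) \<Phi> x)
        - (if F \<in> interfaces \<T> then nF F \<bullet> cross3 (restr (Kr F) v x) (restr (Kr F) \<Phi> x) else 0))
      = face_integral F (\<lambda>x. (-1) * (jmp F v x \<bullet> avg F \<Phi> x))"
    proof (cases "F \<in> interfaces \<T>")
      case True
      note r = face_cell(2)[OF True]
      show ?thesis
      proof (rule face_integral_cong[of "Kl F"])
        show "3 simplex Kl F" "F facet_of Kl F" using l cell by auto
        show "continuous_on UNIV (\<lambda>x. nF F \<bullet> cross3 (restr (Kl F) v x) (restr (Kl F) \<Phi> x)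
          - (if F \<in> interfaces \<T> then nF F \<bullet> cross3 (restr (Kr F) v x) (restr (Kr F) \<Phi> x) else 0))"
          using True l r cv by (simp, intro continuous_intros continuous_on_cross) auto
        show "continuous_on UNIV (\<lambda>x. (-1) * (jmp F v x \<bullet> avg F \<Phi> x))"
          by (intro continuous_on_mult continuous_on_const continuous_on_inner avg_continuous[OF \<Phi>P F]
              polys_continuous[OF jump_polys[OF v F]])
        fix x assume x: "x \<in> F"
        have "cross3 (restr (Kl F) \<Phi> x) (nF F) = cross3 (restr (Kr F) \<Phi> x) (nF F)"
          using Pc_jump[OF \<Phi> True x] True by (simp add: jump_def)
        from cross_average[OF this, of "restr (Kl F) v x" "restr (Kr F) v x"]
        show "nF F \<bullet> cross3 (restr (Kl F) v x) (restr (Kl F) \<Phi> x)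
          - (if F \<in> interfaces \<T> then nF F \<bullet> cross3 (restr (Kr F) v x) (restr (Kr F) \<Phi> x) else 0)
          = (-1) * (jmp F v x \<bullet> avg F \<Phi> x)" using True by (simp add: jump_def average_def)
      qed
    next
      \<comment> \<open>On a boundary face jump and average are one-sided, so the integrands agree
        for every \<Phi>.\<close>
      case False
      then show ?thesis by (simp add: jump_def average_def t)
    qed
  qed
  also have "\<dots> = - jump_form v \<Phi>"
    unfolding face_sum_def face_integral_cmult jump_form_def by (simp add: sum_negf)
  also have "\<dots> = - ip D (lft l v) \<Phi>" using lifting_spec(2)[OF v \<Phi>P] by simp
  finally have "ip D v (curlh \<T> \<Phi>) = ip D (curlh \<T> v) \<Phi> + ip D (lft l v) \<Phi>" by simp
  also have "\<dots> = ip D (discrete_curl D \<T> Kl Kr nF l v) \<Phi>"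
    unfolding discrete_curl_def[abs_def]
    by (rule ip_add_left[OF L(3) PbD(1)[OF lifting_spec(1)[OF v]] L(2), symmetric])
  finally have "ip D v (curlh \<T> \<Phi>) = ip D (discrete_curl D \<T> Kl Kr nF l v) \<Phi>" .
  moreover have "ip D v (wcurl D \<Phi>) = ip D v (curlh \<T> \<Phi>)"
    using wcurl_Pb[OF \<Phi>P wc] wc L2D(1)[OF L(1)] L2D(1)[OF L(4)]
    by (intro ip_cong_AE) (auto simp: is_weak_curl_def L2D)
  ultimately show ?thesis by simp
qed

end

section \<open>The coefficient and the weighted norms\<close>

lemma linear_term_eq_0:
  fixes a b :: real
  assumes "\<And>t. 0 \<le> 2 * t * b + t\<^sup>2 * a" "0 \<le> a"
  shows "b = 0"
  using quadratic_nonneg_discriminant[of 0 b a] assms by simp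

lemma symmetric_inner:
  fixes A :: "real^3^3"
  assumes "transpose A = A"
  shows "(A *v x) \<bullet> y = x \<bullet> (A *v y)"
  using dot_lmul_matrix[of x A y] assms transpose_matrix_vector[of A x] by simp

text \<open>Minimality of the Rayleigh quotient at \<open>u\<close> makes \<open>u\<close> an eigenvector.\<close>

lemma min_rayleigh_eigenvalue:
  fixes A :: "real^3^3"
  assumes A: "transpose A = A"
  obtains u where "u \<noteq> 0" "A *v u = min_rayleigh A *\<^sub>R u"
    "\<And>w. min_rayleigh A * (norm w)\<^sup>2 \<le> (A *v w) \<bullet> w"
proof -
  let ?f = "\<lambda>u. (A *v u) \<bullet> u"
  have cA: "continuous_on S (\<lambda>u. A *v u)" for S by (intro linear_continuous_on linear_linear[THEN iffD2] matrix_vector_mul_linear)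
  have "\<exists>u\<in>sphere (0::real^3) 1. \<forall>w\<in>sphere 0 1. ?f u \<le> ?f w"
    by (intro continuous_attains_inf continuous_on_inner cA continuous_on_id compact_sphere) simp
  then obtain u where u: "norm u = 1" "\<And>w. norm w = 1 \<Longrightarrow> ?f u \<le> ?f w" by auto
  have m: "min_rayleigh A = ?f u"
    unfolding min_rayleigh_def using u by (intro cInf_eq_minimum) auto
  have le: "?f u * (norm w)\<^sup>2 \<le> ?f w" for w
  proof (cases "w = 0")
    case False
    have "?f u \<le> ?f ((1 / norm w) *\<^sub>R w)" using False by (intro u(2)) simp
    also have "\<dots> = ?f w / (norm w)\<^sup>2"
      by (simp add: matrix_vector_mult_scaleR power2_eq_square)
    finally show ?thesis using False by (simp add: field_simps)
  qed simp
  have "A *v u = ?f u *\<^sub>R u"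
  proof -
    \<comment> \<open>The residual of the eigenvalue equation. Perturbing the minimiser u by t h
      changes the Rayleigh defect to first order by 2 t |h|^2, which stays nonnegative for both
      signs of t only if h = 0.\<close>
    define h where "h = A *v u - ?f u *\<^sub>R u"
    have uu: "u \<bullet> u = 1" using u(1) by (simp add: power2_norm_eq_inner[symmetric])
    have "0 \<le> 2 * t * (h \<bullet> h) + t\<^sup>2 * (?f h - ?f u * (norm h)\<^sup>2)" for t
    proof -
      have A: "?f (u + t *\<^sub>R h) = ?f u + 2 * t * ((A *v u) \<bullet> h) + t\<^sup>2 * ?f h"
      proof -
        have "(A *v h) \<bullet> u = (A *v u) \<bullet> h" using symmetric_inner[OF A, of h u] by (simp add: inner_commute)
        then show ?thesis
          by (simp only: matrix_vector_right_distrib matrix_vector_mult_scaleR inner_add_left inner_add_right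
            inner_scaleR_left inner_scaleR_right) (simp add: power2_eq_square algebra_simps)
      qed
      have N: "(norm (u + t *\<^sub>R h))\<^sup>2 = 1 + 2 * t * (u \<bullet> h) + t\<^sup>2 * (norm h)\<^sup>2"
        unfolding power2_norm_eq_inner
        by (simp only: inner_add_left inner_add_right inner_scaleR_left inner_scaleR_right inner_commute[of h u] uu)
          (simp add: power2_eq_square algebra_simps)
      have H: "h \<bullet> h = (A *v u) \<bullet> h - ?f u * (u \<bullet> h)"
        by (subst (1) h_def) (simp add: inner_diff_left)
      have "?f (u + t *\<^sub>R h) - ?f u * (norm (u + t *\<^sub>R h))\<^sup>2
          = 2 * t * (h \<bullet> h) + t\<^sup>2 * (?f h - ?f u * (norm h)\<^sup>2)"
        unfolding A N H by (simp add: algebra_simps)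
      then show ?thesis using le[of "u + t *\<^sub>R h"] by linarith
    qed
    moreover have "0 \<le> ?f h - ?f u * (norm h)\<^sup>2" using le by simp
    ultimately have "h \<bullet> h = 0" by (rule linear_term_eq_0)
    then show ?thesis by (simp add: h_def)
  qed
  moreover have "u \<noteq> 0" using u(1) by auto
  ultimately show thesis using le unfolding m[symmetric] by (intro that[of u]) auto
qed

text \<open>The largest eigenvalue of A is minus the smallest one of -A.\<close>

lemma rayleigh_le:
  fixes A :: "real^3^3"
  assumes A: "transpose A = A" and ev: "\<And>\<mu> u. u \<noteq> 0 \<Longrightarrow> A *v u = \<mu> *\<^sub>R u \<Longrightarrow> \<mu> \<le> \<beta>"
  shows "(A *v w) \<bullet> w \<le> \<beta> * (norm w)\<^sup>2"
proof -
  have mm: "(- A) *v x = - (A *v x)" for x :: "real^3"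
    by (simp add: matrix_vector_mult_def vec_eq_iff sum_negf)
  have T: "transpose (- A) = - A" using A by (simp add: transpose_def vec_eq_iff)
  obtain u where u: "u \<noteq> 0" "(- A) *v u = min_rayleigh (- A) *\<^sub>R u"
    "\<And>w. min_rayleigh (- A) * (norm w)\<^sup>2 \<le> ((- A) *v w) \<bullet> w"
    using min_rayleigh_eigenvalue[OF T] by blast
  have "A *v u = - (- (A *v u))" by (rule minus_minus[symmetric])
  also have "- (A *v u) = min_rayleigh (- A) *\<^sub>R u" using u(2) unfolding mm .
  finally have "A *v u = (- min_rayleigh (- A)) *\<^sub>R u" unfolding scaleR_minus_left .
  then have "- min_rayleigh (- A) \<le> \<beta>" by (rule ev[OF u(1)])
  then have "(- min_rayleigh (- A)) * (norm w)\<^sup>2 \<le> \<beta> * (norm w)\<^sup>2" by (intro mult_right_mono) auto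
  then show ?thesis using u(3)[of w] unfolding mm by simp
qed

lemma ip_Cauchy_Schwarz:
  assumes "u \<in> L2 S" "w \<in> L2 S"
  shows "\<bar>ip S u w\<bar> \<le> L2norm S u * L2norm S w"
proof -
  have nn: "0 \<le> ip S v v" for v by (simp add: ip_def)
  have "0 \<le> ip S u u + 2 * t * ip S u w + t\<^sup>2 * ip S w w" for t
  proof -
    let ?s = "\<lambda>x. u x + t *\<^sub>R w x"
    note tw = L2_scaleR[OF assms(2), of t]
    have "ip S ?s ?s = ip S u ?s + t * ip S w ?s"
      unfolding ip_add_left[OF assms(1) tw L2_add[OF assms(1) tw]] ip_scaleR_left ..
    also have "ip S u ?s = ip S u u + t * ip S u w"
      unfolding ip_add_right[OF assms(1) tw assms(1)] ip_commute[of S u "\<lambda>x. t *\<^sub>R w x"] ip_scaleR_left ip_commute[of S w u] ..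
    also have "ip S w ?s = ip S u w + t * ip S w w"
      unfolding ip_add_right[OF assms(1) tw assms(2)] ip_commute[of S w "\<lambda>x. t *\<^sub>R w x"] ip_scaleR_left ip_commute[of S w u] ..
    finally have "ip S ?s ?s = ip S u u + 2 * t * ip S u w + t\<^sup>2 * ip S w w"
      by (simp add: power2_eq_square algebra_simps)
    with nn[of ?s] show ?thesis by linarith
  qed
  then have "(ip S u w)\<^sup>2 \<le> ip S u u * ip S w w" by (rule quadratic_nonneg_discriminant[OF _ nn])
  then have "sqrt ((ip S u w)\<^sup>2) \<le> sqrt (ip S u u * ip S w w)" by (rule real_sqrt_le_mono)
  then show ?thesis by (simp add: L2norm_def real_sqrt_mult)
qed

section \<open>Coefficient bounds and weighted Cauchy-Schwarz inequalities\<close>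

locale coeff = mesh +
  fixes \<nu> :: "real^3 \<Rightarrow> real^3^3" and \<alpha> \<beta> :: real
  assumes nu_borel: "\<nu> \<in> borel_measurable (lebesgue_on D)"
    and nu_sym: "x \<in> D \<Longrightarrow> transpose (\<nu> x) = \<nu> x"
    and alpha_pos: "0 < \<alpha>"
    and eigen: "x \<in> D \<Longrightarrow> u \<noteq> 0 \<Longrightarrow> \<nu> x *v u = \<mu> *\<^sub>R u \<Longrightarrow> \<alpha> \<le> \<mu> \<and> \<mu> \<le> \<beta>"
begin

lemma rayleigh_bounds:
  assumes "x \<in> D"
  shows "\<alpha> \<le> min_rayleigh (\<nu> x)" "min_rayleigh (\<nu> x) \<le> \<beta>"
    "\<alpha> * (norm w)\<^sup>2 \<le> (\<nu> x *v w) \<bullet> w" "(\<nu> x *v w) \<bullet> w \<le> \<beta> * (norm w)\<^sup>2"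
proof -
  obtain u where u: "u \<noteq> 0" "\<nu> x *v u = min_rayleigh (\<nu> x) *\<^sub>R u"
    "\<And>w. min_rayleigh (\<nu> x) * (norm w)\<^sup>2 \<le> (\<nu> x *v w) \<bullet> w"
    using min_rayleigh_eigenvalue[OF nu_sym[OF assms]] by blast
  show a: "\<alpha> \<le> min_rayleigh (\<nu> x)" and "min_rayleigh (\<nu> x) \<le> \<beta>" using eigen[OF assms u(1,2)] by auto
  have "\<alpha> * (norm w)\<^sup>2 \<le> min_rayleigh (\<nu> x) * (norm w)\<^sup>2" using a by (intro mult_right_mono) auto
  then show "\<alpha> * (norm w)\<^sup>2 \<le> (\<nu> x *v w) \<bullet> w" using u(3)[of w] by simp
  show "(\<nu> x *v w) \<bullet> w \<le> \<beta> * (norm w)\<^sup>2" using eigen[OF assms] by (intro rayleigh_le nu_sym[OF assms]) auto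
qed

lemma nu_invertible:
  assumes "x \<in> D"
  shows "invertible (\<nu> x)" "\<nu> x *v (matrix_inv (\<nu> x) *v b) = b"
proof -
  have "inj ((*v) (\<nu> x))"
  proof (rule linear_injective_0[OF matrix_vector_mul_linear, THEN iffD2], intro allI impI)
    fix w assume "\<nu> x *v w = 0"
    then have "\<alpha> * (norm w)\<^sup>2 \<le> 0" using rayleigh_bounds(3)[OF assms, of w] by simp
    then show "w = 0" using alpha_pos by (simp add: mult_le_0_iff)
  qed
  then show i: "invertible (\<nu> x)"
    by (metis invertible_left_inverse matrix_left_invertible_injective)
  show "\<nu> x *v (matrix_inv (\<nu> x) *v b) = b"
    using someI_ex[OF i[unfolded invertible_def]] by (simp add: matrix_vector_mul_assoc matrix_inv_def)
qed

lemma nu_component_borel: "(\<lambda>x. \<nu> x $ i $ j) \<in> borel_measurable (lebesgue_on D)"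
proof -
  have "(\<lambda>A :: real^3^3. A $ i $ j) \<in> borel_measurable borel"
    by (intro borel_measurable_continuous_onI continuous_intros)
  from measurable_compose[OF nu_borel this] show ?thesis .
qed

lemma L2_component_borel: "v \<in> borel_measurable (lebesgue_on D) \<Longrightarrow> (\<lambda>x. (v x :: real^3) $ i) \<in> borel_measurable (lebesgue_on D)"
proof -
  assume v: "v \<in> borel_measurable (lebesgue_on D)"
  have "(\<lambda>a :: real^3. a $ i) \<in> borel_measurable borel"
    by (intro borel_measurable_continuous_onI continuous_intros)
  from measurable_compose[OF v this] show ?thesis .
qed

lemma nu_quadratic_integrable:
  assumes v: "v \<in> L2 D"
  shows "integrable (lebesgue_on D) (\<lambda>x. (\<nu> x *v v x) \<bullet> v x)"
proof (rule Bochner_Integration.integrable_bound)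
  show "integrable (lebesgue_on D) (\<lambda>x. \<bar>\<beta>\<bar> * (norm (v x))\<^sup>2)" using L2D(2)[OF v] by simp
  have "(\<lambda>x. (\<nu> x *v v x) \<bullet> v x) = (\<lambda>x. \<Sum>i\<in>UNIV. (\<Sum>j\<in>UNIV. \<nu> x $ i $ j * v x $ j) * v x $ i)"
    by (simp add: inner_vec_def matrix_vector_mult_def)
  also have "\<dots> \<in> borel_measurable (lebesgue_on D)"
    by (intro borel_measurable_sum borel_measurable_times nu_component_borel L2_component_borel L2D(1)[OF v])
  finally show "(\<lambda>x. (\<nu> x *v v x) \<bullet> v x) \<in> borel_measurable (lebesgue_on D)" .
  show "AE x in lebesgue_on D. norm ((\<nu> x *v v x) \<bullet> v x) \<le> norm (\<bar>\<beta>\<bar> * (norm (v x))\<^sup>2)"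
  proof (rule AE_I2)
    fix x assume "x \<in> space (lebesgue_on D)"
    then have x: "x \<in> D" by (simp add: space_restrict_space)
    have "0 \<le> \<alpha> * (norm (v x))\<^sup>2" using alpha_pos by simp
    moreover have "\<beta> * (norm (v x))\<^sup>2 \<le> \<bar>\<beta>\<bar> * (norm (v x))\<^sup>2" by (intro mult_right_mono) auto
    ultimately show "norm ((\<nu> x *v v x) \<bullet> v x) \<le> norm (\<bar>\<beta>\<bar> * (norm (v x))\<^sup>2)"
      using rayleigh_bounds(3,4)[OF x, of "v x"] by simp
  qed
qed

lemma nu_inv_quadratic_integrable:
  assumes v: "v \<in> L2 D"
  shows "integrable (lebesgue_on D) (\<lambda>x. (matrix_inv (\<nu> x) *v v x) \<bullet> v x)"
proof (rule Bochner_Integration.integrable_bound)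
  let ?A = "\<lambda>x k. (\<chi> i j. if j = k then v x $ i else \<nu> x $ i $ j) :: real^3^3"
  show "integrable (lebesgue_on D) (\<lambda>x. inverse \<alpha> * (norm (v x))\<^sup>2)" using L2D(2)[OF v] by simp
  \<comment> \<open>Cramer's rule writes the inverse through determinants of measurable entries,
    which yields measurability.\<close>
  have cr: "matrix_inv (\<nu> x) *v v x = (\<chi> k. det (?A x k) / det (\<nu> x))" if x: "x \<in> D" for x
    using cramer[of "\<nu> x" "matrix_inv (\<nu> x) *v v x" "v x"] nu_invertible[OF x] invertible_det_nz by blast
  have e: "(\<lambda>x. \<Sum>k\<in>UNIV. (det (?A x k) / det (\<nu> x)) * v x $ k) \<in> borel_measurable (lebesgue_on D)"
  proof (intro borel_measurable_sum borel_measurable_times borel_measurable_divide L2_component_borel L2D(1)[OF v])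
    show "(\<lambda>x. det (\<nu> x)) \<in> borel_measurable (lebesgue_on D)"
      unfolding det_3 by (intro borel_measurable_add borel_measurable_diff borel_measurable_times nu_component_borel)
    fix k :: 3
    have c: "(\<lambda>x. ?A x k $ i $ j) \<in> borel_measurable (lebesgue_on D)" for i j
      using L2_component_borel[OF L2D(1)[OF v]] nu_component_borel by (cases "j = k") auto
    show "(\<lambda>x. det (?A x k)) \<in> borel_measurable (lebesgue_on D)"
      unfolding det_3 by (intro borel_measurable_add borel_measurable_diff borel_measurable_times c)
  qed
  have "(matrix_inv (\<nu> x) *v v x) \<bullet> v x = (\<Sum>k\<in>UNIV. (det (?A x k) / det (\<nu> x)) * v x $ k)" if "x \<in> space (lebesgue_on D)" for x
    using cr[of x] that by (simp add: inner_vec_def space_restrict_space)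
  with e show "(\<lambda>x. (matrix_inv (\<nu> x) *v v x) \<bullet> v x) \<in> borel_measurable (lebesgue_on D)"
    by (subst measurable_cong) auto
  show "AE x in lebesgue_on D. norm ((matrix_inv (\<nu> x) *v v x) \<bullet> v x) \<le> norm (inverse \<alpha> * (norm (v x))\<^sup>2)"
  proof (rule AE_I2)
    fix x assume "x \<in> space (lebesgue_on D)"
    then have x: "x \<in> D" by (simp add: space_restrict_space)
    let ?c = "matrix_inv (\<nu> x) *v v x"
    \<comment> \<open>Coercivity of \<nu> at c bounds |c| by |v| / \<alpha>.\<close>
    have "\<alpha> * (norm ?c)\<^sup>2 \<le> v x \<bullet> ?c" using rayleigh_bounds(3)[OF x, of ?c] nu_invertible(2)[OF x] by simp
    also have "\<dots> \<le> norm (v x) * norm ?c" by (rule norm_cauchy_schwarz)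
    finally have "norm ?c * (\<alpha> * norm ?c) \<le> norm ?c * norm (v x)" by (simp add: power2_eq_square algebra_simps)
    then have "\<alpha> * norm ?c \<le> norm (v x)" by (cases "?c = 0") auto
    then have c: "norm ?c \<le> inverse \<alpha> * norm (v x)" using alpha_pos by (simp add: field_simps)
    have "\<bar>?c \<bullet> v x\<bar> \<le> norm ?c * norm (v x)" by (rule Cauchy_Schwarz_ineq2)
    also have "\<dots> \<le> inverse \<alpha> * norm (v x) * norm (v x)" using c by (intro mult_right_mono) auto
    finally show "norm (?c \<bullet> v x) \<le> norm (inverse \<alpha> * (norm (v x))\<^sup>2)"
      using alpha_pos by (simp add: power2_eq_square mult.assoc)
  qed
qed

text \<open>With c the inverse of \<nu> applied to b, the quadratic form of \<nu> at a + t c has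
  cross term 2 t (a . b); integrating and taking the discriminant gives the pairing of the two dual
  norms.\<close>

lemma weighted_Cauchy_Schwarz:
  assumes a: "a \<in> L2 D" and b: "b \<in> L2 D"
  shows "\<bar>ip D a b\<bar> \<le> wnorm D \<nu> a * wnorm D (\<lambda>x. matrix_inv (\<nu> x)) b"
proof -
  let ?A = "ipw D \<nu> a a" and ?B = "ipw D (\<lambda>x. matrix_inv (\<nu> x)) b b"
  note ia = nu_quadratic_integrable[OF a] and ib = nu_inv_quadratic_integrable[OF b] and iab = L2_inner_integrable[OF a b]
  have "0 \<le> ?A + 2 * t * ip D a b + t\<^sup>2 * ?B" for t
  proof -
    have "?A + 2 * t * ip D a b + t\<^sup>2 * ?B =
      integral\<^sup>L (lebesgue_on D) (\<lambda>x. (\<nu> x *v a x) \<bullet> a x + 2 * t * (a x \<bullet> b x) + t\<^sup>2 * ((matrix_inv (\<nu> x) *v b x) \<bullet> b x))"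
      using ia ib iab by (simp add: ipw_def ip_def)
    also have "0 \<le> \<dots>"
    proof (rule integral_nonneg_AE, rule AE_I2)
      fix x assume "x \<in> space (lebesgue_on D)"
      then have x: "x \<in> D" by (simp add: space_restrict_space)
      let ?c = "matrix_inv (\<nu> x) *v b x"
      have 1: "\<nu> x *v ?c = b x" by (rule nu_invertible(2)[OF x])
      have 2: "(\<nu> x *v a x) \<bullet> ?c = a x \<bullet> b x" using symmetric_inner[OF nu_sym[OF x]] 1 by metis
      have "(\<nu> x *v (a x + t *\<^sub>R ?c)) \<bullet> (a x + t *\<^sub>R ?c)
        = (\<nu> x *v a x) \<bullet> a x + 2 * t * (a x \<bullet> b x) + t\<^sup>2 * (?c \<bullet> b x)"
        by (simp only: matrix_vector_right_distrib matrix_vector_mult_scaleR 1 inner_add_left inner_add_right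
            inner_scaleR_left inner_scaleR_right 2)
          (simp add: power2_eq_square algebra_simps inner_commute)
      moreover have "0 \<le> \<alpha> * (norm (a x + t *\<^sub>R ?c))\<^sup>2" using alpha_pos by simp
      ultimately show "0 \<le> (\<nu> x *v a x) \<bullet> a x + 2 * t * (a x \<bullet> b x) + t\<^sup>2 * (?c \<bullet> b x)"
        using rayleigh_bounds(3)[OF x, of "a x + t *\<^sub>R ?c"] by linarith
    qed
    finally show ?thesis .
  qed
  moreover have "0 \<le> ?B"
    unfolding ipw_def ip_def
  proof (rule integral_nonneg_AE, rule AE_I2)
    fix x assume "x \<in> space (lebesgue_on D)"
    then have x: "x \<in> D" by (simp add: space_restrict_space)
    let ?c = "matrix_inv (\<nu> x) *v b x"
    have "0 \<le> \<alpha> * (norm ?c)\<^sup>2" using alpha_pos by simp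
    then show "0 \<le> ?c \<bullet> b x"
      using rayleigh_bounds(3)[OF x, of ?c] nu_invertible(2)[OF x, of "b x"] by (simp add: inner_commute)
  qed
  ultimately have "(ip D a b)\<^sup>2 \<le> ?A * ?B" by (rule quadratic_nonneg_discriminant)
  then have "sqrt ((ip D a b)\<^sup>2) \<le> sqrt (?A * ?B)" by (rule real_sqrt_le_mono)
  then show ?thesis by (simp add: wnorm_def real_sqrt_mult)
qed

lemma piecewise_interior:
  assumes "K \<in> \<T>" "x \<in> interior K"
  shows "piecewise \<T> c x = c K"
proof -
  have "piecewise \<T> c x = (\<Sum>K'\<in>{K}. c K' * indicat_real (interior K') x)"
    unfolding piecewise_def using assms cell_interior_disjoint[OF assms(1)]
    by (intro sum.mono_neutral_right finite_mesh) (auto simp: indicator_def)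
  then show ?thesis using assms by simp
qed

text \<open>The conditions are placed on f instead of on a term with \<open>piecewise\<close>, so
  that they also fit products, roots and inverses of piecewise constants.\<close>

lemma piecewise_scaleR_L2:
  assumes v: "v \<in> L2 D" and c: "\<And>K x. K \<in> \<T> \<Longrightarrow> x \<in> interior K \<Longrightarrow> f x = c K"
    and z: "\<And>x. (\<forall>K\<in>\<T>. x \<notin> interior K) \<Longrightarrow> f x = 0"
  shows "(\<lambda>x. f x *\<^sub>R v x) \<in> L2 D"
proof -
  have f: "f = piecewise \<T> c"
  proof
    fix x
    show "f x = piecewise \<T> c x"
    proof (cases "\<exists>K\<in>\<T>. x \<in> interior K")
      case True
      then show ?thesis using c piecewise_interior by metis
    next
      case False
      then show ?thesis using z[of x] by (simp add: piecewise_def)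
    qed
  qed
  have fm: "f \<in> borel_measurable (lebesgue_on D)"
    unfolding f piecewise_def[abs_def]
    by (intro borel_lebesgue_on borel_measurable_sum borel_measurable_times borel_measurable_const borel_measurable_indicator) auto
  then have m: "(\<lambda>x. f x *\<^sub>R v x) \<in> borel_measurable (lebesgue_on D)"
    using L2D(1)[OF v] by (intro borel_measurable_scaleR)
  have b: "\<bar>f x\<bar> \<le> (\<Sum>K\<in>\<T>. \<bar>c K\<bar>)" for x
    unfolding f piecewise_def by (rule order_trans[OF sum_abs]) (auto intro!: sum_mono simp: indicator_def)
  have "integrable (lebesgue_on D) (\<lambda>x. (norm (f x *\<^sub>R v x))\<^sup>2)"
  proof (rule Bochner_Integration.integrable_bound)
    show "integrable (lebesgue_on D) (\<lambda>x. (\<Sum>K\<in>\<T>. \<bar>c K\<bar>)\<^sup>2 * (norm (v x))\<^sup>2)" using L2D(2)[OF v] by simp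
    show "(\<lambda>x. (norm (f x *\<^sub>R v x))\<^sup>2) \<in> borel_measurable (lebesgue_on D)" by (rule borel_norm_square[OF m])
    show "AE x in lebesgue_on D. norm ((norm (f x *\<^sub>R v x))\<^sup>2) \<le> norm ((\<Sum>K\<in>\<T>. \<bar>c K\<bar>)\<^sup>2 * (norm (v x))\<^sup>2)"
    proof (rule AE_I2)
      fix x
      have "\<bar>f x\<bar>\<^sup>2 \<le> (\<Sum>K\<in>\<T>. \<bar>c K\<bar>)\<^sup>2" using b[of x] by (intro power_mono) auto
      then show "norm ((norm (f x *\<^sub>R v x))\<^sup>2) \<le> norm ((\<Sum>K\<in>\<T>. \<bar>c K\<bar>)\<^sup>2 * (norm (v x))\<^sup>2)"
        by (simp add: power_mult_distrib mult_right_mono)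
    qed
  qed
  then show ?thesis using m by (simp add: L2_def)
qed

text \<open>\<open>ess_inf_on\<close> is a supremum of real numbers, informative only for a nonempty
  set that is bounded above. \<alpha> belongs to the set, and \<beta> bounds it because a cell has
  positive measure.\<close>

lemma nu_tilde_pos:
  assumes K: "K \<in> \<T>" "x \<in> interior K"
  shows "0 < nu_tilde \<T> \<nu> x"
proof -
  let ?S = "{c. AE x in lebesgue_on K. c \<le> min_rayleigh (\<nu> x)}"
  have "AE x in lebesgue_on K. \<alpha> \<le> min_rayleigh (\<nu> x)"
    by (rule AE_cell[OF K(1)]) (use rayleigh_bounds(1) interior_cell_subset[OF K(1)] in blast)
  then have a: "\<alpha> \<in> ?S" by simp
  have "c \<le> \<beta>" if "c \<in> ?S" for c
  proof (rule ccontr)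
    assume c: "\<not> c \<le> \<beta>"
    have b: "AE x in lebesgue_on K. min_rayleigh (\<nu> x) \<le> \<beta>"
      by (rule AE_cell[OF K(1)]) (use rayleigh_bounds(2) interior_cell_subset[OF K(1)] in blast)
    have "AE x in lebesgue_on K. c \<le> min_rayleigh (\<nu> x)" using that by simp
    with b have "AE x in lebesgue_on K. False" by eventually_elim (use c in linarith)
    then show False
      using AE_open_closed[OF open_interior interior_subset cell_props(6)[OF K(1)], of "\<lambda>_. False" x] K(2) by simp
  qed
  then have "bdd_above ?S" by (rule bdd_aboveI)
  then have "\<alpha> \<le> ess_inf_on K (\<lambda>x. min_rayleigh (\<nu> x))"
    unfolding ess_inf_on_def using a by (intro cSup_upper)
  then show ?thesis using alpha_pos unfolding nu_tilde_def piecewise_interior[OF K] by simp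
qed

lemma h_tilde_pos:
  assumes K: "K \<in> \<T>" "x \<in> interior K"
  shows "0 < h_tilde \<T> x"
proof -
  obtain e where e: "e > 0" "ball x e \<subseteq> K" using K(2) by (auto simp: mem_interior)
  have "x + (e / 2) *\<^sub>R axis 1 1 \<in> ball x e" using e(1) by (simp add: dist_norm norm_axis_1)
  then have "dist x (x + (e / 2) *\<^sub>R axis 1 1) \<le> diameter K"
    using e K by (intro diameter_bounded_bound compact_imp_bounded cell_props(1)) auto
  moreover have "dist x (x + (e / 2) *\<^sub>R axis 1 1) = e / 2" using e(1) by (simp add: dist_norm norm_axis_1)
  ultimately show ?thesis using e(1) unfolding h_tilde_def piecewise_interior[OF K] by simp
qed

text \<open>The two weights are mutually inverse on the open cells; the skeleton, where both
  evaluate to 0, is a null set.\<close>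

lemma meshsize_Cauchy_Schwarz:
  assumes a: "a \<in> L2 D" and b: "b \<in> L2 D"
  shows "\<bar>ip D a b\<bar> \<le> L2norm D (\<lambda>x. (sqrt (nu_tilde \<T> \<nu> x) * inverse (h_tilde \<T> x)) *\<^sub>R a x)
    * L2norm D (\<lambda>x. (inverse (sqrt (nu_tilde \<T> \<nu> x)) * h_tilde \<T> x) *\<^sub>R b x)"
proof -
  let ?e = "\<lambda>K. ess_inf_on K (\<lambda>x. min_rayleigh (\<nu> x))"
  have z: "h_tilde \<T> x = 0" "nu_tilde \<T> \<nu> x = 0" if "\<forall>K\<in>\<T>. x \<notin> interior K" for x
    using that by (simp_all add: h_tilde_def nu_tilde_def piecewise_def)
  have L: "(\<lambda>x. (sqrt (nu_tilde \<T> \<nu> x) * inverse (h_tilde \<T> x)) *\<^sub>R a x) \<in> L2 D"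
    by (rule piecewise_scaleR_L2[OF a, where c = "\<lambda>K. sqrt (?e K) * inverse (diameter K)"])
      (simp_all add: nu_tilde_def h_tilde_def piecewise_interior, simp add: piecewise_def)
  have R: "(\<lambda>x. (inverse (sqrt (nu_tilde \<T> \<nu> x)) * h_tilde \<T> x) *\<^sub>R b x) \<in> L2 D"
    by (rule piecewise_scaleR_L2[OF b, where c = "\<lambda>K. inverse (sqrt (?e K)) * diameter K"])
      (simp_all add: nu_tilde_def h_tilde_def piecewise_interior, simp add: piecewise_def)
  have "AE x in lebesgue_on D. ((sqrt (nu_tilde \<T> \<nu> x) * inverse (h_tilde \<T> x)) *\<^sub>R a x) \<bullet>
      ((inverse (sqrt (nu_tilde \<T> \<nu> x)) * h_tilde \<T> x) *\<^sub>R b x) = a x \<bullet> b x"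
  proof (rule AE_mesh)
    fix K x assume "K \<in> \<T>" "x \<in> interior K"
    from nu_tilde_pos[OF this] h_tilde_pos[OF this]
    have "sqrt (nu_tilde \<T> \<nu> x) \<noteq> 0" "h_tilde \<T> x \<noteq> 0" by auto
    then show "((sqrt (nu_tilde \<T> \<nu> x) * inverse (h_tilde \<T> x)) *\<^sub>R a x) \<bullet>
      ((inverse (sqrt (nu_tilde \<T> \<nu> x)) * h_tilde \<T> x) *\<^sub>R b x) = a x \<bullet> b x" by (simp add: field_simps)
  qed
  then have "ip D (\<lambda>x. (sqrt (nu_tilde \<T> \<nu> x) * inverse (h_tilde \<T> x)) *\<^sub>R a x)
      (\<lambda>x. (inverse (sqrt (nu_tilde \<T> \<nu> x)) * h_tilde \<T> x) *\<^sub>R b x) = ip D a b"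
    unfolding ip_def
    using L2_inner_integrable[OF L R] L2_inner_integrable[OF a b] by (intro integral_cong_AE) auto
  then show ?thesis using ip_Cauchy_Schwarz[OF L R] by simp
qed

text \<open>The second vector is reversed since \<open>normE\<close> lists the mesh-size term first
  and \<open>normH\<close> lists it last.\<close>

lemma sqrt_Cauchy_Schwarz:
  fixes a b c d :: real
  shows "a * d + b * c \<le> sqrt (a\<^sup>2 + b\<^sup>2) * sqrt (c\<^sup>2 + d\<^sup>2)"
proof -
  have "0 \<le> (a * c - b * d)\<^sup>2" by simp
  then have "(a * d + b * c)\<^sup>2 \<le> (a\<^sup>2 + b\<^sup>2) * (c\<^sup>2 + d\<^sup>2)"
    by (simp add: power2_eq_square algebra_simps)
  then have "\<bar>a * d + b * c\<bar> \<le> sqrt ((a\<^sup>2 + b\<^sup>2) * (c\<^sup>2 + d\<^sup>2))"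
    by (metis real_sqrt_abs real_sqrt_le_mono)
  then show ?thesis by (simp add: real_sqrt_mult)
qed

lemma consistency_error_bound:
  assumes \<sigma>: "(\<lambda>x. \<nu> x *v wcurl D \<Psi> x) \<in> Hcurl D" and \<Psi>: "\<Psi> \<in> Hcurl D"
    and v: "v \<in> Pb D \<T> k" and vc: "vc \<in> Pc0 D \<T> k" and \<Phi>: "\<Phi> \<in> Pc D \<T> l"
  shows "\<bar>consistency_error D \<T> Kl Kr nF \<nu> l v \<Psi>\<bar>
    \<le> normE D \<T> Kl Kr nF \<nu> l (\<lambda>x. v x - vc x) * normH D \<T> \<nu> (\<lambda>x. \<nu> x *v wcurl D \<Psi> x - \<Phi> x)"
proof -
  let ?C = "discrete_curl D \<T> Kl Kr nF l"
  define s where "s x = \<nu> x *v wcurl D \<Psi> x" for x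
  define v' where "v' x = v x - vc x" for x
  define \<eta> where "\<eta> x = s x - \<Phi> x" for x
  have \<sigma>H: "s \<in> Hcurl D" using \<sigma> by (simp add: s_def[abs_def])
  have sL: "s \<in> L2 D" using \<sigma>H by (simp add: Hcurl_def)
  note ws = wcurl_is_weak_curl[OF \<sigma>H]
  have wsL: "wcurl D s \<in> L2 D" using ws by (simp add: is_weak_curl_def)
  have vcP: "vc \<in> Pb D \<T> k" using vc by (simp add: Pc0_def)
  have v'P: "v' \<in> Pb D \<T> k" using Pb_diff(1)[OF v vcP] by (simp add: v'_def[abs_def])
  have \<Phi>P: "\<Phi> \<in> Pb D \<T> l" and \<Phi>H: "\<Phi> \<in> Hcurl D" using \<Phi> by (auto simp: Pc_def)
  note w\<Phi> = wcurl_is_weak_curl[OF \<Phi>H]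
  have w\<Phi>L: "wcurl D \<Phi> \<in> L2 D" using w\<Phi> by (simp add: is_weak_curl_def)
  have CL: "?C u \<in> L2 D" if "u \<in> Pb D \<T> k" for u
    using L2_add[OF curlh_L2[OF that] PbD(1)[OF lifting_spec(1)[OF that]]] by (simp add: discrete_curl_def[abs_def])
  have \<eta>L: "\<eta> \<in> L2 D" using L2_diff[OF sL PbD(1)[OF \<Phi>P]] by (simp add: \<eta>_def[abs_def])
  have w\<eta>: "is_weak_curl D \<eta> (\<lambda>x. wcurl D s x - wcurl D \<Phi> x)"
    unfolding is_weak_curl_def
  proof (intro conjI ballI L2_diff[OF wsL w\<Phi>L])
    fix \<phi> assume \<phi>: "\<phi> \<in> test_fields D"
    note P = test_fields_C1_jac[OF \<phi>]
    have pL: "\<phi> \<in> L2 D" "curl \<phi> \<in> L2 D"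
      by (intro L2_continuous C1_jacD(3)[OF P] continuous_curl[OF P] bounded_D D_sets)+
    show "ip D \<eta> (curl \<phi>) = ip D (\<lambda>x. wcurl D s x - wcurl D \<Phi> x) \<phi>"
      using ws w\<Phi> \<phi> ip_diff_left[OF sL PbD(1)[OF \<Phi>P] pL(2)] ip_diff_left[OF wsL w\<Phi>L pL(1)]
      by (simp add: is_weak_curl_def \<eta>_def[abs_def])
  qed
  have \<eta>H: "\<eta> \<in> Hcurl D" using \<eta>L w\<eta> by (auto simp: Hcurl_def)
  note wc\<eta> = wcurl_is_weak_curl[OF \<eta>H]
  have wc\<eta>L: "wcurl D \<eta> \<in> L2 D" using wc\<eta> by (simp add: is_weak_curl_def)
  have 1: "ip D v' (wcurl D \<eta>) = ip D v' (wcurl D s) - ip D v' (wcurl D \<Phi>)"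
  proof -
    have "ip D v' (wcurl D \<eta>) = ip D v' (\<lambda>x. wcurl D s x - wcurl D \<Phi> x)"
      using weak_curl_AE_unique[OF open_D bounded_D wc\<eta> w\<eta>] L2D(1)[OF wc\<eta>L] L2D(1)[OF L2_diff[OF wsL w\<Phi>L]] L2D(1)[OF PbD(1)[OF v'P]]
      by (intro ip_cong_AE) auto
    then show ?thesis using ip_diff_right[OF wsL w\<Phi>L PbD(1)[OF v'P]] by simp
  qed
  have 2: "ip D (?C v') \<eta> = ip D (?C v') s - ip D (?C v') \<Phi>"
    using ip_diff_right[OF sL PbD(1)[OF \<Phi>P] CL[OF v'P]] by (simp add: \<eta>_def[abs_def])
  \<comment> \<open>In 3 and 4 the same quantity (curl v_c, s) is subtracted, so replacing v by v'
    leaves the consistency error unchanged; by 5 the two \<Phi> terms cancel.\<close>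
  have 3: "ip D v' (wcurl D s) = ip D v (wcurl D s) - ip D (curlh \<T> vc) s"
    using ip_diff_left[OF PbD(1)[OF v] PbD(1)[OF vcP] wsL] H0curl_Pb_pairing[OF vc sL ws]
    by (simp add: v'_def[abs_def] ip_commute)
  have 4: "ip D (?C v') s = ip D (?C v) s - ip D (curlh \<T> vc) s"
  proof -
    have "?C v' = (\<lambda>x. ?C v x - curlh \<T> vc x)"
      unfolding discrete_curl_def[abs_def] v'_def[abs_def] curlh_diff[OF v vcP] lifting_diff_Pc0[OF v vc]
      by (simp add: algebra_simps)
    then show ?thesis using ip_diff_left[OF CL[OF v] curlh_L2[OF vcP] sL] by simp
  qed
  have 5: "ip D v' (wcurl D \<Phi>) = ip D (?C v') \<Phi>" by (rule discrete_curl_consistent[OF v'P \<Phi>])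
  \<comment> \<open>Symmetry of \<nu> shifts the weight from the discrete curl to the curl of
    \<Psi>.\<close>
  have 6: "ipw D \<nu> (?C v) (wcurl D \<Psi>) = ip D (?C v) s"
    unfolding ipw_def ip_def
    by (intro Bochner_Integration.integral_cong refl)
      (simp add: space_restrict_space s_def symmetric_inner nu_sym)
  have \<delta>: "consistency_error D \<T> Kl Kr nF \<nu> l v \<Psi> = ip D v' (wcurl D \<eta>) - ip D (?C v') \<eta>"
    unfolding consistency_error_def 6 s_def[abs_def, symmetric] using 1 2 3 4 5 by simp
  have "\<bar>ip D v' (wcurl D \<eta>) - ip D (?C v') \<eta>\<bar> \<le> \<bar>ip D v' (wcurl D \<eta>)\<bar> + \<bar>ip D (?C v') \<eta>\<bar>" by (rule abs_triangle_ineq4)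
  also have "\<dots> \<le> L2norm D (\<lambda>x. (sqrt (nu_tilde \<T> \<nu> x) * inverse (h_tilde \<T> x)) *\<^sub>R v' x)
      * L2norm D (\<lambda>x. (inverse (sqrt (nu_tilde \<T> \<nu> x)) * h_tilde \<T> x) *\<^sub>R wcurl D \<eta> x)
    + wnorm D \<nu> (?C v') * wnorm D (\<lambda>x. matrix_inv (\<nu> x)) \<eta>"
    by (intro add_mono meshsize_Cauchy_Schwarz weighted_Cauchy_Schwarz PbD(1)[OF v'P] wc\<eta>L CL[OF v'P] \<eta>L)
  also have "\<dots> \<le> normE D \<T> Kl Kr nF \<nu> l v' * normH D \<T> \<nu> \<eta>"
    unfolding normE_def normH_def by (rule sqrt_Cauchy_Schwarz)
  finally show ?thesis unfolding \<delta> by (simp add: v'_def[abs_def] \<eta>_def[abs_def] s_def[abs_def])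
qed

lemma normE_nonneg: "0 \<le> normE D \<T> Kl Kr nF \<nu> l v" and normH_nonneg: "0 \<le> normH D \<T> \<nu> v"
  by (simp_all add: normE_def normH_def)

text \<open>Supplies members of the approximation spaces, so that the infima run over nonempty sets.
  The chosen \<open>wcurl\<close> of the zero field is known to be 0 only almost everywhere, hence
  the detour through integrals.\<close>

lemma zero_Hcurl: "(\<lambda>x. 0) \<in> Hcurl D" "(\<lambda>x. 0) \<in> H0curl D"
proof -
  have L: "(\<lambda>x. 0) \<in> L2 D" by (rule PbD(1)[OF Pb_zero(1)[of 0]])
  have wz: "is_weak_curl D (\<lambda>x. 0) (\<lambda>x. 0)" using L by (simp add: is_weak_curl_def ip_def)
  show H: "(\<lambda>x. 0) \<in> Hcurl D" using L wz by (auto simp: Hcurl_def)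
  have AE: "AE x in lebesgue_on D. wcurl D (\<lambda>x. 0) x = 0"
    by (rule weak_curl_AE_unique[OF open_D bounded_D wcurl_is_weak_curl[OF H] wz])
  have "ip D (wcurl D (\<lambda>x. 0)) w = 0" for w
  proof -
    have "AE x in lebesgue_on D. wcurl D (\<lambda>x. 0) x \<bullet> w x = 0" using AE by eventually_elim simp
    then show ?thesis unfolding ip_def by (rule integral_eq_zero_AE)
  qed
  then show "(\<lambda>x. 0) \<in> H0curl D" using H by (simp add: H0curl_def tangential_trace_def ip_def)
qed

end

text \<open>Infima are taken one factor at a time, dividing by the other factor and without appeal
  to minimisers. A vanishing factor is treated apart: the bound at hand then already reads c \<le>
  0.\<close>

lemma le_INF_mult_INF:
  fixes f :: "'a \<Rightarrow> real" and g :: "'b \<Rightarrow> real"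
  assumes "A \<noteq> {}" "B \<noteq> {}" "\<And>a. a \<in> A \<Longrightarrow> 0 \<le> f a" "\<And>b. b \<in> B \<Longrightarrow> 0 \<le> g b"
    and le: "\<And>a b. a \<in> A \<Longrightarrow> b \<in> B \<Longrightarrow> c \<le> f a * g b"
  shows "c \<le> (INF a\<in>A. f a) * (INF b\<in>B. g b)"
proof -
  let ?G = "INF b\<in>B. g b"
  have G: "0 \<le> ?G" using assms by (intro cINF_greatest) auto
  have 1: "c \<le> f a * ?G" if a: "a \<in> A" for a
  proof (cases "f a = 0")
    case True
    obtain b where "b \<in> B" using assms(2) by blast
    then show ?thesis using le[OF a] True by auto
  next
    case False
    then have fa: "0 < f a" using assms(3)[OF a] by simp
    have "c / f a \<le> ?G"
    proof (rule cINF_greatest[OF assms(2)])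
      fix b assume "b \<in> B"
      then show "c / f a \<le> g b" using le[OF a] fa by (simp add: pos_divide_le_eq mult.commute)
    qed
    then show ?thesis using fa by (simp add: pos_divide_le_eq mult.commute)
  qed
  show ?thesis
  proof (cases "?G = 0")
    case True
    obtain a where "a \<in> A" using assms(1) by blast
    then show ?thesis using 1 True by auto
  next
    case False
    then have Gp: "0 < ?G" using G by simp
    have "c / ?G \<le> (INF a\<in>A. f a)"
    proof (rule cINF_greatest[OF assms(1)])
      fix a assume "a \<in> A"
      then show "c / ?G \<le> f a" using 1 Gp by (simp add: pos_divide_le_eq)
    qed
    then show ?thesis using Gp by (simp add: pos_divide_le_eq)
  qed
qed
theorem lemma4p4:
  fixes D :: "(real^3) set"
    and \<nu> :: "real^3 \<Rightarrow> real^3^3"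
    and \<T> :: "(real^3) set set"
    and Kl Kr :: "(real^3) set \<Rightarrow> (real^3) set"
    and nF :: "(real^3) set \<Rightarrow> real^3"
    and k l :: nat
    and \<Psi> v :: "real^3 \<Rightarrow> real^3"
  assumes "lipschitz_polyhedron D"
    and "admissible_coeff D \<nu>"
    and "simplicial_mesh D \<T>"
    and "face_orientation D \<T> Kl Kr nF"
    and "1 \<le> k" and "k - 1 \<le> l"
    and "\<Psi> \<in> H0curl D"
    and "(\<lambda>x. \<nu> x *v wcurl D \<Psi> x) \<in> Hcurl D"
    and "v \<in> Pb D \<T> k"
  shows "\<bar>consistency_error D \<T> Kl Kr nF \<nu> l v \<Psi>\<bar>
    \<le> nc D \<T> Kl Kr nF \<nu> k l v
       * (INF \<Phi>\<in>Pc D \<T> l. normH D \<T> \<nu> (\<lambda>x. \<nu> x *v wcurl D \<Psi> x - \<Phi> x))"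
proof -
  obtain \<alpha> \<beta> where ab: "0 < \<alpha>"
    "\<And>x \<mu> u. x \<in> D \<Longrightarrow> u \<noteq> 0 \<Longrightarrow> \<nu> x *v u = \<mu> *\<^sub>R u \<Longrightarrow> \<alpha> \<le> \<mu> \<and> \<mu> \<le> \<beta>"
    using assms(2) unfolding admissible_coeff_def by blast
  interpret coeff D \<T> Kl Kr nF \<nu> \<alpha> \<beta>
    using assms(1-4) ab by unfold_locales (auto simp: admissible_coeff_def)
  have "(\<lambda>x. 0) \<in> Pc0 D \<T> k" "(\<lambda>x. 0) \<in> Pc D \<T> l"
    using Pb_zero(1) zero_Hcurl by (auto simp: Pc0_def Pc_def)
  moreover have "\<Psi> \<in> Hcurl D" using assms(7) by (simp add: H0curl_def)
  ultimately show ?thesis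
    unfolding nc_def
    by (intro le_INF_mult_INF normE_nonneg normH_nonneg consistency_error_bound[OF assms(8) _ assms(9)]) auto
qed

end
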